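(* Let $n\ge1$ and let $(\mathscr C,\Sigma,\square)$ be an $(n+2)$-angulated category, where $\Sigma$ is an automorphism of the additive category $\mathscr C$. Let $\mathbb E_\Sigma=\mathscr C(-,\Sigma-):\mathscr C^{op}\times\mathscr C\to Ab$, i.e. $\mathbb E_\Sigma(C,A)=\mathscr C(C,\Sigma A)$ and $\mathbb E_\Sigma(c,a)(\delta)=(\Sigma a)\circ\delta\circ c$. For each $\delta\in\mathbb E_\Sigma(C,A)$ complete $\delta$ to an $(n+2)$-angle $$A\xrightarrow{d_X^0}X^1\xrightarrow{d_X^1}\cdots\xrightarrow{d_X^{n-1}}X^n\xrightarrow{d_X^n}C\xrightarrow{\delta}\Sigma A$$ in $\square$ and put $\mathfrak s_\square(\delta)=[X^\bullet]$, where $X^\bullet=(A\xrightarrow{d_X^0}X^1\to\cdots\to X^n\xrightarrow{d_X^n}C)\in\mathbf C^{n+2}_{(A,C)}$ (this class does not depend on the choice). Then $(\mathscr C,\mathbb E_\Sigma,\mathfrak s_\square)$ is an $n$-exangulated category.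
   Context: **$(n+2)$-angulated categories (Geiss–Keller–Oppermann).** Let $\mathscr C$ be additive with an automorphism $\Sigma$. An $(n+2)$-$\Sigma$-sequence is a sequence $X^0\xrightarrow{d_X^0}X^1\to\cdots\xrightarrow{d_X^n}X^{n+1}\xrightarrow{\delta}\Sigma X^0$; a morphism to $Y^0\to\cdots\to Y^{n+1}\xrightarrow{\rho}\Sigma Y^0$ is a tuple $(f^0,\dots,f^{n+1})$ making all squares, including $(\Sigma f^0)\delta=\rho f^{n+1}$, commute. $(\mathscr C,\Sigma,\square)$ is $(n+2)$-angulated if $\square$ is a class of $(n+2)$-$\Sigma$-sequences (called $(n+2)$-angles), closed under isomorphism, with: (F1) (a) $\square$ is closed under direct sums and direct summands; (b) $X\xrightarrow{1}X\to0\to\cdots\to0\to\Sigma X$ is in $\square$ for all $X$; (c) every morphism $X^0\to X^1$ is the first morphism of some $(n+2)$-angle. (F2) An $(n+2)$-$\Sigma$-sequence $X^0\xrightarrow{d_X^0}X^1\xrightarrow{d_X^1}\cdots\xrightarrow{d_X^n}X^{n+1}\xrightarrow{\delta}\Sigma X^0$ is in $\square$ iff its rotation $X^1\xrightarrow{d_X^1}\cdots\xrightarrow{d_X^n}X^{n+1}\xrightarrow{\delta}\Sigma X^0\xrightarrow{(-1)^n\Sigma d_X^0}\Sigma X^1$ is. (F3) Given two $(n+2)$-angles and $f^0,f^1$ with $f^1d_X^0=d_Y^0f^0$, there are $f^2,\dots,f^{n+1}$ making $(f^0,\dots,f^{n+1})$ a morphism. (F4) In (F3), $f^2,\dots,f^{n+1}$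 can be chosen such that the cone $X^1\oplus Y^0\to X^2\oplus Y^1\to\cdots\to\Sigma X^0\oplus Y^{n+1}\to\Sigma X^1\oplus\Sigma Y^0$, with maps $\begin{bmatrix}-d_X^{i+1}&0\\ f^{i+1}&d_Y^i\end{bmatrix}$ ($0\le i\le n$, $d_X^{n+1}:=\delta$) and $\begin{bmatrix}-\Sigma d_X^0&0\\ \Sigma f^0&\rho\end{bmatrix}$, is in $\square$. **$n$-exangulated categories.** Let $n\ge1$, $\mathscr C$ additive, $\mathbb E:\mathscr C^{op}\times\mathscr C\to Ab$ biadditive. Extensions: an element $\delta\in\mathbb E(C,A)$ is an extension; for $a:A\to A'$, $c:C'\to C$ put $a_*\delta=\mathbb E(C,a)(\delta)$, $c^*\delta=\mathbb E(c,A)(\delta)$. For $\delta\in\mathbb E(C,A)$, $\rho\in\mathbb E(D,B)$ a morphism of extensions $(a,c):\delta\to\rho$ is a pair $a:A\to B$, $c:C\to D$ with $a_*\delta=c^*\rho$. Put $\delta_\sharp:\mathscr C(-,C)\to\mathbb E(-,A)$, $f\mapsto f^*\delta$, and $\delta^\sharp:\mathscr C(A,-)\to\mathbb E(C,-)$, $g\mapsto g_*\delta$. Complexes: $\mathbf C^{n+2}_{\mathscr C}$ is the category of complexes $X^\bullet=(X^0\xrightarrow{d_X^0}\cdots\xrightarrow{d_X^n}X^{n+1})$ concentrated in degrees $0,\dots,n+1$, with usual chain homotopy. $\mathbf C^{n+2}_{(A,C)}$ has as objects the complexes with $X^0=A$, $X^{n+1}=C$ and as morphisms the chain maps with $f^0=1_A$,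 $f^{n+1}=1_C$; homotopy is the same relation, homotopy equivalences are taken within this category, and $[X^\bullet]$ is the homotopy equivalence class in it. $n$-exangles: a pair $\langle X^\bullet,\delta\rangle$ with $\delta\in\mathbb E(X^{n+1},X^0)$ is an $n$-exangle if $\mathscr C(-,X^0)\to\cdots\to\mathscr C(-,X^{n+1})\xrightarrow{\delta_\sharp}\mathbb E(-,X^0)$ and $\mathscr C(X^{n+1},-)\to\cdots\to\mathscr C(X^0,-)\xrightarrow{\delta^\sharp}\mathbb E(X^{n+1},-)$ are exact (at all inner terms). Exact realization: a correspondence $\mathfrak s$ assigning to each $\delta\in\mathbb E(C,A)$ a class $\mathfrak s(\delta)=[X^\bullet]$ of an object of $\mathbf C^{n+2}_{(A,C)}$ such that: (R0) if $\mathfrak s(\delta)=[X^\bullet]$, $\mathfrak s(\rho)=[Y^\bullet]$, every morphism $(a,c):\delta\to\rho$ has a lift, i.e. a chain map $f^\bullet:X^\bullet\to Y^\bullet$ with $f^0=a$, $f^{n+1}=c$; (R1) $\mathfrak s(\delta)=[X^\bullet]$ implies $\langle X^\bullet,\delta\rangle$ is an $n$-exangle; (R2) $0\in\mathbb E(0,A)$ has $\mathfrak s(0)=[A\xrightarrow{1}A\to0\to\cdots\to0]$ and $0\in\mathbb E(A,0)$ has $\mathfrak s(0)=[0\to\cdots\to0\to A\xrightarrow{1}A]$. If $\mathfrak s(\delta)=[X^\bullet]$, $\langle X^\bullet,\delta\rangle$ is called distinguished, $d_X^0$ an inflation, $d_X^n$ a deflation. Cones: for $f^\bullet:X^\bullet\to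 Y^\bullet$ with $f^0=1$, $M_f^\bullet$ is $X^1\to X^2\oplus Y^1\to\cdots\to X^{n+1}\oplus Y^n\to Y^{n+1}$ with $d^0=\begin{bmatrix}-d_X^1\\ f^1\end{bmatrix}$, $d^i=\begin{bmatrix}-d_X^{i+1}&0\\ f^{i+1}&d_Y^i\end{bmatrix}$ ($1\le i\le n-1$), $d^n=[f^{n+1}\ d_Y^n]$. Dually for $h^\bullet$ with $h^{n+1}=1$, the mapping cocone is $X^0\to X^1\oplus Y^0\to\cdots\to X^n\oplus Y^{n-1}\to Y^n$ with $\begin{bmatrix}d_X^0\\ h^0\end{bmatrix}$, $\begin{bmatrix}d_X^i&0\\ h^i&-d_Y^{i-1}\end{bmatrix}$, $[h^n\ -d_Y^{n-1}]$. $(\mathscr C,\mathbb E,\mathfrak s)$ is $n$-exangulated if $\mathfrak s$ is an exact realization and: (EA1) inflations are closed under composition, and so are deflations; (EA2) for $\rho\in\mathbb E(D,A)$, $c:C\to D$ and distinguished $\langle X^\bullet,c^*\rho\rangle$, $\langle Y^\bullet,\rho\rangle$, $(1_A,c)$ has a lift $f^\bullet$ such that $\langle M_f^\bullet,(d_X^0)_*\rho\rangle$ is distinguished; (EA2$^{op}$) for $\delta\in\mathbb E(C,A)$, $a:A\to B$ and distinguished $\langle X^\bullet,\delta\rangle$, $\langle Y^\bullet,a_*\delta\rangle$, $(a,1_C)$ has a lift whose mapping cocone with extension $(d_Y^n)^*\delta$ is distinguished. *)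

theory Defs
  imports "HOL-Algebra.Coset"
begin

text \<open>
  Abelian groups are commutative groups in the sense of HOL-Algebra, hence are written
  multiplicatively: the sum of morphisms is the group operation, the zero morphism is the
  neutral element and the negative is the inverse of the group of morphisms.

  Every axiom about morphisms is relative to a given pair of objects, so the sets
  of morphisms need not be assumed to be disjoint.
\<close>

section \<open>Additive categories\<close>

record ('o, 'm) precat =
  Obj :: "'o set"
  Hom :: "'o \<Rightarrow> 'o \<Rightarrow> 'm monoid"
  Id :: "'o \<Rightarrow> 'm"
  Comp :: "'m \<Rightarrow> 'm \<Rightarrow> 'm"

record ('o, 'm) bipr =
  bob :: 'o
  in1 :: 'm
  in2 :: 'm
  pr1 :: 'm
  pr2 :: 'm

text \<open>
  A diagram \<open>X\<^sup>0 \<rightarrow> X\<^sup>1 \<rightarrow> X\<^sup>2 \<rightarrow> \<dots>\<close>. For sequences with objects \<open>X\<^sup>0, \<dots>, X\<^sup>n\<^sup>+\<^sup>1\<close> only the objects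
  of index at most \<open>n + 1\<close> and the morphisms of index at most \<open>n\<close> are relevant; two sequences that
  agree there are isomorphic by identities. The same convention applies to families
  \<open>f\<^sup>0, \<dots>, f\<^sup>n\<^sup>+\<^sup>1\<close> of morphisms.
\<close>

record ('o, 'm) diagram =
  ob :: "nat \<Rightarrow> 'o"
  df :: "nat \<Rightarrow> 'm"

locale preadditive_category =
  fixes C :: "('o, 'm) precat"
  assumes Hom_group: "\<lbrakk>A \<in> Obj C; B \<in> Obj C\<rbrakk> \<Longrightarrow> comm_group (Hom C A B)"
    and Id_Hom: "A \<in> Obj C \<Longrightarrow> Id C A \<in> carrier (Hom C A A)"
    and Comp_Hom: "\<lbrakk>A \<in> Obj C; B \<in> Obj C; D \<in> Obj C;
        f \<in> carrier (Hom C A B); g \<in> carrier (Hom C B D)\<rbrakk> \<Longrightarrow> Comp C g f \<in> carrier (Hom C A D)"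
    and Comp_Id_right: "\<lbrakk>A \<in> Obj C; B \<in> Obj C; f \<in> carrier (Hom C A B)\<rbrakk> \<Longrightarrow> Comp C f (Id C A) = f"
    and Comp_Id_left: "\<lbrakk>A \<in> Obj C; B \<in> Obj C; f \<in> carrier (Hom C A B)\<rbrakk> \<Longrightarrow> Comp C (Id C B) f = f"
    and Comp_assoc: "\<lbrakk>A \<in> Obj C; B \<in> Obj C; D \<in> Obj C; E \<in> Obj C;
        f \<in> carrier (Hom C A B); g \<in> carrier (Hom C B D); h \<in> carrier (Hom C D E)\<rbrakk>
      \<Longrightarrow> Comp C h (Comp C g f) = Comp C (Comp C h g) f"
    and Comp_add_right: "\<lbrakk>A \<in> Obj C; B \<in> Obj C; D \<in> Obj C;
        f \<in> carrier (Hom C A B); f' \<in> carrier (Hom C A B); g \<in> carrier (Hom C B D)\<rbrakk>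
      \<Longrightarrow> Comp C g (f \<otimes>\<^bsub>Hom C A B\<^esub> f') = Comp C g f \<otimes>\<^bsub>Hom C A D\<^esub> Comp C g f'"
    and Comp_add_left: "\<lbrakk>A \<in> Obj C; B \<in> Obj C; D \<in> Obj C;
        f \<in> carrier (Hom C A B); g \<in> carrier (Hom C B D); g' \<in> carrier (Hom C B D)\<rbrakk>
      \<Longrightarrow> Comp C (g \<otimes>\<^bsub>Hom C B D\<^esub> g') f = Comp C g f \<otimes>\<^bsub>Hom C A D\<^esub> Comp C g' f"
begin

abbreviation mor :: "'o \<Rightarrow> 'o \<Rightarrow> 'm set"
  where "mor A B \<equiv> carrier (Hom C A B)"

abbreviation comp :: "'m \<Rightarrow> 'm \<Rightarrow> 'm"  (infixr "\<cdot>" 80)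
  where "g \<cdot> f \<equiv> Comp C g f"

abbreviation add :: "'o \<Rightarrow> 'o \<Rightarrow> 'm \<Rightarrow> 'm \<Rightarrow> 'm"
  where "add A B f g \<equiv> f \<otimes>\<^bsub>Hom C A B\<^esub> g"

abbreviation zero :: "'o \<Rightarrow> 'o \<Rightarrow> 'm"
  where "zero A B \<equiv> \<one>\<^bsub>Hom C A B\<^esub>"

abbreviation neg :: "'o \<Rightarrow> 'o \<Rightarrow> 'm \<Rightarrow> 'm"
  where "neg A B f \<equiv> inv\<^bsub>Hom C A B\<^esub> f"

definition zero_object :: "'o \<Rightarrow> bool"
  where "zero_object Z \<longleftrightarrow> Z \<in> Obj C \<and>
    (\<forall>A\<in>Obj C. (\<exists>!f. f \<in> mor A Z) \<and> (\<exists>!f. f \<in> mor Z A))"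

definition is_biproduct :: "'o \<Rightarrow> 'o \<Rightarrow> ('o, 'm) bipr \<Rightarrow> bool"
  where "is_biproduct A B P \<longleftrightarrow> bob P \<in> Obj C \<and>
    in1 P \<in> mor A (bob P) \<and> in2 P \<in> mor B (bob P) \<and>
    pr1 P \<in> mor (bob P) A \<and> pr2 P \<in> mor (bob P) B \<and>
    pr1 P \<cdot> in1 P = Id C A \<and> pr2 P \<cdot> in2 P = Id C B \<and>
    pr2 P \<cdot> in1 P = zero A B \<and> pr1 P \<cdot> in2 P = zero B A \<and>
    add (bob P) (bob P) (in1 P \<cdot> pr1 P) (in2 P \<cdot> pr2 P) = Id C (bob P)"

text \<open>A fixed choice of the direct sum of each pair of objects.\<close>

definition bp :: "'o \<Rightarrow> 'o \<Rightarrow> ('o, 'm) bipr"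
  where "bp A B = (SOME P. is_biproduct A B P)"

definition osum :: "'o \<Rightarrow> 'o \<Rightarrow> 'o"
  where "osum A B = bob (bp A B)"

text \<open>The morphism \<open>[a; c] : P \<rightarrow> A \<oplus> B\<close>.\<close>

definition col :: "'o \<Rightarrow> 'o \<Rightarrow> 'o \<Rightarrow> 'm \<Rightarrow> 'm \<Rightarrow> 'm"
  where "col P A B a c = add P (osum A B) (in1 (bp A B) \<cdot> a) (in2 (bp A B) \<cdot> c)"

text \<open>The morphism \<open>[a b] : A \<oplus> B \<rightarrow> Q\<close>.\<close>

definition row :: "'o \<Rightarrow> 'o \<Rightarrow> 'o \<Rightarrow> 'm \<Rightarrow> 'm \<Rightarrow> 'm"
  where "row A B Q a b = add (osum A B) Q (a \<cdot> pr1 (bp A B)) (b \<cdot> pr2 (bp A B))"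

text \<open>The morphism \<open>A \<oplus> B \<rightarrow> A' \<oplus> B'\<close> with rows \<open>[a b]\<close> and \<open>[c d]\<close>.\<close>

definition mat :: "'o \<Rightarrow> 'o \<Rightarrow> 'o \<Rightarrow> 'o \<Rightarrow> 'm \<Rightarrow> 'm \<Rightarrow> 'm \<Rightarrow> 'm \<Rightarrow> 'm"
  where "mat A B A' B' a b c d =
    col (osum A B) A' B' (row A B A' a b) (row A B B' c d)"

section \<open>Complexes\<close>

definition is_sequence :: "nat \<Rightarrow> ('o, 'm) diagram \<Rightarrow> bool"
  where "is_sequence n X \<longleftrightarrow>
    (\<forall>i\<le>n + 1. ob X i \<in> Obj C) \<and> (\<forall>i\<le>n. df X i \<in> mor (ob X i) (ob X (i + 1)))"

definition is_complex :: "nat \<Rightarrow> ('o, 'm) diagram \<Rightarrow> bool"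
  where "is_complex n X \<longleftrightarrow> is_sequence n X \<and>
    (\<forall>i<n. df X (i + 1) \<cdot> df X i = zero (ob X i) (ob X (i + 2)))"

definition complexes :: "nat \<Rightarrow> 'o \<Rightarrow> 'o \<Rightarrow> ('o, 'm) diagram set"
  where "complexes n A B = {X. is_complex n X \<and> ob X 0 = A \<and> ob X (n + 1) = B}"

definition chain_map :: "nat \<Rightarrow> ('o, 'm) diagram \<Rightarrow> ('o, 'm) diagram \<Rightarrow> (nat \<Rightarrow> 'm) \<Rightarrow> bool"
  where "chain_map n X Y f \<longleftrightarrow>
    (\<forall>i\<le>n + 1. f i \<in> mor (ob X i) (ob Y i)) \<and>
    (\<forall>i\<le>n. df Y i \<cdot> f i = f (i + 1) \<cdot> df X i)"

definition homotopic ::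
    "nat \<Rightarrow> ('o, 'm) diagram \<Rightarrow> ('o, 'm) diagram \<Rightarrow> (nat \<Rightarrow> 'm) \<Rightarrow> (nat \<Rightarrow> 'm) \<Rightarrow> bool"
  where "homotopic n X Y f g \<longleftrightarrow> (\<exists>h.
    (\<forall>i\<in>{1..n + 1}. h i \<in> mor (ob X i) (ob Y (i - 1))) \<and>
    add (ob X 0) (ob Y 0) (f 0) (neg (ob X 0) (ob Y 0) (g 0)) = h 1 \<cdot> df X 0 \<and>
    (\<forall>i\<in>{1..n}. add (ob X i) (ob Y i) (f i) (neg (ob X i) (ob Y i) (g i)) =
       add (ob X i) (ob Y i) (df Y (i - 1) \<cdot> h i) (h (i + 1) \<cdot> df X i)) \<and>
    add (ob X (n + 1)) (ob Y (n + 1)) (f (n + 1)) (neg (ob X (n + 1)) (ob Y (n + 1)) (g (n + 1))) =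
       df Y n \<cdot> h (n + 1))"

definition chain_map_fixed ::
    "nat \<Rightarrow> 'o \<Rightarrow> 'o \<Rightarrow> ('o, 'm) diagram \<Rightarrow> ('o, 'm) diagram \<Rightarrow> (nat \<Rightarrow> 'm) \<Rightarrow> bool"
  where "chain_map_fixed n A B X Y f \<longleftrightarrow>
    chain_map n X Y f \<and> f 0 = Id C A \<and> f (n + 1) = Id C B"

definition homotopy_equivalent ::
    "nat \<Rightarrow> 'o \<Rightarrow> 'o \<Rightarrow> ('o, 'm) diagram \<Rightarrow> ('o, 'm) diagram \<Rightarrow> bool"
  where "homotopy_equivalent n A B X Y \<longleftrightarrow> (\<exists>f g.
    chain_map_fixed n A B X Y f \<and> chain_map_fixed n A B Y X g \<and>
    homotopic n X X (\<lambda>i. g i \<cdot> f i) (\<lambda>i. Id C (ob X i)) \<and>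
    homotopic n Y Y (\<lambda>i. f i \<cdot> g i) (\<lambda>i. Id C (ob Y i)))"

definition hclass :: "nat \<Rightarrow> 'o \<Rightarrow> 'o \<Rightarrow> ('o, 'm) diagram \<Rightarrow> ('o, 'm) diagram set"
  where "hclass n A B X = {Y \<in> complexes n A B. homotopy_equivalent n A B X Y}"

text \<open>\<open>A \<rightarrow> A \<rightarrow> Z \<rightarrow> \<dots> \<rightarrow> Z\<close> and \<open>Z \<rightarrow> \<dots> \<rightarrow> Z \<rightarrow> A \<rightarrow> A\<close>, with \<open>A \<rightarrow> A\<close> the identity.\<close>

definition trivial_left :: "'o \<Rightarrow> 'o \<Rightarrow> ('o, 'm) diagram"
  where "trivial_left Z A = (let X = (\<lambda>i. if i \<le> 1 then A else Z) in
    \<lparr>ob = X, df = (\<lambda>i. if i = 0 then Id C A else zero (X i) (X (i + 1)))\<rparr>)"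

definition trivial_right :: "nat \<Rightarrow> 'o \<Rightarrow> 'o \<Rightarrow> ('o, 'm) diagram"
  where "trivial_right n Z A = (let X = (\<lambda>i. if n \<le> i then A else Z) in
    \<lparr>ob = X, df = (\<lambda>i. if i = n then Id C A else zero (X i) (X (i + 1)))\<rparr>)"

definition mapping_cone ::
    "nat \<Rightarrow> ('o, 'm) diagram \<Rightarrow> ('o, 'm) diagram \<Rightarrow> (nat \<Rightarrow> 'm) \<Rightarrow> ('o, 'm) diagram"
  where "mapping_cone n X Y f =
    \<lparr>ob = (\<lambda>i. if i = 0 then ob X 1
               else if i \<le> n then osum (ob X (i + 1)) (ob Y i)
               else ob Y (n + 1)),
     df = (\<lambda>i. if i = 0 then
                 col (ob X 1) (ob X 2) (ob Y 1) (neg (ob X 1) (ob X 2) (df X 1)) (f 1)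
               else if i < n then
                 mat (ob X (i + 1)) (ob Y i) (ob X (i + 2)) (ob Y (i + 1))
                   (neg (ob X (i + 1)) (ob X (i + 2)) (df X (i + 1))) (zero (ob Y i) (ob X (i + 2)))
                   (f (i + 1)) (df Y i)
               else
                 row (ob X (n + 1)) (ob Y n) (ob Y (n + 1)) (f (n + 1)) (df Y n))\<rparr>"

definition mapping_cocone ::
    "nat \<Rightarrow> ('o, 'm) diagram \<Rightarrow> ('o, 'm) diagram \<Rightarrow> (nat \<Rightarrow> 'm) \<Rightarrow> ('o, 'm) diagram"
  where "mapping_cocone n X Y h =
    \<lparr>ob = (\<lambda>i. if i = 0 then ob X 0
               else if i \<le> n then osum (ob X i) (ob Y (i - 1))
               else ob Y n),
     df = (\<lambda>i. if i = 0 then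
                 col (ob X 0) (ob X 1) (ob Y 0) (df X 0) (h 0)
               else if i < n then
                 mat (ob X i) (ob Y (i - 1)) (ob X (i + 1)) (ob Y i)
                   (df X i) (zero (ob Y (i - 1)) (ob X (i + 1)))
                   (h i) (neg (ob Y (i - 1)) (ob Y i) (df Y (i - 1)))
               else
                 row (ob X n) (ob Y (n - 1)) (ob Y n)
                   (h n) (neg (ob Y (n - 1)) (ob Y n) (df Y (n - 1))))\<rparr>"

end

locale additive_category = preadditive_category +
  assumes has_zero_object: "\<exists>Z. zero_object Z"
    and has_biproducts: "\<lbrakk>A \<in> Obj C; B \<in> Obj C\<rbrakk> \<Longrightarrow> \<exists>P. is_biproduct A B P"

section \<open>Angulated categories\<close>

record ('o, 'm) endofunctor =
  FOb :: "'o \<Rightarrow> 'o"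
  FMor :: "'m \<Rightarrow> 'm"

text \<open>
  The automorphism is not required to preserve sums of morphisms: an automorphism of an
  additive category preserves biproducts, and therefore does so automatically.
\<close>

locale suspended_category = additive_category C
  for C :: "('o, 'm) precat" +
  fixes S :: "('o, 'm) endofunctor"
  assumes S_Obj: "bij_betw (FOb S) (Obj C) (Obj C)"
    and S_Hom: "\<lbrakk>A \<in> Obj C; B \<in> Obj C\<rbrakk>
      \<Longrightarrow> bij_betw (FMor S) (carrier (Hom C A B)) (carrier (Hom C (FOb S A) (FOb S B)))"
    and S_Id: "A \<in> Obj C \<Longrightarrow> FMor S (Id C A) = Id C (FOb S A)"
    and S_Comp: "\<lbrakk>A \<in> Obj C; B \<in> Obj C; D \<in> Obj C;
        f \<in> carrier (Hom C A B); g \<in> carrier (Hom C B D)\<rbrakk>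
      \<Longrightarrow> FMor S (Comp C g f) = Comp C (FMor S g) (FMor S f)"
begin

text \<open>
  A pair \<open>(X, \<delta>)\<close> stands for the sequence \<open>X\<^sup>0 \<rightarrow> \<dots> \<rightarrow> X\<^sup>n\<^sup>+\<^sup>1 \<rightarrow> \<Sigma> X\<^sup>0\<close> whose last morphism is \<open>\<delta>\<close>.
\<close>

definition is_S_sequence :: "nat \<Rightarrow> ('o, 'm) diagram \<times> 'm \<Rightarrow> bool"
  where "is_S_sequence n = (\<lambda>(X, \<delta>).
    is_sequence n X \<and> \<delta> \<in> mor (ob X (n + 1)) (FOb S (ob X 0)))"

definition S_morphism ::
    "nat \<Rightarrow> ('o, 'm) diagram \<times> 'm \<Rightarrow> ('o, 'm) diagram \<times> 'm \<Rightarrow> (nat \<Rightarrow> 'm) \<Rightarrow> bool"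
  where "S_morphism n = (\<lambda>(X, \<delta>) (Y, \<rho>) f.
    chain_map n X Y f \<and> FMor S (f 0) \<cdot> \<delta> = \<rho> \<cdot> f (n + 1))"

definition S_isomorphic :: "nat \<Rightarrow> ('o, 'm) diagram \<times> 'm \<Rightarrow> ('o, 'm) diagram \<times> 'm \<Rightarrow> bool"
  where "S_isomorphic n T U \<longleftrightarrow> (\<exists>f g. S_morphism n T U f \<and> S_morphism n U T g \<and>
    (\<forall>i\<le>n + 1. g i \<cdot> f i = Id C (ob (fst T) i) \<and> f i \<cdot> g i = Id C (ob (fst U) i)))"

text \<open>
  The morphism \<open>[a; c] : P \<rightarrow> \<Sigma>(A \<oplus> B)\<close>, where \<open>\<Sigma>(A \<oplus> B)\<close> is regarded as the direct sum of
  \<open>\<Sigma> A\<close> and \<open>\<Sigma> B\<close> with the injections \<open>\<Sigma>(in1)\<close> and \<open>\<Sigma>(in2)\<close>.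
\<close>

definition S_col :: "'o \<Rightarrow> 'o \<Rightarrow> 'o \<Rightarrow> 'm \<Rightarrow> 'm \<Rightarrow> 'm"
  where "S_col P A B a c = add P (FOb S (osum A B))
    (FMor S (in1 (bp A B)) \<cdot> a) (FMor S (in2 (bp A B)) \<cdot> c)"

definition S_mat :: "'o \<Rightarrow> 'o \<Rightarrow> 'o \<Rightarrow> 'o \<Rightarrow> 'm \<Rightarrow> 'm \<Rightarrow> 'm \<Rightarrow> 'm \<Rightarrow> 'm"
  where "S_mat A B A' B' a b c d =
    S_col (osum A B) A' B' (row A B (FOb S A') a b) (row A B (FOb S B') c d)"

definition S_sum ::
    "nat \<Rightarrow> ('o, 'm) diagram \<times> 'm \<Rightarrow> ('o, 'm) diagram \<times> 'm \<Rightarrow> ('o, 'm) diagram \<times> 'm"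
  where "S_sum n = (\<lambda>(X, \<delta>) (Y, \<rho>).
    (\<lparr>ob = (\<lambda>i. osum (ob X i) (ob Y i)),
      df = (\<lambda>i. mat (ob X i) (ob Y i) (ob X (i + 1)) (ob Y (i + 1))
        (df X i) (zero (ob Y i) (ob X (i + 1)))
        (zero (ob X i) (ob Y (i + 1))) (df Y i))\<rparr>,
     S_mat (ob X (n + 1)) (ob Y (n + 1)) (ob X 0) (ob Y 0)
       \<delta> (zero (ob Y (n + 1)) (FOb S (ob X 0)))
       (zero (ob X (n + 1)) (FOb S (ob Y 0))) \<rho>))"

definition S_rotate :: "nat \<Rightarrow> ('o, 'm) diagram \<times> 'm \<Rightarrow> ('o, 'm) diagram \<times> 'm"
  where "S_rotate n = (\<lambda>(X, \<delta>).
    (\<lparr>ob = (\<lambda>i. if i \<le> n then ob X (i + 1) else FOb S (ob X 0)),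
      df = (\<lambda>i. if i < n then df X (i + 1) else \<delta>)\<rparr>,
     if even n then FMor S (df X 0)
     else neg (FOb S (ob X 0)) (FOb S (ob X 1)) (FMor S (df X 0))))"

definition S_cone ::
    "nat \<Rightarrow> ('o, 'm) diagram \<times> 'm \<Rightarrow> ('o, 'm) diagram \<times> 'm \<Rightarrow> (nat \<Rightarrow> 'm)
      \<Rightarrow> ('o, 'm) diagram \<times> 'm"
  where "S_cone n = (\<lambda>(X, \<delta>) (Y, \<rho>) f.
    let X' = (\<lambda>i. if i \<le> n + 1 then ob X i else FOb S (ob X 0));
        d = (\<lambda>i. if i \<le> n then df X i else \<delta>)
    in (\<lparr>ob = (\<lambda>i. osum (X' (i + 1)) (ob Y i)),
         df = (\<lambda>i. mat (X' (i + 1)) (ob Y i) (X' (i + 2)) (ob Y (i + 1))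
           (neg (X' (i + 1)) (X' (i + 2)) (d (i + 1))) (zero (ob Y i) (X' (i + 2)))
           (f (i + 1)) (df Y i))\<rparr>,
        S_mat (FOb S (ob X 0)) (ob Y (n + 1)) (ob X 1) (ob Y 0)
          (neg (FOb S (ob X 0)) (FOb S (ob X 1)) (FMor S (df X 0)))
          (zero (ob Y (n + 1)) (FOb S (ob X 1)))
          (FMor S (f 0)) \<rho>))"

end

locale angulated_category = suspended_category C S
  for C :: "('o, 'm) precat" and S :: "('o, 'm) endofunctor" +
  fixes n :: nat
    and Angles :: "(('o, 'm) diagram \<times> 'm) set"
  assumes Angles_sequences: "T \<in> Angles \<Longrightarrow> is_S_sequence n T"
    and Angles_iso: "\<lbrakk>T \<in> Angles; is_S_sequence n U; S_isomorphic n T U\<rbrakk> \<Longrightarrow> U \<in> Angles"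
    and F1a_sum: "\<lbrakk>T \<in> Angles; U \<in> Angles\<rbrakk> \<Longrightarrow> S_sum n T U \<in> Angles"
    and F1a_summand: "\<lbrakk>is_S_sequence n T; is_S_sequence n U; S_sum n T U \<in> Angles\<rbrakk>
      \<Longrightarrow> T \<in> Angles \<and> U \<in> Angles"
    and F1b: "\<lbrakk>A \<in> Obj C; zero_object Z\<rbrakk> \<Longrightarrow> (trivial_left Z A, zero Z (FOb S A)) \<in> Angles"
    and F1c: "\<lbrakk>A \<in> Obj C; B \<in> Obj C; f \<in> mor A B\<rbrakk>
      \<Longrightarrow> \<exists>X \<delta>. (X, \<delta>) \<in> Angles \<and> ob X 0 = A \<and> ob X 1 = B \<and> df X 0 = f"
    and F2: "is_S_sequence n T \<Longrightarrow> T \<in> Angles \<longleftrightarrow> S_rotate n T \<in> Angles"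
    and F3: "\<lbrakk>(X, \<delta>) \<in> Angles; (Y, \<rho>) \<in> Angles;
        f0 \<in> mor (ob X 0) (ob Y 0); f1 \<in> mor (ob X 1) (ob Y 1); f1 \<cdot> df X 0 = df Y 0 \<cdot> f0\<rbrakk>
      \<Longrightarrow> \<exists>f. S_morphism n (X, \<delta>) (Y, \<rho>) f \<and> f 0 = f0 \<and> f 1 = f1"
    and F4: "\<lbrakk>(X, \<delta>) \<in> Angles; (Y, \<rho>) \<in> Angles;
        f0 \<in> mor (ob X 0) (ob Y 0); f1 \<in> mor (ob X 1) (ob Y 1); f1 \<cdot> df X 0 = df Y 0 \<cdot> f0\<rbrakk>
      \<Longrightarrow> \<exists>f. S_morphism n (X, \<delta>) (Y, \<rho>) f \<and> f 0 = f0 \<and> f 1 = f1 \<and>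
            S_cone n (X, \<delta>) (Y, \<rho>) f \<in> Angles"

section \<open>Exangulated categories\<close>

text \<open>\<open>EOb E C A\<close> is \<open>\<bbbE>(C, A)\<close>, contravariant in \<open>C\<close>; \<open>EMor E c a\<close> is \<open>\<bbbE>(c, a)\<close>.\<close>

record ('o, 'm, 'e) bifunctor =
  EOb :: "'o \<Rightarrow> 'o \<Rightarrow> 'e monoid"
  EMor :: "'m \<Rightarrow> 'm \<Rightarrow> 'e \<Rightarrow> 'e"

locale extension_category = additive_category C
  for C :: "('o, 'm) precat" +
  fixes E :: "('o, 'm, 'e) bifunctor"
  assumes E_group: "\<lbrakk>B \<in> Obj C; A \<in> Obj C\<rbrakk> \<Longrightarrow> comm_group (EOb E B A)"
    and E_hom: "\<lbrakk>A \<in> Obj C; A' \<in> Obj C; B \<in> Obj C; B' \<in> Obj C; c \<in> mor B' B; a \<in> mor A A'\<rbrakk>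
      \<Longrightarrow> EMor E c a \<in> hom (EOb E B A) (EOb E B' A')"
    and E_Id: "\<lbrakk>A \<in> Obj C; B \<in> Obj C; \<delta> \<in> carrier (EOb E B A)\<rbrakk>
      \<Longrightarrow> EMor E (Id C B) (Id C A) \<delta> = \<delta>"
    and E_Comp: "\<lbrakk>A \<in> Obj C; A' \<in> Obj C; A'' \<in> Obj C; B \<in> Obj C; B' \<in> Obj C; B'' \<in> Obj C;
        c \<in> mor B' B; c' \<in> mor B'' B'; a \<in> mor A A'; a' \<in> mor A' A''; \<delta> \<in> carrier (EOb E B A)\<rbrakk>
      \<Longrightarrow> EMor E (c \<cdot> c') (a' \<cdot> a) \<delta> = EMor E c' a' (EMor E c a \<delta>)"
    and E_add_left: "\<lbrakk>A \<in> Obj C; A' \<in> Obj C; B \<in> Obj C; B' \<in> Obj C;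
        c \<in> mor B' B; c' \<in> mor B' B; a \<in> mor A A'; \<delta> \<in> carrier (EOb E B A)\<rbrakk>
      \<Longrightarrow> EMor E (add B' B c c') a \<delta> = EMor E c a \<delta> \<otimes>\<^bsub>EOb E B' A'\<^esub> EMor E c' a \<delta>"
    and E_add_right: "\<lbrakk>A \<in> Obj C; A' \<in> Obj C; B \<in> Obj C; B' \<in> Obj C;
        c \<in> mor B' B; a \<in> mor A A'; a' \<in> mor A A'; \<delta> \<in> carrier (EOb E B A)\<rbrakk>
      \<Longrightarrow> EMor E c (add A A' a a') \<delta> = EMor E c a \<delta> \<otimes>\<^bsub>EOb E B' A'\<^esub> EMor E c a' \<delta>"
begin

text \<open>\<open>push B a \<delta>\<close> is \<open>a\<^sub>*\<delta>\<close> for \<open>\<delta> \<in> \<bbbE>(B, A)\<close>, and \<open>pull A c \<delta>\<close> is \<open>c\<^sup>*\<delta>\<close>.\<close>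

definition push :: "'o \<Rightarrow> 'm \<Rightarrow> 'e \<Rightarrow> 'e"
  where "push B a \<delta> = EMor E (Id C B) a \<delta>"

definition pull :: "'o \<Rightarrow> 'm \<Rightarrow> 'e \<Rightarrow> 'e"
  where "pull A c \<delta> = EMor E c (Id C A) \<delta>"

definition exangle :: "nat \<Rightarrow> ('o, 'm) diagram \<Rightarrow> 'e \<Rightarrow> bool"
  where "exangle n X \<delta> \<longleftrightarrow> is_complex n X \<and> \<delta> \<in> carrier (EOb E (ob X (n + 1)) (ob X 0)) \<and>
    (\<forall>T\<in>Obj C.
      (\<forall>i\<in>{1..n}. (\<lambda>g. df X (i - 1) \<cdot> g) ` mor T (ob X (i - 1)) =
         kernel (Hom C T (ob X i)) (Hom C T (ob X (i + 1))) (\<lambda>g. df X i \<cdot> g)) \<and>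
      (\<lambda>g. df X n \<cdot> g) ` mor T (ob X n) =
         kernel (Hom C T (ob X (n + 1))) (EOb E T (ob X 0)) (\<lambda>g. pull (ob X 0) g \<delta>)) \<and>
    (\<forall>T\<in>Obj C.
      (\<forall>i\<in>{1..n}. (\<lambda>g. g \<cdot> df X i) ` mor (ob X (i + 1)) T =
         kernel (Hom C (ob X i) T) (Hom C (ob X (i - 1)) T) (\<lambda>g. g \<cdot> df X (i - 1))) \<and>
      (\<lambda>g. g \<cdot> df X 0) ` mor (ob X 1) T =
         kernel (Hom C (ob X 0) T) (EOb E (ob X (n + 1)) T) (\<lambda>g. push (ob X (n + 1)) g \<delta>))"

end

locale realized_category = extension_category C E
  for C :: "('o, 'm) precat" and E :: "('o, 'm, 'e) bifunctor" +
  fixes n :: nat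
    and s :: "'o \<Rightarrow> 'o \<Rightarrow> 'e \<Rightarrow> ('o, 'm) diagram set"
  assumes n_ge_1: "1 \<le> n"
    and s_class: "\<lbrakk>A \<in> Obj C; B \<in> Obj C; \<delta> \<in> carrier (EOb E B A)\<rbrakk>
      \<Longrightarrow> \<exists>X\<in>complexes n A B. s B A \<delta> = hclass n A B X"
    and R0: "\<lbrakk>A \<in> Obj C; B \<in> Obj C; A' \<in> Obj C; B' \<in> Obj C;
        \<delta> \<in> carrier (EOb E B A); \<rho> \<in> carrier (EOb E B' A');
        X \<in> complexes n A B; s B A \<delta> = hclass n A B X;
        Y \<in> complexes n A' B'; s B' A' \<rho> = hclass n A' B' Y;
        a \<in> mor A A'; c \<in> mor B B'; push B a \<delta> = pull A' c \<rho>\<rbrakk>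
      \<Longrightarrow> \<exists>f. chain_map n X Y f \<and> f 0 = a \<and> f (n + 1) = c"
    and R1: "\<lbrakk>A \<in> Obj C; B \<in> Obj C; \<delta> \<in> carrier (EOb E B A);
        X \<in> complexes n A B; s B A \<delta> = hclass n A B X\<rbrakk> \<Longrightarrow> exangle n X \<delta>"
    and R2_left: "\<lbrakk>A \<in> Obj C; zero_object Z\<rbrakk>
      \<Longrightarrow> s Z A \<one>\<^bsub>EOb E Z A\<^esub> = hclass n A Z (trivial_left Z A)"
    and R2_right: "\<lbrakk>A \<in> Obj C; zero_object Z\<rbrakk>
      \<Longrightarrow> s A Z \<one>\<^bsub>EOb E A Z\<^esub> = hclass n Z A (trivial_right n Z A)"
begin

definition distinguished :: "('o, 'm) diagram \<Rightarrow> 'e \<Rightarrow> bool"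
  where "distinguished X \<delta> \<longleftrightarrow> is_complex n X \<and> \<delta> \<in> carrier (EOb E (ob X (n + 1)) (ob X 0)) \<and>
    s (ob X (n + 1)) (ob X 0) \<delta> = hclass n (ob X 0) (ob X (n + 1)) X"

definition inflation :: "'o \<Rightarrow> 'o \<Rightarrow> 'm \<Rightarrow> bool"
  where "inflation A B f \<longleftrightarrow>
    (\<exists>X \<delta>. distinguished X \<delta> \<and> ob X 0 = A \<and> ob X 1 = B \<and> df X 0 = f)"

definition deflation :: "'o \<Rightarrow> 'o \<Rightarrow> 'm \<Rightarrow> bool"
  where "deflation A B f \<longleftrightarrow>
    (\<exists>X \<delta>. distinguished X \<delta> \<and> ob X n = A \<and> ob X (n + 1) = B \<and> df X n = f)"

end

locale exangulated_category = realized_category C E n s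
  for C :: "('o, 'm) precat" and E :: "('o, 'm, 'e) bifunctor" and n :: nat
    and s :: "'o \<Rightarrow> 'o \<Rightarrow> 'e \<Rightarrow> ('o, 'm) diagram set" +
  assumes EA1_inflation: "\<lbrakk>inflation A B f; inflation B D g\<rbrakk> \<Longrightarrow> inflation A D (g \<cdot> f)"
    and EA1_deflation: "\<lbrakk>deflation A B f; deflation B D g\<rbrakk> \<Longrightarrow> deflation A D (g \<cdot> f)"
    and EA2: "\<lbrakk>A \<in> Obj C; B \<in> Obj C; D \<in> Obj C; \<rho> \<in> carrier (EOb E D A); c \<in> mor B D;
        X \<in> complexes n A B; distinguished X (pull A c \<rho>);
        Y \<in> complexes n A D; distinguished Y \<rho>\<rbrakk>
      \<Longrightarrow> \<exists>f. chain_map n X Y f \<and> f 0 = Id C A \<and> f (n + 1) = c \<and>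
            distinguished (mapping_cone n X Y f) (push D (df X 0) \<rho>)"
    and EA2_op: "\<lbrakk>A \<in> Obj C; B \<in> Obj C; D \<in> Obj C; \<delta> \<in> carrier (EOb E D A); a \<in> mor A B;
        X \<in> complexes n A D; distinguished X \<delta>;
        Y \<in> complexes n B D; distinguished Y (push D a \<delta>)\<rbrakk>
      \<Longrightarrow> \<exists>h. chain_map n X Y h \<and> h 0 = a \<and> h (n + 1) = Id C D \<and>
            distinguished (mapping_cocone n X Y h) (pull A (df Y n) \<delta>)"

section \<open>The realization defined by the angles\<close>

definition E_Sigma :: "('o, 'm) precat \<Rightarrow> ('o, 'm) endofunctor \<Rightarrow> ('o, 'm, 'm) bifunctor"
  where "E_Sigma C S =
    \<lparr>EOb = (\<lambda>B A. Hom C B (FOb S A)),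
     EMor = (\<lambda>c a \<delta>. Comp C (FMor S a) (Comp C \<delta> c))\<rparr>"

definition completes ::
    "nat \<Rightarrow> (('o, 'm) diagram \<times> 'm) set \<Rightarrow> 'o \<Rightarrow> 'o \<Rightarrow> 'm \<Rightarrow> ('o, 'm) diagram \<Rightarrow> bool"
  where "completes n Angles B A \<delta> X \<longleftrightarrow> (X, \<delta>) \<in> Angles \<and> ob X 0 = A \<and> ob X (n + 1) = B"

definition s_angles ::
    "('o, 'm) precat \<Rightarrow> nat \<Rightarrow> (('o, 'm) diagram \<times> 'm) set
      \<Rightarrow> 'o \<Rightarrow> 'o \<Rightarrow> 'm \<Rightarrow> ('o, 'm) diagram set"
  where "s_angles C n Angles B A \<delta> =
    preadditive_category.hclass C n A B (SOME X. completes n Angles B A \<delta> X)"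

end

theory Submission
  imports Defs
begin

text \<open>
  All morphisms are embedded into one ring, where \<open>\<Sigma>\<close> acts as an inner automorphism, so that
  identities between morphisms become identities in a ring. An \<open>(n + 2)\<close>-angle is extended
  periodically to a sequence indexed by the integers, so that rotation is a shift of the index;
  the completion of morphisms (F3) and the cone (F4) are then available in every position,
  and exactness follows. Two exact complexes with the same ends are homotopy equivalent relative
  to their ends as soon as there are maps in both directions fixing the ends: if \<open>f\<close> and \<open>g\<close> are
  such maps, \<open>(g f - 1)\<^sup>2\<close> is null-homotopic. Hence \<open>\<delta>\<close> is realized exactly by the exact complexes
  that are linked in this way to an angle on \<open>\<delta>\<close>. As every morphism is both an inflation and a
  deflation, (EA1) is trivial. For (EA2) and its dual, the mapping cone or cocone
  is linked to the angle that (F4) provides as the cone of a completed morphism; the ends of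
  the obvious comparison maps are corrected by exactness.
\<close>

section \<open>A ring containing all morphisms\<close>

text \<open>Axiom (EA2) and its dual concern arbitrary representatives of two homotopy classes,
  whereas (F4) speaks of angles. A lift is therefore built through angles, x -> W -> V -> y, where
  the middle map \<phi> is a completion whose cone is again an angle. The resulting map f agrees
  with \<phi> only up to homotopy, and these homotopies enter the comparison of the cone of f with
  the cone of \<phi>. Moreover the cone in (F4) has two summands more than the cone of an
  exangulated category, one at each end; they are tied together by the end component of \<phi> that
  is an identity. Eliminating them gives comparison maps whose composite is visibly the identity at
  one end but not at the other, which is why exactness has to correct the second end. The ring makes
  such checks uniform: matrix identities between many different hom-sets become identities of words,
  with idempotents in place of identity morphisms, and membership in a hom-set is needed only where
  an idempotent is to be cancelled.\<close>

typedef (overloaded) 'a endo = "{f :: 'a::ab_group_add \<Rightarrow> 'a. \<forall>x y. f (x + y) = f x + f y}"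
  morphisms app Endo
  by (rule exI[of _ "\<lambda>x. x"]) simp

lemma app_add: "app r (x + y) = app r x + app r y"
  using app[of r] by simp

lemma app_zero: "app r 0 = 0"
  using app_add[of r 0 0] by simp

lemma app_Endo: "(\<And>x y. f (x + y) = f x + f y) \<Longrightarrow> app (Endo f) = f"
  by (rule Endo_inverse) simp

lemma endo_eqI: "(\<And>x. app r x = app s x) \<Longrightarrow> r = s"
  by (metis app_inverse ext)

instantiation endo :: (ab_group_add) ring
begin

definition "0 = Endo (\<lambda>x. 0)"
definition "r + s = Endo (\<lambda>x. app r x + app s x)"
definition "- r = Endo (\<lambda>x. - app r x)"
definition "r - s = Endo (\<lambda>x. app r x - app s x)"
definition "r * s = Endo (\<lambda>x. app r (app s x))"

lemma app_ring_ops: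
  "app 0 x = 0" "app (r + s) x = app r x + app s x" "app (- r) x = - app r x"
  "app (r - s) x = app r x - app s x" "app (r * s) x = app r (app s x)"
  unfolding zero_endo_def plus_endo_def uminus_endo_def minus_endo_def times_endo_def
  by (subst app_Endo; simp add: app_add)+

instance
  by standard (auto intro!: endo_eqI simp: app_ring_ops app_add)

end

instantiation endo :: (ab_group_add) monoid_mult
begin

definition "1 = Endo (\<lambda>x. x)"

lemma app_one: "app 1 x = x"
  unfolding one_endo_def by (subst app_Endo) simp_all

instance
  by standard (auto intro!: endo_eqI simp: app_ring_ops app_one)

end

text \<open>Record fields carry no meaning outside preadditive categories and their objects. A
  one-element group is put there, so that every index of a family gives an abelian group.\<close>

definition hom_group :: "('o, 'm) precat \<Rightarrow> 'o \<Rightarrow> 'o \<Rightarrow> 'm monoid"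
  where "hom_group C A B = (if preadditive_category C \<and> A \<in> Obj C \<and> B \<in> Obj C then Hom C A B
    else \<lparr>carrier = {undefined}, mult = \<lambda>_ _. undefined, one = undefined\<rparr>)"

lemma comm_group_hom_group: "comm_group (hom_group C A B)"
  unfolding hom_group_def
  by (auto simp: preadditive_category.Hom_group intro!: comm_groupI)

text \<open>
  A type cannot depend on a category, so the families of morphisms are taken over all
  preadditive categories at once.
\<close>

typedef ('o, 'm) family =
  "{x :: ('o, 'm) precat \<Rightarrow> 'o \<Rightarrow> 'o \<Rightarrow> 'm. \<forall>C A B. x C A B \<in> carrier (hom_group C A B)}"
  morphisms fam Family
  by (rule exI[of _ "\<lambda>C A B. \<one>\<^bsub>hom_group C A B\<^esub>"])
    (simp add: comm_group.axioms(2)[OF comm_group_hom_group] group.is_monoid monoid.one_closed)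

lemma fam_closed: "fam x C A B \<in> carrier (hom_group C A B)"
  using fam[of x] by simp

lemma fam_Family:
  "(\<And>C A B. x C A B \<in> carrier (hom_group C A B)) \<Longrightarrow> fam (Family x) = x"
  by (rule Family_inverse) simp

lemma family_eqI: "(\<And>C A B. fam x C A B = fam y C A B) \<Longrightarrow> x = y"
  by (metis fam_inverse ext)

lemma hom_group_simps:
  "group (hom_group C A B)" "monoid (hom_group C A B)" "comm_monoid (hom_group C A B)"
  by (simp_all add: comm_group.axioms[OF comm_group_hom_group] group.is_monoid)

instantiation family :: (type, type) ab_group_add
begin

definition "0 = Family (\<lambda>C A B. \<one>\<^bsub>hom_group C A B\<^esub>)"
definition "x + y = Family (\<lambda>C A B. fam x C A B \<otimes>\<^bsub>hom_group C A B\<^esub> fam y C A B)"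
definition "- x = Family (\<lambda>C A B. inv\<^bsub>hom_group C A B\<^esub> fam x C A B)"
definition "(x :: ('a, 'b) family) - y = x + - y"

lemma fam_ops:
  "fam 0 C A B = \<one>\<^bsub>hom_group C A B\<^esub>"
  "fam (x + y) C A B = fam x C A B \<otimes>\<^bsub>hom_group C A B\<^esub> fam y C A B"
  "fam (- x) C A B = inv\<^bsub>hom_group C A B\<^esub> fam x C A B"
  unfolding zero_family_def plus_family_def uminus_family_def
  by (subst fam_Family; simp add: hom_group_simps fam_closed monoid.m_closed monoid.one_closed
      group.inv_closed)+

instance
  by standard (auto intro!: family_eqI simp: fam_ops minus_family_def fam_closed hom_group_simps
      monoid.m_assoc comm_monoid.m_comm monoid.l_one group.l_inv group.r_inv)

end

type_synonym ('o, 'm) gen = "('o, 'm) family endo"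

section \<open>Morphisms of one category as ring elements\<close>

context preadditive_category
begin

lemma Hom_simps:
  assumes "A \<in> Obj C" "B \<in> Obj C"
  shows "group (Hom C A B)" "monoid (Hom C A B)" "comm_monoid (Hom C A B)"
  by (simp_all add: comm_group.axioms[OF Hom_group[OF assms]] group.is_monoid)

lemma zero_mor [simp]: "\<lbrakk>A \<in> Obj C; B \<in> Obj C\<rbrakk> \<Longrightarrow> zero A B \<in> mor A B"
  by (simp add: Hom_simps monoid.one_closed)

lemma add_mor [simp]: "\<lbrakk>A \<in> Obj C; B \<in> Obj C; f \<in> mor A B; g \<in> mor A B\<rbrakk> \<Longrightarrow> add A B f g \<in> mor A B"
  by (simp add: Hom_simps monoid.m_closed)

lemma neg_mor [simp]: "\<lbrakk>A \<in> Obj C; B \<in> Obj C; f \<in> mor A B\<rbrakk> \<Longrightarrow> neg A B f \<in> mor A B"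
  by (simp add: Hom_simps group.inv_closed)

lemma add_self_iff:
  assumes "A \<in> Obj C" "B \<in> Obj C" "f \<in> mor A B" "add A B f f = f"
  shows "f = zero A B"
proof -
  interpret group "Hom C A B" using assms Hom_simps by blast
  show ?thesis using assms by (metis l_cancel_one)
qed

lemma comp_zero_right:
  assumes "A \<in> Obj C" "B \<in> Obj C" "D \<in> Obj C" "g \<in> mor B D"
  shows "g \<cdot> zero A B = zero A D"
proof (rule add_self_iff)
  have "zero A B = add A B (zero A B) (zero A B)"
    using assms by (simp add: Hom_simps monoid.l_one)
  then show "add A D (g \<cdot> zero A B) (g \<cdot> zero A B) = g \<cdot> zero A B"
    using assms Comp_add_right[of A B D "zero A B" "zero A B" g] by simp
qed (use assms Comp_Hom[of A B D] in auto)

lemma hom_group_eq: "\<lbrakk>A \<in> Obj C; B \<in> Obj C\<rbrakk> \<Longrightarrow> hom_group C A B = Hom C A B"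
  by (simp add: hom_group_def preadditive_category_axioms)

lemma fam_mor: "\<lbrakk>A \<in> Obj C; B \<in> Obj C\<rbrakk> \<Longrightarrow> fam x C A B \<in> mor A B"
  using fam_closed[of x C A B] by (simp add: hom_group_eq)

text \<open>A matrix unit: postcomposition with \<open>f\<close>, for all test objects
  \<open>T\<close> at once, moves the components ending at \<open>A\<close> to those ending at
  \<open>B\<close> and annihilates the rest. Composition of morphisms thereby becomes the ring
  product.\<close>

definition arr :: "'o \<Rightarrow> 'o \<Rightarrow> 'm \<Rightarrow> ('o, 'm) gen"
  where "arr A B f = Endo (\<lambda>x. Family (\<lambda>C' T D.
    if C' = C \<and> T \<in> Obj C \<and> D = B then f \<cdot> fam x C T A else \<one>\<^bsub>hom_group C' T D\<^esub>))"

lemma fam_arr: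
  assumes "A \<in> Obj C" "B \<in> Obj C" "f \<in> mor A B"
  shows "fam (app (arr A B f) x) C' T D =
    (if C' = C \<and> T \<in> Obj C \<and> D = B then f \<cdot> fam x C T A else \<one>\<^bsub>hom_group C' T D\<^esub>)"
proof -
  let ?F = "\<lambda>x C' T D.
    if C' = C \<and> T \<in> Obj C \<and> D = B then f \<cdot> fam x C T A else \<one>\<^bsub>hom_group C' T D\<^esub>"
  have F: "fam (Family (?F x)) = ?F x" for x
    using assms Comp_Hom[of _ A B]
    by (intro fam_Family) (auto simp: hom_group_eq fam_mor hom_group_simps monoid.one_closed)
  have "app (Endo (\<lambda>x. Family (?F x))) = (\<lambda>x. Family (?F x))"
    using assms by (intro app_Endo family_eqI)
      (auto simp: fam_ops F hom_group_eq Comp_add_right[of _ A B] fam_mor hom_group_simps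
        monoid.one_closed monoid.l_one)
  then show ?thesis
    unfolding arr_def by (simp add: F)
qed

text \<open>Yoneda: \<open>f\<close> is read off from its effect on the family whose only nonzero
  component is the identity of \<open>A\<close>.\<close>

lemma arr_inj:
  assumes "A \<in> Obj C" "B \<in> Obj C" "f \<in> mor A B" "g \<in> mor A B" "arr A B f = arr A B g"
  shows "f = g"
proof -
  define x where "x = Family (\<lambda>C' T D. if C' = C \<and> T = A \<and> D = A then Id C A
    else \<one>\<^bsub>hom_group C' T D\<^esub>)"
  have "fam x C A A = Id C A"
    unfolding x_def using assms
    by (subst fam_Family) (auto simp: hom_group_eq Id_Hom hom_group_simps monoid.one_closed)
  then have *: "fam (app (arr A B h) x) C A B = h" if "h \<in> mor A B" for h
    using assms(1,2) that by (simp add: fam_arr Comp_Id_right)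
  show ?thesis using *[OF assms(3)] *[OF assms(4)] unfolding assms(5) by (rule trans[OF sym])
qed

lemma arr_comp:
  assumes "A \<in> Obj C" "B \<in> Obj C" "D \<in> Obj C" "f \<in> mor A B" "g \<in> mor B D"
  shows "arr A D (g \<cdot> f) = arr B D g * arr A B f"
  using assms Comp_Hom[OF assms]
  by (intro endo_eqI family_eqI) (auto simp: app_ring_ops fam_arr fam_mor Comp_assoc[of _ A B D])

lemma arr_add:
  assumes "A \<in> Obj C" "B \<in> Obj C" "f \<in> mor A B" "g \<in> mor A B"
  shows "arr A B (add A B f g) = arr A B f + arr A B g"
  using assms
  by (intro endo_eqI family_eqI)
    (auto simp: app_ring_ops fam_arr fam_ops fam_mor hom_group_eq Comp_add_left[of _ A B]
      hom_group_simps monoid.one_closed monoid.l_one)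

lemma arr_zero:
  assumes "A \<in> Obj C" "B \<in> Obj C"
  shows "arr A B (zero A B) = 0"
proof -
  have "add A B (zero A B) (zero A B) = zero A B"
    using assms by (simp add: Hom_simps monoid.l_one)
  then show ?thesis
    using assms arr_add[of A B "zero A B" "zero A B"] by simp
qed

lemma arr_neg:
  assumes "A \<in> Obj C" "B \<in> Obj C" "f \<in> mor A B"
  shows "arr A B (neg A B f) = - arr A B f"
proof -
  have "add A B (neg A B f) f = zero A B"
    using assms by (simp add: Hom_simps group.l_inv)
  then have "arr A B (neg A B f) + arr A B f = 0"
    using assms arr_add[of A B "neg A B f" f] by (simp add: arr_zero)
  then show ?thesis by (simp add: eq_neg_iff_add_eq_0)
qed

text \<open>An idempotent, in general different from the unit \<open>1\<close> of the ring. It can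
  be cancelled next to \<open>x\<close> only when \<open>x\<close> is known to lie in some
  \<open>hom A B\<close> with a matching end.\<close>

definition one :: "'o \<Rightarrow> ('o, 'm) gen"
  where "one A = arr A A (Id C A)"

text \<open>Empty unless both ends are objects, so that membership also records
  \<open>A \<in> Obj C\<close> and \<open>B \<in> Obj C\<close>.\<close>

definition hom :: "'o \<Rightarrow> 'o \<Rightarrow> ('o, 'm) gen set"
  where "hom A B = (if A \<in> Obj C \<and> B \<in> Obj C then arr A B ` mor A B else {})"

definition carr :: "'o \<Rightarrow> 'o \<Rightarrow> ('o, 'm) gen \<Rightarrow> 'm"
  where "carr A B = inv_into (mor A B) (arr A B)"

lemma hom_Obj: "x \<in> hom A B \<Longrightarrow> A \<in> Obj C \<and> B \<in> Obj C"
  by (simp add: hom_def split: if_splits)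

lemma arr_hom [intro]: "\<lbrakk>A \<in> Obj C; B \<in> Obj C; f \<in> mor A B\<rbrakk> \<Longrightarrow> arr A B f \<in> hom A B"
  by (simp add: hom_def)

lemma carr_mor: "x \<in> hom A B \<Longrightarrow> carr A B x \<in> mor A B"
  unfolding carr_def hom_def by (auto intro: inv_into_into split: if_splits)

lemma arr_carr: "x \<in> hom A B \<Longrightarrow> arr A B (carr A B x) = x"
  unfolding carr_def hom_def by (auto intro: f_inv_into_f split: if_splits)

lemma carr_arr: "\<lbrakk>A \<in> Obj C; B \<in> Obj C; f \<in> mor A B\<rbrakk> \<Longrightarrow> carr A B (arr A B f) = f"
  using arr_inj[of A B] unfolding carr_def
  by (intro inv_into_f_f) (auto simp: inj_on_def)

lemma arr_eq_iff:
  "\<lbrakk>A \<in> Obj C; B \<in> Obj C; f \<in> mor A B; g \<in> mor A B\<rbrakk> \<Longrightarrow> arr A B f = arr A B g \<longleftrightarrow> f = g"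
  using arr_inj by blast

lemma hom_comp: "\<lbrakk>x \<in> hom A B; y \<in> hom B D\<rbrakk> \<Longrightarrow> y * x \<in> hom A D"
  unfolding hom_def by (auto simp flip: arr_comp split: if_splits intro!: imageI Comp_Hom[of A B D])

lemma hom_add: "\<lbrakk>x \<in> hom A B; y \<in> hom A B\<rbrakk> \<Longrightarrow> x + y \<in> hom A B"
  unfolding hom_def by (auto simp flip: arr_add split: if_splits)

lemma hom_uminus: "x \<in> hom A B \<Longrightarrow> - x \<in> hom A B"
  unfolding hom_def by (auto simp flip: arr_neg split: if_splits)

lemma hom_diff: "\<lbrakk>x \<in> hom A B; y \<in> hom A B\<rbrakk> \<Longrightarrow> x - y \<in> hom A B"
  using hom_add[of x A B "- y"] hom_uminus[of y A B] by simp

lemma hom_zero: "\<lbrakk>A \<in> Obj C; B \<in> Obj C\<rbrakk> \<Longrightarrow> 0 \<in> hom A B"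
  using arr_zero[of A B] arr_hom[of A B "zero A B"] by simp

lemma one_hom: "A \<in> Obj C \<Longrightarrow> one A \<in> hom A A"
  by (simp add: one_def arr_hom Id_Hom)

lemma one_left: "x \<in> hom A B \<Longrightarrow> one B * x = x"
  unfolding hom_def one_def
  by (auto simp flip: arr_comp simp: Id_Hom Comp_Id_left split: if_splits)

lemma one_right: "x \<in> hom A B \<Longrightarrow> x * one A = x"
  unfolding hom_def one_def
  by (auto simp flip: arr_comp simp: Id_Hom Comp_Id_right split: if_splits)

lemma one_left': "x \<in> hom A B \<Longrightarrow> one B * (x * y) = x * y"
  by (simp add: one_left flip: mult.assoc)

text \<open>Every element of \<open>hom A Z\<close> or \<open>hom Z A\<close> absorbs the idempotent
  \<open>one Z\<close> and so vanishes with it. Later computations use zero objects in the form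
  \<open>one Z = 0\<close>.\<close>

lemma one_eq_zero_iff:
  assumes "Z \<in> Obj C"
  shows "zero_object Z \<longleftrightarrow> one Z = 0"
proof
  assume "zero_object Z"
  then have "Id C Z = zero Z Z"
    using assms Id_Hom[of Z] zero_mor[of Z Z] unfolding zero_object_def by blast
  then show "one Z = 0" using assms by (simp add: one_def arr_zero)
next
  assume *: "one Z = 0"
  have "x = 0" if "x \<in> hom A Z" for x A using one_left[OF that] * by simp
  moreover have "x = 0" if "x \<in> hom Z A" for x A using one_right[OF that] * by simp
  ultimately show "zero_object Z"
    unfolding zero_object_def using assms
    by (metis arr_hom arr_inj zero_mor)
qed

end

section \<open>The suspension as a ring automorphism\<close>

context additive_category
begin

lemma bp: "\<lbrakk>A \<in> Obj C; B \<in> Obj C\<rbrakk> \<Longrightarrow> is_biproduct A B (bp A B)"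
  unfolding bp_def using has_biproducts by (rule someI_ex)

definition j1 :: "'a \<Rightarrow> 'a \<Rightarrow> ('a, 'b) gen" where "j1 A B = arr A (osum A B) (in1 (bp A B))"
definition j2 :: "'a \<Rightarrow> 'a \<Rightarrow> ('a, 'b) gen" where "j2 A B = arr B (osum A B) (in2 (bp A B))"
definition q1 :: "'a \<Rightarrow> 'a \<Rightarrow> ('a, 'b) gen" where "q1 A B = arr (osum A B) A (pr1 (bp A B))"
definition q2 :: "'a \<Rightarrow> 'a \<Rightarrow> ('a, 'b) gen" where "q2 A B = arr (osum A B) B (pr2 (bp A B))"

lemma bp_mor:
  assumes "A \<in> Obj C" "B \<in> Obj C"
  shows "osum A B \<in> Obj C" "in1 (bp A B) \<in> mor A (osum A B)" "in2 (bp A B) \<in> mor B (osum A B)"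
    "pr1 (bp A B) \<in> mor (osum A B) A" "pr2 (bp A B) \<in> mor (osum A B) B"
  using bp[OF assms] unfolding is_biproduct_def osum_def by auto

lemma bp_hom:
  assumes "A \<in> Obj C" "B \<in> Obj C"
  shows "j1 A B \<in> hom A (osum A B)" "j2 A B \<in> hom B (osum A B)"
    "q1 A B \<in> hom (osum A B) A" "q2 A B \<in> hom (osum A B) B"
  unfolding j1_def j2_def q1_def q2_def using bp_mor[OF assms] assms by auto

lemma bp_eqs:
  assumes "A \<in> Obj C" "B \<in> Obj C"
  shows "q1 A B * j1 A B = one A" "q2 A B * j2 A B = one B"
    "q2 A B * j1 A B = 0" "q1 A B * j2 A B = 0"
    "j1 A B * q1 A B + j2 A B * q2 A B = one (osum A B)"
proof -
  note bp[OF assms, unfolded is_biproduct_def, folded osum_def]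
  then show "q1 A B * j1 A B = one A" "q2 A B * j2 A B = one B"
    "q2 A B * j1 A B = 0" "q1 A B * j2 A B = 0"
    "j1 A B * q1 A B + j2 A B * q2 A B = one (osum A B)"
    unfolding j1_def j2_def q1_def q2_def one_def using assms
    by (simp_all add: arr_zero Comp_Hom[of "osum A B" A "osum A B"] Comp_Hom[of "osum A B" B "osum A B"]
        flip: arr_comp arr_add)
qed

end

section \<open>The suspension on morphisms and its additivity\<close>

context suspended_category
begin

lemma FOb_Obj [simp]: "A \<in> Obj C \<Longrightarrow> FOb S A \<in> Obj C"
  using S_Obj bij_betwE by blast

lemma FMor_mor: "\<lbrakk>A \<in> Obj C; B \<in> Obj C; f \<in> mor A B\<rbrakk> \<Longrightarrow> FMor S f \<in> mor (FOb S A) (FOb S B)"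
  using S_Hom bij_betwE by blast

lemma FMor_inj:
  "\<lbrakk>A \<in> Obj C; B \<in> Obj C; f \<in> mor A B; g \<in> mor A B; FMor S f = FMor S g\<rbrakk> \<Longrightarrow> f = g"
  by (rule inj_onD[OF bij_betw_imp_inj_on[OF S_Hom]])

lemma FMor_surj:
  assumes "A \<in> Obj C" "B \<in> Obj C" "g \<in> mor (FOb S A) (FOb S B)"
  obtains f where "f \<in> mor A B" "FMor S f = g"
proof -
  have "g \<in> FMor S ` mor A B"
    using S_Hom[OF assms(1,2)] assms(3) by (simp add: bij_betw_def)
  then show ?thesis using that by auto
qed

text \<open>Additivity is not yet at hand. A zero morphism factors through a zero object
  \<open>Z\<close>, and bijectivity on hom-sets leaves only one morphism from \<open>FOb S A\<close>
  to \<open>FOb S Z\<close>, so the image again factors through a zero morphism.\<close>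

lemma FMor_zero:
  assumes "A \<in> Obj C" "B \<in> Obj C"
  shows "FMor S (zero A B) = zero (FOb S A) (FOb S B)"
proof -
  obtain Z where Z: "Z \<in> Obj C" "zero_object Z"
    using has_zero_object unfolding zero_object_def by blast
  have "f = g" if fg: "f \<in> mor (FOb S A) (FOb S Z)" "g \<in> mor (FOb S A) (FOb S Z)" for f g
  proof -
    obtain f' g' where "f' \<in> mor A Z" "FMor S f' = f" "g' \<in> mor A Z" "FMor S g' = g"
      using FMor_surj[OF assms(1) Z(1)] fg by metis
    then show ?thesis using Z(2) assms unfolding zero_object_def by metis
  qed
  then have "FMor S (zero A Z) = zero (FOb S A) (FOb S Z)"
    using assms Z FMor_mor[of A Z] by simp
  moreover have "zero A B = zero Z B \<cdot> zero A Z"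
    using assms Z comp_zero_right[of A Z B "zero Z B"] by simp
  ultimately show ?thesis
    using assms Z FMor_mor[of Z B "zero Z B"] S_Comp[of A Z B "zero A Z" "zero Z B"]
      comp_zero_right[of "FOb S A" "FOb S Z" "FOb S B" "FMor S (zero Z B)"] by simp
qed

text \<open>A provisional suspension of ring elements that needs the two ends as arguments. It
  serves to prove additivity, on which the version \<open>sig\<close> without ends depends.\<close>

definition tau :: "'o \<Rightarrow> 'o \<Rightarrow> ('o, 'm) gen \<Rightarrow> ('o, 'm) gen"
  where "tau A B x = arr (FOb S A) (FOb S B) (FMor S (carr A B x))"

lemma tau_arr:
  "\<lbrakk>A \<in> Obj C; B \<in> Obj C; f \<in> mor A B\<rbrakk>
    \<Longrightarrow> tau A B (arr A B f) = arr (FOb S A) (FOb S B) (FMor S f)"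
  by (simp add: tau_def carr_arr)

lemma tau_comp:
  assumes "x \<in> hom A B" "y \<in> hom B D"
  shows "tau A D (y * x) = tau B D y * tau A B x"
proof -
  obtain f g where f: "f \<in> mor A B" "x = arr A B f" and g: "g \<in> mor B D" "y = arr B D g"
    using assms unfolding hom_def by (auto split: if_splits)
  have obj: "A \<in> Obj C" "B \<in> Obj C" "D \<in> Obj C" using assms hom_Obj by auto
  have "tau A D (y * x) = tau A D (arr A D (g \<cdot> f))"
    using obj f g arr_comp[of A B D f g] by simp
  then show ?thesis
    using obj f g Comp_Hom[of A B D f g] by (simp add: tau_arr S_Comp[of A B D] arr_comp[of _ "FOb S B"] FMor_mor)
qed

lemma tau_inj: "\<lbrakk>x \<in> hom A B; y \<in> hom A B; tau A B x = tau A B y\<rbrakk> \<Longrightarrow> x = y"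
  unfolding hom_def
  by (auto split: if_splits simp: tau_arr arr_eq_iff FMor_mor) (metis FMor_inj)

lemma tau_surj:
  assumes "A \<in> Obj C" "B \<in> Obj C" "y \<in> hom (FOb S A) (FOb S B)"
  obtains x where "x \<in> hom A B" "tau A B x = y"
proof -
  obtain f where "f \<in> mor (FOb S A) (FOb S B)" "y = arr (FOb S A) (FOb S B) f"
    using assms unfolding hom_def by (auto split: if_splits)
  moreover then obtain g where "g \<in> mor A B" "FMor S g = f"
    using FMor_surj assms by metis
  ultimately show ?thesis using that[of "arr A B g"] assms by (auto simp: tau_arr)
qed

lemma tau_hom: "x \<in> hom A B \<Longrightarrow> tau A B x \<in> hom (FOb S A) (FOb S B)"
  unfolding hom_def by (auto simp: tau_arr FMor_mor split: if_splits)

lemma tau_zero: "\<lbrakk>A \<in> Obj C; B \<in> Obj C\<rbrakk> \<Longrightarrow> tau A B 0 = 0"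
  using tau_arr[of A B "zero A B"] by (simp add: FMor_zero arr_zero)

text \<open>
  Additivity is forced by the diagonal \<open>A \<rightarrow> A \<oplus> A\<close>, which is determined by its components
  and hence mapped to the sum of the images of the injections.
\<close>

lemma tau_add:
  assumes x: "x \<in> hom A B" and y: "y \<in> hom A B"
  shows "tau A B (x + y) = tau A B x + tau A B y"
proof -
  have A: "A \<in> Obj C" and B: "B \<in> Obj C" using hom_Obj[OF x] by auto
  define P where "P = osum A A"
  note h = bp_hom[OF A A, folded P_def] and e = bp_eqs[OF A A, folded P_def]
  have "P \<in> Obj C" using hom_Obj[OF h(1)] by simp
  obtain t where t: "t \<in> hom A P" "tau A P t = tau A P (j1 A A) + tau A P (j2 A A)"
    using tau_surj[OF A \<open>P \<in> Obj C\<close>] hom_add[OF tau_hom[OF h(1)] tau_hom[OF h(2)]] by metis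
  have "tau A A (q1 A A * t) = tau A A (one A)" "tau A A (q2 A A * t) = tau A A (one A)"
    unfolding tau_comp[OF t(1) h(3)] tau_comp[OF t(1) h(4)] t(2) distrib_left
      tau_comp[OF h(1) h(3), symmetric] tau_comp[OF h(2) h(3), symmetric]
      tau_comp[OF h(1) h(4), symmetric] tau_comp[OF h(2) h(4), symmetric]
    using A by (simp_all add: e tau_zero)
  then have qt: "q1 A A * t = one A" "q2 A A * t = one A"
    using A h t(1) by (auto intro!: tau_inj[of _ A A] hom_comp one_hom)
  have "(j1 A A * q1 A A + j2 A A * q2 A A) * t = j1 A A + j2 A A"
    by (simp add: distrib_right mult.assoc qt one_right[OF h(1)] one_right[OF h(2)])
  then have t': "t = j1 A A + j2 A A"
    by (simp add: e one_left[OF t(1)])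
  \<comment> \<open>\<open>?r\<close> is the row \<open>[x y]\<close> on the sum of two copies of
    \<open>A\<close>. Composed with the diagonal \<open>t\<close> it gives \<open>x + y\<close>, and
    \<open>t\<close> is now known both before and after suspension.\<close>
  let ?r = "x * q1 A A + y * q2 A A"
  have r: "?r \<in> hom P B" using h x y by (auto intro: hom_add hom_comp)
  have rj: "?r * j1 A A = x" "?r * j2 A A = y"
    by (simp_all add: distrib_right mult.assoc e one_right[OF x] one_right[OF y])
  have "tau A B (x + y) = tau A B (?r * t)"
    by (simp add: t' distrib_left rj)
  also have "\<dots> = tau A B (?r * j1 A A) + tau A B (?r * j2 A A)"
    unfolding tau_comp[OF t(1) r] t(2) distrib_left tau_comp[OF h(1) r] tau_comp[OF h(2) r] ..
  finally show ?thesis by (simp add: rj)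
qed

lemma FMor_add:
  assumes "A \<in> Obj C" "B \<in> Obj C" "f \<in> mor A B" "g \<in> mor A B"
  shows "FMor S (add A B f g) = add (FOb S A) (FOb S B) (FMor S f) (FMor S g)"
proof (rule arr_inj[of "FOb S A" "FOb S B"])
  show "arr (FOb S A) (FOb S B) (FMor S (add A B f g)) =
      arr (FOb S A) (FOb S B) (add (FOb S A) (FOb S B) (FMor S f) (FMor S g))"
    using assms tau_add[OF arr_hom arr_hom, of A B f g]
    by (simp add: tau_arr FMor_mor arr_add[symmetric])
qed (use assms in \<open>simp_all add: FMor_mor\<close>)

text \<open>\<open>SO\<close> and \<open>SOi\<close> are the identity off the objects, which makes
  them inverse to each other on the whole type; the periodic extension iterates them on arbitrary
  values.\<close>

definition SO :: "'o \<Rightarrow> 'o" where "SO A = (if A \<in> Obj C then FOb S A else A)"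
definition SOi :: "'o \<Rightarrow> 'o" where "SOi A = (if A \<in> Obj C then inv_into (Obj C) (FOb S) A else A)"

lemma SO_Obj: "SO A \<in> Obj C \<longleftrightarrow> A \<in> Obj C"
  by (simp add: SO_def)

lemma SO_SOi: "SO (SOi A) = A"
  using S_Obj unfolding SO_def SOi_def bij_betw_def by (auto simp: f_inv_into_f inv_into_into)

lemma SOi_SO: "SOi (SO A) = A"
  using S_Obj unfolding SO_def SOi_def bij_betw_def by auto

lemma SOi_Obj: "SOi A \<in> Obj C \<longleftrightarrow> A \<in> Obj C"
  using SO_Obj[of "SOi A"] by (simp add: SO_SOi)

lemma SOi_eq_iff: "SOi A = B \<longleftrightarrow> A = SO B"
  using SO_SOi[of A] SOi_SO[of B] by auto

text \<open>Components between objects of \<open>C\<close> are transported by the suspension. The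
  others stay fixed, so that the map is a bijection on all families and conjugation by it makes
  sense.\<close>

definition shift :: "('o, 'm) family \<Rightarrow> ('o, 'm) family"
  where "shift x = Family (\<lambda>C' T D. if C' = C \<and> T \<in> Obj C \<and> D \<in> Obj C
    then FMor S (fam x C (SOi T) (SOi D)) else fam x C' T D)"

definition unshift :: "('o, 'm) family \<Rightarrow> ('o, 'm) family"
  where "unshift x = Family (\<lambda>C' T D. if C' = C \<and> T \<in> Obj C \<and> D \<in> Obj C
    then inv_into (mor T D) (FMor S) (fam x C (SO T) (SO D)) else fam x C' T D)"

lemma fam_shift: "fam (shift x) C' T D = (if C' = C \<and> T \<in> Obj C \<and> D \<in> Obj C
    then FMor S (fam x C (SOi T) (SOi D)) else fam x C' T D)"
proof -
  have "FMor S (fam x C (SOi T) (SOi D)) \<in> mor T D" if "T \<in> Obj C" "D \<in> Obj C" for T D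
    using FMor_mor[OF _ _ fam_mor[of "SOi T" "SOi D" x]] that SO_SOi SOi_Obj
    by (metis SO_def)
  then show ?thesis
    unfolding shift_def by (subst fam_Family) (auto simp: hom_group_eq fam_closed)
qed

lemma fam_unshift: "fam (unshift x) C' T D = (if C' = C \<and> T \<in> Obj C \<and> D \<in> Obj C
    then inv_into (mor T D) (FMor S) (fam x C (SO T) (SO D)) else fam x C' T D)"
proof -
  have "inv_into (mor T D) (FMor S) (fam x C (SO T) (SO D)) \<in> mor T D"
    if "T \<in> Obj C" "D \<in> Obj C" for T D
    using S_Hom[OF that] fam_mor[of "SO T" "SO D" x] that
    unfolding bij_betw_def by (simp add: SO_def inv_into_into)
  then show ?thesis
    unfolding unshift_def by (subst fam_Family) (auto simp: hom_group_eq fam_closed)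
qed

lemma shift_unshift: "shift (unshift x) = x"
proof (rule family_eqI)
  fix C' T D
  show "fam (shift (unshift x)) C' T D = fam x C' T D"
  proof (cases "C' = C \<and> T \<in> Obj C \<and> D \<in> Obj C")
    case True
    then have "SOi T \<in> Obj C" "SOi D \<in> Obj C" by (simp_all add: SOi_Obj)
    from S_Hom[OF this] have "FMor S ` mor (SOi T) (SOi D) = mor T D"
      using \<open>SOi T \<in> Obj C\<close> \<open>SOi D \<in> Obj C\<close> SO_SOi unfolding bij_betw_def SO_def by metis
    then show ?thesis using True fam_mor[of T D x]
      by (simp add: fam_shift fam_unshift SOi_Obj SO_SOi f_inv_into_f)
  qed (auto simp: fam_shift fam_unshift)
qed

lemma unshift_shift: "unshift (shift x) = x"
proof (rule family_eqI)
  fix C' T D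
  show "fam (unshift (shift x)) C' T D = fam x C' T D"
  proof (cases "C' = C \<and> T \<in> Obj C \<and> D \<in> Obj C")
    case True
    then show ?thesis using S_Hom[of T D] fam_mor[of T D x] unfolding bij_betw_def
      by (simp add: fam_shift fam_unshift SO_Obj SOi_SO)
  qed (auto simp: fam_shift fam_unshift)
qed

lemma shift_add: "shift (x + y) = shift x + shift y"
proof (rule family_eqI)
  fix C' T D
  show "fam (shift (x + y)) C' T D = fam (shift x + shift y) C' T D"
    using FMor_add[of "SOi T" "SOi D" "fam x C (SOi T) (SOi D)" "fam y C (SOi T) (SOi D)"]
      SO_SOi[of T] SO_SOi[of D]
    by (auto simp: fam_shift fam_ops hom_group_eq SOi_Obj fam_mor SO_def)
qed

lemma unshift_add: "unshift (x + y) = unshift x + unshift y"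
  using unshift_shift[of "unshift x + unshift y"] by (simp add: shift_add shift_unshift)

lemma shift_zero: "shift 0 = 0"
  using shift_add[of 0 0] by simp

lemma shift_minus: "shift (- x) = - shift x"
  using shift_add[of x "- x"] by (simp add: shift_zero eq_neg_iff_add_eq_0 add.commute)

lemma shift_diff: "shift (x - y) = shift x - shift y"
  using shift_add[of x "- y"] by (simp add: shift_minus)

text \<open>Conjugation by the shift of families extends \<open>\<Sigma>\<close> from the morphisms to the whole ring.\<close>

definition sig :: "('o, 'm) gen \<Rightarrow> ('o, 'm) gen"
  where "sig r = Endo shift * r * Endo unshift"

definition sigi :: "('o, 'm) gen \<Rightarrow> ('o, 'm) gen"
  where "sigi r = Endo unshift * r * Endo shift"

lemma app_shift: "app (Endo shift) = shift" "app (Endo unshift) = unshift"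
  by (simp_all add: app_Endo shift_add unshift_add)

lemma app_sig: "app (sig r) x = shift (app r (unshift x))"
  by (simp add: sig_def app_ring_ops app_shift)

lemma app_sigi: "app (sigi r) x = unshift (app r (shift x))"
  by (simp add: sigi_def app_ring_ops app_shift)

lemma sig_simps [simp]:
  "sig (x + y) = sig x + sig y" "sig (x - y) = sig x - sig y" "sig (- x) = - sig x"
  "sig (x * y) = sig x * sig y" "sig 0 = 0" "sig (sigi x) = x" "sigi (sig x) = x"
  by (rule endo_eqI; simp add: app_ring_ops app_sig app_sigi shift_unshift unshift_shift shift_add
      shift_zero shift_minus shift_diff)+

text \<open>Both sides vanish outside the components of \<open>C\<close> that end at
  \<open>FOb S B\<close>. On those, unshifting, postcomposing with \<open>f\<close> and shifting
  back amounts to postcomposing with \<open>FMor S f\<close>, by functoriality.\<close>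

lemma sig_arr:
  assumes "A \<in> Obj C" "B \<in> Obj C" "f \<in> mor A B"
  shows "sig (arr A B f) = arr (FOb S A) (FOb S B) (FMor S f)"
proof (intro endo_eqI family_eqI)
  fix x C' T D
  have SS: "SO A = FOb S A" "SO B = FOb S B" using assms by (simp_all add: SO_def)
  have "FMor S (f \<cdot> fam (unshift x) C (SOi T) A) = FMor S f \<cdot> fam x C T (FOb S A)"
    if "T \<in> Obj C"
  proof -
    have T: "SOi T \<in> Obj C" "FOb S (SOi T) = T"
      using that SO_SOi[of T] by (simp_all add: SOi_Obj SO_def split: if_splits)
    have "fam x C T (FOb S A) = fam (shift (unshift x)) C T (FOb S A)"
      by (simp add: shift_unshift)
    also have "\<dots> = FMor S (fam (unshift x) C (SOi T) A)"
      using that assms SOi_SO[of A] by (simp add: fam_shift SS)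
    finally show ?thesis using S_Comp[of "SOi T" A B _ f] assms T fam_mor[of "SOi T" A] by simp
  qed
  moreover have "FMor S (zero (SOi T) (SOi D)) = zero T D" if "T \<in> Obj C" "D \<in> Obj C"
    using FMor_zero[of "SOi T" "SOi D"] that SO_SOi by (metis SOi_Obj SO_def)
  ultimately show "fam (app (sig (arr A B f)) x) C' T D =
      fam (app (arr (FOb S A) (FOb S B) (FMor S f)) x) C' T D"
    using assms FMor_mor[OF assms] SO_Obj[of B]
    by (auto simp: app_sig fam_arr fam_shift SOi_Obj SOi_eq_iff SS hom_group_eq)
qed

lemma sig_hom: "x \<in> hom A B \<Longrightarrow> sig x \<in> hom (SO A) (SO B)"
  unfolding hom_def by (auto simp: sig_arr SO_def FMor_mor split: if_splits intro!: imageI)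

lemma sigi_hom:
  assumes "x \<in> hom (SO A) (SO B)" shows "sigi x \<in> hom A B"
proof -
  have AB: "A \<in> Obj C" "B \<in> Obj C" using hom_Obj[OF assms] SO_Obj by auto
  then obtain f where f: "f \<in> mor (FOb S A) (FOb S B)" "x = arr (FOb S A) (FOb S B) f"
    using assms unfolding hom_def SO_def by auto
  obtain g where "g \<in> mor A B" "FMor S g = f" using FMor_surj[OF AB f(1)] .
  then have "sig (arr A B g) = x" using f AB by (simp add: sig_arr)
  then have "sigi x = arr A B g" using sig_simps(7) by metis
  then show ?thesis using \<open>g \<in> mor A B\<close> AB by auto
qed

lemma sig_hom_iff: "sig x \<in> hom (SO A) (SO B) \<longleftrightarrow> x \<in> hom A B"
  using sig_hom sigi_hom sig_simps(7) by metis

lemma sig_eq_iff: "sig x = sig y \<longleftrightarrow> x = y"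
  using sig_simps(7) by metis

lemma sig_one: "A \<in> Obj C \<Longrightarrow> sig (one A) = one (SO A)"
  by (simp add: one_def sig_arr Id_Hom S_Id SO_def)

end

section \<open>Periodic extension of finite sequences\<close>

definition zpow :: "('a \<Rightarrow> 'a) \<Rightarrow> ('a \<Rightarrow> 'a) \<Rightarrow> int \<Rightarrow> 'a \<Rightarrow> 'a"
  where "zpow f g k x = (if 0 \<le> k then (f ^^ nat k) x else (g ^^ nat (- k)) x)"

lemma zpow_step:
  assumes "\<And>x. f (g x) = x"
  shows "zpow f g (k + 1) x = f (zpow f g k x)"
proof -
  consider "0 \<le> k" | "k = -1" | "k < -1" by linarith
  then show ?thesis
  proof cases
    case 1
    then have "nat (k + 1) = Suc (nat k)" by simp
    then show ?thesis using 1 by (simp add: zpow_def)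
  next
    case 2
    then show ?thesis using assms by (simp add: zpow_def)
  next
    case 3
    then have "nat (- k) = Suc (nat (- (k + 1)))" by simp
    then show ?thesis using 3 assms by (simp add: zpow_def)
  qed
qed

text \<open>The extension of x 0, ..., x (p - 1) along the action of \<open>f\<close>, with
  \<open>g\<close> as its inverse. Integer \<open>div\<close> rounds down, so a negative index also
  has its remainder in the base period.\<close>

definition pext :: "('a \<Rightarrow> 'a) \<Rightarrow> ('a \<Rightarrow> 'a) \<Rightarrow> nat \<Rightarrow> (nat \<Rightarrow> 'a) \<Rightarrow> int \<Rightarrow> 'a"
  where "pext f g p x i = zpow f g (i div int p) (x (nat (i mod int p)))"

lemma pext_period:
  assumes "0 < p" "\<And>x. f (g x) = x"
  shows "pext f g p x (i + int p) = f (pext f g p x i)"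
  proof -
  have "(i + int p) div int p = i div int p + 1" using assms(1) by (intro div_add_self2) simp
  then show ?thesis using assms(2) by (simp add: pext_def zpow_step)
qed

lemma pext_base: "i < p \<Longrightarrow> pext f g p x (int i) = x i"
  by (simp add: pext_def zpow_def zdiv_int[symmetric] zmod_int[symmetric])

text \<open>Brings claims about periodic extensions back to one period, where they are statements
  about the finite data.\<close>

lemma periodic_all:
  fixes p :: int
  assumes "0 < p" "\<And>i. P (i + p) \<longleftrightarrow> P i" "\<And>i. k \<le> i \<Longrightarrow> i < k + p \<Longrightarrow> P i"
  shows "P i"
proof -
  have "P (j + m * p) \<longleftrightarrow> P j" for j m
  proof (induction m rule: int_induct[where k = 0])
    case (step1 m)
    then show ?case using assms(2)[of "j + m * p"] by (simp add: algebra_simps)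
  next
    case (step2 m)
    then show ?case using assms(2)[of "j + (m - 1) * p"] by (simp add: algebra_simps)
  qed simp
  from this[of "k + (i - k) mod p" "(i - k) div p"] show ?thesis
    using assms(1) assms(3)[of "k + (i - k) mod p"] by (simp add: algebra_simps)
qed

section \<open>Periodic sequences\<close>

context additive_category
begin

lemma arr_col:
  assumes "P \<in> Obj C" "A \<in> Obj C" "B \<in> Obj C" "a \<in> mor P A" "c \<in> mor P B"
  shows "col P A B a c \<in> mor P (osum A B)"
    "arr P (osum A B) (col P A B a c) = j1 A B * arr P A a + j2 A B * arr P B c"
  using assms bp_mor[of A B] Comp_Hom[of P A "osum A B"] Comp_Hom[of P B "osum A B"]
  unfolding col_def j1_def j2_def
  by (simp_all add: arr_add arr_comp[of P A "osum A B"] arr_comp[of P B "osum A B"])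

lemma arr_row:
  assumes "Q \<in> Obj C" "A \<in> Obj C" "B \<in> Obj C" "a \<in> mor A Q" "b \<in> mor B Q"
  shows "row A B Q a b \<in> mor (osum A B) Q"
    "arr (osum A B) Q (row A B Q a b) = arr A Q a * q1 A B + arr B Q b * q2 A B"
  using assms bp_mor[of A B] Comp_Hom[of "osum A B" A Q] Comp_Hom[of "osum A B" B Q]
  unfolding row_def q1_def q2_def
  by (simp_all add: arr_add arr_comp[of "osum A B" A Q] arr_comp[of "osum A B" B Q])

lemma arr_mat:
  assumes "A \<in> Obj C" "B \<in> Obj C" "A' \<in> Obj C" "B' \<in> Obj C"
    "a \<in> mor A A'" "b \<in> mor B A'" "c \<in> mor A B'" "d \<in> mor B B'"
  shows "mat A B A' B' a b c d \<in> mor (osum A B) (osum A' B')"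
    "arr (osum A B) (osum A' B') (mat A B A' B' a b c d) =
      j1 A' B' * (arr A A' a * q1 A B + arr B A' b * q2 A B) +
      j2 A' B' * (arr A B' c * q1 A B + arr B B' d * q2 A B)"
  using assms bp_mor[of A B]
  unfolding mat_def by (simp_all add: arr_col arr_row)

end

context suspended_category
begin

lemma arr_S_mat:
  assumes "A \<in> Obj C" "B \<in> Obj C" "A' \<in> Obj C" "B' \<in> Obj C"
    "a \<in> mor A (FOb S A')" "b \<in> mor B (FOb S A')" "c \<in> mor A (FOb S B')" "d \<in> mor B (FOb S B')"
  shows "S_mat A B A' B' a b c d \<in> mor (osum A B) (FOb S (osum A' B'))"
    "arr (osum A B) (FOb S (osum A' B')) (S_mat A B A' B' a b c d) =
      sig (j1 A' B') * (arr A (FOb S A') a * q1 A B + arr B (FOb S A') b * q2 A B) +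
      sig (j2 A' B') * (arr A (FOb S B') c * q1 A B + arr B (FOb S B') d * q2 A B)"
proof -
  have r: "row A B (FOb S A') a b \<in> mor (osum A B) (FOb S A')"
    "row A B (FOb S B') c d \<in> mor (osum A B) (FOb S B')"
    using assms by (simp_all add: arr_row)
  have i: "FMor S (in1 (bp A' B')) \<in> mor (FOb S A') (FOb S (osum A' B'))"
    "FMor S (in2 (bp A' B')) \<in> mor (FOb S B') (FOb S (osum A' B'))"
    using assms bp_mor[of A' B'] by (simp_all add: FMor_mor)
  have o: "osum A B \<in> Obj C" "osum A' B' \<in> Obj C" using assms bp_mor by auto
  have c: "FMor S (in1 (bp A' B')) \<cdot> row A B (FOb S A') a b \<in> mor (osum A B) (FOb S (osum A' B'))"
    "FMor S (in2 (bp A' B')) \<cdot> row A B (FOb S B') c d \<in> mor (osum A B) (FOb S (osum A' B'))"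
    using assms o r i Comp_Hom FOb_Obj by blast+
  show "S_mat A B A' B' a b c d \<in> mor (osum A B) (FOb S (osum A' B'))"
    unfolding S_mat_def S_col_def using o c by simp
  have s: "sig (j1 A' B') = arr (FOb S A') (FOb S (osum A' B')) (FMor S (in1 (bp A' B')))"
    "sig (j2 A' B') = arr (FOb S B') (FOb S (osum A' B')) (FMor S (in2 (bp A' B')))"
    unfolding j1_def j2_def using assms bp_mor[of A' B'] by (simp_all add: sig_arr)
  show "arr (osum A B) (FOb S (osum A' B')) (S_mat A B A' B' a b c d) =
      sig (j1 A' B') * (arr A (FOb S A') a * q1 A B + arr B (FOb S A') b * q2 A B) +
      sig (j2 A' B') * (arr A (FOb S B') c * q1 A B + arr B (FOb S B') d * q2 A B)"
    unfolding S_mat_def S_col_def s using assms o c r i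
    by (simp add: arr_add arr_comp[of _ "FOb S A'"] arr_comp[of _ "FOb S B'"] arr_row)
qed

end

section \<open>Rotation as a shift of the index\<close>

locale positive_angulated_category = angulated_category C S n Angles
  for C :: "('o, 'm) precat" and S :: "('o, 'm) endofunctor" and n :: nat
    and Angles :: "(('o, 'm) diagram \<times> 'm) set" +
  assumes n_pos: "1 \<le> n"
begin

abbreviation per :: int where "per \<equiv> int n + 2"

text \<open>The sign (-1)^n of the morphism that rotation appends in (F2).\<close>

definition tw :: "('o, 'm) gen \<Rightarrow> ('o, 'm) gen"
  where "tw x = (if even n then x else - x)"

lemma tw_simps [simp]:
  "tw (tw x) = x" "tw 0 = 0" "tw (- x) = - tw x" "tw x * y = tw (x * y)" "x * tw y = tw (x * y)"
  "tw x = tw y \<longleftrightarrow> x = y" "tw x = 0 \<longleftrightarrow> x = 0" "sig (tw x) = tw (sig x)"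
  by (simp_all add: tw_def)

lemma tw_add: "tw (x + y) = tw x + tw y" "tw (x - y) = tw x - tw y"
  by (simp_all add: tw_def)

lemma tw_hom [simp]: "tw x \<in> hom A B \<longleftrightarrow> x \<in> hom A B"
  using hom_uminus[of x A B] hom_uminus[of "- x" A B] by (auto simp: tw_def)

text \<open>
  A sequence \<open>X\<^sup>0 \<rightarrow> \<dots> \<rightarrow> X\<^sup>n\<^sup>+\<^sup>1 \<rightarrow> \<Sigma> X\<^sup>0\<close> is extended to all integers in such a way that
  rotation becomes a shift of the indices. The sign makes the extended sequence agree with
  the iterated rotations.
\<close>

definition periodic :: "(int \<Rightarrow> 'o) \<Rightarrow> (int \<Rightarrow> ('o, 'm) gen) \<Rightarrow> bool"
  where "periodic X d \<longleftrightarrow> (\<forall>i. X i \<in> Obj C \<and> d i \<in> hom (X i) (X (i + 1)) \<and>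
    X (i + per) = SO (X i) \<and> d (i + per) = tw (sig (d i)))"

definition trunc :: "(int \<Rightarrow> 'o) \<Rightarrow> (int \<Rightarrow> ('o, 'm) gen) \<Rightarrow> ('o, 'm) diagram \<times> 'm"
  where "trunc X d =
    (\<lparr>ob = (\<lambda>i. X (int i)), df = (\<lambda>i. carr (X (int i)) (X (int i + 1)) (d (int i)))\<rparr>,
     carr (X (int n + 1)) (X per) (d (int n + 1)))"

definition angle :: "(int \<Rightarrow> 'o) \<Rightarrow> (int \<Rightarrow> ('o, 'm) gen) \<Rightarrow> bool"
  where "angle X d \<longleftrightarrow> periodic X d \<and> trunc X d \<in> Angles"

lemma periodicD:
  assumes "periodic X d"
  shows "X i \<in> Obj C" "d i \<in> hom (X i) (X (i + 1))" "X (i + per) = SO (X i)"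
    "d (i + per) = tw (sig (d i))" "X per = SO (X 0)" "X per = FOb S (X 0)"
    "d per = tw (sig (d 0))"
  using assms unfolding periodic_def
  by (auto simp: SO_def dest: spec[of _ "0 :: int"])

lemma angleD:
  assumes "angle X d"
  shows "periodic X d" "X i \<in> Obj C" "d i \<in> hom (X i) (X (i + 1))" "X (i + per) = SO (X i)"
    "d (i + per) = tw (sig (d i))" "X per = SO (X 0)" "X per = FOb S (X 0)"
    "d per = tw (sig (d 0))"
  using assms periodicD[of X d] unfolding angle_def by blast+

lemma periodic_last: "periodic X d \<Longrightarrow> d (int n + 1) \<in> hom (X (int n + 1)) (X per)"
  using periodicD(2)[of X d "int n + 1"] by (simp add: add.assoc)

lemma trunc_sequence:
  assumes "periodic X d"
  shows "is_S_sequence n (trunc X d)"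
proof -
  have "carr (X (int i)) (X (int (i + 1))) (d (int i)) \<in> mor (X (int i)) (X (int (i + 1)))" for i
    using carr_mor[OF periodicD(2)[OF assms, of "int i"]] by (simp add: add.commute)
  then show ?thesis
    using carr_mor[OF periodic_last[OF assms]]
    by (simp add: is_S_sequence_def is_sequence_def trunc_def periodicD(1)[OF assms]
        periodicD(6)[OF assms] add.commute)
qed

text \<open>Diagrams carry meaningless entries beyond the last index. Changing them is harmless,
  because identities form an isomorphism of sequences and \<open>Angles\<close> is closed under
  isomorphism.\<close>

lemma Angles_agree:
  assumes T: "(X, \<delta>) \<in> Angles"
    and eq: "\<And>i. i \<le> n + 1 \<Longrightarrow> ob Y i = ob X i" "\<And>i. i \<le> n \<Longrightarrow> df Y i = df X i"
  shows "(Y, \<delta>) \<in> Angles"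
proof (rule Angles_iso[OF T])
  note seq = Angles_sequences[OF T, unfolded is_S_sequence_def is_sequence_def, simplified]
  show "is_S_sequence n (Y, \<delta>)"
    using seq eq by (auto simp: is_S_sequence_def is_sequence_def)
  have "FMor S (Id C (ob X 0)) = Id C (FOb S (ob X 0))"
    using seq by (simp add: S_Id)
  then have "FMor S (Id C (ob X 0)) \<cdot> \<delta> = \<delta> \<cdot> Id C (ob X (Suc n))"
    using seq Comp_Id_left[of "ob X (n + 1)" "FOb S (ob X 0)" \<delta>]
      Comp_Id_right[of "ob X (n + 1)" "FOb S (ob X 0)" \<delta>] by simp
  moreover have "df X i \<cdot> Id C (ob X i) = Id C (ob X (Suc i)) \<cdot> df X i" if "i \<le> n" for i
    using that seq Comp_Id_left[of "ob X i" "ob X (Suc i)" "df X i"]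
      Comp_Id_right[of "ob X i" "ob X (Suc i)" "df X i"] by simp
  ultimately have "S_morphism n (X, \<delta>) (Y, \<delta>) (\<lambda>i. Id C (ob X i))"
    "S_morphism n (Y, \<delta>) (X, \<delta>) (\<lambda>i. Id C (ob X i))"
    using seq eq Id_Hom by (auto simp: S_morphism_def chain_map_def)
  moreover have "Id C (ob X i) \<cdot> Id C (ob X i) = Id C (ob X i)" if "i \<le> n + 1" for i
    using that seq Id_Hom[of "ob X i"] Comp_Id_left[of "ob X i" "ob X i" "Id C (ob X i)"] by simp
  ultimately show "S_isomorphic n (X, \<delta>) (Y, \<delta>)"
    unfolding S_isomorphic_def using eq(1) by fastforce
qed

lemma angle_of_finite:
  assumes T: "(Y, \<delta>) \<in> Angles"
  obtains X d where "angle X d" "\<And>i. i \<le> n + 1 \<Longrightarrow> X (int i) = ob Y i"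
    "\<And>i. i \<le> n \<Longrightarrow> d (int i) = arr (ob Y i) (ob Y (i + 1)) (df Y i)"
    "d (int n + 1) = arr (ob Y (n + 1)) (FOb S (ob Y 0)) \<delta>"
proof -
  note seq = Angles_sequences[OF T, unfolded is_S_sequence_def is_sequence_def, simplified]
  define X where "X = pext SO SOi (n + 2) (ob Y)"
  \<comment> \<open>Sign and suspension commute and the sign is an involution, so
    \<open>tw (sigi x)\<close> inverts \<open>tw (sig x)\<close>. The last of the n + 2 base values
    is the extension \<delta>.\<close>
  define d where "d = pext (\<lambda>x. tw (sig x)) (\<lambda>x. tw (sigi x)) (n + 2)
    (\<lambda>i. if i \<le> n then arr (ob Y i) (ob Y (i + 1)) (df Y i)
      else arr (ob Y (n + 1)) (FOb S (ob Y 0)) \<delta>)"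
  have Xp: "X (i + per) = SO (X i)" for i
    using pext_period[of "n + 2" SO SOi "ob Y" i] by (simp add: X_def SO_SOi add.commute)
  have dp: "d (i + per) = tw (sig (d i))" for i
    unfolding d_def using pext_period[of "n + 2" "\<lambda>x. tw (sig x)" "\<lambda>x. tw (sigi x)" _ i]
    by (simp add: add.commute)
  have Xb: "X (int i) = ob Y i" if "i \<le> n + 1" for i
    using that by (simp add: X_def pext_base)
  have db: "d (int i) = arr (ob Y i) (ob Y (i + 1)) (df Y i)" if "i \<le> n" for i
    using that by (simp add: d_def pext_base)
  have db': "d (int n + 1) = arr (ob Y (n + 1)) (FOb S (ob Y 0)) \<delta>"
    using pext_base[of "n + 1" "n + 2" "\<lambda>x. tw (sig x)" "\<lambda>x. tw (sigi x)"]
    by (simp add: d_def add.commute)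
  have Xper: "X per = FOb S (ob Y 0)"
    using Xp[of 0] Xb[of 0] seq by (simp add: SO_def)
  have "X i \<in> Obj C \<and> d i \<in> hom (X i) (X (i + 1))" for i
  proof (rule periodic_all[where k = 0 and p = per and P = "\<lambda>i. X i \<in> Obj C \<and> d i \<in> hom (X i) (X (i + 1))"])
    fix i show "X (i + per) \<in> Obj C \<and> d (i + per) \<in> hom (X (i + per)) (X (i + per + 1)) \<longleftrightarrow>
        X i \<in> Obj C \<and> d i \<in> hom (X i) (X (i + 1))"
      using Xp[of "i + 1"] by (simp add: Xp dp SO_Obj sig_hom_iff add.commute add.left_commute)
  next
    fix i assume "0 \<le> i" "i < 0 + per"
    then have "i = int (nat i) \<and> nat i \<le> n \<or> i = int n + 1" by linarith
    then consider j where "i = int j" "j \<le> n" | "i = int n + 1" by blast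
    then show "X i \<in> Obj C \<and> d i \<in> hom (X i) (X (i + 1))"
    proof cases
      case 1
      then show ?thesis using Xb[of j] Xb[of "j + 1"] db[of j] seq
        by (auto simp: add.commute intro!: arr_hom)
    next
      case 2
      then show ?thesis using Xb[of "n + 1"] db' Xper seq
        by (auto simp: add.commute add.left_commute intro!: arr_hom)
    qed
  qed auto
  then have per: "periodic X d"
    unfolding periodic_def using Xp dp by blast
  have "trunc X d = (fst (trunc X d), \<delta>)"
    using Xb[of "n + 1"] db' Xper seq by (simp add: trunc_def carr_arr add.commute)
  moreover have "(fst (trunc X d), \<delta>) \<in> Angles"
  proof (rule Angles_agree[OF T])
    fix i assume "i \<le> n"
    then show "df (fst (trunc X d)) i = df Y i"
      using Xb[of i] Xb[of "i + 1"] db[of i] seq by (simp add: trunc_def carr_arr add.commute)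
  qed (simp add: trunc_def Xb)
  ultimately have "angle X d"
    unfolding angle_def using per by simp
  then show ?thesis using that Xb db db' by blast
qed

lemma periodic_shift1:
  assumes "periodic X d"
  shows "periodic (\<lambda>i. X (i + 1)) (\<lambda>i. d (i + 1))"
proof -
  have "X (i + 1) \<in> Obj C \<and> d (i + 1) \<in> hom (X (i + 1)) (X (i + 1 + 1)) \<and>
      X (i + per + 1) = SO (X (i + 1)) \<and> d (i + per + 1) = tw (sig (d (i + 1)))" for i
    using periodicD(1-4)[OF assms, of "i + 1"] by (simp add: algebra_simps)
  then show ?thesis unfolding periodic_def by blast
qed

lemma periodic_shift1_iff: "periodic (\<lambda>i. X (i + 1)) (\<lambda>i. d (i + 1)) \<longleftrightarrow> periodic X d"
proof
  assume *: "periodic (\<lambda>i. X (i + 1)) (\<lambda>i. d (i + 1))"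
  have "X i \<in> Obj C \<and> d i \<in> hom (X i) (X (i + 1)) \<and>
      X (i + per) = SO (X i) \<and> d (i + per) = tw (sig (d i))" for i
    using periodicD(1-4)[OF *, of "i - 1"] by (simp add: algebra_simps)
  then show "periodic X d" unfolding periodic_def by blast
qed (rule periodic_shift1)

text \<open>After the shift, position n + 1 holds \<open>d per = tw (sig (d 0))\<close>, exactly the
  signed morphism that rotation appends.\<close>

lemma rotate_trunc:
  assumes "periodic X d"
  shows "S_rotate n (trunc X d) \<in> Angles \<longleftrightarrow> trunc (\<lambda>i. X (i + 1)) (\<lambda>i. d (i + 1)) \<in> Angles"
proof -
  let ?R = "S_rotate n (trunc X d)" and ?T = "trunc (\<lambda>i. X (i + 1)) (\<lambda>i. d (i + 1))"
  note D = periodicD[OF assms]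
  have "d (int n + 1 + 1) = tw (sig (arr (X 0) (X 1) (carr (X 0) (X 1) (d 0))))"
    using D(2)[of 0] by (simp add: D(7) arr_carr add.assoc)
  also have "\<dots> = tw (arr (FOb S (X 0)) (FOb S (X 1)) (FMor S (carr (X 0) (X 1) (d 0))))"
    using D(1)[of 0] D(1)[of 1] D(2)[of 0] by (simp add: sig_arr carr_mor)
  finally have "carr (FOb S (X 0)) (FOb S (X 1)) (d (int n + 1 + 1)) = snd ?R"
    using D(1)[of 0] D(1)[of 1] D(2)[of 0] carr_mor[of "d 0" "X 0" "X 1"]
    by (simp add: tw_def S_rotate_def trunc_def FMor_mor carr_arr flip: arr_neg)
  moreover have "X (int n + 1 + 1) = FOb S (X 0)" "X (per + 1) = FOb S (X 1)"
    using D(6) D(3)[of 1] D(1)[of 1] by (simp_all add: add.assoc SO_def add.commute)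
  ultimately have snd: "snd ?T = snd ?R"
    by (simp add: trunc_def)
  have ob: "ob (fst ?R) i = ob (fst ?T) i" if "i \<le> n + 1" for i
  proof (cases "i \<le> n")
    case True
    then show ?thesis by (simp add: S_rotate_def trunc_def add.commute)
  next
    case False
    then have "i = n + 1" using that by simp
    then show ?thesis using D(6) by (simp add: S_rotate_def trunc_def add.commute)
  qed
  have df: "df (fst ?R) i = df (fst ?T) i" if "i \<le> n" for i
  proof (cases "i < n")
    case True
    then show ?thesis by (simp add: S_rotate_def trunc_def add.commute)
  next
    case False
    then have "i = n" using that by simp
    then show ?thesis using D(6) by (simp add: S_rotate_def trunc_def add.commute)
  qed
  have "?R = (fst ?R, snd ?T)" "?T = (fst ?T, snd ?T)" using snd by (simp_all add: prod_eq_iff)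
  then show ?thesis
    using Angles_agree[of "fst ?R" "snd ?T" "fst ?T"] Angles_agree[of "fst ?T" "snd ?T" "fst ?R"]
      ob df by metis
qed

lemma angle_shift1_iff: "angle (\<lambda>i. X (i + 1)) (\<lambda>i. d (i + 1)) \<longleftrightarrow> angle X d"
  unfolding angle_def periodic_shift1_iff
  using rotate_trunc F2 trunc_sequence by blast

text \<open>(F2) is an equivalence, so the induction over the integers runs in both directions.
  Axioms stated at positions 0 and 1 thus become available at positions k and k + 1.\<close>

lemma angle_shift:
  assumes "angle X d"
  shows "angle (\<lambda>i. X (i + k)) (\<lambda>i. d (i + k))"
proof (induction k rule: int_induct[where k = 0])
  case base
  then show ?case using assms by simp
next
  case (step1 k)
  have eq: "i + 1 + k = i + (k + 1)" for i :: int by simp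
  show ?case
    using step1(2) angle_shift1_iff[of "\<lambda>i. X (i + k)" "\<lambda>i. d (i + k)", unfolded eq] by blast
next
  case (step2 k)
  have eq: "i + 1 + (k - 1) = i + k" for i :: int by simp
  show ?case
    using step2(2) angle_shift1_iff[of "\<lambda>i. X (i + (k - 1))" "\<lambda>i. d (i + (k - 1))", unfolded eq] by blast
qed

text \<open>The periodicity of \<open>f\<close> carries no sign: the two differentials in a
  commuting square change by the same sign.\<close>

definition angle_map ::
    "(int \<Rightarrow> 'o) \<Rightarrow> (int \<Rightarrow> ('o, 'm) gen) \<Rightarrow> (int \<Rightarrow> 'o) \<Rightarrow> (int \<Rightarrow> ('o, 'm) gen)
      \<Rightarrow> (int \<Rightarrow> ('o, 'm) gen) \<Rightarrow> bool"
  where "angle_map X d Y e f \<longleftrightarrow>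
    (\<forall>i. f i \<in> hom (X i) (Y i) \<and> e i * f i = f (i + 1) * d i \<and> f (i + per) = sig (f i))"

text \<open>A direct sum is described by its structure maps because, outside the base period, the
  object in question is a suspension of a chosen sum and need not be a chosen sum itself.\<close>

definition biproduct_maps ::
    "'o \<Rightarrow> 'o \<Rightarrow> 'o \<Rightarrow> ('o, 'm) gen \<Rightarrow> ('o, 'm) gen \<Rightarrow> ('o, 'm) gen \<Rightarrow> ('o, 'm) gen \<Rightarrow> bool"
  where "biproduct_maps A B P a1 a2 b1 b2 \<longleftrightarrow>
    a1 \<in> hom A P \<and> a2 \<in> hom B P \<and> b1 \<in> hom P A \<and> b2 \<in> hom P B \<and>
    b1 * a1 = one A \<and> b2 * a2 = one B \<and> b2 * a1 = 0 \<and> b1 * a2 = 0 \<and>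
    a1 * b1 + a2 * b2 = one P"

lemma biproduct_maps_bp:
  "\<lbrakk>A \<in> Obj C; B \<in> Obj C\<rbrakk>
    \<Longrightarrow> biproduct_maps A B (osum A B) (j1 A B) (j2 A B) (q1 A B) (q2 A B)"
  using bp_hom[of A B] bp_eqs[of A B] by (simp add: biproduct_maps_def)

text \<open>Injection and projection of the first summand carry the same sign, which cancels in
  either composite.\<close>

lemma biproduct_maps_sig:
  assumes "A \<in> Obj C" "B \<in> Obj C" "P \<in> Obj C"
  shows "biproduct_maps (SO A) (SO B) (SO P) (tw (sig a1)) (sig a2) (tw (sig b1)) (sig b2) \<longleftrightarrow>
    biproduct_maps A B P a1 a2 b1 b2"
proof -
  have "sig x = 0 \<longleftrightarrow> x = 0" for x
    using sig_eq_iff[of x 0] by simp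
  then show ?thesis
    unfolding biproduct_maps_def using assms
    by (simp add: sig_hom_iff sig_eq_iff flip: sig_one sig_simps(1,4))
qed

text \<open>Over one period \<open>dN\<close> and the differentials of \<open>X\<close> and
  \<open>Y\<close> acquire the sign of \<open>tw\<close>, whereas \<open>f\<close> does not. Putting
  this sign on the summand \<open>X (i + 1)\<close> alone supplies the entry with
  \<open>f (i + 1)\<close> with the missing sign and leaves the diagonal entries right.\<close>

definition angle_cone ::
    "(int \<Rightarrow> 'o) \<Rightarrow> (int \<Rightarrow> ('o, 'm) gen) \<Rightarrow> (int \<Rightarrow> 'o) \<Rightarrow> (int \<Rightarrow> ('o, 'm) gen)
      \<Rightarrow> (int \<Rightarrow> ('o, 'm) gen) \<Rightarrow> (int \<Rightarrow> 'o) \<Rightarrow> (int \<Rightarrow> ('o, 'm) gen)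
      \<Rightarrow> (int \<Rightarrow> ('o, 'm) gen) \<Rightarrow> (int \<Rightarrow> ('o, 'm) gen) \<Rightarrow> (int \<Rightarrow> ('o, 'm) gen)
      \<Rightarrow> (int \<Rightarrow> ('o, 'm) gen) \<Rightarrow> bool"
  where "angle_cone X d Y e f N dN a1 a2 b1 b2 \<longleftrightarrow> angle N dN \<and>
    (\<forall>i. biproduct_maps (X (i + 1)) (Y i) (N i) (a1 i) (a2 i) (b1 i) (b2 i) \<and>
      dN i = a1 (i + 1) * - d (i + 1) * b1 i
        + a2 (i + 1) * (f (i + 1) * b1 i + e i * b2 i) \<and>
      a1 (i + per) = tw (sig (a1 i)) \<and> a2 (i + per) = sig (a2 i))"

text \<open>(F4) applied to the truncations gives a map and a cone in the base period. Both are
  extended periodically, after which each identity has to be checked in one period only.\<close>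

lemma angle_map_cone_0:
  assumes X: "angle X d" and Y: "angle Y e"
    and f0: "f0 \<in> hom (X 0) (Y 0)" and f1: "f1 \<in> hom (X 1) (Y 1)" and sq: "f1 * d 0 = e 0 * f0"
  shows "\<exists>f N dN a1 a2 b1 b2. angle_map X d Y e f \<and> f 0 = f0 \<and> f 1 = f1 \<and>
    angle_cone X d Y e f N dN a1 a2 b1 b2"
proof -
  note DX = angleD[OF X] and DY = angleD[OF Y]
  let ?m = "\<lambda>X d i. carr (X (int i)) (X (int i + 1)) (d (int i))"
  obtain X' Y' \<delta> \<rho> where tX: "trunc X d = (X', \<delta>)" and tY: "trunc Y e = (Y', \<rho>)"
    by (cases "trunc X d", cases "trunc Y e") blast
  have X': "ob X' = (\<lambda>i. X (int i))" "df X' = ?m X d" "\<delta> = carr (X (int n + 1)) (X per) (d (int n + 1))"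
    using tX by (auto simp: trunc_def)
  have Y': "ob Y' = (\<lambda>i. Y (int i))" "df Y' = ?m Y e" "\<rho> = carr (Y (int n + 1)) (Y per) (e (int n + 1))"
    using tY by (auto simp: trunc_def)
  have "carr (X 1) (Y 1) f1 \<cdot> df X' 0 = df Y' 0 \<cdot> carr (X 0) (Y 0) f0"
  proof (rule arr_inj[of "X 0" "Y 1"])
    show "arr (X 0) (Y 1) (carr (X 1) (Y 1) f1 \<cdot> df X' 0) =
        arr (X 0) (Y 1) (df Y' 0 \<cdot> carr (X 0) (Y 0) f0)"
      using DX(2,3)[of 0] DX(2)[of 1] DY(2,3)[of 0] DY(2)[of 1] f0 f1 sq
      by (simp add: X' Y' arr_comp[of _ "X 1"] arr_comp[of _ "Y 0"] carr_mor arr_carr)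
  qed (use DX(2,3)[of 0] DX(2)[of 1] DY(2,3)[of 0] DY(2)[of 1] f0 f1 in
      \<open>simp_all add: X' Y' carr_mor Comp_Hom[of "X 0" "X 1"] Comp_Hom[of "X 0" "Y 0"]\<close>)
  then obtain g where g: "S_morphism n (X', \<delta>) (Y', \<rho>) g" "g 0 = carr (X 0) (Y 0) f0"
      "g 1 = carr (X 1) (Y 1) f1" and co: "S_cone n (X', \<delta>) (Y', \<rho>) g \<in> Angles"
    using F4[of X' \<delta> Y' \<rho> "carr (X 0) (Y 0) f0" "carr (X 1) (Y 1) f1"] X Y f0 f1
    unfolding angle_def tX tY X'(1) Y'(1) by (auto simp: carr_mor)
  have g_mor: "g i \<in> mor (X (int i)) (Y (int i))" if "i \<le> n + 1" for i
    using g(1) that by (simp add: S_morphism_def chain_map_def X' Y')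
  define f where "f = pext sig sigi (n + 2) (\<lambda>i. arr (X (int i)) (Y (int i)) (g i))"
  have fp: "f (i + per) = sig (f i)" for i
    unfolding f_def using pext_period[of "n + 2" sig sigi _ i] by (simp add: add.commute)
  have fb: "f (int i) = arr (X (int i)) (Y (int i)) (g i)" if "i \<le> n + 1" for i
    using that by (simp add: f_def pext_base)
  have f01: "f 0 = f0" "f 1 = f1"
    using fb[of 0] fb[of 1] g f0 f1 by (simp_all add: arr_carr)
  have base: "P i" if "0 \<le> i" "i < 0 + per" "\<And>i. i \<le> n + 1 \<Longrightarrow> P (int i)" for i and P :: "int \<Rightarrow> bool"
    using that(3)[of "nat i"] that(1,2) by simp
  \<comment> \<open>The index n + 1 is kept apart: there the differential is the extension, and the
    square ends in a suspension.\<close>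
  have base': "P i" if "0 \<le> i" "i < 0 + per" "\<And>i. i \<le> n \<Longrightarrow> P (int i)" "P (int n + 1)"
    for i and P :: "int \<Rightarrow> bool"
    using that(3)[of "nat i"] that(1,2,4) by (cases "i = int n + 1") simp_all
  have f_hom: "f i \<in> hom (X i) (Y i)" for i
  proof (rule periodic_all[where P = "\<lambda>i. f i \<in> hom (X i) (Y i)" and k = 0 and p = per])
    fix i assume "0 \<le> i" "i < 0 + per"
    then show "f i \<in> hom (X i) (Y i)"
      by (rule base) (use g_mor DX(2) DY(2) in \<open>auto simp: fb\<close>)
  qed (simp_all add: fp DX(4) DY(4) sig_hom_iff)
  have p1: "i + per + 1 = i + 1 + per" for i by simp
  have f_comm: "e i * f i = f (i + 1) * d i" for i
  proof (rule periodic_all[where P = "\<lambda>i. e i * f i = f (i + 1) * d i" and k = 0 and p = per])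
    fix i show "e (i + per) * f (i + per) = f (i + per + 1) * d (i + per) \<longleftrightarrow> e i * f i = f (i + 1) * d i"
      unfolding p1 fp DX(5) DY(5) by (simp add: sig_eq_iff flip: sig_simps(4))
  next
    fix i assume "0 \<le> i" "i < 0 + per"
    then show "e i * f i = f (i + 1) * d i"
    proof (rule base')
      fix i assume i: "i \<le> n"
      have "df Y' i \<cdot> g i = g (i + 1) \<cdot> df X' i"
        using g(1) i by (simp add: S_morphism_def chain_map_def)
      then have "arr (X (int i)) (Y (int i + 1)) (df Y' i \<cdot> g i) =
          arr (X (int i)) (Y (int i + 1)) (g (i + 1) \<cdot> df X' i)"
        by simp
      then show "e (int i) * f (int i) = f (int i + 1) * d (int i)"
        using g_mor[of i] g_mor[of "i + 1"] fb[of i] fb[of "i + 1"] i DX(2) DX(3)[of "int i"] DY(2) DY(3)[of "int i"]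
        by (simp add: X' Y' arr_comp[of _ "Y (int i)"] arr_comp[of _ "X (1 + int i)"] carr_mor
            arr_carr add.commute)
    next
      have "FMor S (g 0) \<cdot> \<delta> = \<rho> \<cdot> g (n + 1)"
        using g(1) by (simp add: S_morphism_def)
      then have "arr (X (int n + 1)) (Y per) (FMor S (g 0) \<cdot> \<delta>) = arr (X (int n + 1)) (Y per) (\<rho> \<cdot> g (n + 1))"
        by simp
      moreover have "f (int n + 1 + 1) = arr (X per) (Y per) (FMor S (g 0))"
        using fp[of 0] fb[of 0] g_mor[of 0] DX(2) DY(2) by (simp add: sig_arr DX(7) DY(7) add.assoc)
      ultimately show "e (int n + 1) * f (int n + 1) = f (int n + 1 + 1) * d (int n + 1)"
        using fb[of "n + 1"] g_mor[of "n + 1"] periodic_last[OF DX(1)] periodic_last[OF DY(1)] DX(2) DY(2)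
          FMor_mor[of "X 0" "Y 0" "g 0"] g_mor[of 0]
        by (simp add: X' Y' arr_comp[of _ "Y (1 + int n)"] arr_comp[of _ "FOb S (X 0)"] carr_mor
            arr_carr add.commute DX(7) DY(7))
    qed
  qed simp
  have map: "angle_map X d Y e f"
    unfolding angle_map_def using f_hom f_comm fp by blast
  obtain K \<epsilon> where K: "S_cone n (X', \<delta>) (Y', \<rho>) g = (K, \<epsilon>)" by fastforce
  \<comment> \<open>These repeat the local abbreviations of \<open>S_cone\<close>, in which the
    sequence of \<open>X'\<close> is continued by one step, to the suspension of its first object at
    index n + 2.\<close>
  define Xf df' where "Xf = (\<lambda>i. if i \<le> n + 1 then ob X' i else FOb S (ob X' 0))"
    and "df' = (\<lambda>i. if i \<le> n then df X' i else \<delta>)"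
  have K_ob': "ob K = (\<lambda>i. osum (Xf (i + 1)) (ob Y' i))"
    and K_df': "df K = (\<lambda>i. mat (Xf (i + 1)) (ob Y' i) (Xf (i + 2)) (ob Y' (i + 1))
           (neg (Xf (i + 1)) (Xf (i + 2)) (df' (i + 1))) (zero (ob Y' i) (Xf (i + 2)))
           (g (i + 1)) (df Y' i))"
    and K_ext': "\<epsilon> = S_mat (FOb S (ob X' 0)) (ob Y' (n + 1)) (ob X' 1) (ob Y' 0)
          (neg (FOb S (ob X' 0)) (FOb S (ob X' 1)) (FMor S (df X' 0)))
          (zero (ob Y' (n + 1)) (FOb S (ob X' 1)))
          (FMor S (g 0)) \<rho>"
    using K unfolding S_cone_def Let_def Xf_def df'_def by auto
  have Xf: "Xf i = X (int i)" if "i \<le> n + 2" for i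
  proof (cases "i \<le> n + 1")
    case False
    then have "int i = per" using that by simp
    then show ?thesis using False by (simp only: Xf_def DX(7) X') simp
  qed (simp add: Xf_def X')
  have df': "df' i = carr (X (int i)) (X (int i + 1)) (d (int i))" if "i \<le> n + 1" for i
  proof (cases "i \<le> n")
    case False
    then have "int i = int n + 1" using that by simp
    moreover have "int n + 1 + 1 = per" by simp
    ultimately show ?thesis using False by (simp only: df'_def X') simp
  qed (simp add: df'_def X')
  have K_ob: "ob K i = osum (X (int i + 1)) (Y (int i))" if "i \<le> n + 1" for i
    using that by (simp add: K_ob' Xf Y' add.commute)
  have K_df: "arr (ob K i) (ob K (i + 1)) (df K i) =
      j1 (X (int i + 2)) (Y (int i + 1)) * (- d (int i + 1) * q1 (X (int i + 1)) (Y (int i)))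
      + j2 (X (int i + 2)) (Y (int i + 1)) * (f (int i + 1) * q1 (X (int i + 1)) (Y (int i))
        + e (int i) * q2 (X (int i + 1)) (Y (int i)))" if i: "i \<le> n" for i
  proof -
    have I: "int (i + 1) = int i + 1" "int (i + 2) = int i + 2" "int i + 1 + 1 = int i + 2" by simp_all
    have o: "Xf (i + 1) = X (int i + 1)" "Xf (i + 2) = X (int i + 2)" "ob Y' i = Y (int i)"
      "ob Y' (i + 1) = Y (int i + 1)" "df' (i + 1) = carr (X (int i + 1)) (X (int i + 2)) (d (int i + 1))"
      "df Y' i = carr (Y (int i)) (Y (int i + 1)) (e (int i))"
      using Xf[of "i + 1"] Xf[of "i + 2"] df'[of "i + 1"] i unfolding I Y' by simp_all
    note h = DX(3)[of "int i + 1", unfolded I] DY(3)[of "int i"]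
    have gm: "g (i + 1) \<in> mor (X (int i + 1)) (Y (int i + 1))"
      "arr (X (int i + 1)) (Y (int i + 1)) (g (i + 1)) = f (int i + 1)"
      using g_mor[of "i + 1"] fb[of "i + 1"] i unfolding I by simp_all
    have "ob K (i + 1) = osum (X (int i + 2)) (Y (int i + 1))"
      using K_ob[of "i + 1"] i unfolding I by simp
    moreover have "ob K i = osum (X (int i + 1)) (Y (int i))"
      using K_ob[of i] i by simp
    moreover have "df K i = mat (X (int i + 1)) (Y (int i)) (X (int i + 2)) (Y (int i + 1))
        (neg (X (int i + 1)) (X (int i + 2)) (carr (X (int i + 1)) (X (int i + 2)) (d (int i + 1))))
        (zero (Y (int i)) (X (int i + 2))) (g (i + 1)) (carr (Y (int i)) (Y (int i + 1)) (e (int i)))"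
      unfolding K_df' o ..
    ultimately show ?thesis
      using DX(2) DY(2) h carr_mor[OF h(1)] carr_mor[OF h(2)] gm
      by (simp add: arr_mat(2) arr_neg arr_zero arr_carr)
  qed
  have K_ext: "arr (ob K (n + 1)) (FOb S (ob K 0)) \<epsilon> =
      sig (j1 (X 1) (Y 0)) * (- sig (d 0) * q1 (X per) (Y (int n + 1)))
      + sig (j2 (X 1) (Y 0)) * (sig (f 0) * q1 (X per) (Y (int n + 1))
        + e (int n + 1) * q2 (X per) (Y (int n + 1)))"
  proof -
    have I: "int (n + 1) = int n + 1" "int n + 1 + 1 = per" "int 0 = 0" "(0::int) + 1 = 1" "int 1 = 1" by simp_all
    have o: "ob K (n + 1) = osum (FOb S (X 0)) (Y (int n + 1))" "ob K 0 = osum (X 1) (Y 0)"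
      using K_ob[of "n + 1"] K_ob[of 0] unfolding I DX(7) by simp_all
    note h = DX(3)[of 0, unfolded I] periodic_last[OF DY(1), unfolded DY(7)]
    have gm: "g 0 \<in> mor (X 0) (Y 0)" "arr (X 0) (Y 0) (g 0) = f 0"
      using g_mor[of 0] fb[of 0] by simp_all
    have \<epsilon>: "\<epsilon> = S_mat (FOb S (X 0)) (Y (int n + 1)) (X 1) (Y 0)
        (neg (FOb S (X 0)) (FOb S (X 1)) (FMor S (carr (X 0) (X 1) (d 0))))
        (zero (Y (int n + 1)) (FOb S (X 1))) (FMor S (g 0))
        (carr (Y (int n + 1)) (FOb S (Y 0)) (e (int n + 1)))"
      unfolding K_ext' X' Y' I DY(7) by simp
    have "arr (FOb S (X 0)) (FOb S (X 1)) (FMor S (carr (X 0) (X 1) (d 0))) = sig (d 0)"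
      "arr (FOb S (X 0)) (FOb S (Y 0)) (FMor S (g 0)) = sig (f 0)"
      using sig_arr[of "X 0" "X 1" "carr (X 0) (X 1) (d 0)"] sig_arr[of "X 0" "Y 0" "g 0"]
        DX(2) DY(2) h gm by (simp_all add: carr_mor arr_carr)
    then show ?thesis
      unfolding o \<epsilon> using DX(2) DY(2) h carr_mor[OF h(1)] carr_mor[OF h(2)] gm
      by (simp add: arr_S_mat(2) arr_neg arr_zero arr_carr FMor_mor DX(7))
  qed
  obtain N dN where N: "angle N dN" "\<And>i. i \<le> n + 1 \<Longrightarrow> N (int i) = ob K i"
    "\<And>i. i \<le> n \<Longrightarrow> dN (int i) = arr (ob K i) (ob K (i + 1)) (df K i)"
    "dN (int n + 1) = arr (ob K (n + 1)) (FOb S (ob K 0)) \<epsilon>"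
    using angle_of_finite co unfolding K by metis
  note DN = angleD[OF N(1)]
  \<comment> \<open>Extension with and without the sign, for the structure maps of the first and of
    the second summand respectively.\<close>
  define ex1 ex2 :: "(nat \<Rightarrow> ('o, 'm) gen) \<Rightarrow> int \<Rightarrow> ('o, 'm) gen"
    where "ex1 = pext (\<lambda>x. tw (sig x)) (\<lambda>x. tw (sigi x)) (n + 2)" and "ex2 = pext sig sigi (n + 2)"
  have ex: "ex1 x (i + per) = tw (sig (ex1 x i))" "ex2 x (i + per) = sig (ex2 x i)" for x i
    using pext_period[of "n + 2" sig sigi x i]
      pext_period[of "n + 2" "\<lambda>x. tw (sig x)" "\<lambda>x. tw (sigi x)" x i]
    by (simp_all add: ex1_def ex2_def add.commute)
  have exb: "ex1 x (int i) = x i" "ex2 x (int i) = x i" if "i \<le> n + 1" for x i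
    using that by (simp_all add: ex1_def ex2_def pext_base)
  define a1 a2 b1 b2 where
    "a1 = ex1 (\<lambda>i. j1 (X (int i + 1)) (Y (int i)))" and "a2 = ex2 (\<lambda>i. j2 (X (int i + 1)) (Y (int i)))" and
    "b1 = ex1 (\<lambda>i. q1 (X (int i + 1)) (Y (int i)))" and "b2 = ex2 (\<lambda>i. q2 (X (int i + 1)) (Y (int i)))"
  have abp: "a1 (i + per) = tw (sig (a1 i))" "a2 (i + per) = sig (a2 i)"
    "b1 (i + per) = tw (sig (b1 i))" "b2 (i + per) = sig (b2 i)" for i
    by (simp_all add: a1_def a2_def b1_def b2_def ex)
  have abb: "a1 (int i) = j1 (X (int i + 1)) (Y (int i))" "a2 (int i) = j2 (X (int i + 1)) (Y (int i))"
    "b1 (int i) = q1 (X (int i + 1)) (Y (int i))" "b2 (int i) = q2 (X (int i + 1)) (Y (int i))"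
    if "i \<le> n + 1" for i
    using that by (simp_all add: a1_def a2_def b1_def b2_def exb)
  have bip: "biproduct_maps (X (i + 1)) (Y i) (N i) (a1 i) (a2 i) (b1 i) (b2 i)" for i
  proof (rule periodic_all[where k = 0 and p = per and
        P = "\<lambda>i. biproduct_maps (X (i + 1)) (Y i) (N i) (a1 i) (a2 i) (b1 i) (b2 i)"])
    fix i show "biproduct_maps (X (i + per + 1)) (Y (i + per)) (N (i + per)) (a1 (i + per)) (a2 (i + per))
        (b1 (i + per)) (b2 (i + per)) \<longleftrightarrow> biproduct_maps (X (i + 1)) (Y i) (N i) (a1 i) (a2 i) (b1 i) (b2 i)"
      unfolding p1 abp DX(4) DY(4) DN(4) by (rule biproduct_maps_sig) (rule DX DY DN)+
  next
    fix i assume "0 \<le> i" "i < 0 + per"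
    then show "biproduct_maps (X (i + 1)) (Y i) (N i) (a1 i) (a2 i) (b1 i) (b2 i)"
      by (rule base) (use DX(2) DY(2) in \<open>auto simp: abb N(2) K_ob intro: biproduct_maps_bp\<close>)
  qed simp
  have dN: "dN i = a1 (i + 1) * - d (i + 1) * b1 i + a2 (i + 1) * (f (i + 1) * b1 i + e i * b2 i)" for i
  proof (rule periodic_all[where k = 0 and p = per and
        P = "\<lambda>i. dN i = a1 (i + 1) * - d (i + 1) * b1 i + a2 (i + 1) * (f (i + 1) * b1 i + e i * b2 i)"])
    fix i show "dN (i + per) = a1 (i + per + 1) * - d (i + per + 1) * b1 (i + per)
        + a2 (i + per + 1) * (f (i + per + 1) * b1 (i + per) + e (i + per) * b2 (i + per)) \<longleftrightarrow>
      dN i = a1 (i + 1) * - d (i + 1) * b1 i + a2 (i + 1) * (f (i + 1) * b1 i + e i * b2 i)"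
      unfolding p1 abp DX(5) DY(5) DN(5) fp
      by (simp add: sig_eq_iff flip: sig_simps(1-4) tw_add)
  next
    fix i assume "0 \<le> i" "i < 0 + per"
    then show "dN i = a1 (i + 1) * - d (i + 1) * b1 i + a2 (i + 1) * (f (i + 1) * b1 i + e i * b2 i)"
    proof (rule base')
      fix i assume i: "i \<le> n"
      then show "dN (int i) = a1 (int i + 1) * - d (int i + 1) * b1 (int i)
          + a2 (int i + 1) * (f (int i + 1) * b1 (int i) + e (int i) * b2 (int i))"
        using abb[of i] abb[of "i + 1"] K_df[of i] by (simp add: N mult.assoc add.commute)
    next
      \<comment> \<open>In the passage to the next period the signs of \<open>a1\<close> and of
        \<open>d\<close> at index n + 2 cancel and leave the entry \<open>- sig (d 0)\<close> that
        \<open>S_cone\<close> prescribes.\<close>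
      have "a1 (int n + 1 + 1) = tw (sig (j1 (X 1) (Y 0)))" "a2 (int n + 1 + 1) = sig (j2 (X 1) (Y 0))"
        "f (int n + 1 + 1) = sig (f 0)" "d (int n + 1 + 1) = tw (sig (d 0))"
        using abp[of 0] abb[of 0] fp[of 0] DX(5)[of 0] by (simp_all add: add.assoc)
      moreover have "X (int (n + 1) + 1) = X per" by (simp add: add.commute)
      ultimately show "dN (int n + 1) = a1 (int n + 1 + 1) * - d (int n + 1 + 1) * b1 (int n + 1)
          + a2 (int n + 1 + 1) * (f (int n + 1 + 1) * b1 (int n + 1) + e (int n + 1) * b2 (int n + 1))"
        using abb[of "n + 1"] K_ext N(4) by (simp add: mult.assoc add.commute)
    qed
  qed simp
  have "angle_cone X d Y e f N dN a1 a2 b1 b2"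
    unfolding angle_cone_def using N(1) bip dN abp(1,2) by blast
  then show ?thesis using map f01 by blast
qed

lemma angle_map_cone:
  assumes X: "angle X d" and Y: "angle Y e"
    and f: "fk \<in> hom (X k) (Y k)" "fk' \<in> hom (X (k + 1)) (Y (k + 1))" "fk' * d k = e k * fk"
  obtains f N dN a1 a2 b1 b2 where "angle_map X d Y e f" "f k = fk" "f (k + 1) = fk'"
    "angle_cone X d Y e f N dN a1 a2 b1 b2"
proof -
  let ?s = "\<lambda>x i. x (i + k)" and ?t = "\<lambda>x i. x (i - k)"
  have f': "fk \<in> hom (X (0 + k)) (Y (0 + k))" "fk' \<in> hom (X (1 + k)) (Y (1 + k))"
    "fk' * d (0 + k) = e (0 + k) * fk"
    using f by (simp_all add: add.commute)
  obtain f N dN a1 a2 b1 b2 where m: "angle_map (?s X) (?s d) (?s Y) (?s e) f" "f 0 = fk" "f 1 = fk'"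
    and c: "angle_cone (?s X) (?s d) (?s Y) (?s e) f N dN a1 a2 b1 b2"
    using angle_map_cone_0[OF angle_shift[OF X, of k] angle_shift[OF Y, of k] f'] by blast
  have E: "i - k + k = i" "i - k + 1 + k = i + 1" "i - k + 1 = i + 1 - k"
    "i - k + per = i + per - k" for i by simp_all
  have "angle_map X d Y e (?t f)"
    using m(1)[unfolded angle_map_def, THEN spec, of "_ - k", unfolded E]
    by (simp add: angle_map_def)
  moreover have "angle_cone X d Y e (?t f) (?t N) (?t dN) (?t a1) (?t a2) (?t b1) (?t b2)"
    using c[unfolded angle_cone_def, THEN conjunct2, THEN spec, of "_ - k", unfolded E]
      c[unfolded angle_cone_def, THEN conjunct1, THEN angle_shift, of "- k"]
    by (simp add: angle_cone_def)
  ultimately show ?thesis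
    using that[of "?t f" "?t N"] m(2,3) by simp
qed

section \<open>Exactness of angles\<close>

lemma one_zero_hom:
  "one Z = 0 \<Longrightarrow> x \<in> hom Z A \<Longrightarrow> x = 0" "one Z = 0 \<Longrightarrow> x \<in> hom A Z \<Longrightarrow> x = 0"
  using one_left[of x A Z] one_right[of x Z A] by simp_all

text \<open>A test angle that represents \<open>T\<close> at positions k and k + 1 and has zero
  neighbours. Mapping it into an angle, or an angle into it, turns the completion of morphisms into
  exactness.\<close>

lemma trivial_angle:
  assumes T: "T \<in> Obj C"
  obtains X d where "angle X d" "X k = T" "X (k + 1) = T" "d k = one T" "one (X (k + 2)) = 0"
    "one (X (k - 1)) = 0"
proof -
  obtain Z where Z: "zero_object Z" "Z \<in> Obj C"
    using has_zero_object unfolding zero_object_def by blast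
  then have oz: "one Z = 0" using one_eq_zero_iff by blast
  obtain X d where X: "angle X d" "\<And>i. i \<le> n + 1 \<Longrightarrow> X (int i) = ob (trivial_left Z T) i"
    "\<And>i. i \<le> n \<Longrightarrow> d (int i) = arr (ob (trivial_left Z T) i) (ob (trivial_left Z T) (i + 1))
      (df (trivial_left Z T) i)"
    using angle_of_finite[OF F1b[OF T Z(1)]] by metis
  have b: "X 0 = T" "X 1 = T" "X 2 = Z" "X (int (n + 1)) = Z" "d 0 = one T"
    using X(2)[of 0] X(2)[of 1] X(2)[of 2] X(2)[of "n + 1"] X(3)[of 0] n_pos
    by (simp_all add: trivial_left_def Let_def one_def)
  \<comment> \<open>(F1)(b) describes the base period only. Position -1 is reached by periodicity:
    its suspension is the last object \<open>Z\<close> of the base period.\<close>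
  have "sig (one (X (- 1))) = one (X (- 1 + per))"
    unfolding angleD(4)[OF X(1)] using angleD(2)[OF X(1)] by (simp add: sig_one)
  also have "- 1 + per = int (n + 1)" by simp
  finally have "sig (one (X (- 1))) = sig 0" using b(4) oz by simp
  then have "one (X (- 1)) = 0" using sig_eq_iff by blast
  then show ?thesis
    using that[OF angle_shift[OF X(1), of "- k"]] b oz by (simp add: add.commute)
qed

text \<open>The square with sides \<open>one (X k)\<close> and \<open>d k\<close> extends to a map
  from the test angle on \<open>X k\<close>. Its next component starts at a zero object, and
  commutativity there says that the composite vanishes.\<close>

lemma angle_complex:
  assumes X: "angle X d" shows "d (k + 1) * d k = 0"
proof -
  note D = angleD[OF X]
  obtain U u where U: "angle U u" "U k = X k" "U (k + 1) = X k" "u k = one (X k)" "one (U (k + 2)) = 0"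
    using trivial_angle[OF D(2)] by metis
  have "d k * u k = d k * one (X k)" using U by simp
  then obtain f where f: "angle_map U u X d f" "f (k + 1) = d k"
    using angle_map_cone[OF U(1) X, of "one (X k)" k "d k"] U D(2,3)[of k] one_hom by metis
  have *: "f (k + 2) \<in> hom (U (k + 2)) (X (k + 2))" "d (k + 1) * f (k + 1) = f (k + 2) * u (k + 1)"
    using f(1) unfolding angle_map_def by (simp_all add: add.assoc)
  then show ?thesis using one_zero_hom(1)[OF U(5) *(1)] f(2) by simp
qed

text \<open>A map from the test angle on \<open>T\<close> is completed from \<open>g\<close> at k +
  1 and 0 at k + 2. The completed map is periodic, hence also has a component at k, and this
  component is the required factor.\<close>

lemma angle_exact_cov:
  assumes X: "angle X d" and g: "g \<in> hom T (X (k + 1))" "d (k + 1) * g = 0"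
  obtains h where "h \<in> hom T (X k)" "g = d k * h"
proof -
  note D = angleD[OF X]
  have T: "T \<in> Obj C" using hom_Obj[OF g(1)] by simp
  obtain U u where U: "angle U u" "U k = T" "U (k + 1) = T" "u k = one T" "one (U (k + 2)) = 0"
    using trivial_angle[OF T] by metis
  have "0 \<in> hom (U (k + 1 + 1)) (X (k + 1 + 1))" using angleD(2)[OF U(1)] D(2) by (rule hom_zero)
  then obtain f where f: "angle_map U u X d f" "f (k + 1) = g"
    using angle_map_cone[OF U(1) X, of g "k + 1" 0] U g by (metis mult_zero_left)
  have "f k \<in> hom T (X k)" "d k * f k = g * one T"
    using f U unfolding angle_map_def by metis+
  then show ?thesis using that one_right[OF g(1)] by simp
qed

text \<open>Dually, the angle is mapped into the test angle, starting from 0 at k - 1 and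
  \<open>g\<close> at k; the component at k + 1 is the factor.\<close>

lemma angle_exact_con:
  assumes X: "angle X d" and g: "g \<in> hom (X k) T" "g * d (k - 1) = 0"
  obtains h where "h \<in> hom (X (k + 1)) T" "g = h * d k"
proof -
  note D = angleD[OF X]
  have T: "T \<in> Obj C" using hom_Obj[OF g(1)] by simp
  obtain U u where U: "angle U u" "U k = T" "U (k + 1) = T" "u k = one T" "one (U (k - 1)) = 0"
    using trivial_angle[OF T] by metis
  have "0 \<in> hom (X (k - 1)) (U (k - 1))" using D(2) angleD(2)[OF U(1)] by (rule hom_zero)
  moreover have "g \<in> hom (X (k - 1 + 1)) (U (k - 1 + 1))" using g(1) U by simp
  ultimately obtain f where f: "angle_map X d U u f" "f (k - 1 + 1) = g"
    using angle_map_cone[OF X U(1), of 0 "k - 1" g] g by (metis mult_zero_right)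
  have "f (k + 1) \<in> hom (X (k + 1)) T" "one T * g = f (k + 1) * d k"
    using f U unfolding angle_map_def by (simp, metis)+
  then show ?thesis using that one_left[OF g(1)] by simp
qed

lemma angle_completion:
  assumes f: "f \<in> hom A B"
  obtains X d where "angle X d" "X k = A" "X (k + 1) = B" "d k = f"
proof -
  have o: "A \<in> Obj C" "B \<in> Obj C" using hom_Obj[OF f] by auto
  obtain Y \<delta> where Y: "(Y, \<delta>) \<in> Angles" "ob Y 0 = A" "ob Y 1 = B" "df Y 0 = carr A B f"
    using F1c[OF o carr_mor[OF f]] by blast
  obtain X d where X: "angle X d" "\<And>i. i \<le> n + 1 \<Longrightarrow> X (int i) = ob Y i"
    "\<And>i. i \<le> n \<Longrightarrow> d (int i) = arr (ob Y i) (ob Y (i + 1)) (df Y i)"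
    using angle_of_finite[OF Y(1)] by metis
  have "X 0 = A" "X 1 = B" "d 0 = f"
    using X(2)[of 0] X(2)[of 1] X(3)[of 0] Y arr_carr[OF f] by simp_all
  then show ?thesis
    using that[OF angle_shift[OF X(1), of "- k"]] by (simp add: add.commute)
qed

end

section \<open>Complexes\<close>

context preadditive_category
begin

definition cpx :: "nat \<Rightarrow> (nat \<Rightarrow> 'o) \<Rightarrow> (nat \<Rightarrow> ('o, 'm) gen) \<Rightarrow> bool"
  where "cpx n x d \<longleftrightarrow> (\<forall>i\<le>n + 1. x i \<in> Obj C) \<and> (\<forall>i\<le>n. d i \<in> hom (x i) (x (i + 1))) \<and>
    (\<forall>i<n. d (i + 1) * d i = 0)"

definition cmap ::
    "nat \<Rightarrow> (nat \<Rightarrow> 'o) \<Rightarrow> (nat \<Rightarrow> ('o, 'm) gen) \<Rightarrow> (nat \<Rightarrow> 'o) \<Rightarrow> (nat \<Rightarrow> ('o, 'm) gen)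
      \<Rightarrow> (nat \<Rightarrow> ('o, 'm) gen) \<Rightarrow> bool"
  where "cmap n x d y e f \<longleftrightarrow>
    (\<forall>i\<le>n + 1. f i \<in> hom (x i) (y i)) \<and> (\<forall>i\<le>n. e i * f i = f (i + 1) * d i)"

definition fmap ::
    "nat \<Rightarrow> (nat \<Rightarrow> 'o) \<Rightarrow> (nat \<Rightarrow> ('o, 'm) gen) \<Rightarrow> (nat \<Rightarrow> 'o) \<Rightarrow> (nat \<Rightarrow> ('o, 'm) gen)
      \<Rightarrow> (nat \<Rightarrow> ('o, 'm) gen) \<Rightarrow> bool"
  where "fmap n x d y e f \<longleftrightarrow>
    cmap n x d y e f \<and> f 0 = one (x 0) \<and> f (n + 1) = one (x (n + 1))"

definition null ::
    "nat \<Rightarrow> (nat \<Rightarrow> 'o) \<Rightarrow> (nat \<Rightarrow> ('o, 'm) gen) \<Rightarrow> (nat \<Rightarrow> 'o) \<Rightarrow> (nat \<Rightarrow> ('o, 'm) gen)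
      \<Rightarrow> (nat \<Rightarrow> ('o, 'm) gen) \<Rightarrow> bool"
  where "null n x d y e f \<longleftrightarrow> (\<exists>h. (\<forall>i\<in>{1..n + 1}. h i \<in> hom (x i) (y (i - 1))) \<and>
    f 0 = h 1 * d 0 \<and> (\<forall>i\<in>{1..n}. f i = e (i - 1) * h i + h (i + 1) * d i) \<and>
    f (n + 1) = e n * h (n + 1))"

definition heq ::
    "nat \<Rightarrow> (nat \<Rightarrow> 'o) \<Rightarrow> (nat \<Rightarrow> ('o, 'm) gen) \<Rightarrow> (nat \<Rightarrow> 'o) \<Rightarrow> (nat \<Rightarrow> ('o, 'm) gen) \<Rightarrow> bool"
  where "heq n x d y e \<longleftrightarrow> (\<exists>f g. fmap n x d y e f \<and> fmap n y e x d g \<and>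
    null n x d x d (\<lambda>i. g i * f i - one (x i)) \<and> null n y e y e (\<lambda>i. f i * g i - one (y i)))"

text \<open>Homotopies are left out, so that links compose without any work; between complexes
  satisfying \<open>con_exact\<close> they can be recovered.\<close>

definition linked ::
    "nat \<Rightarrow> (nat \<Rightarrow> 'o) \<Rightarrow> (nat \<Rightarrow> ('o, 'm) gen) \<Rightarrow> (nat \<Rightarrow> 'o) \<Rightarrow> (nat \<Rightarrow> ('o, 'm) gen) \<Rightarrow> bool"
  where "linked n x d y e \<longleftrightarrow> x 0 = y 0 \<and> x (n + 1) = y (n + 1) \<and>
    (\<exists>f. fmap n x d y e f) \<and> (\<exists>g. fmap n y e x d g)"

text \<open>This half of exactness suffices to construct homotopies degree by degree. The covariant
  half is later transported from an angle.\<close>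

definition con_exact :: "nat \<Rightarrow> (nat \<Rightarrow> 'o) \<Rightarrow> (nat \<Rightarrow> ('o, 'm) gen) \<Rightarrow> bool"
  where "con_exact n x d \<longleftrightarrow> (\<forall>i\<in>{1..n}. \<forall>T. \<forall>g\<in>hom (x i) T. g * d (i - 1) = 0 \<longrightarrow>
    (\<exists>h\<in>hom (x (i + 1)) T. g = h * d i))"

lemma con_exactD:
  assumes "con_exact n x d" "1 \<le> i" "i \<le> n" "g \<in> hom (x i) T" "g * d (i - 1) = 0"
  obtains h where "h \<in> hom (x (i + 1)) T" "g = h * d i"
  using assms unfolding con_exact_def by (metis atLeastAtMost_iff)

lemma cmapD:
  assumes "cmap n x d y e f"
  shows "i \<le> n + 1 \<Longrightarrow> f i \<in> hom (x i) (y i)" "i \<le> n \<Longrightarrow> e i * f i = f (i + 1) * d i"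
  using assms by (simp_all add: cmap_def)

lemma cpxD:
  assumes "cpx n x d"
  shows "i \<le> n + 1 \<Longrightarrow> x i \<in> Obj C" "i \<le> n \<Longrightarrow> d i \<in> hom (x i) (x (i + 1))"
    "i < n \<Longrightarrow> d (i + 1) * d i = 0"
  using assms by (simp_all add: cpx_def)

lemma cmap_comp:
  assumes f: "cmap n x d y e f" and g: "cmap n y e z r g"
  shows "cmap n x d z r (\<lambda>i. g i * f i)"
  unfolding cmap_def
proof (intro conjI allI impI)
  show "g i * f i \<in> hom (x i) (z i)" if "i \<le> n + 1" for i
    using cmapD(1)[OF f that] cmapD(1)[OF g that] by (rule hom_comp)
  fix i assume "i \<le> n"
  then have "e i * f i = f (i + 1) * d i" "r i * g i = g (i + 1) * e i"
    using cmapD(2)[OF f] cmapD(2)[OF g] by simp_all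
  then show "r i * (g i * f i) = g (i + 1) * f (i + 1) * d i"
    by (metis mult.assoc)
qed

lemma cmap_add:
  "\<lbrakk>cmap n x d y e f; cmap n x d y e g\<rbrakk> \<Longrightarrow> cmap n x d y e (\<lambda>i. f i + g i)"
  by (simp add: cmap_def hom_add distrib_left distrib_right)

lemma cmap_diff:
  "\<lbrakk>cmap n x d y e f; cmap n x d y e g\<rbrakk> \<Longrightarrow> cmap n x d y e (\<lambda>i. f i - g i)"
  by (simp add: cmap_def hom_diff left_diff_distrib right_diff_distrib)

lemma cmap_one:
  assumes "cpx n x d" shows "cmap n x d x d (\<lambda>i. one (x i))"
  using cpxD[OF assms] one_left[OF cpxD(2)[OF assms]] one_right[OF cpxD(2)[OF assms]]
  by (simp add: cmap_def one_hom)

lemma fmap_comp: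
  assumes "fmap n x d y e f" "fmap n y e z r g" "x 0 = y 0" "x (n + 1) = y (n + 1)"
  shows "fmap n x d z r (\<lambda>i. g i * f i)"
proof -
  have f: "cmap n x d y e f" and g: "cmap n y e z r g" using assms by (simp_all add: fmap_def)
  then show ?thesis
    using assms cmap_comp[OF f g] one_left[OF cmapD(1)[OF f, of 0]] one_left[OF cmapD(1)[OF f, of "n + 1"]]
    by (simp add: fmap_def)
qed

lemma linked_sym: "linked n x d y e \<Longrightarrow> linked n y e x d"
  by (auto simp: linked_def)

lemma linked_trans: "\<lbrakk>linked n x d y e; linked n y e z r\<rbrakk> \<Longrightarrow> linked n x d z r"
  unfolding linked_def using fmap_comp[of n x d y e _ z r] fmap_comp[of n z r y e _ x d] by metis

lemma heq_linked: "\<lbrakk>heq n x d y e; x 0 = y 0; x (n + 1) = y (n + 1)\<rbrakk> \<Longrightarrow> linked n x d y e"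
  unfolding heq_def linked_def by blast

lemma heq_refl:
  assumes "cpx n x d" shows "heq n x d x d"
proof -
  have f: "fmap n x d x d (\<lambda>i. one (x i))"
    using cmap_one[OF assms] by (simp add: fmap_def)
  have "one (x i) * one (x i) = one (x i)" if "i \<le> n + 1" for i
    using cpxD(1)[OF assms that] one_left[OF one_hom] by simp
  moreover have "0 \<in> hom (x i) (x (i - 1))" if "i \<le> n + 1" for i
    using that cpxD(1)[OF assms] by (intro hom_zero) simp_all
  ultimately have "null n x d x d (\<lambda>i. one (x i) * one (x i) - one (x i))"
    unfolding null_def by (intro exI[of _ "\<lambda>i. 0"]) simp
  then show ?thesis using f unfolding heq_def by blast
qed

text \<open>
  Exactness provides a contraction of \<open>f\<close> except in the last degree, which is enough to
  contract \<open>f \<circ> f\<close>.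
\<close>

lemma null_square:
  assumes x: "cpx n x d" "con_exact n x d" and f: "cmap n x d x d f" and f0: "f 0 = 0" "f (n + 1) = 0"
  shows "null n x d x d (\<lambda>i. - (f i * f i))"
proof -
  have "\<exists>k. k 1 = 0 \<and> (\<forall>i\<in>{1..m + 1}. k i \<in> hom (x i) (x (i - 1))) \<and>
      (\<forall>i\<in>{1..m}. f i = d (i - 1) * k i + k (i + 1) * d i)" if "m \<le> n" for m
    using that
  proof (induction m)
    case 0
    then show ?case using cpxD(1)[OF x(1)] by (intro exI[of _ "\<lambda>i. 0"]) (simp add: hom_zero)
  next
    case (Suc m)
    then obtain k where k: "k 1 = 0" "\<And>i. i \<in> {1..m + 1} \<Longrightarrow> k i \<in> hom (x i) (x (i - 1))"
      "\<And>i. i \<in> {1..m} \<Longrightarrow> f i = d (i - 1) * k i + k (i + 1) * d i"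
      by auto
    have dm: "d m \<in> hom (x m) (x (m + 1))" using cpxD(2)[OF x(1), of m] Suc by simp
    have km: "k (m + 1) \<in> hom (x (m + 1)) (x m)" using k(2)[of "m + 1"] by simp
    \<comment> \<open>The part of \<open>f (m + 1)\<close> not yet accounted for by the homotopy. It
      annihilates \<open>d m\<close>, so exactness yields the next component.\<close>
    let ?g = "f (m + 1) - d m * k (m + 1)"
    have g: "?g \<in> hom (x (m + 1)) (x (m + 1))"
      using cmapD(1)[OF f, of "m + 1"] Suc hom_comp[OF km dm] by (simp add: hom_diff)
    have "d m * f m = d m * k (m + 1) * d m"
    proof (cases "m = 0")
      case False
      then have "d m * d (m - 1) = 0" using cpxD(3)[OF x(1), of "m - 1"] Suc by simp
      then show ?thesis using k(3)[of m] False by (simp add: distrib_left flip: mult.assoc)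
    qed (use k(1) f0 in simp)
    then have "?g * d m = 0"
      using cmapD(2)[OF f, of m] Suc by (simp add: left_diff_distrib)
    then obtain h where h: "h \<in> hom (x (m + 2)) (x (m + 1))" "?g = h * d (m + 1)"
      using con_exactD[OF x(2), of "m + 1" ?g] g Suc(2) by auto
    let ?k = "k(m + 2 := h)"
    have "f (m + 1) = d m * k (m + 1) + h * d (m + 1)" using h(2) by (simp add: algebra_simps)
    then have "?k 1 = 0 \<and> (\<forall>i\<in>{1..Suc m + 1}. ?k i \<in> hom (x i) (x (i - 1))) \<and>
      (\<forall>i\<in>{1..Suc m}. f i = d (i - 1) * ?k i + ?k (i + 1) * d i)"
      using k h(1) by (auto simp: le_Suc_eq)
    then show ?case by (rule exI[of _ ?k])
  qed
  then obtain k where k: "k 1 = 0" "\<And>i. i \<in> {1..n + 1} \<Longrightarrow> k i \<in> hom (x i) (x (i - 1))"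
      "\<And>i. i \<in> {1..n} \<Longrightarrow> f i = d (i - 1) * k i + k (i + 1) * d i"
    by blast
  \<comment> \<open>Multiplication by \<open>f\<close> removes the defect of \<open>k\<close> in the
    last degree, since \<open>d n * f n = f (n + 1) * d n = 0\<close>.\<close>
  let ?h = "\<lambda>i. - (f (i - 1) * k i)"
  have "?h i \<in> hom (x i) (x (i - 1))" if "i \<in> {1..n + 1}" for i
    using that hom_comp[OF k(2)[OF that] cmapD(1)[OF f, of "i - 1"]] by (intro hom_uminus) auto
  moreover have "- (f i * f i) = d (i - 1) * ?h i + ?h (i + 1) * d i" if i: "i \<in> {1..n}" for i
  proof -
    have "f i * d (i - 1) = d (i - 1) * f (i - 1)"
      using cmapD(2)[OF f, of "i - 1"] i by (cases i) auto
    moreover have "f i * f i = f i * d (i - 1) * k i + f i * k (i + 1) * d i"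
      using k(3)[OF i] by (metis distrib_left mult.assoc)
    ultimately show ?thesis by (simp add: mult.assoc)
  qed
  moreover have "d n * ?h (n + 1) = 0"
    using cmapD(2)[OF f, of n] f0 by (simp flip: mult.assoc)
  ultimately show ?thesis
    unfolding null_def using f0 by (intro exI[of _ ?h]) auto
qed

text \<open>
  Mutually opposite maps \<open>f\<close> and \<open>g\<close> become homotopy inverse when \<open>g\<close> is replaced by
  \<open>2 g - g f g\<close>: the deviation from the identity is then \<open>- (g f - 1)\<^sup>2\<close>.
\<close>

lemma linked_heq:
  assumes x: "cpx n x d" "con_exact n x d" and y: "cpx n y e" "con_exact n y e"
    and l: "linked n x d y e"
  shows "heq n x d y e"
proof -
  obtain f g where f: "fmap n x d y e f" and g: "fmap n y e x d g"
      and e: "x 0 = y 0" "x (n + 1) = y (n + 1)"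
    using l unfolding linked_def by blast
  have fc: "cmap n x d y e f" and gc: "cmap n y e x d g" using f g by (simp_all add: fmap_def)
  let ?g = "\<lambda>i. g i + (g i - g i * (f i * g i))"
  have g': "fmap n y e x d ?g"
    using cmap_add[OF gc cmap_diff[OF gc cmap_comp[OF cmap_comp[OF gc fc] gc]]] f g e
      one_left[OF one_hom[OF cpxD(1)[OF y(1)]], of 0] one_left[OF one_hom[OF cpxD(1)[OF y(1)]], of "n + 1"]
    by (simp add: fmap_def)
  have n0: "null n z d z d (\<lambda>i. - ((g i * f i - one (z i)) * (g i * f i - one (z i))))"
    if z: "cpx n z d" "con_exact n z d" and f: "fmap n z d w e f" and g: "fmap n w e z d g"
      and e: "z 0 = w 0" "z (n + 1) = w (n + 1)" for z d w e f g
    using cmap_diff[OF cmap_comp cmap_one, of n z d w e f g] f g z e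
      one_left[OF one_hom[OF cpxD(1)[OF z(1)]], of 0] one_left[OF one_hom[OF cpxD(1)[OF z(1)]], of "n + 1"]
    by (intro null_square) (simp_all add: fmap_def)
  have cong: "null n z d z d r" if "null n z d z d s" "\<And>i. i \<le> n + 1 \<Longrightarrow> r i = s i" for z d r s
    using that unfolding null_def by auto
  have "null n x d x d (\<lambda>i. ?g i * f i - one (x i))"
  proof (rule cong[OF n0[OF x f g e]])
    fix i assume i: "i \<le> n + 1"
    have "g i * f i \<in> hom (x i) (x i)" using cmapD(1)[OF cmap_comp[OF fc gc] i] .
    from one_left[OF this] one_right[OF this]
    show "?g i * f i - one (x i) = - ((g i * f i - one (x i)) * (g i * f i - one (x i)))"
      using one_left[OF one_hom[OF cpxD(1)[OF x(1) i]]] by (simp add: algebra_simps)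
  qed
  moreover have "null n y e y e (\<lambda>i. f i * ?g i - one (y i))"
  proof (rule cong[OF n0[OF y g f e[symmetric]]])
    fix i assume i: "i \<le> n + 1"
    have "f i * g i \<in> hom (y i) (y i)" using cmapD(1)[OF cmap_comp[OF gc fc] i] .
    from one_left[OF this] one_right[OF this]
    show "f i * ?g i - one (y i) = - ((f i * g i - one (y i)) * (f i * g i - one (y i)))"
      using one_left[OF one_hom[OF cpxD(1)[OF y(1) i]]] by (simp add: algebra_simps)
  qed
  ultimately show ?thesis unfolding heq_def using f g' by blast
qed

text \<open>A map on \<open>y\<close> annihilated by the preceding differential is pulled back along
  \<open>f\<close>, factored over \<open>x\<close> by exactness and returned along \<open>g\<close>;
  the homotopy between f g and the identity supplies the correction term.\<close>

lemma con_exact_heq: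
  assumes x: "con_exact n x d" and y: "cpx n y e" and h: "heq n x d y e"
  shows "con_exact n y e"
  unfolding con_exact_def
proof (intro ballI allI impI)
  fix i T u assume i: "i \<in> {1..n}" and u: "u \<in> hom (y i) T" "u * e (i - 1) = 0"
  obtain f g where f: "cmap n x d y e f" and g: "cmap n y e x d g"
      and k: "null n y e y e (\<lambda>i. f i * g i - one (y i))"
    using h unfolding heq_def fmap_def by blast
  obtain k where k: "\<And>i. i \<in> {1..n + 1} \<Longrightarrow> k i \<in> hom (y i) (y (i - 1))"
      "\<And>i. i \<in> {1..n} \<Longrightarrow> f i * g i - one (y i) = e (i - 1) * k i + k (i + 1) * e i"
    using k unfolding null_def by blast
  have "u * f i * d (i - 1) = u * (f i * d (i - 1))" by (simp add: mult.assoc)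
  also have "f i * d (i - 1) = e (i - 1) * f (i - 1)"
    using cmapD(2)[OF f, of "i - 1"] i by (cases i) auto
  also have "u * (e (i - 1) * f (i - 1)) = 0" using u(2) by (simp flip: mult.assoc)
  finally have "u * f i * d (i - 1) = 0" .
  moreover have "u * f i \<in> hom (x i) T" using hom_comp[OF cmapD(1)[OF f] u(1)] i by simp
  ultimately obtain v where v: "v \<in> hom (x (i + 1)) T" "u * f i = v * d i"
    using x i unfolding con_exact_def by blast
  have "u * (f i * g i - one (y i)) = u * (e (i - 1) * k i + k (i + 1) * e i)"
    using k(2)[OF i] by simp
  then have "u * f i * g i - u = u * k (i + 1) * e i"
    using u(2) one_right[OF u(1)] by (simp add: right_diff_distrib distrib_left flip: mult.assoc)
  moreover have "u * f i * g i = v * g (i + 1) * e i"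
    using v(2) cmapD(2)[OF g, of i] i by (simp add: mult.assoc)
  ultimately have "u = (v * g (i + 1) - u * k (i + 1)) * e i" by (simp add: algebra_simps)
  moreover have "v * g (i + 1) - u * k (i + 1) \<in> hom (y (i + 1)) T"
    using hom_comp[OF cmapD(1)[OF g, of "i + 1"] v(1)] hom_comp[OF k(1)[of "i + 1"]] u(1) i
    by (simp add: hom_diff)
  ultimately show "\<exists>h\<in>hom (y (i + 1)) T. u = h * e i" by blast
qed

lemma cmap_cong:
  assumes "\<And>i. i \<le> n + 1 \<Longrightarrow> x i = x' i" "\<And>i. i \<le> n \<Longrightarrow> d i = d' i"
    "\<And>i. i \<le> n + 1 \<Longrightarrow> y i = y' i" "\<And>i. i \<le> n \<Longrightarrow> e i = e' i"
  shows "cmap n x d y e f \<longleftrightarrow> cmap n x' d' y' e' f"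
  using assms by (simp add: cmap_def)

lemma cpx_cong:
  assumes "\<And>i. i \<le> n + 1 \<Longrightarrow> x i = x' i" "\<And>i. i \<le> n \<Longrightarrow> d i = d' i"
  shows "cpx n x d \<longleftrightarrow> cpx n x' d'"
  using assms by (simp add: cpx_def)

lemma con_exact_cong:
  assumes "\<And>i. i \<le> n + 1 \<Longrightarrow> x i = x' i" "\<And>i. i \<le> n \<Longrightarrow> d i = d' i"
  shows "con_exact n x d \<longleftrightarrow> con_exact n x' d'"
proof -
  have "x i = x' i \<and> x (i + 1) = x' (i + 1) \<and> d i = d' i \<and> d (i - 1) = d' (i - 1)"
    if "i \<in> {1..n}" for i
    using that assms by (cases i) auto
  then show ?thesis unfolding con_exact_def by (intro ball_cong refl) simp
qed

lemma linked_cong: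
  assumes "\<And>i. i \<le> n + 1 \<Longrightarrow> x i = x' i" "\<And>i. i \<le> n \<Longrightarrow> d i = d' i"
  shows "linked n x d y e \<longleftrightarrow> linked n x' d' y e"
  using assms cmap_cong[of n x x' d d' y y e e] cmap_cong[of n y y e e x x' d d']
  by (simp add: linked_def fmap_def)

section \<open>Complexes, chain maps and homotopies in terms of the ring\<close>

definition dfa :: "('o, 'm) diagram \<Rightarrow> nat \<Rightarrow> ('o, 'm) gen"
  where "dfa X i = arr (ob X i) (ob X (i + 1)) (df X i)"

lemma is_sequenceD:
  assumes "is_sequence n X"
  shows "i \<le> n + 1 \<Longrightarrow> ob X i \<in> Obj C" "i \<le> n \<Longrightarrow> df X i \<in> mor (ob X i) (ob X (i + 1))"
    "i \<le> n \<Longrightarrow> dfa X i \<in> hom (ob X i) (ob X (i + 1))"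
  using assms by (auto simp: is_sequence_def dfa_def intro!: arr_hom)

lemma is_complex_iff:
  "is_complex n X \<longleftrightarrow> is_sequence n X \<and> cpx n (ob X) (dfa X)"
proof (cases "is_sequence n X")
  case True
  note X = is_sequenceD[OF True]
  have "df X (i + 1) \<cdot> df X i = zero (ob X i) (ob X (i + 2)) \<longleftrightarrow> dfa X (i + 1) * dfa X i = 0"
    if i: "i < n" for i
  proof -
    have m: "df X i \<in> mor (ob X i) (ob X (i + 1))" "df X (i + 1) \<in> mor (ob X (i + 1)) (ob X (i + 2))"
      and o: "ob X i \<in> Obj C" "ob X (i + 1) \<in> Obj C" "ob X (i + 2) \<in> Obj C"
      using i X(1) X(2)[of i] X(2)[of "i + 1"] by simp_all
    have "dfa X (i + 1) * dfa X i = arr (ob X i) (ob X (i + 2)) (df X (i + 1) \<cdot> df X i)"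
      using arr_comp[OF o m] by (simp add: dfa_def)
    moreover have "0 = arr (ob X i) (ob X (i + 2)) (zero (ob X i) (ob X (i + 2)))"
      using o by (simp add: arr_zero)
    ultimately show ?thesis
      using arr_eq_iff[OF o(1,3) Comp_Hom[OF o m] zero_mor[OF o(1,3)]] by simp
  qed
  then show ?thesis using True X by (simp add: is_complex_def cpx_def)
qed (simp add: is_complex_def)

lemma cmap_of_chain_map:
  assumes X: "is_sequence n X" and Y: "is_sequence n Y" and f: "chain_map n X Y f"
  shows "cmap n (ob X) (dfa X) (ob Y) (dfa Y) (\<lambda>i. arr (ob X i) (ob Y i) (f i))"
  unfolding cmap_def
proof (intro conjI allI impI)
  note X = is_sequenceD[OF X] and Y = is_sequenceD[OF Y]
  show "arr (ob X i) (ob Y i) (f i) \<in> hom (ob X i) (ob Y i)" if "i \<le> n + 1" for i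
    using that f X Y by (auto simp: chain_map_def)
  fix i assume i: "i \<le> n"
  then have "df Y i \<cdot> f i = f (i + 1) \<cdot> df X i"
    "f i \<in> mor (ob X i) (ob Y i)" "f (i + 1) \<in> mor (ob X (i + 1)) (ob Y (i + 1))"
    using f by (simp_all add: chain_map_def)
  then show "dfa Y i * arr (ob X i) (ob Y i) (f i) = arr (ob X (i + 1)) (ob Y (i + 1)) (f (i + 1)) * dfa X i"
    using X[of i] X(1)[of "i + 1"] Y[of i] Y(1)[of "i + 1"] i
      arr_comp[of "ob X i" "ob Y i" "ob Y (i + 1)" "f i" "df Y i"]
      arr_comp[of "ob X i" "ob X (i + 1)" "ob Y (i + 1)" "df X i" "f (i + 1)"]
    by (simp add: dfa_def)
qed

lemma chain_map_of_cmap: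
  assumes X: "is_sequence n X" and Y: "is_sequence n Y"
    and f: "cmap n (ob X) (dfa X) (ob Y) (dfa Y) f"
  shows "chain_map n X Y (\<lambda>i. carr (ob X i) (ob Y i) (f i))"
  unfolding chain_map_def
proof (intro conjI allI impI)
  note X = is_sequenceD[OF X] and Y = is_sequenceD[OF Y]
  show "carr (ob X i) (ob Y i) (f i) \<in> mor (ob X i) (ob Y i)" if "i \<le> n + 1" for i
    using that f by (simp add: cmap_def carr_mor)
  fix i assume i: "i \<le> n"
  let ?f = "\<lambda>i. carr (ob X i) (ob Y i) (f i)"
  have h: "f i \<in> hom (ob X i) (ob Y i)" "f (i + 1) \<in> hom (ob X (i + 1)) (ob Y (i + 1))"
    and c: "dfa Y i * f i = f (i + 1) * dfa X i"
    using f i by (simp_all add: cmap_def)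
  have o: "ob X i \<in> Obj C" "ob Y i \<in> Obj C" "ob X (i + 1) \<in> Obj C" "ob Y (i + 1) \<in> Obj C"
    using X Y i by simp_all
  show "df Y i \<cdot> ?f i = ?f (i + 1) \<cdot> df X i"
  proof (rule arr_inj[OF o(1,4)])
    show "arr (ob X i) (ob Y (i + 1)) (df Y i \<cdot> ?f i) = arr (ob X i) (ob Y (i + 1)) (?f (i + 1) \<cdot> df X i)"
      using arr_comp[OF o(1,2,4) carr_mor[OF h(1)] Y(2)[OF i]] arr_comp[OF o(1,3,4) X(2)[OF i] carr_mor[OF h(2)]] c
      by (simp add: arr_carr[OF h(1)] arr_carr[OF h(2)] dfa_def del: One_nat_def add_Suc_right Nat.add_0_right)
  qed (rule Comp_Hom[OF o(1,2,4) carr_mor[OF h(1)] Y(2)[OF i]] Comp_Hom[OF o(1,3,4) X(2)[OF i] carr_mor[OF h(2)]])+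
qed

lemma null_cong:
  assumes "null n x d y e f" "\<And>i. i \<le> n + 1 \<Longrightarrow> g i = f i"
  shows "null n x d y e g"
  using assms unfolding null_def by auto

lemma homotopic_iff:
  assumes X: "is_sequence n X" and Y: "is_sequence n Y"
    and f: "\<And>i. i \<le> n + 1 \<Longrightarrow> f i \<in> mor (ob X i) (ob Y i)"
    and g: "\<And>i. i \<le> n + 1 \<Longrightarrow> g i \<in> mor (ob X i) (ob Y i)"
  shows "homotopic n X Y f g \<longleftrightarrow> null n (ob X) (dfa X) (ob Y) (dfa Y)
    (\<lambda>i. arr (ob X i) (ob Y i) (f i) - arr (ob X i) (ob Y i) (g i))"
    (is "_ \<longleftrightarrow> null n _ _ _ _ ?F")
proof -
  note X = is_sequenceD[OF X] and Y = is_sequenceD[OF Y]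
  define P where "P h \<longleftrightarrow> add (ob X 0) (ob Y 0) (f 0) (neg (ob X 0) (ob Y 0) (g 0)) = h 1 \<cdot> df X 0 \<and>
    (\<forall>i\<in>{1..n}. add (ob X i) (ob Y i) (f i) (neg (ob X i) (ob Y i) (g i)) =
       add (ob X i) (ob Y i) (df Y (i - 1) \<cdot> h i) (h (i + 1) \<cdot> df X i)) \<and>
    add (ob X (n + 1)) (ob Y (n + 1)) (f (n + 1)) (neg (ob X (n + 1)) (ob Y (n + 1)) (g (n + 1))) =
       df Y n \<cdot> h (n + 1)" for h
  define Q where "Q H \<longleftrightarrow> ?F 0 = H 1 * dfa X 0 \<and>
    (\<forall>i\<in>{1..n}. ?F i = dfa Y (i - 1) * H i + H (i + 1) * dfa X i) \<and>
    ?F (n + 1) = dfa Y n * H (n + 1)" for H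
  have PQ: "P h \<longleftrightarrow> Q (\<lambda>i. arr (ob X i) (ob Y (i - 1)) (h i))"
    if h: "\<And>i. i \<in> {1..n + 1} \<Longrightarrow> h i \<in> mor (ob X i) (ob Y (i - 1))" for h
  proof -
    have F: "arr (ob X i) (ob Y i) (add (ob X i) (ob Y i) (f i) (neg (ob X i) (ob Y i) (g i))) = ?F i"
      "add (ob X i) (ob Y i) (f i) (neg (ob X i) (ob Y i) (g i)) \<in> mor (ob X i) (ob Y i)"
      if "i \<le> n + 1" for i
      using that X(1)[OF that] Y(1)[OF that] f[OF that] g[OF that] by (simp_all add: arr_add arr_neg)
    have R: "h (i + 1) \<cdot> df X i \<in> mor (ob X i) (ob Y i) \<and>
        arr (ob X i) (ob Y i) (h (i + 1) \<cdot> df X i) = arr (ob X (i + 1)) (ob Y i) (h (i + 1)) * dfa X i"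
      if "i \<le> n" for i
      using that h[of "i + 1"] X(1)[of i] X(1)[of "i + 1"] Y(1)[of i] X(2)[of i]
        arr_comp[of "ob X i" "ob X (i + 1)" "ob Y i" "df X i" "h (i + 1)"]
        Comp_Hom[of "ob X i" "ob X (i + 1)" "ob Y i" "df X i" "h (i + 1)"] by (simp add: dfa_def)
    have L: "df Y j \<cdot> h (j + 1) \<in> mor (ob X (j + 1)) (ob Y (j + 1)) \<and>
        arr (ob X (j + 1)) (ob Y (j + 1)) (df Y j \<cdot> h (j + 1)) = dfa Y j * arr (ob X (j + 1)) (ob Y j) (h (j + 1))"
      if "j \<le> n" for j
      using that h[of "j + 1"] X(1)[of "j + 1"] Y(1)[of j] Y(1)[of "j + 1"] Y(2)[of j]
        arr_comp[of "ob X (j + 1)" "ob Y j" "ob Y (j + 1)" "h (j + 1)" "df Y j"]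
        Comp_Hom[of "ob X (j + 1)" "ob Y j" "ob Y (j + 1)" "h (j + 1)" "df Y j"] by (simp add: dfa_def)
    have "add (ob X 0) (ob Y 0) (f 0) (neg (ob X 0) (ob Y 0) (g 0)) = h 1 \<cdot> df X 0 \<longleftrightarrow>
        ?F 0 = arr (ob X 1) (ob Y 0) (h 1) * dfa X 0"
      using arr_eq_iff[OF X(1)[of 0] Y(1)[of 0] F(2)[of 0], of "h 1 \<cdot> df X 0"] R[of 0] F(1)[of 0] by simp
    moreover have "add (ob X (n + 1)) (ob Y (n + 1)) (f (n + 1)) (neg (ob X (n + 1)) (ob Y (n + 1)) (g (n + 1))) =
        df Y n \<cdot> h (n + 1) \<longleftrightarrow> ?F (n + 1) = dfa Y n * arr (ob X (n + 1)) (ob Y n) (h (n + 1))"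
      using arr_eq_iff[OF X(1)[of "n + 1"] Y(1)[of "n + 1"] F(2)[of "n + 1"], of "df Y n \<cdot> h (n + 1)"]
        L[of n] F(1)[of "n + 1"] by simp
    moreover have "add (ob X i) (ob Y i) (f i) (neg (ob X i) (ob Y i) (g i)) =
         add (ob X i) (ob Y i) (df Y (i - 1) \<cdot> h i) (h (i + 1) \<cdot> df X i) \<longleftrightarrow>
       ?F i = dfa Y (i - 1) * arr (ob X i) (ob Y (i - 1)) (h i) + arr (ob X (i + 1)) (ob Y i) (h (i + 1)) * dfa X i"
      if i: "i \<in> {1..n}" for i
    proof -
      obtain j where j: "i = j + 1" "j \<le> n" "i \<le> n" using i by (cases i) auto
      have o: "ob X i \<in> Obj C" "ob Y i \<in> Obj C" using X(1) Y(1) j by simp_all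
      note l = L[OF j(2), folded j(1)] and r = R[OF j(3)]
      have ji: "i - 1 = j" using j by simp
      show ?thesis
        unfolding ji using l r o F[of i] j(3)
          arr_eq_iff[OF o F(2)[of i] add_mor[OF o conjunct1[OF l] conjunct1[OF r]]]
          arr_add[OF o conjunct1[OF l] conjunct1[OF r]] by simp
    qed
    ultimately show ?thesis unfolding P_def Q_def by simp
  qed
  show ?thesis
  proof
    assume "homotopic n X Y f g"
    then obtain h where h: "\<And>i. i \<in> {1..n + 1} \<Longrightarrow> h i \<in> mor (ob X i) (ob Y (i - 1))" "P h"
      unfolding homotopic_def P_def by blast
    have "arr (ob X i) (ob Y (i - 1)) (h i) \<in> hom (ob X i) (ob Y (i - 1))" if "i \<in> {1..n + 1}" for i
      using h(1)[OF that] X(1)[of i] Y(1)[of "i - 1"] that by (intro arr_hom) auto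
    moreover have "Q (\<lambda>i. arr (ob X i) (ob Y (i - 1)) (h i))" using PQ[OF h(1)] h(2) by blast
    ultimately show "null n (ob X) (dfa X) (ob Y) (dfa Y) ?F"
      unfolding Q_def null_def by (intro exI[of _ "\<lambda>i. arr (ob X i) (ob Y (i - 1)) (h i)"]) blast
  next
    assume "null n (ob X) (dfa X) (ob Y) (dfa Y) ?F"
    then obtain H where H: "\<And>i. i \<in> {1..n + 1} \<Longrightarrow> H i \<in> hom (ob X i) (ob Y (i - 1))" "Q H"
      unfolding null_def Q_def by blast
    define h where "h i = carr (ob X i) (ob Y (i - 1)) (H i)" for i
    have h: "h i \<in> mor (ob X i) (ob Y (i - 1))" "arr (ob X i) (ob Y (i - 1)) (h i) = H i"
      if "i \<in> {1..n + 1}" for i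
      using H(1)[OF that] by (simp_all add: h_def carr_mor arr_carr)
    have "Q (\<lambda>i. arr (ob X i) (ob Y (i - 1)) (h i))"
      using H(2) h(2) h(2)[of "Suc _"] unfolding Q_def by auto
    then have "P h" using PQ[OF h(1)] by blast
    then show "homotopic n X Y f g"
      using h(1) unfolding homotopic_def P_def by (intro exI[of _ h]) blast
  qed
qed

lemma homotopy_equivalent_iff:
  assumes X: "X \<in> complexes n A B" and Y: "Y \<in> complexes n A B"
  shows "homotopy_equivalent n A B X Y \<longleftrightarrow> heq n (ob X) (dfa X) (ob Y) (dfa Y)"
proof -
  have e: "ob X 0 = A" "ob X (n + 1) = B" "ob Y 0 = A" "ob Y (n + 1) = B"
    and s: "is_sequence n X" "is_sequence n Y"
    using X Y by (auto simp: complexes_def is_complex_def)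
  note SX = is_sequenceD[OF s(1)] and SY = is_sequenceD[OF s(2)]
  define P where "P X Y f g \<longleftrightarrow> chain_map_fixed n A B X Y f \<and> chain_map_fixed n A B Y X g \<and>
    homotopic n X X (\<lambda>i. g i \<cdot> f i) (\<lambda>i. Id C (ob X i)) \<and>
    homotopic n Y Y (\<lambda>i. f i \<cdot> g i) (\<lambda>i. Id C (ob Y i))" for X Y f g
  have hom: "homotopic n X X (\<lambda>i. g i \<cdot> f i) (\<lambda>i. Id C (ob X i)) \<longleftrightarrow>
      null n (ob X) (dfa X) (ob X) (dfa X)
        (\<lambda>i. arr (ob Y i) (ob X i) (g i) * arr (ob X i) (ob Y i) (f i) - one (ob X i))" (is "?L \<longleftrightarrow> null n _ _ _ _ ?R")
    if f: "chain_map n X Y f" and g: "chain_map n Y X g" and s: "is_sequence n X" "is_sequence n Y" for X Y f g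
  proof -
    note SX = is_sequenceD[OF s(1)] and SY = is_sequenceD[OF s(2)]
    have m: "f i \<in> mor (ob X i) (ob Y i)" "g i \<in> mor (ob Y i) (ob X i)"
      "g i \<cdot> f i \<in> mor (ob X i) (ob X i)" "Id C (ob X i) \<in> mor (ob X i) (ob X i)" if "i \<le> n + 1" for i
      using f g that SX(1) SY(1) Comp_Hom[of "ob X i" "ob Y i" "ob X i"] by (simp_all add: chain_map_def Id_Hom)
    let ?R' = "\<lambda>i. arr (ob X i) (ob X i) (g i \<cdot> f i) - arr (ob X i) (ob X i) (Id C (ob X i))"
    have "?R i = ?R' i" if "i \<le> n + 1" for i
      using m[OF that] SX(1)[OF that] SY(1)[OF that] by (simp add: arr_comp[of _ "ob Y i"] one_def)
    then have "null n (ob X) (dfa X) (ob X) (dfa X) ?R' \<longleftrightarrow> null n (ob X) (dfa X) (ob X) (dfa X) ?R"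
      using null_cong[of n "ob X" "dfa X" "ob X" "dfa X" ?R' ?R] null_cong[of n "ob X" "dfa X" "ob X" "dfa X" ?R ?R']
      by auto
    moreover have "?L \<longleftrightarrow> null n (ob X) (dfa X) (ob X) (dfa X) ?R'"
      by (rule homotopic_iff[OF s(1) s(1)]) (rule m(3,4), assumption)+
    ultimately show ?thesis by simp
  qed
  show ?thesis
  proof
    assume "homotopy_equivalent n A B X Y"
    then obtain f g where fg: "chain_map_fixed n A B X Y f" "chain_map_fixed n A B Y X g"
      "homotopic n X X (\<lambda>i. g i \<cdot> f i) (\<lambda>i. Id C (ob X i))"
      "homotopic n Y Y (\<lambda>i. f i \<cdot> g i) (\<lambda>i. Id C (ob Y i))"
      unfolding homotopy_equivalent_def by blast
    then have c: "chain_map n X Y f" "chain_map n Y X g" by (simp_all add: chain_map_fixed_def)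
    have "fmap n (ob X) (dfa X) (ob Y) (dfa Y) (\<lambda>i. arr (ob X i) (ob Y i) (f i))"
      "fmap n (ob Y) (dfa Y) (ob X) (dfa X) (\<lambda>i. arr (ob Y i) (ob X i) (g i))"
      using cmap_of_chain_map[OF s c(1)] cmap_of_chain_map[OF s(2,1) c(2)] fg(1,2) e
      by (simp_all add: fmap_def chain_map_fixed_def one_def)
    then show "heq n (ob X) (dfa X) (ob Y) (dfa Y)"
      using fg(3,4) unfolding heq_def hom[OF c s] hom[OF c(2,1) s(2,1)] by blast
  next
    assume "heq n (ob X) (dfa X) (ob Y) (dfa Y)"
    then obtain F G where FG: "fmap n (ob X) (dfa X) (ob Y) (dfa Y) F" "fmap n (ob Y) (dfa Y) (ob X) (dfa X) G"
      "null n (ob X) (dfa X) (ob X) (dfa X) (\<lambda>i. G i * F i - one (ob X i))"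
      "null n (ob Y) (dfa Y) (ob Y) (dfa Y) (\<lambda>i. F i * G i - one (ob Y i))"
      unfolding heq_def by blast
    define f g where "f = (\<lambda>i. carr (ob X i) (ob Y i) (F i))" and "g = (\<lambda>i. carr (ob Y i) (ob X i) (G i))"
    have cm: "cmap n (ob X) (dfa X) (ob Y) (dfa Y) F" "cmap n (ob Y) (dfa Y) (ob X) (dfa X) G"
      using FG(1,2) by (simp_all add: fmap_def)
    have c: "chain_map n X Y f" "chain_map n Y X g"
      unfolding f_def g_def using chain_map_of_cmap[OF s cm(1)] chain_map_of_cmap[OF s(2,1) cm(2)] .
    have arrs: "arr (ob X i) (ob Y i) (f i) = F i" "arr (ob Y i) (ob X i) (g i) = G i" if "i \<le> n + 1" for i
      using cmapD(1)[OF cm(1) that] cmapD(1)[OF cm(2) that] by (simp_all add: f_def g_def arr_carr)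
    have "homotopic n X X (\<lambda>i. g i \<cdot> f i) (\<lambda>i. Id C (ob X i))"
      unfolding hom[OF c s] by (rule null_cong[OF FG(3)]) (simp add: arrs)
    moreover have "homotopic n Y Y (\<lambda>i. f i \<cdot> g i) (\<lambda>i. Id C (ob Y i))"
      unfolding hom[OF c(2,1) s(2,1)] by (rule null_cong[OF FG(4)]) (simp add: arrs)
    moreover have "A \<in> Obj C" "B \<in> Obj C" using SX(1)[of 0] SX(1)[of "n + 1"] e by simp_all
    then have "f 0 = Id C A" "f (n + 1) = Id C B" "g 0 = Id C A" "g (n + 1) = Id C B"
      using FG(1,2) e unfolding f_def g_def fmap_def one_def by (simp_all add: carr_arr Id_Hom)
    ultimately show "homotopy_equivalent n A B X Y"
      unfolding homotopy_equivalent_def chain_map_fixed_def using c by blast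
  qed
qed

end

section \<open>The realization\<close>

context positive_angulated_category
begin

lemma int_plus_1: "int (i + 1) = int i + 1"
  by simp

lemma ob_trunc: "ob (fst (trunc X d)) = (\<lambda>i. X (int i))"
  by (simp add: trunc_def)

lemma angle_cpx: "angle X d \<Longrightarrow> cpx n (\<lambda>i. X (int i)) (\<lambda>i. d (int i))"
  unfolding cpx_def int_plus_1 using angleD(2,3)[of X d] angle_complex[of X d] by simp

lemma angle_con_exact:
  assumes "angle X d" shows "con_exact n (\<lambda>i. X (int i)) (\<lambda>i. d (int i))"
  unfolding con_exact_def
proof (intro ballI allI impI)
  fix i T g assume i: "i \<in> {1..n}" and g: "g \<in> hom (X (int i)) T" "g * d (int (i - 1)) = 0"
  have "int (i - 1) = int i - 1" using i by (simp add: of_nat_diff)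
  then obtain h where "h \<in> hom (X (int i + 1)) T" "g = h * d (int i)"
    using angle_exact_con[OF assms g(1)] g(2) by metis
  then show "\<exists>h\<in>hom (X (int (i + 1))) T. g = h * d (int i)"
    by (auto simp: add.commute)
qed

lemma angle_map_cmap:
  "angle_map X d Y e f \<Longrightarrow>
    cmap n (\<lambda>i. X (int i)) (\<lambda>i. d (int i)) (\<lambda>i. Y (int i)) (\<lambda>i. e (int i)) (\<lambda>i. f (int i))"
  unfolding angle_map_def cmap_def int_plus_1 by simp

text \<open>A morphism of extensions \<open>(a, c)\<close> is a commuting square at positions n + 1
  and n + 2 with sides \<open>c\<close> and \<open>sig a\<close>. Completing from there lifts it,
  and \<open>f 0 = a\<close> follows because \<open>sig\<close> is injective.\<close>

lemma angle_lift:
  assumes X: "angle X d" and Y: "angle Y e"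
    and a: "a \<in> hom (X 0) (Y 0)" and c: "c \<in> hom (X (int n + 1)) (Y (int n + 1))"
    and sq: "sig a * d (int n + 1) = e (int n + 1) * c"
  obtains f N dN a1 a2 b1 b2 where "angle_map X d Y e f" "f 0 = a" "f (int n + 1) = c"
    "angle_cone X d Y e f N dN a1 a2 b1 b2"
proof -
  have E: "int n + 1 + 1 = per" by simp
  have "sig a \<in> hom (X (int n + 1 + 1)) (Y (int n + 1 + 1))"
    unfolding E angleD(6)[OF X] angleD(6)[OF Y] using a by (rule sig_hom)
  then obtain f N dN a1 a2 b1 b2 where f: "angle_map X d Y e f" "f (int n + 1) = c" "f (int n + 1 + 1) = sig a"
    "angle_cone X d Y e f N dN a1 a2 b1 b2"
    using angle_map_cone[OF X Y c _ sq] by metis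
  have "sig (f 0) = sig a"
    using f(1,3) unfolding angle_map_def E by (metis add_0)
  then show ?thesis using that f sig_eq_iff by blast
qed

text \<open>Maps in both directions do not transfer exactness, hence the separate clause
  \<open>con_exact\<close>.\<close>

definition realizes :: "(nat \<Rightarrow> 'o) \<Rightarrow> (nat \<Rightarrow> ('o, 'm) gen) \<Rightarrow> ('o, 'm) gen \<Rightarrow> bool"
  where "realizes x d \<delta> \<longleftrightarrow> cpx n x d \<and> con_exact n x d \<and>
    (\<exists>W w. angle W w \<and> w (int n + 1) = \<delta> \<and> linked n x d (\<lambda>i. W (int i)) (\<lambda>i. w (int i)))"

lemma realizesI:
  assumes "cpx n x d" "con_exact n x d" "angle W w" "w (int n + 1) = \<delta>"
    "W 0 = x 0" "W (int n + 1) = x (n + 1)"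
    "fmap n x d (\<lambda>i. W (int i)) (\<lambda>i. w (int i)) f" "fmap n (\<lambda>i. W (int i)) (\<lambda>i. w (int i)) x d g"
  shows "realizes x d \<delta>"
  unfolding realizes_def linked_def int_plus_1
  by (intro conjI exI[of _ W] exI[of _ w] exI[of _ f] exI[of _ g]) (use assms in simp_all)

lemma angle_realizes: "angle X d \<Longrightarrow> realizes (\<lambda>i. X (int i)) (\<lambda>i. d (int i)) (d (int n + 1))"
  using angle_cpx[of X d] angle_con_exact[of X d] heq_linked[OF heq_refl]
  unfolding realizes_def by blast

text \<open>The lift passes through the angles to which \<open>x\<close> and \<open>y\<close> are
  linked. As the linking maps are identities at the ends, the ends remain \<open>a\<close> and
  \<open>c\<close>.\<close>

lemma realizes_lift:
  assumes x: "realizes x d \<delta>" and y: "realizes y e \<rho>"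
    and a: "a \<in> hom (x 0) (y 0)" and c: "c \<in> hom (x (n + 1)) (y (n + 1))"
    and sq: "sig a * \<delta> = \<rho> * c"
  obtains f where "cmap n x d y e f" "f 0 = a" "f (n + 1) = c"
proof -
  obtain X D where X: "angle X D" "D (int n + 1) = \<delta>" "linked n x d (\<lambda>i. X (int i)) (\<lambda>i. D (int i))"
    using x unfolding realizes_def by blast
  obtain Y E where Y: "angle Y E" "E (int n + 1) = \<rho>" "linked n y e (\<lambda>i. Y (int i)) (\<lambda>i. E (int i))"
    using y unfolding realizes_def by blast
  obtain u where u: "fmap n x d (\<lambda>i. X (int i)) (\<lambda>i. D (int i)) u"
    and ex: "x 0 = X 0" "x (n + 1) = X (int n + 1)"
    using X(3) unfolding linked_def by (auto simp: add.commute)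
  obtain v where v: "fmap n (\<lambda>i. Y (int i)) (\<lambda>i. E (int i)) y e v"
    and ey: "y 0 = Y 0" "y (n + 1) = Y (int n + 1)"
    using Y(3) unfolding linked_def by (auto simp: add.commute)
  obtain f where f: "angle_map X D Y E f" "f 0 = a" "f (int n + 1) = c"
    using angle_lift[OF X(1) Y(1), of a c] a c sq X(2) Y(2) ex ey by metis
  have "cmap n x d y e (\<lambda>i. v i * (f (int i) * u i))"
    using u v cmap_comp[OF cmap_comp[OF _ angle_map_cmap[OF f(1)]]] by (simp add: fmap_def)
  moreover have "v 0 * (f (int 0) * u 0) = a" "v (n + 1) * (f (int (n + 1)) * u (n + 1)) = c"
    using u v f(2,3) one_left[OF a] one_right[OF a] one_left[OF c] one_right[OF c]
    unfolding fmap_def int_plus_1 by (simp_all only: ex ey of_nat_0)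
  ultimately show ?thesis using that by blast
qed

text \<open>Both maps of the link are lifts of the identity morphism of \<delta>.\<close>

lemma realizes_unique:
  assumes x: "realizes x d \<delta>" and y: "realizes y e \<delta>" and e: "x 0 = y 0" "x (n + 1) = y (n + 1)"
  shows "linked n x d y e"
proof -
  have o: "x 0 \<in> Obj C" "x (n + 1) \<in> Obj C" using x cpxD(1)[of n x d] by (simp_all add: realizes_def)
  obtain X D where X: "angle X D" "D (int n + 1) = \<delta>" "linked n x d (\<lambda>i. X (int i)) (\<lambda>i. D (int i))"
    using x unfolding realizes_def by blast
  have \<delta>: "\<delta> \<in> hom (x (n + 1)) (SO (x 0))"
    using X periodic_last[OF angleD(1)[OF X(1)]] angleD(6)[OF X(1)] by (auto simp: linked_def add.commute)
  have sq: "sig (one (x 0)) * \<delta> = \<delta> * one (x (n + 1))"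
    using one_left[OF \<delta>] one_right[OF \<delta>] o by (simp add: sig_one)
  have l: "\<exists>f. fmap n x d y e f" if "realizes x d \<delta>" "realizes y e \<delta>" "x 0 = y 0" "x (n + 1) = y (n + 1)"
    "x 0 \<in> Obj C" "x (n + 1) \<in> Obj C" "sig (one (x 0)) * \<delta> = \<delta> * one (x (n + 1))" for x d y e
    using realizes_lift[OF that(1,2), of "one (x 0)" "one (x (n + 1))"] that one_hom
    by (metis fmap_def)
  show ?thesis
    unfolding linked_def using l[OF x y e o sq] l[OF y x e[symmetric]] o sq e by simp
qed

lemma realizes_iff_heq:
  assumes x: "realizes x d \<delta>" and y: "cpx n y e" and e: "x 0 = y 0" "x (n + 1) = y (n + 1)"
  shows "realizes y e \<delta> \<longleftrightarrow> heq n x d y e"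
proof
  assume "realizes y e \<delta>"
  then show "heq n x d y e"
    using realizes_unique[OF x _ e] x linked_heq by (simp add: realizes_def)
next
  assume "heq n x d y e"
  then have "con_exact n y e" "linked n y e x d"
    using con_exact_heq x y heq_linked e linked_sym by (metis realizes_def, metis)
  then show "realizes y e \<delta>"
    using x y linked_trans unfolding realizes_def by metis
qed

text \<open>Exactness is that of the angle \<open>W\<close>, transported along a homotopy
  equivalence. At the ends no homotopy intervenes: \<open>d 0\<close> and \<open>w 0\<close>, and
  likewise \<open>d n\<close> and \<open>w n\<close>, factor through one another because the
  comparison maps are identities there. In the inner degrees the homotopy on \<open>x\<close> gives
  a correction term.\<close>

lemma realizes_exact:
  assumes x: "realizes x d \<delta>"
  shows "\<delta> \<in> hom (x (n + 1)) (SO (x 0))" "\<delta> * d n = 0" "sig (d 0) * \<delta> = 0"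
    and "\<lbrakk>g \<in> hom (x 0) T; sig g * \<delta> = 0\<rbrakk> \<Longrightarrow> \<exists>h\<in>hom (x 1) T. g = h * d 0"
    and "\<lbrakk>g \<in> hom (x (n + 1)) T; g * d n = 0\<rbrakk> \<Longrightarrow> \<exists>h\<in>hom (SO (x 0)) T. g = h * \<delta>"
    and "\<lbrakk>i \<in> {1..n}; g \<in> hom T (x i); d i * g = 0\<rbrakk> \<Longrightarrow> \<exists>h\<in>hom T (x (i - 1)). g = d (i - 1) * h"
    and "\<lbrakk>g \<in> hom T (x (n + 1)); \<delta> * g = 0\<rbrakk> \<Longrightarrow> \<exists>h\<in>hom T (x n). g = d n * h"
proof -
  obtain W w where W: "angle W w" "w (int n + 1) = \<delta>"
    and l: "linked n x d (\<lambda>i. W (int i)) (\<lambda>i. w (int i))"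
    using x unfolding realizes_def by blast
  have cx: "cpx n x d" "con_exact n x d" using x by (simp_all add: realizes_def)
  have "heq n x d (\<lambda>i. W (int i)) (\<lambda>i. w (int i))"
    using linked_heq[OF cx angle_cpx[OF W(1)] angle_con_exact[OF W(1)] l] .
  then obtain u v where u: "fmap n x d (\<lambda>i. W (int i)) (\<lambda>i. w (int i)) u"
    and v: "fmap n (\<lambda>i. W (int i)) (\<lambda>i. w (int i)) x d v"
    and k: "null n x d x d (\<lambda>i. v i * u i - one (x i))"
    unfolding heq_def by blast
  have e: "x 0 = W 0" "x (n + 1) = W (int n + 1)" using l by (auto simp: linked_def add.commute)
  have uc: "cmap n x d (\<lambda>i. W (int i)) (\<lambda>i. w (int i)) u"
    and vc: "cmap n (\<lambda>i. W (int i)) (\<lambda>i. w (int i)) x d v" using u v by (simp_all add: fmap_def)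
  have I: "int (n + 1) = int n + 1" "int n + 1 + 1 = per" "int n + 1 - 1 = int n" "per - 1 = int n + 1" by simp_all
  note DW = angleD[OF W(1)]
  have wn: "w (int n) \<in> hom (W (int n)) (x (n + 1))" using DW(3)[of "int n"] e by simp
  have w0: "w 0 \<in> hom (x 0) (W 1)" using DW(3)[of 0] e by simp
  have dn: "d n \<in> hom (x n) (x (n + 1))" and d0: "d 0 \<in> hom (x 0) (x 1)"
    using cpxD(2)[OF cx(1), of n] cpxD(2)[OF cx(1), of 0] by simp_all
  have ends: "d n = w (int n) * u n" "w (int n) = d n * v n" "d 0 = v 1 * w 0" "w 0 = u 1 * d 0"
    using cmapD(2)[OF uc, of n] cmapD(2)[OF uc, of 0] cmapD(2)[OF vc, of n] cmapD(2)[OF vc, of 0]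
      u v one_left[OF dn] one_left[OF wn] one_right[OF d0] one_right[OF w0] e
    by (simp_all add: fmap_def add.commute)
  have \<delta>: "\<delta> \<in> hom (x (n + 1)) (SO (x 0))"
    using periodic_last[OF DW(1)] W(2) e DW(6) by simp
  then show "\<delta> \<in> hom (x (n + 1)) (SO (x 0))" .
  have "\<delta> * w (int n) = 0" using angle_complex[OF W(1), of "int n"] W(2) by simp
  then show "\<delta> * d n = 0" using ends(1) by (simp flip: mult.assoc)
  have "w per * \<delta> = 0" using angle_complex[OF W(1), of "int n + 1"] W(2) by (simp add: add.commute)
  then have "sig (w 0) * \<delta> = 0" using DW(8) by simp
  then show "sig (d 0) * \<delta> = 0" using ends(3) by (simp add: mult.assoc)
  show "\<exists>h\<in>hom (x 1) T. g = h * d 0" if g: "g \<in> hom (x 0) T" "sig g * \<delta> = 0"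
  proof -
    \<comment> \<open>The suspension of \<open>g\<close> lives one period later, so exactness is
      used at \<open>per\<close>; \<open>tw (sigi h)\<close> brings the factor back and undoes the
      sign in \<open>w per\<close>.\<close>
    have "sig g \<in> hom (W per) (SO T)" using sig_hom[OF g(1)] e DW(6) by simp
    then obtain h where h: "h \<in> hom (W (per + 1)) (SO T)" "sig g = h * w per"
      using angle_exact_con[OF W(1), of "sig g" per "SO T"] g(2) W(2) unfolding I by metis
    have p1: "per + 1 = 1 + per" by simp
    have "tw (sigi h) \<in> hom (W 1) T"
      using h(1) unfolding p1 DW(4) by (simp add: sigi_hom)
    moreover have "sig g = sig (tw (sigi h) * w 0)" using h(2) DW(8) by simp
    then have "g = tw (sigi h) * w 0" using sig_eq_iff by blast
    then have "g = tw (sigi h) * u 1 * d 0" using ends(4) by (metis mult.assoc)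
    moreover have "u 1 \<in> hom (x 1) (W 1)" using cmapD(1)[OF uc, of 1] by simp
    ultimately show ?thesis using hom_comp by blast
  qed
  show "\<exists>h\<in>hom (SO (x 0)) T. g = h * \<delta>" if g: "g \<in> hom (x (n + 1)) T" "g * d n = 0"
  proof -
    have "g * w (int n) = 0" using g(2) ends(2) by (simp flip: mult.assoc)
    then obtain h where "h \<in> hom (W per) T" "g = h * w (int n + 1)"
      using angle_exact_con[OF W(1), of g "int n + 1" T] g(1) e unfolding I by metis
    then show ?thesis using W(2) DW(6) e by auto
  qed
  show "\<exists>h\<in>hom T (x n). g = d n * h" if g: "g \<in> hom T (x (n + 1))" "\<delta> * g = 0"
  proof -
    obtain h where h: "h \<in> hom T (W (int n))" "g = w (int n) * h"
      using angle_exact_cov[OF W(1), of g T "int n"] g e W(2) by metis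
    moreover have "v n \<in> hom (W (int n)) (x n)" using cmapD(1)[OF vc, of n] by simp
    ultimately have "v n * h \<in> hom T (x n)" "g = d n * (v n * h)"
      using ends(2) hom_comp by (simp_all add: mult.assoc)
    then show ?thesis by blast
  qed
  show "\<exists>h\<in>hom T (x (i - 1)). g = d (i - 1) * h"
    if i: "i \<in> {1..n}" and g: "g \<in> hom T (x i)" "d i * g = 0"
  proof -
    obtain j where j: "i = j + 1" "j + 1 \<le> n" using i by (cases i) auto
    have I: "int i = int j + 1" "i - 1 = j" using j by simp_all
    obtain k where kk: "\<forall>i\<in>{1..n + 1}. k i \<in> hom (x i) (x (i - 1))"
      "\<forall>i\<in>{1..n}. v i * u i - one (x i) = d (i - 1) * k i + k (i + 1) * d i"
      using k unfolding null_def by blast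
    have k: "k i \<in> hom (x i) (x j)" "v i * u i - one (x i) = d j * k i + k (i + 1) * d i"
      using kk(1)[rule_format, of i] kk(2)[rule_format, of i] i unfolding I(2) by simp_all
    have ui: "u i * g \<in> hom T (W (int i))" using hom_comp[OF g(1) cmapD(1)[OF uc]] j by simp
    have "w (int i) * (u i * g) = u (i + 1) * (d i * g)"
      using cmapD(2)[OF uc, of i] j by (simp flip: mult.assoc)
    then obtain h where h: "h \<in> hom T (W (int j))" "u i * g = w (int j) * h"
      using angle_exact_cov[OF W(1), of "u i * g" T "int j"] ui g(2) unfolding I by auto
    have "v i * (u i * g) = d j * (v j * h)"
      using h(2) cmapD(2)[OF vc, of j] j by (simp flip: mult.assoc)
    moreover have "(v i * u i - one (x i)) * g = (d j * k i + k (i + 1) * d i) * g" using k(2) by simp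
    ultimately have "g = d j * (v j * h - k i * g)"
      using g(2) one_left[OF g(1)] by (simp add: algebra_simps)
    moreover have "v j * h - k i * g \<in> hom T (x j)"
      using hom_comp[OF h(1) cmapD(1)[OF vc, of j]] hom_comp[OF g(1) k(1)] j by (simp add: hom_diff)
    ultimately show ?thesis unfolding I by blast
  qed
qed

section \<open>The bifunctor of extensions and the classes assigned to them\<close>

lemma carrier_E_Sigma [simp]: "EOb (E_Sigma C S) B A = Hom C B (FOb S A)"
  by (simp add: E_Sigma_def)

lemma EMor_E_Sigma [simp]: "EMor (E_Sigma C S) c a \<delta> = FMor S a \<cdot> (\<delta> \<cdot> c)"
  by (simp add: E_Sigma_def)

lemma Angles_realizes:
  assumes X: "(X, \<delta>) \<in> Angles"
  shows "is_complex n X" "\<delta> \<in> mor (ob X (n + 1)) (FOb S (ob X 0))"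
    "realizes (ob X) (dfa X) (arr (ob X (n + 1)) (FOb S (ob X 0)) \<delta>)"
proof -
  have seq: "is_sequence n X" "\<delta> \<in> mor (ob X (n + 1)) (FOb S (ob X 0))"
    using Angles_sequences[OF X] by (simp_all add: is_S_sequence_def)
  obtain W w where W: "angle W w" "\<And>i. i \<le> n + 1 \<Longrightarrow> W (int i) = ob X i"
    "\<And>i. i \<le> n \<Longrightarrow> w (int i) = dfa X i"
    "w (int n + 1) = arr (ob X (n + 1)) (FOb S (ob X 0)) \<delta>"
    using angle_of_finite[OF X] unfolding dfa_def by metis
  have c: "cpx n (ob X) (dfa X)"
    using angle_cpx[OF W(1)] cpx_cong[of n "\<lambda>i. W (int i)" "ob X" "\<lambda>i. w (int i)" "dfa X"] W(2,3) by blast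
  have "con_exact n (ob X) (dfa X)"
    using angle_con_exact[OF W(1)] con_exact_cong[of n "\<lambda>i. W (int i)" "ob X" "\<lambda>i. w (int i)" "dfa X"] W(2,3)
    by blast
  moreover have "linked n (ob X) (dfa X) (\<lambda>i. W (int i)) (\<lambda>i. w (int i))"
    using linked_cong[of n "\<lambda>i. W (int i)" "ob X" "\<lambda>i. w (int i)" "dfa X" "\<lambda>i. W (int i)" "\<lambda>i. w (int i)"]
      W(2,3) heq_linked[OF heq_refl[OF angle_cpx[OF W(1)]]] by blast
  ultimately show "realizes (ob X) (dfa X) (arr (ob X (n + 1)) (FOb S (ob X 0)) \<delta>)"
    unfolding realizes_def using W(1,4) c by blast
  show "is_complex n X" using seq c is_complex_iff by blast
  show "\<delta> \<in> mor (ob X (n + 1)) (FOb S (ob X 0))" by (rule seq)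
qed

lemma SO_eq: "A \<in> Obj C \<Longrightarrow> SO A = FOb S A"
  by (simp add: SO_def)

text \<open>An extension is the differential at position n + 1, so the general completion applies
  there. It produces \<open>SO A\<close> at position n + 2, and injectivity of \<open>SO\<close>
  turns this into \<open>W 0 = A\<close>.\<close>

lemma angle_completion_last:
  assumes A: "A \<in> Obj C" and f: "f \<in> hom B (SO A)"
  obtains W w where "angle W w" "W 0 = A" "W (int n + 1) = B" "w (int n + 1) = f"
proof -
  obtain W w where W: "angle W w" "W (int n + 1) = B" "W (int n + 1 + 1) = SO A" "w (int n + 1) = f"
    using angle_completion[OF f] by metis
  have "int n + 1 + 1 = per" by simp
  from W(3)[unfolded this] have "SO (W 0) = SO A" using angleD(6)[OF W(1)] by simp
  then have "W 0 = A" using SOi_SO by metis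
  then show ?thesis using that W by blast
qed

lemma completes_exists:
  assumes A: "A \<in> Obj C" and B: "B \<in> Obj C" and \<delta>: "\<delta> \<in> mor B (FOb S A)"
  shows "\<exists>X. completes n Angles B A \<delta> X"
proof -
  have "arr B (FOb S A) \<delta> \<in> hom B (SO A)" using A B \<delta> by (simp add: SO_eq arr_hom)
  then obtain W w where W: "angle W w" "W 0 = A" "W (int n + 1) = B" "w (int n + 1) = arr B (FOb S A) \<delta>"
    using angle_completion_last[OF A] by metis
  have "trunc W w = (fst (trunc W w), \<delta>)"
    using W A B \<delta> angleD(7)[OF W(1)] by (simp add: trunc_def carr_arr)
  then have "completes n Angles B A \<delta> (fst (trunc W w))"
    using W unfolding completes_def angle_def ob_trunc by (simp add: add.commute)
  then show ?thesis by blast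
qed

text \<open>The right-hand side does not mention \<open>X\<close>; hence the class of \<delta> is
  independent of the chosen angle.\<close>

lemma hclass_realizes:
  assumes X: "X \<in> complexes n A B" and r: "realizes (ob X) (dfa X) \<delta>"
  shows "hclass n A B X = {Y \<in> complexes n A B. realizes (ob Y) (dfa Y) \<delta>}"
  unfolding hclass_def
proof (intro Collect_cong conj_cong refl)
  fix Y assume Y: "Y \<in> complexes n A B"
  have "ob X 0 = ob Y 0" "ob X (n + 1) = ob Y (n + 1)" "cpx n (ob Y) (dfa Y)"
    using X Y by (simp_all add: complexes_def is_complex_iff)
  then show "homotopy_equivalent n A B X Y \<longleftrightarrow> realizes (ob Y) (dfa Y) \<delta>"
    using homotopy_equivalent_iff[OF X Y] realizes_iff_heq[OF r] by simp
qed

lemma completes_realizes: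
  assumes "completes n Angles B A \<delta> X"
  shows "X \<in> complexes n A B" "realizes (ob X) (dfa X) (arr B (FOb S A) \<delta>)"
  using assms Angles_realizes[of X \<delta>] by (auto simp: completes_def complexes_def)

lemma s_angles_iff:
  assumes A: "A \<in> Obj C" and B: "B \<in> Obj C" and \<delta>: "\<delta> \<in> mor B (FOb S A)"
    and X: "X \<in> complexes n A B"
  shows "s_angles C n Angles B A \<delta> = hclass n A B X \<longleftrightarrow>
    realizes (ob X) (dfa X) (arr B (FOb S A) \<delta>)"
proof -
  let ?X = "SOME X. completes n Angles B A \<delta> X"
  have "completes n Angles B A \<delta> ?X"
    using completes_exists[OF A B \<delta>] by (rule someI_ex)
  then have s: "s_angles C n Angles B A \<delta> =
      {Y \<in> complexes n A B. realizes (ob Y) (dfa Y) (arr B (FOb S A) \<delta>)}"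
    unfolding s_angles_def using hclass_realizes completes_realizes by blast
  have "cpx n (ob X) (dfa X)" using X by (simp add: complexes_def is_complex_iff)
  then have "X \<in> hclass n A B X"
    using X homotopy_equivalent_iff[OF X X] heq_refl by (simp add: hclass_def)
  then show ?thesis
    using s hclass_realizes[OF X] X by blast
qed

lemma FMor_comp_mor:
  assumes "A \<in> Obj C" "A' \<in> Obj C" "B \<in> Obj C" "B' \<in> Obj C" "c \<in> mor B' B" "a \<in> mor A A'"
    "\<delta> \<in> mor B (FOb S A)"
  shows "\<delta> \<cdot> c \<in> mor B' (FOb S A)" "FMor S a \<cdot> (\<delta> \<cdot> c) \<in> mor B' (FOb S A')"
  using assms FMor_mor[of A A' a] Comp_Hom[of B' B "FOb S A" c \<delta>]
    Comp_Hom[of B' "FOb S A" "FOb S A'" "\<delta> \<cdot> c" "FMor S a"] by simp_all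

lemma extension_category_E_Sigma: "extension_category C (E_Sigma C S)"
proof (intro extension_category.intro extension_category_axioms.intro additive_category_axioms, goal_cases)
  case (1 B A)
  then show ?case by (simp add: Hom_group)
next
  case (2 A A' B B' c a)
  then show ?case
    using FMor_comp_mor[of A A' B B' c a] FMor_mor[of A A' a]
    by (auto simp: Group.hom_def Comp_add_left[of B' B "FOb S A"] Comp_add_right[of B' "FOb S A" "FOb S A'"])
next
  case (3 A B \<delta>)
  then show ?case
    by (simp add: S_Id Comp_Id_left[of B "FOb S A"] Comp_Id_right[of B "FOb S A"])
next
  case (4 A A' A'' B B' B'' c c' a a' \<delta>)
  have m: "FMor S a \<in> mor (FOb S A) (FOb S A')" "FMor S a' \<in> mor (FOb S A') (FOb S A'')"
    using 4 by (simp_all add: FMor_mor)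
  have h: "arr B'' (FOb S A'') (FMor S (a' \<cdot> a) \<cdot> (\<delta> \<cdot> (c \<cdot> c'))) =
      arr B'' (FOb S A'') (FMor S a' \<cdot> ((FMor S a \<cdot> (\<delta> \<cdot> c)) \<cdot> c'))"
    using 4 m Comp_Hom[of A A' A'' a a'] Comp_Hom[of B'' B' B c' c] FMor_mor[of A A'' "a' \<cdot> a"]
      FMor_comp_mor[of A A'' B B'' "c \<cdot> c'" "a' \<cdot> a" \<delta>] FMor_comp_mor[of A A' B B' c a \<delta>]
      FMor_comp_mor[of A' A'' B' B'' c' a' "FMor S a \<cdot> (\<delta> \<cdot> c)"]
    by (simp add: S_Comp[of A A' A''] arr_comp[of _ "FOb S A"] arr_comp[of _ "FOb S A'"] arr_comp[of _ B]
        arr_comp[of _ B'] mult.assoc)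
  have "FMor S (a' \<cdot> a) \<cdot> (\<delta> \<cdot> (c \<cdot> c')) \<in> mor B'' (FOb S A'')"
    using 4 Comp_Hom[of A A' A'' a a'] Comp_Hom[of B'' B' B c' c]
      FMor_comp_mor(2)[of A A'' B B'' "c \<cdot> c'" "a' \<cdot> a" \<delta>] by simp
  moreover have "FMor S a' \<cdot> ((FMor S a \<cdot> (\<delta> \<cdot> c)) \<cdot> c') \<in> mor B'' (FOb S A'')"
    using 4 FMor_comp_mor[of A A' B B' c a \<delta>]
      FMor_comp_mor(2)[of A' A'' B' B'' c' a' "FMor S a \<cdot> (\<delta> \<cdot> c)"] by simp
  ultimately show ?case using arr_inj[of B'' "FOb S A''"] h 4 by simp
next
  case (5 A A' B B' c c' a \<delta>)
  then show ?case
    using FMor_comp_mor(1)[of A A' B B' c a \<delta>] FMor_comp_mor(1)[of A A' B B' c' a \<delta>] FMor_mor[of A A' a]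
    by (simp add: Comp_add_right[of B' B "FOb S A"] Comp_add_right[of B' "FOb S A" "FOb S A'"])
next
  case (6 A A' B B' c a a' \<delta>)
  then show ?case
    using FMor_comp_mor(1)[of A A' B B' c a \<delta>] FMor_mor[of A A' a] FMor_mor[of A A' a']
    by (simp add: FMor_add Comp_add_left[of B' "FOb S A" "FOb S A'"])
qed

sublocale E: extension_category C "E_Sigma C S"
  by (rule extension_category_E_Sigma)

lemma push_eq:
  assumes "A \<in> Obj C" "A' \<in> Obj C" "B \<in> Obj C" "a \<in> mor A A'" "\<delta> \<in> mor B (FOb S A)"
  shows "E.push B a \<delta> = FMor S a \<cdot> \<delta>" "E.push B a \<delta> \<in> mor B (FOb S A')"
    "arr B (FOb S A') (E.push B a \<delta>) = sig (arr A A' a) * arr B (FOb S A) \<delta>"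
  using assms FMor_mor[of A A' a] Comp_Hom[of B "FOb S A" "FOb S A'" \<delta> "FMor S a"]
  by (simp_all add: E.push_def Comp_Id_right[of B "FOb S A"] arr_comp[of B "FOb S A"] sig_arr)

lemma pull_eq:
  assumes "A \<in> Obj C" "B \<in> Obj C" "B' \<in> Obj C" "c \<in> mor B' B" "\<delta> \<in> mor B (FOb S A)"
  shows "E.pull A c \<delta> = \<delta> \<cdot> c" "E.pull A c \<delta> \<in> mor B' (FOb S A)"
    "arr B' (FOb S A) (E.pull A c \<delta>) = arr B (FOb S A) \<delta> * arr B' B c"
  using assms Comp_Hom[of B' B "FOb S A" c \<delta>]
  by (simp_all add: E.pull_def S_Id Comp_Id_left[of B' "FOb S A"] arr_comp[of B' B])

section \<open>Exangles and the axioms (R0), (R1), (R2)\<close>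

lemma realizes_exangle:
  assumes X: "is_complex n X" and \<delta>: "\<delta> \<in> mor (ob X (n + 1)) (FOb S (ob X 0))"
    and r: "realizes (ob X) (dfa X) (arr (ob X (n + 1)) (FOb S (ob X 0)) \<delta>)"
  shows "E.exangle n X \<delta>"
proof -
  have seq: "is_sequence n X" and cx: "cpx n (ob X) (dfa X)" using X is_complex_iff by auto
  note SX = is_sequenceD[OF seq] and ex = realizes_exact[OF r]
  have ce: "con_exact n (ob X) (dfa X)" using r by (simp add: realizes_def)
  have o: "ob X 0 \<in> Obj C" "ob X 1 \<in> Obj C" "ob X n \<in> Obj C" "ob X (n + 1) \<in> Obj C"
    using SX(1) n_pos by simp_all
  have d0: "df X 0 \<in> mor (ob X 0) (ob X 1)" and dn: "df X n \<in> mor (ob X n) (ob X (n + 1))"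
    and d0': "dfa X 0 = arr (ob X 0) (ob X 1) (df X 0)" and dn': "dfa X n = arr (ob X n) (ob X (n + 1)) (df X n)"
    using SX(2)[of 0] SX(2)[of n] by (simp_all add: dfa_def)
  let ?\<delta> = "arr (ob X (n + 1)) (FOb S (ob X 0)) \<delta>"
  have A: "f \<in> (\<lambda>g. b \<cdot> g) ` mor T B \<longleftrightarrow> (\<exists>h\<in>hom T B. arr T D f = arr B D b * h)"
    if "T \<in> Obj C" "B \<in> Obj C" "D \<in> Obj C" "b \<in> mor B D" "f \<in> mor T D" for T B D b f
  proof
    assume "\<exists>h\<in>hom T B. arr T D f = arr B D b * h"
    then obtain h where h: "h \<in> hom T B" "arr T D f = arr B D b * h" by blast
    then have "arr T D f = arr T D (b \<cdot> carr T B h)"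
      using that by (simp add: arr_comp[of T B D] carr_mor arr_carr)
    then have "f = b \<cdot> carr T B h"
      using arr_inj[of T D f "b \<cdot> carr T B h"] that Comp_Hom[of T B D "carr T B h" b] carr_mor[OF h(1)] by simp
    then show "f \<in> (\<lambda>g. b \<cdot> g) ` mor T B" using carr_mor[OF h(1)] by blast
  qed (use that in \<open>auto simp: arr_comp[of T B D]\<close>)
  have A': "f \<in> (\<lambda>g. g \<cdot> b) ` mor D T \<longleftrightarrow> (\<exists>h\<in>hom D T. arr B T f = h * arr B D b)"
    if "T \<in> Obj C" "B \<in> Obj C" "D \<in> Obj C" "b \<in> mor B D" "f \<in> mor B T" for T B D b f
  proof
    assume "\<exists>h\<in>hom D T. arr B T f = h * arr B D b"
    then obtain h where h: "h \<in> hom D T" "arr B T f = h * arr B D b" by blast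
    then have "arr B T f = arr B T (carr D T h \<cdot> b)"
      using that by (simp add: arr_comp[of B D T] carr_mor arr_carr)
    then have "f = carr D T h \<cdot> b"
      using arr_inj[of B T f "carr D T h \<cdot> b"] that Comp_Hom[of B D T b "carr D T h"] carr_mor[OF h(1)] by simp
    then show "f \<in> (\<lambda>g. g \<cdot> b) ` mor D T" using carr_mor[OF h(1)] by blast
  qed (use that in \<open>auto simp: arr_comp[of B D T]\<close>)
  have Z: "g \<cdot> f = zero A D \<longleftrightarrow> arr B D g * arr A B f = 0"
    if "A \<in> Obj C" "B \<in> Obj C" "D \<in> Obj C" "f \<in> mor A B" "g \<in> mor B D" for A B D f g
    using arr_eq_iff[of A D "g \<cdot> f" "zero A D"] that Comp_Hom[OF that]
    by (simp add: arr_comp[OF that] arr_zero)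
  have cov: "(\<lambda>g. df X (i - 1) \<cdot> g) ` mor T (ob X (i - 1)) =
      kernel (Hom C T (ob X i)) (Hom C T (ob X (i + 1))) (\<lambda>g. df X i \<cdot> g)"
    if T: "T \<in> Obj C" and i: "i \<in> {1..n}" for T i
  proof (rule Set.set_eqI, rule iffI)
    obtain j where j: "i = j + 1" "j + 1 \<le> n" using i by (cases i) auto
    have oj: "ob X j \<in> Obj C" "ob X (j + 1) \<in> Obj C" "ob X (j + 1 + 1) \<in> Obj C"
      and dj: "df X j \<in> mor (ob X j) (ob X (j + 1))" "df X (j + 1) \<in> mor (ob X (j + 1)) (ob X (j + 1 + 1))"
      using j SX(1)[of j] SX(1)[of "j + 1"] SX(1)[of "j + 1 + 1"] SX(2)[of j] SX(2)[of "j + 1"] by simp_all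
    fix f
    { assume "f \<in> (\<lambda>g. df X (i - 1) \<cdot> g) ` mor T (ob X (i - 1))"
      then obtain g where g: "g \<in> mor T (ob X j)" "f = df X j \<cdot> g" using j by auto
      have "dfa X (j + 1) * (dfa X j * arr T (ob X j) g) = 0"
        using cpxD(3)[OF cx, of j] j by (simp flip: mult.assoc)
      then show "f \<in> kernel (Hom C T (ob X i)) (Hom C T (ob X (i + 1))) (\<lambda>g. df X i \<cdot> g)"
        using g T oj dj Comp_Hom[OF T oj(1,2) g(1) dj(1)]
        unfolding j kernel_def by (simp add: Z[of T "ob X (j + 1)"] arr_comp[of T "ob X j"] dfa_def
            del: add_Suc_right One_nat_def Nat.add_0_right) }
    { assume "f \<in> kernel (Hom C T (ob X i)) (Hom C T (ob X (i + 1))) (\<lambda>g. df X i \<cdot> g)"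
      then have f: "f \<in> mor T (ob X (j + 1))" "df X (j + 1) \<cdot> f = zero T (ob X (j + 1 + 1))"
        unfolding kernel_def j by simp_all
      have "dfa X (j + 1) * arr T (ob X (j + 1)) f = 0"
        using f(2) Z[OF T oj(2,3) f(1) dj(2)] by (simp add: dfa_def)
      moreover have "arr T (ob X (j + 1)) f \<in> hom T (ob X (j + 1))" using f(1) T oj by auto
      ultimately have "\<exists>h\<in>hom T (ob X j). arr T (ob X (j + 1)) f = dfa X j * h"
        using ex(6)[OF i, of "arr T (ob X (j + 1)) f" T] unfolding j by simp
      then show "f \<in> (\<lambda>g. df X (i - 1) \<cdot> g) ` mor T (ob X (i - 1))"
        using A[OF T oj(1,2) dj(1) f(1)] j by (simp add: dfa_def) }
  qed
  have con: "(\<lambda>g. g \<cdot> df X i) ` mor (ob X (i + 1)) T =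
      kernel (Hom C (ob X i) T) (Hom C (ob X (i - 1)) T) (\<lambda>g. g \<cdot> df X (i - 1))"
    if T: "T \<in> Obj C" and i: "i \<in> {1..n}" for T i
  proof (rule Set.set_eqI, rule iffI)
    obtain j where j: "i = j + 1" "j + 1 \<le> n" using i by (cases i) auto
    have oj: "ob X j \<in> Obj C" "ob X (j + 1) \<in> Obj C" "ob X (j + 1 + 1) \<in> Obj C"
      and dj: "df X j \<in> mor (ob X j) (ob X (j + 1))" "df X (j + 1) \<in> mor (ob X (j + 1)) (ob X (j + 1 + 1))"
      using j SX(1)[of j] SX(1)[of "j + 1"] SX(1)[of "j + 1 + 1"] SX(2)[of j] SX(2)[of "j + 1"] by simp_all
    have ji: "j + 1 - 1 = j" by simp
    fix f
    { assume "f \<in> (\<lambda>g. g \<cdot> df X i) ` mor (ob X (i + 1)) T"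
      then obtain g where g: "g \<in> mor (ob X (j + 1 + 1)) T" "f = g \<cdot> df X (j + 1)" unfolding j by blast
      have "arr (ob X (j + 1 + 1)) T g * dfa X (j + 1) * dfa X j = 0"
        using cpxD(3)[OF cx, of j] j by (simp add: mult.assoc)
      then have "arr (ob X (j + 1)) T f * arr (ob X j) (ob X (j + 1)) (df X j) = 0"
        using g T oj dj by (simp add: arr_comp[of _ "ob X (j + 1 + 1)"] dfa_def
            del: add_Suc_right One_nat_def Nat.add_0_right)
      moreover have fm: "f \<in> mor (ob X (j + 1)) T" using Comp_Hom[OF oj(2,3) T dj(2) g(1)] g(2) by simp
      ultimately show "f \<in> kernel (Hom C (ob X i) T) (Hom C (ob X (i - 1)) T) (\<lambda>g. g \<cdot> df X (i - 1))"
        unfolding j ji kernel_def using Z[OF oj(1,2) T dj(1) fm] by simp }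
    { assume "f \<in> kernel (Hom C (ob X i) T) (Hom C (ob X (i - 1)) T) (\<lambda>g. g \<cdot> df X (i - 1))"
      then have f: "f \<in> mor (ob X (j + 1)) T" "f \<cdot> df X j = zero (ob X j) T"
        unfolding kernel_def j ji by simp_all
      have "arr (ob X (j + 1)) T f * dfa X j = 0"
        using f(2) Z[OF oj(1,2) T dj(1) f(1)] by (simp add: dfa_def)
      moreover have "arr (ob X (j + 1)) T f \<in> hom (ob X (j + 1)) T" using f(1) T oj by auto
      ultimately obtain h where "h \<in> hom (ob X (j + 1 + 1)) T" "arr (ob X (j + 1)) T f = h * dfa X (j + 1)"
        using con_exactD[OF ce, of "j + 1" "arr (ob X (j + 1)) T f" T] j unfolding ji by auto
      then show "f \<in> (\<lambda>g. g \<cdot> df X i) ` mor (ob X (i + 1)) T"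
        unfolding j A'[OF T oj(2,3) dj(2) f(1)] by (auto simp: dfa_def) }
  qed
  have covE: "(\<lambda>g. df X n \<cdot> g) ` mor T (ob X n) =
      kernel (Hom C T (ob X (n + 1))) (EOb (E_Sigma C S) T (ob X 0)) (\<lambda>g. E.pull (ob X 0) g \<delta>)"
    if T: "T \<in> Obj C" for T
  proof (rule Set.set_eqI, rule iffI)
    fix f
    have P: "f \<in> kernel (Hom C T (ob X (n + 1))) (EOb (E_Sigma C S) T (ob X 0)) (\<lambda>g. E.pull (ob X 0) g \<delta>) \<longleftrightarrow>
        f \<in> mor T (ob X (n + 1)) \<and> ?\<delta> * arr T (ob X (n + 1)) f = 0"
      using Z[of T "ob X (n + 1)" "FOb S (ob X 0)" f \<delta>] T o \<delta> pull_eq(1)[of "ob X 0" "ob X (n + 1)" T f \<delta>]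
      by (auto simp: kernel_def)
    { assume "f \<in> (\<lambda>g. df X n \<cdot> g) ` mor T (ob X n)"
      then obtain g where g: "g \<in> mor T (ob X n)" "f = df X n \<cdot> g" by blast
      have "?\<delta> * (dfa X n * arr T (ob X n) g) = 0" using ex(2) by (simp flip: mult.assoc)
      then show "f \<in> kernel (Hom C T (ob X (n + 1))) (EOb (E_Sigma C S) T (ob X 0)) (\<lambda>g. E.pull (ob X 0) g \<delta>)"
        unfolding P using arr_comp[OF T o(3,4) g(1) dn] Comp_Hom[OF T o(3,4) g(1) dn] g(2) dn' by simp }
    { assume "f \<in> kernel (Hom C T (ob X (n + 1))) (EOb (E_Sigma C S) T (ob X 0)) (\<lambda>g. E.pull (ob X 0) g \<delta>)"
      then have f: "f \<in> mor T (ob X (n + 1))" "?\<delta> * arr T (ob X (n + 1)) f = 0" unfolding P by simp_all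
      then show "f \<in> (\<lambda>g. df X n \<cdot> g) ` mor T (ob X n)"
        using A[OF T o(3,4) dn f(1)] ex(7)[OF arr_hom[OF T o(4) f(1)] f(2)] dn' by simp }
  qed
  have con0: "(\<lambda>g. g \<cdot> df X 0) ` mor (ob X 1) T =
      kernel (Hom C (ob X 0) T) (EOb (E_Sigma C S) (ob X (n + 1)) T) (\<lambda>g. E.push (ob X (n + 1)) g \<delta>)"
    if T: "T \<in> Obj C" for T
  proof (rule Set.set_eqI, rule iffI)
    fix f
    have "E.push (ob X (n + 1)) f \<delta> = zero (ob X (n + 1)) (FOb S T) \<longleftrightarrow> sig (arr (ob X 0) T f) * ?\<delta> = 0"
      if f: "f \<in> mor (ob X 0) T"
      using push_eq[of "ob X 0" T "ob X (n + 1)" f \<delta>] T o \<delta> f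
        arr_eq_iff[of "ob X (n + 1)" "FOb S T" "E.push (ob X (n + 1)) f \<delta>" "zero (ob X (n + 1)) (FOb S T)"]
      by (simp add: arr_zero)
    then have P: "f \<in> kernel (Hom C (ob X 0) T) (EOb (E_Sigma C S) (ob X (n + 1)) T) (\<lambda>g. E.push (ob X (n + 1)) g \<delta>) \<longleftrightarrow>
        f \<in> mor (ob X 0) T \<and> sig (arr (ob X 0) T f) * ?\<delta> = 0"
      by (auto simp: kernel_def)
    { assume "f \<in> (\<lambda>g. g \<cdot> df X 0) ` mor (ob X 1) T"
      then obtain g where g: "g \<in> mor (ob X 1) T" "f = g \<cdot> df X 0" by blast
      have "sig (arr (ob X 1) T g * dfa X 0) * ?\<delta> = 0" using ex(3) by (simp add: mult.assoc)
      then show "f \<in> kernel (Hom C (ob X 0) T) (EOb (E_Sigma C S) (ob X (n + 1)) T) (\<lambda>g. E.push (ob X (n + 1)) g \<delta>)"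
        unfolding P using arr_comp[OF o(1,2) T d0 g(1)] Comp_Hom[OF o(1,2) T d0 g(1)] g(2) d0' by simp }
    { assume "f \<in> kernel (Hom C (ob X 0) T) (EOb (E_Sigma C S) (ob X (n + 1)) T) (\<lambda>g. E.push (ob X (n + 1)) g \<delta>)"
      then have f: "f \<in> mor (ob X 0) T" "sig (arr (ob X 0) T f) * ?\<delta> = 0" unfolding P by simp_all
      then show "f \<in> (\<lambda>g. g \<cdot> df X 0) ` mor (ob X 1) T"
        using A'[OF T o(1,2) d0 f(1)] ex(4)[OF arr_hom[OF o(1) T f(1)] f(2)] d0' by simp }
  qed
  show ?thesis
    unfolding E.exangle_def using X \<delta> cov con covE con0 by simp
qed

lemma trivial_left_realizes:
  assumes A: "A \<in> Obj C" and Z: "zero_object Z"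
  shows "trivial_left Z A \<in> complexes n A Z"
    "realizes (ob (trivial_left Z A)) (dfa (trivial_left Z A)) (arr Z (FOb S A) (zero Z (FOb S A)))"
  using Angles_realizes[OF F1b[OF A Z]] n_pos
  by (auto simp: complexes_def trivial_left_def Let_def)

text \<open>The complex is linked to an arbitrary angle \<open>W\<close> on the zero extension. As
  the extension vanishes, the identity of \<open>A\<close> factors as \<open>w (int n) * u\<close>.
  The comparison maps are \<open>u\<close> and \<open>w (int n)\<close> in degree n, the identity in
  degree n + 1, and 0 elsewhere.\<close>

lemma trivial_right_realizes:
  assumes A: "A \<in> Obj C" and Z: "zero_object Z"
  shows "trivial_right n Z A \<in> complexes n Z A"
    "realizes (ob (trivial_right n Z A)) (dfa (trivial_right n Z A)) (arr A (FOb S Z) (zero A (FOb S Z)))"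
proof -
  have Z': "Z \<in> Obj C" "one Z = 0" using Z one_eq_zero_iff by (auto simp: zero_object_def)
  let ?X = "trivial_right n Z A"
  let ?x = "\<lambda>i. if n \<le> i then A else Z" and ?d = "\<lambda>i. if i = n then one A else 0"
  have x: "ob ?X = ?x" by (simp add: trivial_right_def Let_def)
  have d: "dfa ?X i = ?d i" if "i \<le> n" for i
    using that A Z' by (auto simp: dfa_def trivial_right_def Let_def one_def arr_zero)
  have "is_sequence n ?X"
    using A Z' by (auto simp: is_sequence_def trivial_right_def Let_def Id_Hom)
  moreover have c: "cpx n (ob ?X) (dfa ?X)"
    using A Z' d x by (auto simp: cpx_def one_hom hom_zero)
  ultimately have "is_complex n ?X" by (simp add: is_complex_iff)
  then show "?X \<in> complexes n Z A"
    using n_pos by (simp add: complexes_def trivial_right_def Let_def)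
  have zA: "arr A (FOb S Z) (zero A (FOb S Z)) = 0" using A Z' by (simp add: arr_zero)
  have ce: "con_exact n (ob ?X) (dfa ?X)"
    unfolding con_exact_def
  proof (intro ballI allI impI)
    fix i T g assume i: "i \<in> {1..n}" and g: "g \<in> hom (ob ?X i) T"
    show "\<exists>h\<in>hom (ob ?X (i + 1)) T. g = h * dfa ?X i"
    proof (cases "i = n")
      case True
      then have "g \<in> hom A T" using g x by simp
      then show ?thesis using True d[of n] x one_right[of g A T] by (intro bexI[of _ g]) simp_all
    next
      case False
      then have "g \<in> hom Z T" using g x i by simp
      then have "g = 0" using one_zero_hom(1) Z'(2) by blast
      moreover have "0 \<in> hom (ob ?X (i + 1)) T" using hom_Obj[OF g] A Z' x by (simp add: hom_zero)
      ultimately show ?thesis by (intro bexI[of _ 0]) simp_all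
    qed
  qed
  have "0 \<in> hom A (SO Z)" using A Z' by (simp add: hom_zero SO_Obj)
  then obtain W w where W: "angle W w" "W 0 = Z" "W (int n + 1) = A" "w (int n + 1) = 0"
    using angle_completion_last[OF Z'(1)] by metis
  note DW = angleD[OF W(1)]
  obtain u where u: "u \<in> hom A (W (int n))" "one A = w (int n) * u"
    using angle_exact_cov[OF W(1), of "one A" A "int n"] one_hom[OF A] W(3,4) by auto
  have wn: "w (int n) \<in> hom (W (int n)) A" using DW(3)[of "int n"] W(3) by simp
  have ne: "n \<noteq> 0" using n_pos by simp
  have in1: "int (Suc n) = int n + 1" by simp
  let ?f = "\<lambda>i. if i = n + 1 then one A else if i = n then u else 0"
  let ?g = "\<lambda>i. if i = n + 1 then one A else if i = n then w (int n) else 0"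
  have f: "fmap n (ob ?X) (dfa ?X) (\<lambda>i. W (int i)) (\<lambda>i. w (int i)) ?f"
    unfolding fmap_def cmap_def
  proof (intro conjI allI impI)
    fix i assume "i \<le> n + 1"
    then show "?f i \<in> hom (ob ?X i) (W (int i))"
      using u(1) W(3) one_hom[OF A] Z' DW(2) unfolding x by (auto simp: hom_zero le_Suc_eq add.commute)
  next
    fix i assume "i \<le> n"
    then show "w (int i) * ?f i = ?f (i + 1) * dfa ?X i"
      using u(2) one_left[OF one_hom[OF A]] by (auto simp: d)
  qed (use ne x Z' in simp_all)
  have g: "fmap n (\<lambda>i. W (int i)) (\<lambda>i. w (int i)) (ob ?X) (dfa ?X) ?g"
    unfolding fmap_def cmap_def
  proof (intro conjI allI impI)
    fix i assume "i \<le> n + 1"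
    then show "?g i \<in> hom (W (int i)) (ob ?X i)"
      using wn W(3) A Z' DW(2) unfolding x by (auto simp: one_hom hom_zero le_Suc_eq add.commute)
  next
    fix i assume i: "i \<le> n"
    have "w (int i + 1) * w (int i) = 0" by (rule angle_complex[OF W(1)])
    then have "w (int n) * w (int i) = 0" if "Suc i = n" using that by (auto simp: add.commute)
    then show "dfa ?X i * ?g i = ?g (i + 1) * w (int i)"
      using i by (auto simp: d)
  qed (use ne x Z' W(2,3) in \<open>simp_all add: add.commute\<close>)
  show "realizes (ob ?X) (dfa ?X) (arr A (FOb S Z) (zero A (FOb S Z)))"
    unfolding zA by (rule realizesI[OF c ce W(1,4) _ _ f g]) (use W ne x in simp_all)
qed

lemma realized_category_angles: "realized_category C (E_Sigma C S) n (s_angles C n Angles)"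
proof (intro realized_category.intro extension_category_E_Sigma realized_category_axioms.intro, goal_cases)
  case 1
  show ?case by (rule n_pos)
next
  case (2 A B \<delta>)
  then obtain X where X: "completes n Angles B A \<delta> X"
    using completes_exists[of A B \<delta>] by auto
  then show ?case
    using s_angles_iff[of A B \<delta> X] completes_realizes[OF X] 2 by auto
next
  case (3 A B A' B' \<delta> \<rho> X Y a c)
  have r: "realizes (ob X) (dfa X) (arr B (FOb S A) \<delta>)" "realizes (ob Y) (dfa Y) (arr B' (FOb S A') \<rho>)"
    using 3 s_angles_iff[of A B \<delta> X] s_angles_iff[of A' B' \<rho> Y] by simp_all
  have e: "ob X 0 = A" "ob X (n + 1) = B" "ob Y 0 = A'" "ob Y (n + 1) = B'"
    and s: "is_sequence n X" "is_sequence n Y"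
    using 3 by (simp_all add: complexes_def is_complex_def)
  have "sig (arr A A' a) * arr B (FOb S A) \<delta> = arr B (FOb S A') (E.push B a \<delta>)"
    using 3 push_eq(3)[of A A' B a \<delta>] by simp
  also have "\<dots> = arr B' (FOb S A') \<rho> * arr B B' c"
    using 3 pull_eq(3)[of A' B' B c \<rho>] by simp
  finally obtain f where f: "cmap n (ob X) (dfa X) (ob Y) (dfa Y) f" "f 0 = arr A A' a" "f (n + 1) = arr B B' c"
    using realizes_lift[OF r, of "arr A A' a" "arr B B' c"] 3 e arr_hom by metis
  show ?case
    using chain_map_of_cmap[OF s f(1)] f(2,3) e 3
    by (intro exI[of _ "\<lambda>i. carr (ob X i) (ob Y i) (f i)"]) (simp add: carr_arr)
next
  case (4 A B \<delta> X)
  then show ?case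
    using s_angles_iff[of A B \<delta> X] realizes_exangle[of X \<delta>] by (simp add: complexes_def)
next
  case (5 A Z)
  then have "Z \<in> Obj C" by (simp add: zero_object_def)
  then show ?case
    using s_angles_iff[of A Z "zero Z (FOb S A)"] trivial_left_realizes[OF 5] 5 by simp
next
  case (6 A Z)
  then have "Z \<in> Obj C" by (simp add: zero_object_def)
  then show ?case
    using s_angles_iff[of Z A "zero A (FOb S Z)"] trivial_right_realizes[OF 6] 6 by simp
qed

end

section \<open>Cones and cocones\<close>

text \<open>
  Cones and cocones have the summands \<open>u m \<oplus> v m\<close> in the degrees \<open>1, \<dots>, n\<close>, but only \<open>u 0\<close> in
  degree \<open>0\<close> and only \<open>v (n + 1)\<close> in degree \<open>n + 1\<close>. The injections and projections of
  the missing summands are set to \<open>0\<close>, so that one formula describes all differentials.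
\<close>

context preadditive_category
begin

definition split_sum ::
    "nat \<Rightarrow> (nat \<Rightarrow> 'o) \<Rightarrow> (nat \<Rightarrow> 'o) \<Rightarrow> (nat \<Rightarrow> 'o) \<Rightarrow> (nat \<Rightarrow> ('o, 'm) gen) \<Rightarrow> (nat \<Rightarrow> ('o, 'm) gen)
      \<Rightarrow> (nat \<Rightarrow> ('o, 'm) gen) \<Rightarrow> (nat \<Rightarrow> ('o, 'm) gen) \<Rightarrow> bool"
  where "split_sum n u v M J1 J2 Q1 Q2 \<longleftrightarrow>
    (\<forall>m\<le>n. J1 m \<in> hom (u m) (M m) \<and> Q1 m \<in> hom (M m) (u m) \<and> Q1 m * J1 m = one (u m)) \<and>
    (\<forall>m\<in>{1..n + 1}. J2 m \<in> hom (v m) (M m) \<and> Q2 m \<in> hom (M m) (v m) \<and> Q2 m * J2 m = one (v m)) \<and>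
    (\<forall>m\<le>n + 1. Q2 m * J1 m = 0 \<and> Q1 m * J2 m = 0 \<and> J1 m * Q1 m + J2 m * Q2 m = one (M m)) \<and>
    J2 0 = 0 \<and> Q2 0 = 0 \<and> J1 (n + 1) = 0 \<and> Q1 (n + 1) = 0 \<and>
    M 0 = u 0 \<and> J1 0 = one (u 0) \<and> Q1 0 = one (u 0) \<and>
    M (n + 1) = v (n + 1) \<and> J2 (n + 1) = one (v (n + 1)) \<and> Q2 (n + 1) = one (v (n + 1))"

lemma mult_eq_left: "a * b = c \<Longrightarrow> a * (b * x) = c * (x :: 'a :: semigroup_mult)"
  by (simp flip: mult.assoc)

lemma split_sumD:
  assumes "split_sum n u v M J1 J2 Q1 Q2"
  shows "m \<le> n \<Longrightarrow> J1 m \<in> hom (u m) (M m)" "m \<le> n \<Longrightarrow> Q1 m \<in> hom (M m) (u m)"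
    "1 \<le> m \<Longrightarrow> m \<le> n + 1 \<Longrightarrow> J2 m \<in> hom (v m) (M m)" "1 \<le> m \<Longrightarrow> m \<le> n + 1 \<Longrightarrow> Q2 m \<in> hom (M m) (v m)"
    "m \<le> n + 1 \<Longrightarrow> J1 m * Q1 m + J2 m * Q2 m = one (M m)"
    "J2 0 = 0" "Q2 0 = 0" "J1 (n + 1) = 0" "Q1 (n + 1) = 0" "M 0 = u 0" "J1 0 = one (u 0)" "Q1 0 = one (u 0)"
    "M (n + 1) = v (n + 1)" "J2 (n + 1) = one (v (n + 1))" "Q2 (n + 1) = one (v (n + 1))"
  using assms by (simp_all add: split_sum_def)

lemma split_sum_cancel:
  assumes "split_sum n u v M J1 J2 Q1 Q2"
  shows "m \<le> n \<Longrightarrow> z \<in> hom T (u m) \<Longrightarrow> Q1 m * (J1 m * z) = z"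
    "m \<le> n \<Longrightarrow> z \<in> hom T (u m) \<Longrightarrow> Q1 m * (J1 m * (z * w)) = z * w"
    "1 \<le> m \<Longrightarrow> m \<le> n + 1 \<Longrightarrow> z \<in> hom T (v m) \<Longrightarrow> Q2 m * (J2 m * z) = z"
    "1 \<le> m \<Longrightarrow> m \<le> n + 1 \<Longrightarrow> z \<in> hom T (v m) \<Longrightarrow> Q2 m * (J2 m * (z * w)) = z * w"
    "m \<le> n + 1 \<Longrightarrow> Q2 m * (J1 m * w) = 0" "m \<le> n + 1 \<Longrightarrow> Q1 m * (J2 m * w) = 0"
    "m \<le> n \<Longrightarrow> z' \<in> hom (u m) T \<Longrightarrow> z' * (Q1 m * J1 m) = z'"
    "1 \<le> m \<Longrightarrow> m \<le> n + 1 \<Longrightarrow> z' \<in> hom (v m) T \<Longrightarrow> z' * (Q2 m * J2 m) = z'"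
    "m \<le> n + 1 \<Longrightarrow> Q2 m * J1 m = 0" "m \<le> n + 1 \<Longrightarrow> Q1 m * J2 m = 0"
proof -
  note D = assms[unfolded split_sum_def]
  show "Q1 m * (J1 m * z) = z" "Q1 m * (J1 m * (z * w)) = z * w" if "m \<le> n" "z \<in> hom T (u m)"
    using D that mult_eq_left[of "Q1 m" "J1 m"] one_left[OF that(2)] one_left'[OF that(2)] by simp_all
  show "Q2 m * (J2 m * z) = z" "Q2 m * (J2 m * (z * w)) = z * w" if "1 \<le> m" "m \<le> n + 1" "z \<in> hom T (v m)"
    using D that mult_eq_left[of "Q2 m" "J2 m"] one_left[OF that(3)] one_left'[OF that(3)] by simp_all
  show "Q2 m * (J1 m * w) = 0" "Q1 m * (J2 m * w) = 0" if "m \<le> n + 1"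
    using D that mult_eq_left[of "Q2 m" "J1 m"] mult_eq_left[of "Q1 m" "J2 m"] by simp_all
  show "z' * (Q1 m * J1 m) = z'" if "m \<le> n" "z' \<in> hom (u m) T"
    using D that one_right[OF that(2)] by simp
  show "z' * (Q2 m * J2 m) = z'" if "1 \<le> m" "m \<le> n + 1" "z' \<in> hom (v m) T"
    using D that one_right[OF that(3)] by simp
  show "Q2 m * J1 m = 0" "Q1 m * J2 m = 0" if "m \<le> n + 1"
    using D that by simp_all
qed

lemma split_sum_decompose:
  assumes s: "split_sum n u v M J1 J2 Q1 Q2" and "m \<le> n + 1" "g \<in> hom (M m) T"
  shows "g = g * J1 m * Q1 m + g * J2 m * Q2 m"
  using one_right[OF assms(3)] split_sumD(5)[OF s assms(2)] by (metis distrib_left mult.assoc)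

lemma split_sum_Obj:
  "\<lbrakk>split_sum n u v M J1 J2 Q1 Q2; m \<le> n + 1\<rbrakk> \<Longrightarrow> M m \<in> Obj C"
  using split_sumD(1)[of n u v M J1 J2 Q1 Q2 m] split_sumD(3)[of n u v M J1 J2 Q1 Q2 m] hom_Obj
  by (cases "m \<le> n") (auto simp: not_less_eq_eq)

end

section \<open>Exactness of cones and cocones\<close>

context positive_angulated_category
begin

text \<open>A map on \<open>M m\<close> is a row [a b]. Exactness of \<open>y\<close> factors b
  through \<open>e m\<close>; after the resulting term is subtracted from a, exactness of
  \<open>x\<close> factors the rest through \<open>d (m + 1)\<close>. At the two ends, where a
  summand is missing, the identity \<open>f 0\<close> and the extension \<rho> take over.\<close>

lemma cone_exact:
  assumes x: "realizes x d (\<rho> * c)" and y: "realizes y e \<rho>" and xy: "x 0 = y 0"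
    and f: "cmap n x d y e f" "f 0 = one (x 0)" "f (n + 1) = c"
    and s: "split_sum n (\<lambda>m. x (m + 1)) y M J1 J2 Q1 Q2"
    and dM: "\<And>m. m \<le> n \<Longrightarrow> dM m = J1 (m + 1) * - d (m + 1) * Q1 m
      + J2 (m + 1) * (f (m + 1) * Q1 m + e m * Q2 m)"
  shows "cpx n M dM" "con_exact n M dM" "sig (d 0) * \<rho> \<in> hom (M (n + 1)) (SO (M 0))"
    and "\<lbrakk>g \<in> hom (M 0) T; sig g * (sig (d 0) * \<rho>) = 0\<rbrakk> \<Longrightarrow> \<exists>h\<in>hom (M 1) T. g = h * dM 0"
proof -
  note D = split_sumD[OF s] and K = split_sum_cancel[OF s]
  have cx: "cpx n x d" "con_exact n x d" and cy: "cpx n y e" "con_exact n y e"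
    using x y by (simp_all add: realizes_def)
  note ox = cpxD(1)[OF cx(1)] and oy = cpxD(1)[OF cy(1)]
    and dx = cpxD(2)[OF cx(1)] and dy = cpxD(2)[OF cy(1)]
    and fm = cmapD(1)[OF f(1)] and fc = cmapD(2)[OF f(1)]
  note ex = realizes_exact[OF x] and ey = realizes_exact[OF y]
  have e0: "e 0 = f 1 * d 0"
    using fc[of 0] f(2) one_right[OF dy[of 0]] xy by simp
  have d01: "d 1 * d 0 = 0" using cpxD(3)[OF cx(1), of 0] n_pos by simp
  show \<epsilon>: "sig (d 0) * \<rho> \<in> hom (M (n + 1)) (SO (M 0))"
    using hom_comp[OF ey(1)] sig_hom[OF dx[of 0]] xy D(10,13) by simp
  show "cpx n M dM"
    unfolding cpx_def
  proof (intro conjI allI impI)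
    show "M i \<in> Obj C" if "i \<le> n + 1" for i using split_sum_Obj[OF s that] .
    show "dM i \<in> hom (M i) (M (i + 1))" if i: "i \<le> n" for i
    proof -
      have o: "M i \<in> Obj C" "M (i + 1) \<in> Obj C" using split_sum_Obj[OF s] i by simp_all
      have "J1 (i + 1) * - d (i + 1) * Q1 i \<in> hom (M i) (M (i + 1))"
      proof (cases "i = n")
        case False
        then show ?thesis using i D(2)[of i] D(1)[of "i + 1"] dx[of "i + 1"]
          by (intro hom_comp[of _ _ "x (i + 1)"] hom_comp[of _ _ "x (i + 1 + 1)"] hom_uminus) simp_all
      qed (use D(8) o in \<open>simp add: hom_zero\<close>)
      moreover have "J2 (i + 1) * (f (i + 1) * Q1 i) \<in> hom (M i) (M (i + 1))"
        using i D(2)[of i] D(3)[of "i + 1"] fm[of "i + 1"]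
        by (intro hom_comp[of _ _ "x (i + 1)"] hom_comp[of _ _ "y (i + 1)"]) simp_all
      moreover have "J2 (i + 1) * (e i * Q2 i) \<in> hom (M i) (M (i + 1))"
      proof (cases "i = 0")
        case False
        then show ?thesis using i D(4)[of i] D(3)[of "i + 1"] dy[of i]
          by (intro hom_comp[of _ _ "y i"] hom_comp[of _ _ "y (i + 1)"]) simp_all
      qed (use D(7) o in \<open>simp add: hom_zero\<close>)
      ultimately show ?thesis unfolding dM[OF i] distrib_left by (intro hom_add)
    qed
    show "dM (i + 1) * dM i = 0" if i: "i < n" for i
    proof -
      define j where "j = i + 1"
      have j: "1 \<le> j" "j \<le> n" "j \<le> n + 1" "i \<le> n" using i by (simp_all add: j_def)
      have J: "J1 (j + 1) * (d (j + 1) * (d j * z)) = 0" for z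
        using cpxD(3)[OF cx(1), of j] mult_eq_left[of "d (j + 1)" "d j" 0] D(8) j by (cases "j = n") simp_all
      have "e j * (e i * z) = 0" for z
        using cpxD(3)[OF cy(1) i] mult_eq_left[of "e j" "e i" 0] by (simp add: j_def)
      moreover have "e j * (f j * z) = f (j + 1) * (d j * z)" for z
        using fc[OF j(2)] mult_eq_left by (metis mult.assoc)
      ultimately show ?thesis
        unfolding j_def[symmetric] dM[OF j(2)] dM[OF j(4)]
        using K(2)[OF j(2) dx[OF j(2)]] K(4)[OF j(1,3) fm[OF j(3)]]
          K(4)[OF j(1,3) dy[OF j(4), folded j_def]] K(5,6)[OF j(3)] J
        by (simp add: algebra_simps del: One_nat_def add_Suc_right)
    qed
  qed
  show "con_exact n M dM"
    unfolding con_exact_def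
  proof (intro ballI allI impI)
    fix m T g assume m: "m \<in> {1..n}" and g: "g \<in> hom (M m) T" "g * dM (m - 1) = 0"
    obtain i where i: "m = i + 1" "i + 1 \<le> n" "i \<le> n" "i \<le> n + 1" using m by (cases m) auto
    have m': "1 \<le> m" "m \<le> n" "m \<le> n + 1" using m by simp_all
    define a b where "a = g * J1 m" and "b = g * J2 m"
    have a: "a \<in> hom (x (m + 1)) T" and b: "b \<in> hom (y m) T"
      unfolding a_def b_def using hom_comp[OF D(1)[OF m'(2)] g(1)] hom_comp[OF D(3)[OF m'(1,3)] g(1)] by simp_all
    have gab: "g = a * Q1 m + b * Q2 m"
      unfolding a_def b_def using split_sum_decompose[OF s m'(3) g(1)] .
    have "g * dM i = 0" using g(2) i by simp
    then have g0: "a * (d m * Q1 i) = b * (f m * Q1 i) + b * (e i * Q2 i)"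
      unfolding dM[OF i(3)] a_def b_def i(1)[symmetric] by (simp add: algebra_simps)
    have "a * (d m * Q1 i) * J1 i = b * (f m * Q1 i) * J1 i + b * (e i * Q2 i) * J1 i"
      unfolding g0 by (simp add: distrib_right)
    then have A: "a * d m = b * f m"
      using K(7)[OF i(3), of "a * d m" T] K(7)[OF i(3), of "b * f m" T] K(9)[OF i(4)]
        hom_comp[OF dx[OF m'(2)] a] hom_comp[OF fm[OF m'(3)] b] i by (simp add: mult.assoc)
    have B: "b * e i = 0"
    proof (cases "i = 0")
      case True
      \<comment> \<open>Degree 0 of the cone has no summand \<open>y 0\<close>, so the equation is
        not a component of the hypothesis; it follows from \<open>e 0 = f 1 * d 0\<close>.\<close>
      have "b * e i = a * (d 1 * d 0)"
        using True A i e0 by (simp add: mult.assoc[symmetric])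
      then show ?thesis using d01 by simp
    next
      case False
      have "a * (d m * Q1 i) * J2 i = b * (f m * Q1 i) * J2 i + b * (e i * Q2 i) * J2 i"
        unfolding g0 by (simp add: distrib_right)
      then show ?thesis
        using K(8)[of i "b * e i" T] K(10)[OF i(4)] hom_comp[OF dy[OF i(3)], of b T] b i False
        by (simp add: mult.assoc)
    qed
    obtain b' where b': "b' \<in> hom (y (m + 1)) T" "b = b' * e m"
      using con_exactD[OF cy(2) m'(1,2) b] B i by auto
    have bf: "b' * f (m + 1) \<in> hom (x (m + 1)) T"
      using hom_comp[OF fm b'(1)] m' by simp
    have C: "(a - b' * f (m + 1)) * d m = 0"
      using A fc[OF m'(2)] b'(2) by (simp add: left_diff_distrib mult.assoc)
    show "\<exists>h\<in>hom (M (m + 1)) T. g = h * dM m"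
    proof (cases "m = n")
      case False
      then have mn: "m + 1 \<le> n" "m + 1 \<le> n + 1" using m' by simp_all
      obtain a' where a': "a' \<in> hom (x (m + 1 + 1)) T" "a - b' * f (m + 1) = a' * d (m + 1)"
        using con_exactD[OF cx(2) _ mn(1), of "a - b' * f (m + 1)" T] hom_diff[OF a bf] C by auto
      let ?h = "b' * Q2 (m + 1) - a' * Q1 (m + 1)"
      have "?h \<in> hom (M (m + 1)) T"
        using hom_comp[OF D(2)[OF mn(1)] a'(1)] hom_comp[OF D(4)[OF _ mn(2)] b'(1)] by (simp add: hom_diff)
      moreover have "a = a' * d (m + 1) + b' * f (m + 1)" using a'(2) by (simp add: algebra_simps)
      then have "g = ?h * dM m"
        unfolding gab dM[OF m'(2)] b'(2)
        using K(2)[OF mn(1) dx[OF mn(1)]] K(4)[OF _ mn(2) fm[OF mn(2)]]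
          K(4)[OF _ mn(2) dy[OF m'(2)]] K(5,6)[OF mn(2)]
        by (simp add: algebra_simps del: One_nat_def add_Suc_right)
      ultimately show ?thesis by blast
    next
      case True
      \<comment> \<open>In the last degree the extension \<open>\<rho> * c\<close> takes the place
        of a next differential of \<open>x\<close>. Adding \<open>k * \<rho>\<close> to b' absorbs
        the new term and does not disturb b, because \<open>\<rho> * e n = 0\<close>.\<close>
      obtain k where k: "k \<in> hom (SO (x 0)) T" "a - b' * f (m + 1) = k * (\<rho> * c)"
        using ex(5)[of "a - b' * f (m + 1)" T] hom_diff[OF a bf] C True by auto
      let ?h = "b' + k * \<rho>"
      have h: "?h \<in> hom (y (n + 1)) T"
        using hom_add[OF _ hom_comp[OF ey(1)]] b'(1) k(1) xy True by simp
      have "a = ?h * f (n + 1)" using k(2) f(3) True by (simp add: algebra_simps)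
      moreover have "b = ?h * e n" using b'(2) ey(2) True by (simp add: algebra_simps)
      moreover have "?h = ?h * one (y (n + 1))" using one_right[OF h] by simp
      ultimately have "g = ?h * dM m"
        unfolding gab dM[OF m'(2)] using True D(8,14) one_left'[OF fm[of "n + 1"]] one_left'[OF dy[of n]]
        by (simp add: algebra_simps)
      then show ?thesis using h True D(13) by auto
    qed
  qed
  show "\<exists>h\<in>hom (M 1) T. g = h * dM 0" if g: "g \<in> hom (M 0) T" "sig g * (sig (d 0) * \<rho>) = 0"
  proof -
    have g': "g \<in> hom (x 1) T" using g(1) D(10) by simp
    have n1: "1 \<le> n" "1 \<le> n + 1" using n_pos by simp_all
    have d0: "d 0 \<in> hom (x 0) (x 1)" "d 1 \<in> hom (x 1) (x 2)" "f 1 \<in> hom (x 1) (y 1)"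
      using dx[of 0] dx[of 1] fm[of 1] n_pos by (simp_all add: numeral_2_eq_2)
    have "g * d 0 \<in> hom (y 0) T" "sig (g * d 0) * \<rho> = 0"
      using hom_comp[OF d0(1) g'] g(2) xy by (simp_all add: mult.assoc)
    then obtain b where b: "b \<in> hom (y 1) T" "g * d 0 = b * e 0"
      using ey(4) by blast
    have bf: "b * f 1 \<in> hom (x 1) T" using hom_comp[OF d0(3) b(1)] .
    have "(g - b * f 1) * d (1 - 1) = 0" using b(2) e0 by (simp add: left_diff_distrib mult.assoc)
    then obtain a where a: "a \<in> hom (x 2) T" "g - b * f 1 = a * d 1"
      using con_exactD[OF cx(2) _ n1(1) hom_diff[OF g' bf]] by (auto simp: numeral_2_eq_2)
    let ?h = "b * Q2 1 - a * Q1 1"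
    have "?h \<in> hom (M 1) T"
      using hom_comp[OF D(2)[OF n1(1)], of a T] hom_comp[OF D(4)[OF _ n1(2)] b(1)] a(1)
      by (simp add: hom_diff numeral_2_eq_2)
    moreover have "g = a * d 1 + b * f 1" using a(2) by (simp add: algebra_simps)
    moreover have dM0: "dM 0 = J2 1 * f 1 - J1 1 * d 1"
      using dM[of 0] D(7,12) one_right[OF d0(2)] one_right[OF d0(3)] by (simp add: algebra_simps)
    ultimately have "g = ?h * dM 0"
      unfolding dM0 using K(1)[OF n1(1), of "d 1" "x 1"] K(3)[OF _ n1(2) d0(3)] K(5,6)[OF n1(2)] d0(2)
      by (simp add: algebra_simps numeral_2_eq_2)
    then show ?thesis using \<open>?h \<in> hom (M 1) T\<close> by blast
  qed
qed

text \<open>The same chase with the ends exchanged: the extension is used at the lower end, while at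
  the upper end the identity \<open>f (n + 1)\<close> gives \<open>d n = e n * f n\<close>.\<close>

lemma cocone_exact:
  assumes x: "realizes x d \<delta>" and y: "realizes y e (sig a0 * \<delta>)" and xy: "x (n + 1) = y (n + 1)"
    and f: "cmap n x d y e f" "f 0 = a0" "f (n + 1) = one (x (n + 1))"
    and s: "split_sum n x (\<lambda>m. y (m - 1)) M J1 J2 Q1 Q2"
    and dM: "\<And>m. m \<le> n \<Longrightarrow> dM m = J1 (m + 1) * d m * Q1 m
      + J2 (m + 1) * (f m * Q1 m - e (m - 1) * Q2 m)"
  shows "cpx n M dM" "con_exact n M dM" "\<delta> * e n \<in> hom (M (n + 1)) (SO (M 0))"
    and "\<lbrakk>g \<in> hom T (M (n + 1)); \<delta> * e n * g = 0\<rbrakk> \<Longrightarrow> \<exists>h\<in>hom T (M n). g = dM n * h"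
proof -
  note D = split_sumD[OF s] and K = split_sum_cancel[OF s]
  have cx: "cpx n x d" "con_exact n x d" and cy: "cpx n y e" "con_exact n y e"
    using x y by (simp_all add: realizes_def)
  note ox = cpxD(1)[OF cx(1)] and oy = cpxD(1)[OF cy(1)]
    and dx = cpxD(2)[OF cx(1)] and dy = cpxD(2)[OF cy(1)]
    and fm = cmapD(1)[OF f(1)] and fc = cmapD(2)[OF f(1)]
  note ex = realizes_exact[OF x] and ey = realizes_exact[OF y]
  have en: "d n = e n * f n"
    using fc[of n] f(3) one_left[OF dx[of n]] by simp
  have D3: "J2 (m + 1) \<in> hom (y m) (M (m + 1))" and D4: "Q2 (m + 1) \<in> hom (M (m + 1)) (y m)" if "m \<le> n" for m
    using D(3)[of "m + 1"] D(4)[of "m + 1"] that by simp_all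
  have Mn: "M (n + 1) = y n" "J2 (n + 1) = one (y n)" using D(13,14) by simp_all
  show "\<delta> * e n \<in> hom (M (n + 1)) (SO (M 0))"
    using hom_comp[OF dy[of n]] ex(1) xy D(10) Mn by simp
  have e1: "e i * (e (i - 1) * (Q2 i * z)) = 0" if "i \<le> n" for i z
  proof (cases i)
    case (Suc k)
    then show ?thesis using cpxD(3)[OF cy(1), of k] that mult_eq_left[of "e i" "e (i - 1)" 0] by simp
  qed (use D(7) in simp)
  have o: "M i \<in> Obj C" if "i \<le> n + 1" for i using split_sum_Obj[OF s that] .
  have t3: "e (i - 1) * Q2 i \<in> hom (M i) (y i)" if i: "i \<le> n" for i
  proof (cases i)
    case 0
    then show ?thesis using D(7) o[of 0] oy[of 0] by (simp add: hom_zero)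
  next
    case (Suc k)
    then show ?thesis using hom_comp[OF D4[of k] dy[of k]] i by simp
  qed
  show "cpx n M dM"
    unfolding cpx_def
  proof (intro conjI allI impI)
    show "M i \<in> Obj C" if "i \<le> n + 1" for i using o[OF that] .
    show "dM i \<in> hom (M i) (M (i + 1))" if i: "i \<le> n" for i
    proof -
      have "J1 (i + 1) * d i * Q1 i \<in> hom (M i) (M (i + 1))"
      proof (cases "i = n")
        case False
        then show ?thesis using i D(2)[of i] D(1)[of "i + 1"] dx[of i]
          by (intro hom_comp[of _ _ "x i"] hom_comp[of _ _ "x (i + 1)"]) simp_all
      qed (use D(8) o i in \<open>simp add: hom_zero\<close>)
      moreover have "J2 (i + 1) * (f i * Q1 i - e (i - 1) * Q2 i) \<in> hom (M i) (M (i + 1))"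
        using hom_comp[OF hom_diff[OF hom_comp[OF D(2)[OF i] fm] t3[OF i]] D3[OF i]] i by simp
      ultimately show ?thesis unfolding dM[OF i] by (rule hom_add)
    qed
    show "dM (i + 1) * dM i = 0" if i: "i < n" for i
    proof -
      have i': "i \<le> n" "i + 1 \<le> n" "i + 1 \<le> n + 1" "1 \<le> i + 1" "i + 1 - 1 = i" using i by simp_all
      have "J1 (i + 1 + 1) * (d (i + 1) * (d i * z)) = 0" for z
        using cpxD(3)[OF cx(1) i] mult_eq_left[of "d (i + 1)" "d i" 0] by simp
      moreover have "f (i + 1) * (d i * z) = e i * (f i * z)" for z
        using fc[OF i'(1)] mult_eq_left by (metis mult.assoc)
      moreover have "e i * (e (i - 1) * Q2 i) = 0" using e1[OF i'(1), of "one (M i)"] one_right[OF t3[OF i'(1)]]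
        by (cases i) (use D(7) cpxD(3)[OF cy(1), of "i - 1"] i mult_eq_left[of "e i" "e (i - 1)" 0] in auto)
      ultimately show ?thesis
        unfolding dM[OF i'(2)] dM[OF i'(1)] i'(5)
        using K(2)[OF i'(2) dx[OF i'(1)]] K(4)[OF i'(4,3), of "f i" "x i"] fm[of i] i'(1)
          K(3)[OF i'(4,3), of "e (i - 1) * Q2 i" "M i"] t3[OF i'(1)] K(5,6)[OF i'(3)]
        by (simp add: algebra_simps del: One_nat_def add_Suc_right)
    qed
  qed
  show "con_exact n M dM"
    unfolding con_exact_def
  proof (intro ballI allI impI)
    fix m T g assume m: "m \<in> {1..n}" and g: "g \<in> hom (M m) T" "g * dM (m - 1) = 0"
    obtain i where i: "m = i + 1" "i + 1 \<le> n" "i \<le> n" "i \<le> n + 1" "m - 1 = i" using m by (cases m) auto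
    have m': "1 \<le> m" "m \<le> n" "m \<le> n + 1" using m by simp_all
    define a b where "a = g * J1 m" and "b = g * J2 m"
    have a: "a \<in> hom (x m) T" and b: "b \<in> hom (y i) T"
      unfolding a_def b_def using hom_comp[OF D(1)[OF m'(2)] g(1)] hom_comp[OF D(3)[OF m'(1,3)] g(1)] i by simp_all
    have gab: "g = a * Q1 m + b * Q2 m"
      unfolding a_def b_def using split_sum_decompose[OF s m'(3) g(1)] .
    have "g * dM i = 0" using g(2) i by simp
    then have g0: "a * (d i * Q1 i) + b * (f i * Q1 i) = b * (e (i - 1) * Q2 i)"
      unfolding dM[OF i(3)] a_def b_def i(1)[symmetric] by (simp add: algebra_simps)
    have "a * (d i * Q1 i) * J1 i + b * (f i * Q1 i) * J1 i = b * (e (i - 1) * Q2 i) * J1 i"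
      unfolding g0[symmetric] by (simp add: distrib_right)
    then have A: "a * d i + b * f i = 0"
      using K(7)[OF i(3), of "a * d i" T] K(7)[OF i(3), of "b * f i" T] K(9)[OF i(4)]
        hom_comp[OF dx[OF i(3)], of a T] a hom_comp[OF fm[OF i(4)] b] i by (simp add: mult.assoc)
    obtain b' where b': "b' \<in> hom (y m) T" "b = b' * e i"
    proof (cases i)
      case 0
      \<comment> \<open>No differential precedes \<open>e 0\<close>, so the factor of b comes from
        exactness at \<open>y 0\<close>: the pushforward along b of the extension
        \<open>sig a0 * \<delta>\<close> vanishes, by \<open>A\<close> and
        \<open>sig (d 0) * \<delta> = 0\<close>.\<close>
      have "sig b * (sig a0 * \<delta>) = sig (a * d i + b * f i) * \<delta> - sig a * (sig (d 0) * \<delta>)"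
        using f(2) 0 by (simp add: algebra_simps)
      also have "\<dots> = 0" unfolding A using ex(3) by simp
      finally show ?thesis using ey(4)[of b T] b 0 i that by auto
    next
      case (Suc k)
      have "a * (d i * Q1 i) * J2 i + b * (f i * Q1 i) * J2 i = b * (e k * Q2 i) * J2 i"
        using g0 Suc by (simp flip: distrib_right)
      then have "b * e k = 0"
        using K(8)[of i "b * e k" T] K(10)[OF i(4)] hom_comp[OF dy[of k], of b T] b i Suc
        by (simp add: mult.assoc)
      then show ?thesis
        using con_exactD[OF cy(2) _ i(3) b] Suc i that by auto
    qed
    have bf: "b' * f m \<in> hom (x m) T"
      using hom_comp[OF fm[OF m'(3)] b'(1)] .
    have "(a + b' * f m) * d (m - 1) = 0"
      using A fc[OF i(3)] b'(2) i by (simp add: distrib_right mult.assoc)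
    then obtain a' where a': "a' \<in> hom (x (m + 1)) T" "a + b' * f m = a' * d m"
      using con_exactD[OF cx(2) m'(1,2) hom_add[OF a bf]] by blast
    have av: "a = a' * d m - b' * f m" using a'(2) by (simp add: algebra_simps)
    show "\<exists>h\<in>hom (M (m + 1)) T. g = h * dM m"
    proof (cases "m = n")
      case False
      then have mn: "m + 1 \<le> n" "m + 1 \<le> n + 1" using m' by simp_all
      let ?h = "a' * Q1 (m + 1) - b' * Q2 (m + 1)"
      have "?h \<in> hom (M (m + 1)) T"
        using hom_comp[OF D(2)[OF mn(1)] a'(1)] hom_comp[OF D4[OF m'(2)] b'(1)] by (simp add: hom_diff)
      moreover have "g = ?h * dM m"
        unfolding gab dM[OF m'(2)] b'(2) av i(5)
        using K(2)[OF mn(1) dx[OF m'(2)]] K(4)[OF _ mn(2), of "f m" "x m"] fm[OF m'(3)]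
          K(4)[OF _ mn(2), of "e i" "y i"] dy[OF i(3)] i K(5,6)[OF mn(2)]
        by (simp add: algebra_simps del: One_nat_def add_Suc_right)
      ultimately show ?thesis by blast
    next
      case True
      \<comment> \<open>The summand \<open>x (n + 1)\<close> is missing in the last degree, so a'
        acts through \<open>e n\<close>. The first component is right by
        \<open>d n = e n * f n\<close>, the second by \<open>e n * e i = 0\<close>.\<close>
      let ?h = "a' * e n - b'"
      have h: "?h \<in> hom (y n) T"
        using hom_diff[OF hom_comp[OF dy[of n]]] a'(1) b'(1) True xy by simp
      have "e n * e i = 0" using cpxD(3)[OF cy(1), of i] i True by simp
      then have "e n * (e i * z) = 0" for z using mult_eq_left[of "e n" "e i" 0] by simp
      moreover have "?h = ?h * one (y n)" using one_right[OF h] by simp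
      ultimately have "g = ?h * dM m"
        unfolding gab dM[OF m'(2)] i(5) b'(2) av
        using True D(8) Mn(2) en one_left'[OF fm[of n]] one_left'[OF dy[OF i(3), folded i(1)]]
        by (simp add: algebra_simps)
      then show ?thesis using h True Mn by auto
    qed
  qed
  show "\<exists>h\<in>hom T (M n). g = dM n * h" if g: "g \<in> hom T (M (n + 1))" "\<delta> * e n * g = 0"
  proof -
    obtain k where k: "n = Suc k" using n_pos by (cases n) auto
    have g': "g \<in> hom T (y n)" using g(1) Mn by simp
    have "e n * g \<in> hom T (x (n + 1))" using hom_comp[OF g' dy[of n]] xy by simp
    then obtain u where u: "u \<in> hom T (x n)" "e n * g = d n * u"
      using ex(7)[of "e n * g" T] g(2) by (auto simp: mult.assoc)
    have fu: "f n * u \<in> hom T (y n)" using hom_comp[OF u(1) fm[of n]] by simp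
    have "e n * (g - f n * u) = 0" using u(2) en by (simp add: right_diff_distrib mult.assoc)
    then obtain v where v: "v \<in> hom T (y k)" "g - f n * u = e k * v"
      using ey(6)[of n "g - f n * u" T] hom_diff[OF g' fu] n_pos k by auto
    let ?h = "J1 n * u - J2 n * v"
    have h: "?h \<in> hom T (M n)"
      using hom_comp[OF u(1) D(1)[of n]] hom_comp[OF v(1)] D3[of k] k by (simp add: hom_diff)
    have nn: "n \<le> n" "n \<le> n + 1" "1 \<le> n" "n - 1 = k" using k by simp_all
    have "g = f n * u + e k * v" using v(2) by (simp add: algebra_simps)
    then have "g = dM n * ?h"
      unfolding dM[OF nn(1)] nn(4)
      using K(1)[OF nn(1) u(1)] K(3)[OF nn(3,2), of v T] v(1) K(5,6)[OF nn(2)] D(8) Mn(2) k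
        one_left'[OF fm[of n]] one_left'[OF dy[of k]]
      by (simp add: algebra_simps)
    then show ?thesis using h by blast
  qed
qed

text \<open>Subtracts the boundary of the homotopy with single component \<open>t\<close>, which
  affects degrees 0 and 1 only.\<close>

lemma cmap_adjust_first:
  assumes x: "cpx n x d" and y: "cpx n y e" and r: "cmap n x d y e r" and t: "t \<in> hom (x 1) (y 0)"
  shows "cmap n x d y e (r(0 := r 0 - t * d 0, 1 := r 1 - e 0 * t))"
    (is "cmap n x d y e ?r")
  unfolding cmap_def
proof (intro conjI allI impI)
  have d0: "d 0 \<in> hom (x 0) (x 1)" and e0: "e 0 \<in> hom (y 0) (y 1)"
    using cpxD(2)[OF x, of 0] cpxD(2)[OF y, of 0] by simp_all
  show "?r i \<in> hom (x i) (y i)" if "i \<le> n + 1" for i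
    using cmapD(1)[OF r that] hom_comp[OF d0 t] hom_comp[OF t e0] by (auto simp: hom_diff)
  fix i assume i: "i \<le> n"
  have "e 1 * (e 0 * t) = 0"
    using cpxD(3)[OF y, of 0] n_pos mult_eq_left[of "e 1" "e 0" 0] by simp
  then show "e i * ?r i = ?r (i + 1) * d i"
    using cmapD(2)[OF r i] by (auto simp: algebra_simps)
qed

lemma cmap_adjust_last:
  assumes x: "cpx n x d" and y: "cpx n y e" and r: "cmap n x d y e r" and t: "t \<in> hom (x (n + 1)) (y n)"
  shows "cmap n x d y e (r(n := r n - t * d n, n + 1 := r (n + 1) - e n * t))"
    (is "cmap n x d y e ?r")
  unfolding cmap_def
proof (intro conjI allI impI)
  have dn: "d n \<in> hom (x n) (x (n + 1))" and en: "e n \<in> hom (y n) (y (n + 1))"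
    using cpxD(2)[OF x, of n] cpxD(2)[OF y, of n] by simp_all
  show "?r i \<in> hom (x i) (y i)" if "i \<le> n + 1" for i
    using cmapD(1)[OF r that] hom_comp[OF dn t] hom_comp[OF t en] by (auto simp: hom_diff)
  fix i assume i: "i \<le> n"
  have "t * (d n * d i) = 0" if "Suc i = n"
    using cpxD(3)[OF x, of i] that by auto
  then show "e i * ?r i = ?r (i + 1) * d i"
    using cmapD(2)[OF r i] i by (auto simp: algebra_simps)
qed

text \<open>\<open>M\<close> and \<open>N\<close> have different ends, so \<open>M\<close> is linked
  to an angle \<open>W\<close> on \<epsilon>, by way of \<open>N\<close>: the ends of
  \<open>I\<close> and \<open>P\<close> lift to maps between \<open>W\<close> and \<open>N\<close>.
  The composites between \<open>M\<close> and \<open>W\<close> are identities at n + 1 by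
  \<open>PI\<close>. At 0 both equal \<open>P 0 * I 0\<close>, whose difference from the identity
  pushes \<epsilon> to 0; by exactness it factors over the first differential of either complex and
  can be removed.\<close>

lemma realizes_via_first:
  assumes M: "cpx n M dM" "con_exact n M dM" and \<epsilon>: "\<epsilon> \<in> hom (M (n + 1)) (SO (M 0))"
    and N: "angle N dN"
    and I: "cmap n M dM (\<lambda>i. N (int i)) (\<lambda>i. dN (int i)) I"
    and P: "cmap n (\<lambda>i. N (int i)) (\<lambda>i. dN (int i)) M dM P"
    and sI: "sig (I 0) * \<epsilon> = dN (int n + 1) * I (n + 1)"
    and sP: "sig (P 0) * dN (int n + 1) = \<epsilon> * P (n + 1)"
    and PI: "P (n + 1) * I (n + 1) = one (M (n + 1))"
    and ex: "\<And>g. \<lbrakk>g \<in> hom (M 0) (M 0); sig g * \<epsilon> = 0\<rbrakk> \<Longrightarrow> \<exists>h\<in>hom (M 1) (M 0). g = h * dM 0"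
  shows "realizes M dM \<epsilon>"
proof -
  have o: "M 0 \<in> Obj C" "M (n + 1) \<in> Obj C" using cpxD(1)[OF M(1)] by simp_all
  obtain W w where W: "angle W w" "W 0 = M 0" "W (int n + 1) = M (n + 1)" "w (int n + 1) = \<epsilon>"
    using angle_completion_last[OF o(1) \<epsilon>] by metis
  have I0: "I 0 \<in> hom (W 0) (N 0)" "I (n + 1) \<in> hom (W (int n + 1)) (N (int n + 1))"
    and P0: "P 0 \<in> hom (N 0) (W 0)" "P (n + 1) \<in> hom (N (int n + 1)) (W (int n + 1))"
    using cmapD(1)[OF I, of 0] cmapD(1)[OF I, of "n + 1"] cmapD(1)[OF P, of 0] cmapD(1)[OF P, of "n + 1"]
      W(2,3) by (simp_all add: add.commute)
  obtain F where F: "angle_map W w N dN F" "F 0 = I 0" "F (int n + 1) = I (n + 1)"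
    using angle_lift[OF W(1) N I0] sI W(4) by metis
  obtain G where G: "angle_map N dN W w G" "G 0 = P 0" "G (int n + 1) = P (n + 1)"
    using angle_lift[OF N W(1) P0] sP W(4) by metis
  note cW = angle_cpx[OF W(1)]
  define r where "r i = G (int i) * I i" for i
  define r' where "r' i = P i * F (int i)" for i
  have r: "cmap n M dM (\<lambda>i. W (int i)) (\<lambda>i. w (int i)) r"
    unfolding r_def by (rule cmap_comp[OF I angle_map_cmap[OF G(1)]])
  have r': "cmap n (\<lambda>i. W (int i)) (\<lambda>i. w (int i)) M dM r'"
    unfolding r'_def by (rule cmap_comp[OF angle_map_cmap[OF F(1)] P])
  have e: "r 0 = P 0 * I 0" "r' 0 = P 0 * I 0" "r (n + 1) = one (M (n + 1))" "r' (n + 1) = one (M (n + 1))"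
    using F(2,3) G(2,3) PI by (simp_all add: r_def r'_def add.commute)
  let ?z = "P 0 * I 0 - one (M 0)"
  have z: "?z \<in> hom (M 0) (M 0)"
    using hom_comp[OF I0(1) P0(1)] one_hom[OF o(1)] W(2) by (simp add: hom_diff)
  have "sig (P 0) * (sig (I 0) * \<epsilon>) = \<epsilon>"
    unfolding sI using sP PI one_right[OF \<epsilon>] by (metis mult.assoc)
  then have sz: "sig ?z * \<epsilon> = 0"
    using one_left[OF \<epsilon>] o(1) by (simp add: algebra_simps sig_one)
  obtain t where t: "t \<in> hom (M 1) (W 0)" "?z = t * dM 0"
    using ex[OF z sz] W(2) by auto
  obtain t' where t': "t' \<in> hom (W (int 1)) (M 0)" "?z = t' * w (int 0)"
    using realizes_exact(4)[OF angle_realizes[OF W(1)], of ?z "M 0"] z sz W(2,4) by auto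
  have ne: "n + 1 \<noteq> 0" "n + 1 \<noteq> 1" using n_pos by simp_all
  have rz: "P 0 * I 0 - t * dM 0 = one (M 0)" "P 0 * I 0 - t' * w (int 0) = one (M 0)"
    unfolding t(2)[symmetric] t'(2)[symmetric] by simp_all
  have i1: "int (n + 1) = int n + 1" by simp
  have "fmap n M dM (\<lambda>i. W (int i)) (\<lambda>i. w (int i)) (r(0 := r 0 - t * dM 0, 1 := r 1 - w (int 0) * t))"
    unfolding fmap_def using cmap_adjust_first[OF M(1) cW r, of t] t(1) e ne rz by simp
  moreover have "fmap n (\<lambda>i. W (int i)) (\<lambda>i. w (int i)) M dM (r'(0 := r' 0 - t' * w (int 0), 1 := r' 1 - dM 0 * t'))"
    unfolding fmap_def i1 using cmap_adjust_first[OF cW M(1) r' t'(1)] e ne rz W(2,3) by simp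
  ultimately show ?thesis by (rule realizesI[OF M W(1,4,2,3)])
qed

text \<open>The mirror image: the composites are identities at 0, and the defect at n + 1, which
  \<epsilon> annihilates, is removed through the last differentials.\<close>

lemma realizes_via_last:
  assumes M: "cpx n M dM" "con_exact n M dM" and \<epsilon>: "\<epsilon> \<in> hom (M (n + 1)) (SO (M 0))"
    and N: "angle N dN"
    and I: "cmap n M dM (\<lambda>i. N (int i)) (\<lambda>i. dN (int i)) I"
    and P: "cmap n (\<lambda>i. N (int i)) (\<lambda>i. dN (int i)) M dM P"
    and sI: "sig (I 0) * \<epsilon> = dN (int n + 1) * I (n + 1)"
    and sP: "sig (P 0) * dN (int n + 1) = \<epsilon> * P (n + 1)"
    and PI: "P 0 * I 0 = one (M 0)"
    and ex: "\<And>g. \<lbrakk>g \<in> hom (M (n + 1)) (M (n + 1)); \<epsilon> * g = 0\<rbrakk> \<Longrightarrow> \<exists>h\<in>hom (M (n + 1)) (M n). g = dM n * h"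
  shows "realizes M dM \<epsilon>"
proof -
  have o: "M 0 \<in> Obj C" "M (n + 1) \<in> Obj C" using cpxD(1)[OF M(1)] by simp_all
  obtain W w where W: "angle W w" "W 0 = M 0" "W (int n + 1) = M (n + 1)" "w (int n + 1) = \<epsilon>"
    using angle_completion_last[OF o(1) \<epsilon>] by metis
  have I0: "I 0 \<in> hom (W 0) (N 0)" "I (n + 1) \<in> hom (W (int n + 1)) (N (int n + 1))"
    and P0: "P 0 \<in> hom (N 0) (W 0)" "P (n + 1) \<in> hom (N (int n + 1)) (W (int n + 1))"
    using cmapD(1)[OF I, of 0] cmapD(1)[OF I, of "n + 1"] cmapD(1)[OF P, of 0] cmapD(1)[OF P, of "n + 1"]
      W(2,3) by (simp_all add: add.commute)
  obtain F where F: "angle_map W w N dN F" "F 0 = I 0" "F (int n + 1) = I (n + 1)"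
    using angle_lift[OF W(1) N I0] sI W(4) by metis
  obtain G where G: "angle_map N dN W w G" "G 0 = P 0" "G (int n + 1) = P (n + 1)"
    using angle_lift[OF N W(1) P0] sP W(4) by metis
  note cW = angle_cpx[OF W(1)]
  define r where "r i = G (int i) * I i" for i
  define r' where "r' i = P i * F (int i)" for i
  have r: "cmap n M dM (\<lambda>i. W (int i)) (\<lambda>i. w (int i)) r"
    unfolding r_def by (rule cmap_comp[OF I angle_map_cmap[OF G(1)]])
  have r': "cmap n (\<lambda>i. W (int i)) (\<lambda>i. w (int i)) M dM r'"
    unfolding r'_def by (rule cmap_comp[OF angle_map_cmap[OF F(1)] P])
  let ?e = "P (n + 1) * I (n + 1)"
  have e: "r (n + 1) = ?e" "r' (n + 1) = ?e" "r 0 = one (M 0)" "r' 0 = one (M 0)"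
    using F(2,3) G(2,3) PI by (simp_all add: r_def r'_def add.commute)
  let ?z = "?e - one (M (n + 1))"
  have z: "?z \<in> hom (M (n + 1)) (M (n + 1))"
    using hom_comp[OF I0(2) P0(2)] one_hom[OF o(2)] unfolding W(3) by (rule hom_diff)
  have "\<epsilon> * ?e = sig (P 0) * (sig (I 0) * \<epsilon>)"
    unfolding sI using sP by (metis mult.assoc)
  also have "\<dots> = sig (P 0 * I 0) * \<epsilon>" by (simp add: mult.assoc)
  also have "\<dots> = \<epsilon>" unfolding PI using one_left[OF \<epsilon>] o(1) by (simp add: sig_one)
  finally have sz: "\<epsilon> * ?z = 0"
    using one_right[OF \<epsilon>] by (simp add: right_diff_distrib)
  obtain t where t: "t \<in> hom (W (int n + 1)) (M n)" "?z = dM n * t"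
    using ex[OF z sz] W(3) by auto
  obtain t' where t': "t' \<in> hom (M (n + 1)) (W (int n))" "?z = w (int n) * t'"
    using realizes_exact(7)[OF angle_realizes[OF W(1)], of ?z "M (n + 1)"] z sz W(3,4)
    by (auto simp: add.commute)
  have ne: "n \<noteq> 0" using n_pos by simp
  have i1: "int (n + 1) = int n + 1" by simp
  have rz: "?e - dM n * t = one (M (n + 1))" "?e - w (int n) * t' = one (M (n + 1))"
    unfolding t(2)[symmetric] t'(2)[symmetric] by simp_all
  have "fmap n M dM (\<lambda>i. W (int i)) (\<lambda>i. w (int i)) (r(n := r n - t' * dM n, n + 1 := r (n + 1) - w (int n) * t'))"
    unfolding fmap_def using cmap_adjust_last[OF M(1) cW r t'(1)] e ne rz by simp
  moreover have "fmap n (\<lambda>i. W (int i)) (\<lambda>i. w (int i)) M dM (r'(n := r' n - t * w (int n), n + 1 := r' (n + 1) - dM n * t))"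
    unfolding fmap_def i1 using cmap_adjust_last[OF cW M(1) r', unfolded i1, OF t(1)] e ne rz W(2,3) by simp
  ultimately show ?thesis by (rule realizesI[OF M W(1,4,2,3)])
qed

section \<open>Comparison with the cones provided by (F4)\<close>

lemma angle_coneD:
  assumes "angle_cone X d Y e f N dN a1 a2 b1 b2"
  shows "angle N dN" "a1 i \<in> hom (X (i + 1)) (N i)" "a2 i \<in> hom (Y i) (N i)"
    "b1 i \<in> hom (N i) (X (i + 1))" "b2 i \<in> hom (N i) (Y i)"
    "b1 i * a1 i = one (X (i + 1))" "b2 i * a2 i = one (Y i)" "b2 i * a1 i = 0" "b1 i * a2 i = 0"
    "dN i = a1 (i + 1) * - d (i + 1) * b1 i + a2 (i + 1) * (f (i + 1) * b1 i + e i * b2 i)"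
    "a1 (i + per) = tw (sig (a1 i))" "a2 (i + per) = sig (a2 i)"
proof -
  show "angle N dN" using assms by (simp add: angle_cone_def)
  note * = assms[unfolded angle_cone_def biproduct_maps_def, THEN conjunct2, THEN spec, of i]
  show "a1 i \<in> hom (X (i + 1)) (N i)" "a2 i \<in> hom (Y i) (N i)"
    "b1 i \<in> hom (N i) (X (i + 1))" "b2 i \<in> hom (N i) (Y i)"
    "b1 i * a1 i = one (X (i + 1))" "b2 i * a2 i = one (Y i)" "b2 i * a1 i = 0" "b1 i * a2 i = 0"
    "dN i = a1 (i + 1) * - d (i + 1) * b1 i + a2 (i + 1) * (f (i + 1) * b1 i + e i * b2 i)"
    "a1 (i + per) = tw (sig (a1 i))" "a2 (i + per) = sig (a2 i)"
    using * by blast+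
qed

lemma angle_cone_cancel:
  assumes "angle_cone X d Y e f N dN a1 a2 b1 b2"
  shows "z \<in> hom T (X (i + 1)) \<Longrightarrow> b1 i * (a1 i * z) = z"
    "z \<in> hom T (X (i + 1)) \<Longrightarrow> b1 i * (a1 i * (z * w)) = z * w"
    "z \<in> hom T (Y i) \<Longrightarrow> b2 i * (a2 i * z) = z"
    "z \<in> hom T (Y i) \<Longrightarrow> b2 i * (a2 i * (z * w)) = z * w"
    "b2 i * (a1 i * w) = 0" "b1 i * (a2 i * w) = 0" "b2 i * a1 i = 0" "b1 i * a2 i = 0"
proof -
  note D = angle_coneD(6-9)[OF assms, of i]
  show "b1 i * (a1 i * z) = z" "b1 i * (a1 i * (z * w)) = z * w" if "z \<in> hom T (X (i + 1))"
    using mult_eq_left[OF D(1)] one_left[OF that] one_left'[OF that] by simp_all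
  show "b2 i * (a2 i * z) = z" "b2 i * (a2 i * (z * w)) = z * w" if "z \<in> hom T (Y i)"
    using mult_eq_left[OF D(2)] one_left[OF that] one_left'[OF that] by simp_all
  show "b2 i * (a1 i * w) = 0" "b1 i * (a2 i * w) = 0" "b2 i * a1 i = 0" "b1 i * a2 i = 0"
    using D mult_eq_left[OF D(3)] mult_eq_left[OF D(4)] by simp_all
qed

text \<open>
  Complexes \<open>x\<close> and \<open>y\<close> realizing \<open>\<delta>\<close> and \<open>\<rho>\<close> are replaced by angles \<open>W\<close> and \<open>V\<close>, which have a map
  \<open>\<phi>\<close> with a cone \<open>N\<close>. The map \<open>f = \<beta> \<phi> q : x \<rightarrow> y\<close> corresponds to \<open>\<phi>\<close> up to the homotopies
  \<open>\<sigma>\<close> and \<open>\<tau>\<close>.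
\<close>

lemma realizes_lift_cone:
  assumes x: "realizes x d \<delta>" and y: "realizes y e \<rho>"
    and a: "a \<in> hom (x 0) (y 0)" and c: "c \<in> hom (x (n + 1)) (y (n + 1))"
    and sq: "sig a * \<delta> = \<rho> * c"
  obtains W w V v \<phi> N dN a1 a2 b1 b2 p q \<beta> \<gamma> f \<sigma> \<tau> where
    "angle W w" "W 0 = x 0" "W (int n + 1) = x (n + 1)" "w (int n + 1) = \<delta>"
    "angle V v" "V 0 = y 0" "V (int n + 1) = y (n + 1)" "v (int n + 1) = \<rho>"
    "angle_map W w V v \<phi>" "\<phi> 0 = a" "\<phi> (int n + 1) = c"
    "angle_cone W w V v \<phi> N dN a1 a2 b1 b2"
    "fmap n (\<lambda>i. W (int i)) (\<lambda>i. w (int i)) x d p" "fmap n x d (\<lambda>i. W (int i)) (\<lambda>i. w (int i)) q"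
    "fmap n (\<lambda>i. V (int i)) (\<lambda>i. v (int i)) y e \<beta>" "fmap n y e (\<lambda>i. V (int i)) (\<lambda>i. v (int i)) \<gamma>"
    "cmap n x d y e f" "f 0 = a" "f (n + 1) = c"
    "\<forall>i\<le>n. \<sigma> (i + 1) \<in> hom (x (i + 1)) (V (int i))"
    "\<forall>i<n. \<gamma> (i + 1) * f (i + 1) = \<phi> (int i + 1) * q (i + 1) + v (int i) * \<sigma> (i + 1) + \<sigma> (i + 2) * d (i + 1)"
    "\<sigma> 1 * d 0 = 0" "v (int n) * \<sigma> (n + 1) = 0"
    "\<forall>i\<le>n. \<tau> (i + 1) \<in> hom (W (int i + 1)) (y i)"
    "\<forall>i<n. f (i + 1) * p (i + 1) = \<beta> (i + 1) * \<phi> (int i + 1) + e i * \<tau> (i + 1) + \<tau> (i + 2) * w (int i + 1)"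
    "\<tau> 1 * w 0 = 0" "e n * \<tau> (n + 1) = 0"
proof -
  have cx: "cpx n x d" "con_exact n x d" and cy: "cpx n y e" "con_exact n y e"
    using x y by (simp_all add: realizes_def)
  have data: "\<exists>W w p q l. angle W w \<and> W 0 = x 0 \<and> W (int n + 1) = x (n + 1) \<and> w (int n + 1) = \<delta> \<and>
      fmap n (\<lambda>i. W (int i)) (\<lambda>i. w (int i)) x d p \<and> fmap n x d (\<lambda>i. W (int i)) (\<lambda>i. w (int i)) q \<and>
      (\<forall>i\<in>{1..n + 1}. l i \<in> hom (W (int i)) (W (int (i - 1)))) \<and>
      q 0 * p 0 - one (W (int 0)) = l 1 * w (int 0) \<and>
      (\<forall>i\<in>{1..n}. q i * p i - one (W (int i)) = w (int (i - 1)) * l i + l (i + 1) * w (int i)) \<and>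
      q (n + 1) * p (n + 1) - one (W (int (n + 1))) = w (int n) * l (n + 1)"
    if x: "realizes x d \<delta>" for x d \<delta>
  proof -
    obtain W w where W: "angle W w" "w (int n + 1) = \<delta>" and l: "linked n x d (\<lambda>i. W (int i)) (\<lambda>i. w (int i))"
      using x unfolding realizes_def by blast
    have "heq n (\<lambda>i. W (int i)) (\<lambda>i. w (int i)) x d"
      using linked_heq[OF angle_cpx[OF W(1)] angle_con_exact[OF W(1)] _ _ linked_sym[OF l]] x
      by (simp add: realizes_def)
    moreover have "W 0 = x 0" "W (int n + 1) = x (n + 1)"
      using l unfolding linked_def int_plus_1 by simp_all
    ultimately show ?thesis
      using W unfolding heq_def null_def by blast
  qed
  obtain W w p q l where W: "angle W w" "W 0 = x 0" "W (int n + 1) = x (n + 1)" "w (int n + 1) = \<delta>"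
    and p: "fmap n (\<lambda>i. W (int i)) (\<lambda>i. w (int i)) x d p" and q: "fmap n x d (\<lambda>i. W (int i)) (\<lambda>i. w (int i)) q"
    and l: "\<And>i. i \<in> {1..n + 1} \<Longrightarrow> l i \<in> hom (W (int i)) (W (int (i - 1)))"
      "q 0 * p 0 - one (W (int 0)) = l 1 * w (int 0)"
      "\<And>i. i \<in> {1..n} \<Longrightarrow> q i * p i - one (W (int i)) = w (int (i - 1)) * l i + l (i + 1) * w (int i)"
      "q (n + 1) * p (n + 1) - one (W (int (n + 1))) = w (int n) * l (n + 1)"
    using data[OF x] by metis
  obtain V v \<beta> \<gamma> k where V: "angle V v" "V 0 = y 0" "V (int n + 1) = y (n + 1)" "v (int n + 1) = \<rho>"
    and \<beta>: "fmap n (\<lambda>i. V (int i)) (\<lambda>i. v (int i)) y e \<beta>" and \<gamma>: "fmap n y e (\<lambda>i. V (int i)) (\<lambda>i. v (int i)) \<gamma>"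
    and k: "\<And>i. i \<in> {1..n + 1} \<Longrightarrow> k i \<in> hom (V (int i)) (V (int (i - 1)))"
      "\<gamma> 0 * \<beta> 0 - one (V (int 0)) = k 1 * v (int 0)"
      "\<And>i. i \<in> {1..n} \<Longrightarrow> \<gamma> i * \<beta> i - one (V (int i)) = v (int (i - 1)) * k i + k (i + 1) * v (int i)"
      "\<gamma> (n + 1) * \<beta> (n + 1) - one (V (int (n + 1))) = v (int n) * k (n + 1)"
    using data[OF y] by metis
  obtain \<phi> N dN a1 a2 b1 b2 where \<phi>: "angle_map W w V v \<phi>" "\<phi> 0 = a" "\<phi> (int n + 1) = c"
    and N: "angle_cone W w V v \<phi> N dN a1 a2 b1 b2"
    using angle_lift[OF W(1) V(1), of a c] a c sq W V by metis
  have pc: "cmap n (\<lambda>i. W (int i)) (\<lambda>i. w (int i)) x d p" and qc: "cmap n x d (\<lambda>i. W (int i)) (\<lambda>i. w (int i)) q"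
    and \<beta>c: "cmap n (\<lambda>i. V (int i)) (\<lambda>i. v (int i)) y e \<beta>" and \<gamma>c: "cmap n y e (\<lambda>i. V (int i)) (\<lambda>i. v (int i)) \<gamma>"
    using p q \<beta> \<gamma> by (simp_all add: fmap_def)
  note \<phi>c = angle_map_cmap[OF \<phi>(1)]
  define f where "f i = \<beta> i * (\<phi> (int i) * q i)" for i
  \<comment> \<open>As f = \<beta> \<phi> q, the difference \<gamma> f - \<phi> q equals (\<gamma>
    \<beta> - 1) \<phi> q, and f p - \<beta> \<phi> equals \<beta> \<phi> (q p - 1). So \<sigma> and
    \<tau> arise from the homotopies \<open>k\<close> and \<open>l\<close> by composition.\<close>
  define \<sigma> where "\<sigma> i = k i * (\<phi> (int i) * q i)" for i
  define \<tau> where "\<tau> i = \<beta> (i - 1) * (\<phi> (int (i - 1)) * l i)" for i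
  have f: "cmap n x d y e f"
    unfolding f_def by (rule cmap_comp[OF cmap_comp[OF qc \<phi>c] \<beta>c])
  have i1: "int (n + 1) = int n + 1" "int (Suc i) = int i + 1" for i by simp_all
  have ends: "p 0 = one (x 0)" "p (n + 1) = one (x (n + 1))" "q 0 = one (x 0)" "q (n + 1) = one (x (n + 1))"
    "\<beta> 0 = one (y 0)" "\<beta> (n + 1) = one (y (n + 1))" "\<gamma> 0 = one (y 0)" "\<gamma> (n + 1) = one (y (n + 1))"
    using p q \<beta> \<gamma> W V unfolding fmap_def i1 by simp_all
  have f0: "f 0 = a" "f (n + 1) = c"
    unfolding f_def i1 ends of_nat_0 \<phi> using one_left[OF a] one_right[OF a] one_left[OF c] one_right[OF c] by simp_all
  have oo: "one (x 0) * one (x 0) = one (x 0)" "one (x (n + 1)) * one (x (n + 1)) = one (x (n + 1))"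
    "one (y 0) * one (y 0) = one (y 0)" "one (y (n + 1)) * one (y (n + 1)) = one (y (n + 1))"
    using one_left[OF one_hom] hom_Obj[OF a] hom_Obj[OF c] by simp_all
  \<comment> \<open>In the end degrees the comparison maps are identities, so the homotopies have
    zero boundary there. This gives the four vanishing conditions on \<sigma> and \<tau>.\<close>
  have z: "l 1 * w 0 = 0" "w (int n) * l (n + 1) = 0" "k 1 * v 0 = 0" "v (int n) * k (n + 1) = 0"
    using l(2,4) k(2,4) unfolding ends i1 of_nat_0 W V oo by simp_all
  have \<phi>q: "v (int i) * (\<phi> (int i) * z) = \<phi> (int i + 1) * (w (int i) * z)" for i z
    using \<phi>(1) mult_eq_left unfolding angle_map_def by (metis mult.assoc)
  have qd: "w (int i) * (q i * z) = q (i + 1) * (d i * z)" if "i \<le> n" for i z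
    using cmapD(2)[OF qc that] mult_eq_left by (metis mult.assoc)
  have qd': "w (int i) * q i = q (i + 1) * d i" if "i \<le> n" for i
    using cmapD(2)[OF qc that] .
  have ev: "e i * (\<beta> i * z) = \<beta> (i + 1) * (v (int i) * z)" if "i \<le> n" for i z
    using cmapD(2)[OF \<beta>c that] mult_eq_left by (metis mult.assoc)
  show ?thesis
  proof (rule that[OF W V \<phi> N p q \<beta> \<gamma> f f0, of \<sigma> \<tau>]; (intro allI impI)?)
    show "\<sigma> (i + 1) \<in> hom (x (i + 1)) (V (int i))" if "i \<le> n" for i
      using hom_comp[OF hom_comp[OF cmapD(1)[OF qc, of "i + 1"] cmapD(1)[OF \<phi>c, of "i + 1"]] k(1)[of "i + 1"]] that
      by (simp add: \<sigma>_def)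
    show "\<tau> (i + 1) \<in> hom (W (int i + 1)) (y i)" if "i \<le> n" for i
      using hom_comp[OF hom_comp[OF l(1)[of "i + 1", unfolded add_diff_cancel_right'] cmapD(1)[OF \<phi>c, of i]] cmapD(1)[OF \<beta>c, of i]] that
      by (simp add: \<tau>_def add.commute)
    show "\<sigma> 1 * d 0 = 0"
    proof -
      have "\<sigma> 1 * d 0 = k 1 * (v 0 * (\<phi> 0 * q 0))"
        using \<phi>q[of 0 "q 0"] qd'[of 0] by (simp add: \<sigma>_def mult.assoc)
      then show ?thesis using mult_eq_left[OF z(3)] by simp
    qed
    show "v (int n) * \<sigma> (n + 1) = 0"
      using mult_eq_left[OF z(4)] by (simp add: \<sigma>_def)
    show "\<tau> 1 * w 0 = 0"
      using z(1) by (simp add: \<tau>_def mult.assoc)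
    show "e n * \<tau> (n + 1) = 0"
      using ev[of n] \<phi>q[of n] z(2) by (simp add: \<tau>_def)
    fix i assume i: "i < n"
    have I: "int (i + 1) = int i + 1" "int (i + 1 - 1) = int i" "int (i + 2 - 1) = int i + 1" "i + 2 - 1 = i + 1"
      "i + 1 - 1 = i" "int (i + 2) = int i + 2" "int i + 1 + 1 = int i + 2" "i + 1 + 1 = i + 2" by simp_all
    have i': "i + 1 \<in> {1..n}" "i \<le> n" "i + 1 \<le> n" "i + 1 \<le> n + 1" using i by simp_all
    have h: "\<phi> (int i + 1) * q (i + 1) \<in> hom (x (i + 1)) (V (int i + 1))"
      using hom_comp[OF cmapD(1)[OF qc i'(4)] cmapD(1)[OF \<phi>c i'(4)]] unfolding I .
    have "(\<gamma> (i + 1) * \<beta> (i + 1) - one (V (int (i + 1)))) * (\<phi> (int i + 1) * q (i + 1)) =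
        (v (int (i + 1 - 1)) * k (i + 1) + k (i + 1 + 1) * v (int (i + 1))) * (\<phi> (int i + 1) * q (i + 1))"
      using k(3)[OF i'(1)] by simp
    then have "\<gamma> (i + 1) * f (i + 1) - \<phi> (int i + 1) * q (i + 1) =
        v (int i) * \<sigma> (i + 1) + k (i + 2) * (v (int i + 1) * (\<phi> (int i + 1) * q (i + 1)))"
      unfolding I f_def \<sigma>_def using one_left[OF h] by (simp add: distrib_right left_diff_distrib mult.assoc)
    also have "v (int i + 1) * (\<phi> (int i + 1) * q (i + 1)) = \<phi> (int i + 2) * (q (i + 2) * d (i + 1))"
      using \<phi>q[of "i + 1" "q (i + 1)"] qd'[OF i'(3)] unfolding I by simp
    also have "k (i + 2) * \<dots> = \<sigma> (i + 2) * d (i + 1)"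
      unfolding \<sigma>_def I by (simp add: mult.assoc)
    finally show "\<gamma> (i + 1) * f (i + 1) = \<phi> (int i + 1) * q (i + 1) + v (int i) * \<sigma> (i + 1) + \<sigma> (i + 2) * d (i + 1)"
      by (simp add: algebra_simps)
    have h': "\<beta> (i + 1) * \<phi> (int i + 1) \<in> hom (W (int i + 1)) (y (i + 1))"
      using hom_comp[OF cmapD(1)[OF \<phi>c i'(4)] cmapD(1)[OF \<beta>c i'(4)]] unfolding I .
    have "\<beta> (i + 1) * \<phi> (int i + 1) * (q (i + 1) * p (i + 1) - one (W (int (i + 1)))) =
        \<beta> (i + 1) * \<phi> (int i + 1) * (w (int (i + 1 - 1)) * l (i + 1) + l (i + 1 + 1) * w (int (i + 1)))"
      using l(3)[OF i'(1)] by simp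
    then have "f (i + 1) * p (i + 1) - \<beta> (i + 1) * \<phi> (int i + 1) =
        \<beta> (i + 1) * (\<phi> (int i + 1) * (w (int i) * l (i + 1))) + \<tau> (i + 2) * w (int i + 1)"
      unfolding f_def \<tau>_def I right_diff_distrib distrib_left one_right[OF h'] by (simp add: mult.assoc)
    also have "\<beta> (i + 1) * (\<phi> (int i + 1) * (w (int i) * l (i + 1))) = e i * \<tau> (i + 1)"
      unfolding \<tau>_def I ev[OF i'(2)] \<phi>q ..
    finally show "f (i + 1) * p (i + 1) = \<beta> (i + 1) * \<phi> (int i + 1) + e i * \<tau> (i + 1) + \<tau> (i + 2) * w (int i + 1)"
      by (simp add: algebra_simps)
  qed
qed

lemma angle_map_shift: "angle_map X d Y e f \<Longrightarrow> f per = sig (f 0)"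
  unfolding angle_map_def by (metis add_0)

text \<open>Compared with \<open>M\<close>, the cone \<open>N\<close> of \<phi> has the extra
  summands \<open>V 0\<close> in degree 0 and the suspension of \<open>x 0\<close> in degree n + 1,
  which the identity \<open>\<phi> 0\<close> ties together. On the common summands the comparison
  maps \<open>I\<close> and \<open>P\<close> are the triangular matrices with entries q, \<sigma>,
  \<gamma> and p, -\<tau>, \<beta>.\<close>

lemma cone_realizes:
  assumes x: "realizes x d (\<rho> * c)" and y: "realizes y e \<rho>" and xy: "x 0 = y 0"
    and c: "c \<in> hom (x (n + 1)) (y (n + 1))"
  obtains f where "cmap n x d y e f" "f 0 = one (x 0)" "f (n + 1) = c"
    "\<And>M dM J1 J2 Q1 Q2. \<lbrakk>split_sum n (\<lambda>m. x (m + 1)) y M J1 J2 Q1 Q2;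
      \<And>m. m \<le> n \<Longrightarrow> dM m = J1 (m + 1) * - d (m + 1) * Q1 m
        + J2 (m + 1) * (f (m + 1) * Q1 m + e m * Q2 m)\<rbrakk> \<Longrightarrow> realizes M dM (sig (d 0) * \<rho>)"
proof -
  have cx: "cpx n x d" and cy: "cpx n y e" using x y by (simp_all add: realizes_def)
  note ex = realizes_exact[OF x] and ey = realizes_exact[OF y]
  have o: "x 0 \<in> Obj C" using cpxD(1)[OF cx, of 0] by simp
  have \<rho>: "\<rho> \<in> hom (y (n + 1)) (SO (x 0))" using ey(1) xy by simp
  have a: "one (x 0) \<in> hom (x 0) (y 0)" using one_hom[OF o] xy by simp
  have sq: "sig (one (x 0)) * (\<rho> * c) = \<rho> * c"
    using one_left[OF ex(1)] o by (simp add: sig_one)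
  obtain W w V v \<phi> N dN a1 a2 b1 b2 p q \<beta> \<gamma> f \<sigma> \<tau> where
    W: "angle W w" "W 0 = x 0" "W (int n + 1) = x (n + 1)" "w (int n + 1) = \<rho> * c"
    and V: "angle V v" "V 0 = y 0" "V (int n + 1) = y (n + 1)" "v (int n + 1) = \<rho>"
    and \<phi>: "angle_map W w V v \<phi>" "\<phi> 0 = one (x 0)" "\<phi> (int n + 1) = c"
    and N: "angle_cone W w V v \<phi> N dN a1 a2 b1 b2"
    and p: "fmap n (\<lambda>i. W (int i)) (\<lambda>i. w (int i)) x d p" and q: "fmap n x d (\<lambda>i. W (int i)) (\<lambda>i. w (int i)) q"
    and \<beta>: "fmap n (\<lambda>i. V (int i)) (\<lambda>i. v (int i)) y e \<beta>" and \<gamma>: "fmap n y e (\<lambda>i. V (int i)) (\<lambda>i. v (int i)) \<gamma>"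
    and f: "cmap n x d y e f" "f 0 = one (x 0)" "f (n + 1) = c"
    and \<sigma>: "\<forall>i\<le>n. \<sigma> (i + 1) \<in> hom (x (i + 1)) (V (int i))"
    "\<forall>i<n. \<gamma> (i + 1) * f (i + 1) = \<phi> (int i + 1) * q (i + 1) + v (int i) * \<sigma> (i + 1) + \<sigma> (i + 2) * d (i + 1)"
    "\<sigma> 1 * d 0 = 0" "v (int n) * \<sigma> (n + 1) = 0"
    and \<tau>: "\<forall>i\<le>n. \<tau> (i + 1) \<in> hom (W (int i + 1)) (y i)"
    "\<forall>i<n. f (i + 1) * p (i + 1) = \<beta> (i + 1) * \<phi> (int i + 1) + e i * \<tau> (i + 1) + \<tau> (i + 2) * w (int i + 1)"
    "\<tau> 1 * w 0 = 0" "e n * \<tau> (n + 1) = 0"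
    by (rule realizes_lift_cone[OF x y a c sq]) (rule that; assumption)
  note \<sigma> = \<sigma>(1)[rule_format] \<sigma>(2)[rule_format] \<sigma>(3,4) and \<tau> = \<tau>(1)[rule_format] \<tau>(2)[rule_format] \<tau>(3,4)
  show ?thesis
  proof (rule that[OF f])
    fix M dM J1 J2 Q1 Q2
    assume s: "split_sum n (\<lambda>m. x (m + 1)) y M J1 J2 Q1 Q2"
      and dM: "\<And>m. m \<le> n \<Longrightarrow> dM m = J1 (m + 1) * - d (m + 1) * Q1 m
        + J2 (m + 1) * (f (m + 1) * Q1 m + e m * Q2 m)"
    note D = split_sumD[OF s] and K = split_sum_cancel[OF s]
    have M: "cpx n M dM" "con_exact n M dM" "sig (d 0) * \<rho> \<in> hom (M (n + 1)) (SO (M 0))"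
      by (rule cone_exact[OF x y xy f s]; erule dM)+
    have dx: "d i \<in> hom (x i) (x (i + 1))" and dy: "e i \<in> hom (y i) (y (i + 1))" if "i \<le> n" for i
      using that cpxD(2)[OF cx] cpxD(2)[OF cy] by simp_all
    have pc: "cmap n (\<lambda>i. W (int i)) (\<lambda>i. w (int i)) x d p" and qc: "cmap n x d (\<lambda>i. W (int i)) (\<lambda>i. w (int i)) q"
      and \<beta>c: "cmap n (\<lambda>i. V (int i)) (\<lambda>i. v (int i)) y e \<beta>" and \<gamma>c: "cmap n y e (\<lambda>i. V (int i)) (\<lambda>i. v (int i)) \<gamma>"
      using p q \<beta> \<gamma> by (simp_all add: fmap_def)
    have ends: "p (n + 1) = one (x (n + 1))" "q (n + 1) = one (x (n + 1))" "q 0 = one (x 0)" "p 0 = one (x 0)"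
      "\<beta> 0 = one (y 0)" "\<beta> (n + 1) = one (y (n + 1))" "\<gamma> (n + 1) = one (y (n + 1))"
      using p q \<beta> \<gamma> W V unfolding fmap_def int_plus_1 by simp_all
    have ph: "p i \<in> hom (W (int i)) (x i)" and qh: "q i \<in> hom (x i) (W (int i))"
      and \<beta>h: "\<beta> i \<in> hom (V (int i)) (y i)" and \<gamma>h: "\<gamma> i \<in> hom (y i) (V (int i))" and fh: "f i \<in> hom (x i) (y i)"
      if "i \<le> n + 1" for i
      using that cmapD(1)[OF pc] cmapD(1)[OF qc] cmapD(1)[OF \<beta>c] cmapD(1)[OF \<gamma>c] cmapD(1)[OF f(1)] by simp_all
    note DW = angleD[OF W(1)] and DV = angleD[OF V(1)]
    note NC = angle_coneD[OF N] and NK = angle_cone_cancel[OF N]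
    have \<phi>h: "\<phi> i \<in> hom (W i) (V i)" and \<phi>v: "v i * \<phi> i = \<phi> (i + 1) * w i" for i
      using \<phi>(1) unfolding angle_map_def by blast+
    have I1: "int (i + 1) = int i + 1" "i + 1 + 1 = i + 2" "int i + 1 + 1 = int i + 2" for i by simp_all
    have WS: "W (int n + 1 + 1) = SO (x 0)" "w (int n + 1 + 1) = tw (sig (w 0))"
        "\<phi> (int n + 1 + 1) = sig (one (x 0))"
      and aS: "a1 (int n + 1 + 1) = tw (sig (a1 0))" "a2 (int n + 1 + 1) = sig (a2 0)"
      using DW(6,8) W(2) angle_map_shift[OF \<phi>(1)] \<phi>(2) NC(11,12)[of 0] by (simp_all add: add.assoc)
    have b1l: "b1 (int n + 1) \<in> hom (N (int n + 1)) (SO (x 0))" "a1 (int n + 1) \<in> hom (SO (x 0)) (N (int n + 1))"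
      using NC(4)[of "int n + 1"] NC(2)[of "int n + 1"] unfolding WS by simp_all
    have b2l: "b2 (int n + 1) \<in> hom (N (int n + 1)) (y (n + 1))" "a2 (int n + 1) \<in> hom (y (n + 1)) (N (int n + 1))"
      using NC(5)[of "int n + 1"] NC(3)[of "int n + 1"] V(3) by simp_all
    have dNl: "dN (int n + 1) = - (sig (a1 0) * (sig (w 0) * b1 (int n + 1)))
        + sig (a2 0) * (b1 (int n + 1) + \<rho> * b2 (int n + 1))"
      using NC(10)[of "int n + 1"] one_left[OF b1l(1)] o unfolding WS aS V(4)
      by (simp add: sig_one mult.assoc)
    \<comment> \<open>The term with \<sigma> compensates that the square of f and \<phi> commutes
      only up to homotopy. In degree n + 1 the summand \<open>- a1 (int n + 1) * \<rho>\<close>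
      matches the entry of \<open>dN\<close> that comes from
      \<open>w (int n + 1) = \<rho> * c\<close>.\<close>
    define I where "I m = (if m = n + 1 then a2 (int n + 1) - a1 (int n + 1) * \<rho>
      else a1 (int m) * (q (m + 1) * Q1 m) + a2 (int m) * (\<sigma> (m + 1) * Q1 m) + a2 (int m) * (\<gamma> m * Q2 m))" for m
    \<comment> \<open>In degree 0 there is no summand \<open>y 0\<close> to receive
      \<open>V 0\<close>; what would land there is sent on to \<open>x 1\<close> by
      \<open>d 0\<close>, as \<open>x 0\<close> and \<open>y 0\<close> coincide.\<close>
    define P where "P m = (if m = n + 1 then b2 (int n + 1)
      else if m = 0 then p 1 * b1 0 + d 0 * b2 0 - d 0 * (\<tau> 1 * b1 0)
      else J1 m * (p (m + 1) * b1 (int m)) - J2 m * (\<tau> (m + 1) * b1 (int m)) + J2 m * (\<beta> m * b2 (int m)))" for m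
    have n0: "0 \<noteq> n + 1" "0 < n" "1 \<le> n" "1 \<le> n + 1" using n_pos by simp_all
    have Ic: "cmap n M dM (\<lambda>i. N (int i)) (\<lambda>i. dN (int i)) I"
      unfolding cmap_def
    proof (intro conjI allI impI)
      fix i assume i: "i \<le> n + 1"
      show "I i \<in> hom (M i) (N (int i))"
      proof (cases "i = n + 1")
        case True
        then show ?thesis
          using hom_diff[OF b2l(2) hom_comp[OF \<rho> b1l(2)]] D(13) by (simp add: I_def add.commute)
      next
        case False
        then have i': "i \<le> n" "i + 1 \<le> n + 1" "i \<noteq> n + 1" using i by simp_all
        have "a2 (int i) * (\<gamma> i * Q2 i) \<in> hom (M i) (N (int i))"
        proof (cases "i = 0")
          case True
          then show ?thesis using D(7) split_sum_Obj[OF s i] angleD(2)[OF NC(1)] by (simp add: hom_zero)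
        next
          case False
          then show ?thesis using hom_comp[OF hom_comp[OF D(4)[of i] \<gamma>h[OF i]] NC(3)] i by simp
        qed
        moreover have "a1 (int i) * (q (i + 1) * Q1 i) \<in> hom (M i) (N (int i))"
          using hom_comp[OF hom_comp[OF D(2)[OF i'(1)] qh[OF i'(2), unfolded I1]] NC(2)] .
        moreover have "a2 (int i) * (\<sigma> (i + 1) * Q1 i) \<in> hom (M i) (N (int i))"
          using hom_comp[OF hom_comp[OF D(2)[OF i'(1)] \<sigma>(1)[OF i'(1)]] NC(3)] .
        ultimately show ?thesis unfolding I_def if_not_P[OF i'(3)] by (intro hom_add)
      qed
    next
      fix i assume i: "i \<le> n"
      have i': "i + 1 \<le> n + 1" "i \<le> n + 1" "i \<noteq> n + 1" "1 \<le> i + 1" using i by simp_all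
      have qs: "q (i + 1) \<in> hom (x (i + 1)) (W (int i + 1))" using qh[OF i'(1)] unfolding I1 .
      have \<gamma>e: "v (int i) * (\<gamma> i * z) = \<gamma> (i + 1) * (e i * z)" for z
        using mult_eq_left[OF cmapD(2)[OF \<gamma>c i], of z] by (simp only: mult.assoc)
      show "dN (int i) * I i = I (i + 1) * dM i"
      proof (cases "i = n")
        case True
        have ne: "\<rho> * (e n * z) = 0" for z using ey(2) mult_eq_left[of \<rho> "e n" 0] by simp
        have vs: "v (int n) * (\<sigma> (n + 1) * z) = 0" for z
          using \<sigma>(4) mult_eq_left[of "v (int n)" "\<sigma> (n + 1)" 0] by simp
        have Q: "Q1 n \<in> hom (M n) (x (n + 1))" using D(2)[of n] by simp
        have bQ: "b1 (int n) * (a1 (int n) * Q1 n) = Q1 n" using NK(1)[of "Q1 n" "M n" "int n"] Q W(3) by simp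
        have L: "dN (int n) * I n = - (a1 (int n + 1) * (\<rho> * (c * Q1 n))) + a2 (int n + 1) * (c * Q1 n) + a2 (int n + 1) * (e n * Q2 n)"
          unfolding NC(10)[of "int n"] I_def
          using NK(2)[of "q (n + 1)" "x (n + 1)" "int n"] NK(4)[of "\<sigma> (n + 1)" "x (n + 1)" "int n"]
            NK(4)[of "\<gamma> n" "y n" "int n"] NK(5,6)[of "int n"] qs \<sigma>(1)[OF i] \<gamma>h[OF i'(2)] W(4) \<phi>(3) vs
            \<gamma>e one_left[OF Q] one_left'[OF dy[of n]] ends True bQ
          by (simp add: algebra_simps)
        have R: "I (n + 1) * dM n = (a2 (int n + 1) - a1 (int n + 1) * \<rho>) * (c * Q1 n + e n * Q2 n)"
          unfolding dM[OF order_refl] I_def f(3) D(8,14)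
          using one_left'[OF c] one_left'[OF dy[of n]] by (simp add: distrib_left)
        show ?thesis unfolding True L R using ne by (simp add: algebra_simps)
      next
        case False
        then have j: "i < n" "i + 1 \<le> n" "i + 1 \<noteq> n + 1" using i by simp_all
        have wq: "w (int i + 1) * (q (i + 1) * z) = q (i + 2) * (d (i + 1) * z)" for z
          using mult_eq_left[OF cmapD(2)[OF qc j(2)], of z] unfolding I1 by (simp only: mult.assoc)
        have R3: "\<gamma> (i + 1) * (f (i + 1) * z) = \<phi> (int i + 1) * (q (i + 1) * z)
            + v (int i) * (\<sigma> (i + 1) * z) + \<sigma> (i + 2) * (d (i + 1) * z)" for z
          using mult_eq_left[OF \<sigma>(2)[OF j(1)], of z] by (simp add: algebra_simps)
        show ?thesis
          unfolding NC(10)[of "int i"] dM[OF i] I_def I1 if_not_P[OF i'(3)] if_not_P[OF j(3)]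
          using NK(2)[OF qs] NK(4)[OF \<sigma>(1)[OF i]] NK(4)[OF \<gamma>h[OF i'(2)]] NK(5,6)[of "int i"]
            K(2)[OF j(2) dx[OF j(2)]] K(4)[OF i'(4,1) fh[OF i'(1)]] K(4)[OF i'(4,1) dy[OF i]] K(5,6)[OF i'(1)]
            wq R3 \<gamma>e
          by (simp add: algebra_simps del: One_nat_def add_Suc_right add_2_eq_Suc')
      qed
    qed
    have d01: "d 1 * (d 0 * z) = 0" for z
      using cpxD(3)[OF cx, of 0] n0 mult_eq_left[of "d 1" "d 0" 0] by simp
    have f1d0: "f 1 * (d 0 * z) = e 0 * z" for z
      using cmapD(2)[OF f(1), of 0] mult_eq_left[of "f 1" "d 0"] f(2) one_right[OF dy[of 0]] xy by simp
    have Pc: "cmap n (\<lambda>i. N (int i)) (\<lambda>i. dN (int i)) M dM P"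
      unfolding cmap_def
    proof (intro conjI allI impI)
      fix i assume i: "i \<le> n + 1"
      show "P i \<in> hom (N (int i)) (M i)"
      proof (cases "i = n + 1")
        case True
        then show ?thesis using b2l D(13) by (simp add: P_def add.commute)
      next
        case False
        then have i': "i \<le> n" "i + 1 \<le> n + 1" "i \<noteq> n + 1" using i by simp_all
        note pb = hom_comp[OF NC(4)[of "int i"] ph[OF i'(2), unfolded I1]]
          and tb = hom_comp[OF NC(4)[of "int i"] \<tau>(1)[OF i'(1)]]
        show ?thesis
        proof (cases "i = 0")
          case True
          have d0: "d 0 \<in> hom (V 0) (x 1)" using dx[of 0] V(2) xy by simp
          have d0': "d 0 \<in> hom (y 0) (x 1)" using dx[of 0] xy by simp
          show ?thesis
            using pb hom_comp[OF NC(5)[of 0] d0] hom_comp[OF tb, of "d 0" "x 1"] d0' True D(10) n0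
            by (simp add: P_def hom_add hom_diff)
        next
          case False
          then have i1: "1 \<le> i" by simp
          have bb: "\<beta> i * b2 (int i) \<in> hom (N (int i)) (y i)" using hom_comp[OF NC(5) \<beta>h[OF i]] .
          show ?thesis
            unfolding P_def if_not_P[OF i'(3)] if_not_P[OF False]
            using hom_add[OF hom_diff[OF hom_comp[OF pb D(1)[OF i'(1)]] hom_comp[OF tb D(3)[OF i1 i]]] hom_comp[OF bb D(3)[OF i1 i]]] .
        qed
      qed
    next
      fix i assume i: "i \<le> n"
      have i': "i + 1 \<le> n + 1" "i \<le> n + 1" "i \<noteq> n + 1" "1 \<le> i + 1" "i + 1 \<noteq> 0" using i by simp_all
      have ps: "p (i + 1) \<in> hom (W (int i + 1)) (x (i + 1))" using ph[OF i'(1)] unfolding I1 .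
      have \<beta>v: "\<beta> (i + 1) * (v (int i) * z) = e i * (\<beta> i * z)" for z
        using mult_eq_left[OF cmapD(2)[OF \<beta>c i], of z] by (simp only: mult.assoc)
      show "dM i * P i = P (i + 1) * dN (int i)"
      proof (cases "i = n")
        case True
        have nn: "n \<noteq> n + 1" "n \<noteq> 0" "n \<le> n" "n \<le> n + 1" using n0 by simp_all
        have et: "e n * (\<tau> (n + 1) * z) = 0" for z using \<tau>(4) mult_eq_left[of "e n" "\<tau> (n + 1)" 0] by simp
        have B: "b1 (int n) \<in> hom (N (int n)) (x (n + 1))" using NC(4)[of "int n"] W(3) by simp
        have vn: "v (int n) \<in> hom (V (int n)) (y (n + 1))" using DV(3)[of "int n"] V(3) by simp
        have L: "dM n * P n = c * b1 (int n) + v (int n) * b2 (int n)"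
          unfolding dM[OF nn(3)] P_def if_not_P[OF nn(1)] if_not_P[OF nn(2)] f(3) D(8,14)
          using one_left'[OF c] one_left'[OF dy[of n]] K(2)[OF nn(3), of "p (n + 1)" "W (int n + 1)"] ps
            K(4)[OF n0(3) nn(4) \<tau>(1)[OF nn(3)]] K(4)[OF n0(3) nn(4) \<beta>h[OF nn(4)]] K(5,6)[OF nn(4)] True
            \<beta>v[unfolded True, symmetric] et ends one_left[OF B] one_left'[OF vn]
            K(1)[OF nn(3) B]
          by (simp add: algebra_simps)
        have R: "P (n + 1) * dN (int n) = c * b1 (int n) + v (int n) * b2 (int n)"
          unfolding NC(10)[of "int n"] P_def \<phi>(3)
          using NK(4)[of c "x (n + 1)" "int n + 1"] NK(4)[of "v (int n)" "V (int n)" "int n + 1"] c vn V(3)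
            NK(5)[of "int n + 1"] by (simp add: algebra_simps)
        show ?thesis unfolding True L R ..
      next
        case False
        then have j: "i < n" "i + 1 \<le> n" "i + 1 \<noteq> n + 1" using i by simp_all
        have wp: "d (i + 1) * (p (i + 1) * z) = p (i + 2) * (w (int i + 1) * z)" for z
          using mult_eq_left[OF cmapD(2)[OF pc j(2)], of z] unfolding I1 by (simp only: mult.assoc)
        have S3: "f (i + 1) * (p (i + 1) * z) =
            \<beta> (i + 1) * (\<phi> (int i + 1) * z) + e i * (\<tau> (i + 1) * z) + \<tau> (i + 2) * (w (int i + 1) * z)" for z
          using mult_eq_left[OF \<tau>(2)[OF j(1)], of z] by (simp add: algebra_simps)
        have R: "P (i + 1) * dN (int i) = - (J1 (i + 1) * (p (i + 2) * (w (int i + 1) * b1 (int i))))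
            + J2 (i + 1) * (\<tau> (i + 2) * (w (int i + 1) * b1 (int i)))
            + J2 (i + 1) * (\<beta> (i + 1) * (\<phi> (int i + 1) * b1 (int i)))
            + J2 (i + 1) * (e i * (\<beta> i * b2 (int i)))"
          unfolding NC(10)[of "int i"] P_def I1 if_not_P[OF j(3)] if_not_P[OF i'(5)]
          using NK(2)[of "w (int i + 1)" "W (int i + 1)" "int i + 1"] DW(3)[of "int i + 1"]
            NK(4)[of "\<phi> (int i + 1)" "W (int i + 1)" "int i + 1"] \<phi>h[of "int i + 1"]
            NK(4)[of "v (int i)" "V (int i)" "int i + 1"] DV(3)[of "int i"] NK(5,6)[of "int i + 1"] \<beta>v
          by (simp add: algebra_simps del: One_nat_def add_Suc_right add_2_eq_Suc')
        show ?thesis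
        proof (cases "i = 0")
          case True
          have B: "b2 0 \<in> hom (N 0) (y 0)" using NC(5)[of 0] V(2) by simp
          have p1: "p 1 \<in> hom (W 1) (x 1)" and t1: "\<tau> 1 \<in> hom (W 1) (y 0)"
            using ps \<tau>(1)[of 0] True by simp_all
          have P0: "P 0 = p 1 * b1 0 + d 0 * b2 0 - d 0 * (\<tau> 1 * b1 0)" using n0 by (simp add: P_def)
          show ?thesis
            unfolding R unfolding True dM[OF le0] P0 D(7,12)
            using one_left'[OF p1] one_left'[OF dx[of 0]] wp[unfolded True] S3[unfolded True] d01 f1d0 ends one_left[OF B]
            by (simp add: algebra_simps)
        next
          case False
          then have i1: "1 \<le> i" by simp
          show ?thesis
            unfolding R unfolding dM[OF i] P_def I1 if_not_P[OF i'(3)] if_not_P[OF False]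
            using K(2)[OF i ps] K(4)[OF i1 i'(2) \<tau>(1)[OF i]] K(4)[OF i1 i'(2) \<beta>h[OF i'(2)]] K(5,6)[OF i'(2)] wp S3
            by (simp add: algebra_simps del: One_nat_def add_Suc_right add_2_eq_Suc')
        qed
      qed
    qed
    have I0: "I 0 = a1 0 * q 1 + a2 0 * \<sigma> 1"
      using n0 qh[of 1] \<sigma>(1)[of 0] one_right[of "q 1" "x 1"] one_right[of "\<sigma> 1" "x 1"] by (simp add: I_def D(7,12))
    have P0: "P 0 = p 1 * b1 0 + d 0 * b2 0 - d 0 * (\<tau> 1 * b1 0)" using n0 by (simp add: P_def)
    have w0: "w 0 = q 1 * d 0" "p 1 * w 0 = d 0"
      using cmapD(2)[OF qc, of 0] cmapD(2)[OF pc, of 0] ends one_right[OF dx[of 0]] one_right[of "w 0" "x 0" "W 1"] DW(3)[of 0] W(2)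
      by simp_all
    have sz: "sig (\<sigma> 1) * (sig (d 0) * z) = 0" "sig (\<tau> 1) * (sig (w 0) * z) = 0"
        "sig (p 1) * (sig (w 0) * z) = sig (d 0) * z" "sig (q 1) * (sig (d 0) * z) = sig (w 0) * z" for z
      using arg_cong[OF \<sigma>(3), of sig] arg_cong[OF \<tau>(3), of sig] arg_cong[OF w0(2), of sig] arg_cong[OF w0(1), of sig]
        mult_eq_left[of "sig (\<sigma> 1)" "sig (d 0)" 0] mult_eq_left[of "sig (\<tau> 1)" "sig (w 0)" 0]
        mult_eq_left[of "sig (p 1)" "sig (w 0)"] mult_eq_left[of "sig (q 1)" "sig (d 0)"] by simp_all
    have sI: "sig (I 0) * (sig (d 0) * \<rho>) = dN (int n + 1) * I (n + 1)"
      unfolding dNl I0 unfolding I_def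
      using NK(1)[of \<rho> "y (n + 1)" "int n + 1"] NC(7)[of "int n + 1"] \<rho> WS(1) NK(5-8)[of "int n + 1"] V(3) one_right[OF \<rho>] sz
      by (simp add: algebra_simps)
    have sb: "sig (b1 0) * (sig (a1 0) * z) = sig (b1 0 * a1 0) * z" "sig (b2 0) * (sig (a2 0) * z) = sig (b2 0 * a2 0) * z"
        "sig (b1 0) * (sig (a2 0) * z) = 0" "sig (b2 0) * (sig (a1 0) * z) = 0" for z
      using arg_cong[OF NC(8)[of 0], of sig] arg_cong[OF NC(9)[of 0], of sig]
        mult_eq_left[of "sig (b1 0)" "sig (a2 0)" 0] mult_eq_left[of "sig (b2 0)" "sig (a1 0)" 0]
      by (simp_all add: mult.assoc)
    have sw: "sig (w 0) \<in> hom (SO (x 0)) (SO (W 1))" using sig_hom[OF DW(3)[of 0]] W(2) by simp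
    have sP: "sig (P 0) * dN (int n + 1) = sig (d 0) * \<rho> * P (n + 1)"
      unfolding dNl P0 unfolding P_def
      using sb NC(6,7)[of 0] DW(2)[of 1] DV(2)[of 0] V(2) xy sz one_left'[OF sw] one_left[OF b1l(1)] one_left'[OF \<rho>] 
      by (simp add: algebra_simps sig_one del: sig_simps(4)) (simp add: sz algebra_simps)
    have PI: "P (n + 1) * I (n + 1) = one (M (n + 1))"
      unfolding P_def I_def using NC(7)[of "int n + 1"] NK(5)[of "int n + 1"] V(3) D(13) by (simp add: right_diff_distrib)
    show "realizes M dM (sig (d 0) * \<rho>)"
      by (rule realizes_via_first[OF M(1-3) NC(1) Ic Pc sI sP PI])
        (rule cone_exact(4)[OF x y xy f s, of dM], erule dM)
  qed
qed

text \<open>The cocone and the shifted cone of (F4) have opposite signs on the diagonal, which makes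
  the natural comparison maps anticommute with the differentials. The factor (-1)^i turns them into
  chain maps.\<close>

definition alt :: "nat \<Rightarrow> ('o, 'm) gen \<Rightarrow> ('o, 'm) gen"
  where "alt i z = (if even i then z else - z)"

lemma alt_last: "alt (n + 1) z = - tw z"
  by (simp add: alt_def tw_def)

lemma cmap_alt:
  assumes "\<And>i. i \<le> n + 1 \<Longrightarrow> f i \<in> hom (x i) (y i)" "\<And>i. i \<le> n \<Longrightarrow> e i * f i = - (f (i + 1) * d i)"
  shows "cmap n x d y e (\<lambda>i. alt i (f i))"
  using assms by (simp add: cmap_def alt_def hom_uminus)

text \<open>The cocone is compared with the cone \<open>N\<close> rotated back by one step, so that
  degree i of \<open>M\<close> meets \<open>N (i - 1)\<close> with its summands \<open>W i\<close>
  and \<open>V (i - 1)\<close>. The extra summands are now \<open>V (- 1)\<close> in degree 0 and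
  \<open>W (n + 1)\<close> in degree n + 1.\<close>

lemma cocone_realizes:
  assumes x: "realizes x d \<delta>" and y: "realizes y e (sig a * \<delta>)" and xy: "x (n + 1) = y (n + 1)"
    and a: "a \<in> hom (x 0) (y 0)"
  obtains f where "cmap n x d y e f" "f 0 = a" "f (n + 1) = one (x (n + 1))"
    "\<And>M dM J1 J2 Q1 Q2. \<lbrakk>split_sum n x (\<lambda>m. y (m - 1)) M J1 J2 Q1 Q2;
      \<And>m. m \<le> n \<Longrightarrow> dM m = J1 (m + 1) * d m * Q1 m
        + J2 (m + 1) * (f m * Q1 m - e (m - 1) * Q2 m)\<rbrakk> \<Longrightarrow> realizes M dM (\<delta> * e n)"
proof -
  have cx: "cpx n x d" and cy: "cpx n y e" using x y by (simp_all add: realizes_def)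
  note ex = realizes_exact[OF x] and ey = realizes_exact[OF y]
  have o: "x (n + 1) \<in> Obj C" using cpxD(1)[OF cx, of "n + 1"] by simp
  have c: "one (x (n + 1)) \<in> hom (x (n + 1)) (y (n + 1))" using one_hom[OF o] xy by simp
  have sq: "sig a * \<delta> = sig a * \<delta> * one (x (n + 1))"
    using one_right[OF ex(1)] by (simp add: mult.assoc)
  obtain W w V v \<phi> N dN a1 a2 b1 b2 p q \<beta> \<gamma> f \<sigma> \<tau> where
    W: "angle W w" "W 0 = x 0" "W (int n + 1) = x (n + 1)" "w (int n + 1) = \<delta>"
    and V: "angle V v" "V 0 = y 0" "V (int n + 1) = y (n + 1)" "v (int n + 1) = sig a * \<delta>"
    and \<phi>: "angle_map W w V v \<phi>" "\<phi> 0 = a" "\<phi> (int n + 1) = one (x (n + 1))"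
    and N: "angle_cone W w V v \<phi> N dN a1 a2 b1 b2"
    and p: "fmap n (\<lambda>i. W (int i)) (\<lambda>i. w (int i)) x d p" and q: "fmap n x d (\<lambda>i. W (int i)) (\<lambda>i. w (int i)) q"
    and \<beta>: "fmap n (\<lambda>i. V (int i)) (\<lambda>i. v (int i)) y e \<beta>" and \<gamma>: "fmap n y e (\<lambda>i. V (int i)) (\<lambda>i. v (int i)) \<gamma>"
    and f: "cmap n x d y e f" "f 0 = a" "f (n + 1) = one (x (n + 1))"
    and \<sigma>: "\<forall>i\<le>n. \<sigma> (i + 1) \<in> hom (x (i + 1)) (V (int i))"
    "\<forall>i<n. \<gamma> (i + 1) * f (i + 1) = \<phi> (int i + 1) * q (i + 1) + v (int i) * \<sigma> (i + 1) + \<sigma> (i + 2) * d (i + 1)"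
    "\<sigma> 1 * d 0 = 0" "v (int n) * \<sigma> (n + 1) = 0"
    and \<tau>: "\<forall>i\<le>n. \<tau> (i + 1) \<in> hom (W (int i + 1)) (y i)"
    "\<forall>i<n. f (i + 1) * p (i + 1) = \<beta> (i + 1) * \<phi> (int i + 1) + e i * \<tau> (i + 1) + \<tau> (i + 2) * w (int i + 1)"
    "\<tau> 1 * w 0 = 0" "e n * \<tau> (n + 1) = 0"
    by (rule realizes_lift_cone[OF x y a c sq]) (rule that; assumption)
  note \<sigma> = \<sigma>(1)[rule_format] \<sigma>(2)[rule_format] \<sigma>(3,4) and \<tau> = \<tau>(1)[rule_format] \<tau>(2)[rule_format] \<tau>(3,4)
  show ?thesis
  proof (rule that[OF f])
    fix M dM J1 J2 Q1 Q2
    assume s: "split_sum n x (\<lambda>m. y (m - 1)) M J1 J2 Q1 Q2"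
      and dM: "\<And>m. m \<le> n \<Longrightarrow> dM m = J1 (m + 1) * d m * Q1 m
        + J2 (m + 1) * (f m * Q1 m - e (m - 1) * Q2 m)"
    note D = split_sumD[OF s] and K = split_sum_cancel[OF s]
    have M: "cpx n M dM" "con_exact n M dM" "\<delta> * e n \<in> hom (M (n + 1)) (SO (M 0))"
      by (rule cocone_exact[OF x y xy f s]; erule dM)+
    have dx: "d i \<in> hom (x i) (x (i + 1))" and dy: "e i \<in> hom (y i) (y (i + 1))" if "i \<le> n" for i
      using that cpxD(2)[OF cx] cpxD(2)[OF cy] by simp_all
    have pc: "cmap n (\<lambda>i. W (int i)) (\<lambda>i. w (int i)) x d p" and qc: "cmap n x d (\<lambda>i. W (int i)) (\<lambda>i. w (int i)) q"
      and \<beta>c: "cmap n (\<lambda>i. V (int i)) (\<lambda>i. v (int i)) y e \<beta>" and \<gamma>c: "cmap n y e (\<lambda>i. V (int i)) (\<lambda>i. v (int i)) \<gamma>"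
      using p q \<beta> \<gamma> by (simp_all add: fmap_def)
    have ends: "p (n + 1) = one (x (n + 1))" "q (n + 1) = one (x (n + 1))" "q 0 = one (x 0)" "p 0 = one (x 0)"
      "\<beta> 0 = one (y 0)" "\<beta> (n + 1) = one (y (n + 1))" "\<gamma> (n + 1) = one (y (n + 1))" "\<gamma> 0 = one (y 0)"
      using p q \<beta> \<gamma> W V unfolding fmap_def int_plus_1 by simp_all
    have ph: "p i \<in> hom (W (int i)) (x i)" and qh: "q i \<in> hom (x i) (W (int i))"
      and \<beta>h: "\<beta> i \<in> hom (V (int i)) (y i)" and \<gamma>h: "\<gamma> i \<in> hom (y i) (V (int i))" and fh: "f i \<in> hom (x i) (y i)"
      if "i \<le> n + 1" for i
      using that cmapD(1)[OF pc] cmapD(1)[OF qc] cmapD(1)[OF \<beta>c] cmapD(1)[OF \<gamma>c] cmapD(1)[OF f(1)] by simp_all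
    note DW = angleD[OF W(1)] and DV = angleD[OF V(1)]
    note NC = angle_coneD[OF N] and NK = angle_cone_cancel[OF N]
    have \<phi>h: "\<phi> i \<in> hom (W i) (V i)" and \<phi>v: "v i * \<phi> i = \<phi> (i + 1) * w i" and \<phi>p: "\<phi> (i + per) = sig (\<phi> i)" for i
      using \<phi>(1) unfolding angle_map_def by blast+
    have m1: "(- 1 :: int) + 1 = 0" "- 1 + per = int n + 1" by simp_all
    have Mn: "M (n + 1) = y n" "J2 (n + 1) = one (y n)" "Q2 (n + 1) = one (y n)" using D(13-15) by simp_all
    have tws: "w (int n + 1) = tw (sig (w (- 1)))" "a1 (int n + 1) = tw (sig (a1 (- 1)))"
      "a2 (int n + 1) = sig (a2 (- 1))" "W (int n + 1) = SO (W (- 1))" "V (int n + 1) = SO (V (- 1))"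
      "\<phi> (int n + 1) = sig (\<phi> (- 1))"
      using DW(4,5)[of "- 1"] DV(4)[of "- 1"] NC(11,12)[of "- 1"] \<phi>p[of "- 1"] unfolding m1 by simp_all
    have "SO (W (- 1)) = SO (V (- 1))" using tws(4,5) W(3) V(3) xy by simp
    then have WV: "W (- 1) = V (- 1)" using SOi_SO by metis
    \<comment> \<open>Position -1 lies one period before n + 1, where \<phi> is an identity;
      injectivity of \<open>sig\<close> carries this back, and the square at -1 becomes
      \<open>a * w (- 1) = v (- 1)\<close>.\<close>
    have "sig (\<phi> (- 1)) = sig (one (W (- 1)))"
      using tws(4,6) \<phi>(3) W(3) DW(2)[of "- 1"] by (simp add: sig_one)
    then have "\<phi> (- 1) = one (W (- 1))" using sig_eq_iff by blast
    then have aw: "a * w (- 1) = v (- 1)"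
      using \<phi>v[of "- 1"] \<phi>(2) one_right[OF DV(3)[of "- 1"]] WV by simp
    have w1: "w (- 1) \<in> hom (V (- 1)) (x 0)" using DW(3)[of "- 1"] WV W(2) by simp
    have n0: "0 \<noteq> n + 1" "0 < n" "1 \<le> n" "1 \<le> n + 1" "1 \<noteq> n + 1" using n_pos by simp_all
    \<comment> \<open>In degree n + 1 there is no projection onto \<open>x (n + 1)\<close>. Since x
      and y share their last object, \<open>e n\<close> takes its place. The minus signs make
      \<open>I\<close> anticommute with the differentials.\<close>
    define I where "I m = (if m = n + 1 then a2 (int n) * (\<gamma> n - \<sigma> (n + 1) * e n) - a1 (int n) * e n
      else if m = 0 then - a1 (- 1)
      else a2 (int (m - 1)) * (\<gamma> (m - 1) * Q2 m) - a1 (int (m - 1)) * (q m * Q1 m) - a2 (int (m - 1)) * (\<sigma> m * Q1 m))" for m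
    \<comment> \<open>In degree 0 the extra summand \<open>V (- 1)\<close>, which equals
      \<open>W (- 1)\<close>, is sent to \<open>x 0\<close> by \<open>w (- 1)\<close>.\<close>
    define P where "P m = (if m = n + 1 then \<beta> n * b2 (int n) - \<tau> (n + 1) * b1 (int n)
      else if m = 0 then - (b1 (- 1) + w (- 1) * b2 (- 1))
      else J2 m * (\<beta> (m - 1) * b2 (int (m - 1))) - J1 m * (p m * b1 (int (m - 1))) - J2 m * (\<tau> m * b1 (int (m - 1))))" for m
    have IS: "I (j + 1) = a2 (int j) * (\<gamma> j * Q2 (j + 1)) - a1 (int j) * (q (j + 1) * Q1 (j + 1)) - a2 (int j) * (\<sigma> (j + 1) * Q1 (j + 1))"
      and PS: "P (j + 1) = J2 (j + 1) * (\<beta> j * b2 (int j)) - J1 (j + 1) * (p (j + 1) * b1 (int j)) - J2 (j + 1) * (\<tau> (j + 1) * b1 (int j))"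
      if "j < n" for j
      using that by (simp_all add: I_def P_def)
    have IL: "I (n + 1) = a2 (int n) * (\<gamma> n - \<sigma> (n + 1) * e n) - a1 (int n) * e n"
      and PL: "P (n + 1) = \<beta> n * b2 (int n) - \<tau> (n + 1) * b1 (int n)"
      and I0: "I 0 = - a1 (- 1)" and P0: "P 0 = - (b1 (- 1) + w (- 1) * b2 (- 1))"
      by (simp_all add: I_def P_def)
    have J1: "int (j + 1) = int j + 1" "j + 1 + 1 = j + 2" "j + 1 - 1 = j" "int j + 1 + - 1 = int j" "int j + - 1 + 1 = int j"
      "(0::int) + - 1 = - 1" for j :: nat by simp_all
    have \<gamma>e: "v (int i) * (\<gamma> i * z) = \<gamma> (i + 1) * (e i * z)"
      and \<beta>v: "\<beta> (i + 1) * (v (int i) * z) = e i * (\<beta> i * z)"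
      and wq: "w (int i) * (q i * z) = q (i + 1) * (d i * z)"
      and wp: "d i * (p i * z) = p (i + 1) * (w (int i) * z)" if i: "i \<le> n" for i z
      using mult_eq_left[OF cmapD(2)[OF \<gamma>c i], of z] mult_eq_left[OF cmapD(2)[OF \<beta>c i], of z]
        mult_eq_left[OF cmapD(2)[OF qc i], of z] mult_eq_left[OF cmapD(2)[OF pc i], of z]
      by (simp_all only: mult.assoc)
    have R3: "\<gamma> (j + 1) * (f (j + 1) * z) = \<phi> (int j + 1) * (q (j + 1) * z)
        + v (int j) * (\<sigma> (j + 1) * z) + \<sigma> (j + 2) * (d (j + 1) * z)"
      and S3: "f (j + 1) * (p (j + 1) * z) =
        \<beta> (j + 1) * (\<phi> (int j + 1) * z) + e j * (\<tau> (j + 1) * z) + \<tau> (j + 2) * (w (int j + 1) * z)"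
      if "j < n" for j z
      using mult_eq_left[OF \<sigma>(2)[OF that], of z] mult_eq_left[OF \<tau>(2)[OF that], of z] by (simp_all add: algebra_simps)
    have enf: "e n * (f n * z) = d n * z" for z
      using cmapD(2)[OF f(1), of n] mult_eq_left[of "e n" "f n" "d n"] f(3) one_left[OF dx[of n]] by simp
    have w0: "w 0 = q 1 * d 0" "p 1 * w 0 = d 0"
      using cmapD(2)[OF qc, of 0] cmapD(2)[OF pc, of 0] ends one_right[OF dx[of 0]] one_right[of "w 0" "x 0" "W 1"] DW(3)[of 0] W(2)
      by simp_all
    have dw: "d 0 * (w (- 1) * z) = 0" for z
      using angle_complex[OF W(1), of "- 1"] w0(2) mult_eq_left[of "w 0" "w (- 1)" 0] by (simp flip: w0(2) add: mult.assoc)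
    have a1n: "a1 (- 1) \<in> hom (x 0) (N (- 1))" and b1n: "b1 (- 1) \<in> hom (N (- 1)) (x 0)"
      using NC(2)[of "- 1"] NC(4)[of "- 1"] W(2) by simp_all
    have Ia: "cmap n M dM (\<lambda>i. N (int i + - 1)) (\<lambda>i. dN (int i + - 1)) (\<lambda>i. alt i (I i))"
    proof (rule cmap_alt)
      fix i assume i: "i \<le> n + 1"
      show "I i \<in> hom (M i) (N (int i + - 1))"
      proof (cases i)
        case 0
        then show ?thesis using a1n D(10) by (simp add: I0 hom_uminus)
      next
        case (Suc j)
        then have ij: "i = j + 1" "j \<le> n" using i by simp_all
        show ?thesis
        proof (cases "j = n")
          case True
          have en: "e n \<in> hom (y n) (x (n + 1))" using dy[of n] xy by simp
          have en': "e n \<in> hom (y n) (W (int n + 1))" using en W(3) by simp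
          show ?thesis
            unfolding ij True IL Mn J1
            by (rule hom_diff[OF hom_comp[OF hom_diff[OF \<gamma>h hom_comp[OF en \<sigma>(1)]] NC(3)] hom_comp[OF en' NC(2)]]) simp_all
        next
          case False
          then have j: "j < n" "j + 1 \<le> n" "j \<le> n + 1" "1 \<le> j + 1" "j + 1 \<le> n + 1" using ij by simp_all
          have "Q2 (j + 1) \<in> hom (M (j + 1)) (y j)" using D(4)[OF j(4,5)] unfolding J1 .
          moreover have "q (j + 1) \<in> hom (x (j + 1)) (W (int j + 1))" using qh[OF j(5)] unfolding J1 .
          ultimately show ?thesis
            unfolding ij IS[OF j(1)] J1
            using D(2)[OF j(2)] \<gamma>h[OF j(3)] \<sigma>(1)[OF ij(2)] NC(2,3)[of "int j"]
            by (intro hom_diff) (rule hom_comp[OF hom_comp], assumption+)+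
        qed
      qed
    next
      fix i assume i: "i \<le> n"
      show "dN (int i + - 1) * I i = - (I (i + 1) * dM i)"
      proof (cases i)
        case 0
        have sd: "\<sigma> 1 * (d 0 * z) = 0" for z using \<sigma>(3) mult_eq_left[of "\<sigma> 1" "d 0" 0] by simp
        have w0x: "w 0 \<in> hom (x 0) (W 1)" using DW(3)[of 0] W(2) by simp
        have L: "dN (- 1) * I 0 = a1 0 * w 0 - a2 0 * a"
          unfolding NC(10)[of "- 1"] m1 I0 \<phi>(2)
          using NC(6)[of "- 1"] NC(8)[of "- 1"] W(2) one_right[OF w0x] one_right[OF a] mult_eq_left[OF NC(6)[of "- 1"]]
          by (simp add: algebra_simps)
        have dM0: "dM 0 = J1 1 * d 0 + J2 1 * a"
          using dM[of 0] D(7,12) f(2) one_right[OF dx[of 0]] one_right[OF a] by (simp add: mult.assoc)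
        have I1: "I 1 = a2 0 * (\<gamma> 0 * Q2 1) - a1 0 * (q 1 * Q1 1) - a2 0 * (\<sigma> 1 * Q1 1)"
          using IS[OF n0(2)] by simp
        have R: "I 1 * dM 0 = a2 0 * a - a1 0 * w 0"
          unfolding I1 dM0
          using K(1)[OF n0(3), of "d 0" "x 0"] dx[of 0] K(3)[OF order_refl n0(4), of a "x 0"] a K(5,6)[OF n0(4)] \<sigma>(3) w0(1)
            ends one_left[OF a] by (simp add: algebra_simps)
        show ?thesis unfolding 0 using L R by simp
      next
        case (Suc j)
        then have ij: "i = j + 1" "j < n" "j + 1 \<le> n" "j \<le> n" "j + 1 \<le> n + 1" "1 \<le> j + 1" "j \<le> n + 1" using i by simp_all
        have qs: "q (j + 1) \<in> hom (x (j + 1)) (W (int j + 1))" using qh[OF ij(5)] unfolding J1 .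
        have L: "dN (int j) * I (j + 1) = a1 (int j + 1) * (q (j + 2) * (d (j + 1) * Q1 (j + 1)))
            - a2 (int j + 1) * (\<phi> (int j + 1) * (q (j + 1) * Q1 (j + 1))) - a2 (int j + 1) * (v (int j) * (\<sigma> (j + 1) * Q1 (j + 1)))
            + a2 (int j + 1) * (\<gamma> (j + 1) * (e j * Q2 (j + 1)))"
          unfolding NC(10)[of "int j"] IS[OF ij(2)]
          using NK(2)[OF qs] NK(4)[OF \<sigma>(1)[OF ij(4)]] NK(4)[OF \<gamma>h[OF ij(7)]] NK(5,6)[of "int j"]
            wq[OF ij(3), unfolded J1] \<gamma>e[OF ij(4)]
          by (simp add: algebra_simps del: One_nat_def add_Suc_right add_2_eq_Suc')
        show ?thesis
        proof (cases "j + 1 = n")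
          case True
          have ee: "e n * (e j * z) = 0" for z
            using cpxD(3)[OF cy ij(2)] mult_eq_left[of "e n" "e j" 0] True by simp
          have dMn: "dM (j + 1) = f n * Q1 n - e j * Q2 n"
            unfolding dM[OF ij(3)] J1(3) unfolding True D(8) Mn
            using one_left'[OF fh[of n]] one_left'[OF dy[OF ij(4)]] True by (simp add: right_diff_distrib)
          have I2: "I (j + 1 + 1) = a2 (int j + 1) * (\<gamma> n - \<sigma> (n + 1) * e n) - a1 (int j + 1) * e n"
            using IL True by (metis J1(1))
          have "q (n + 1) * (d n * z) = d n * z" for z using ends one_left'[OF dx[of n]] by simp
          moreover have jn: "j + 2 = n + 1" using True by simp
          ultimately show ?thesis
            unfolding ij J1(1,4) L I2 dMn
            using R3[OF ij(2)] enf ee unfolding True jn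
            by (simp add: algebra_simps del: One_nat_def add_Suc_right add_2_eq_Suc')
        next
          case False
          then have j: "j + 1 < n" "j + 2 \<le> n" "j + 2 \<le> n + 1" "1 \<le> j + 2" using ij by simp_all
          have I2: "I (j + 2) = a2 (int j + 1) * (\<gamma> (j + 1) * Q2 (j + 2)) - a1 (int j + 1) * (q (j + 2) * Q1 (j + 2))
              - a2 (int j + 1) * (\<sigma> (j + 2) * Q1 (j + 2))"
            using IS[OF j(1)] unfolding J1 .
          have e2: "j + 2 - 1 = j + 1" by simp
          show ?thesis
            unfolding ij J1(1,2,4) L I2 dM[OF ij(3)] J1(2,3)
            using K(2)[OF j(2) dx[OF ij(3), unfolded J1]] K(4)[OF j(4,3), unfolded e2, OF fh[OF ij(5)]]
              K(4)[OF j(4,3), unfolded e2, OF dy[OF ij(4)]] K(5,6)[OF j(3)] R3[OF ij(2)]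
            by (simp add: algebra_simps del: One_nat_def add_Suc_right add_2_eq_Suc')
        qed
      qed
    qed
    have Pa: "cmap n (\<lambda>i. N (int i + - 1)) (\<lambda>i. dN (int i + - 1)) M dM (\<lambda>i. alt i (P i))"
    proof (rule cmap_alt)
      fix i assume i: "i \<le> n + 1"
      show "P i \<in> hom (N (int i + - 1)) (M i)"
      proof (cases i)
        case 0
        then show ?thesis using b1n hom_comp[OF NC(5) w1] D(10) by (simp add: P0 hom_uminus hom_add del: minus_add_distrib)
      next
        case (Suc j)
        then have ij: "i = j + 1" "j \<le> n" "j \<le> n + 1" "j + 1 \<le> n + 1" "1 \<le> j + 1" using i by simp_all
        note bb = hom_comp[OF NC(5) \<beta>h[OF ij(3)]] and tb = hom_comp[OF NC(4) \<tau>(1)[OF ij(2)]]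
        show ?thesis
        proof (cases "j = n")
          case True
          show ?thesis
            unfolding ij True PL Mn J1 using bb tb unfolding True by (rule hom_diff)
        next
          case False
          then have j: "j < n" "j + 1 \<le> n" using ij by simp_all
          have J2: "J2 (j + 1) \<in> hom (y j) (M (j + 1))" using D(3)[OF ij(5,4)] unfolding J1 .
          have ps: "p (j + 1) \<in> hom (W (int j + 1)) (x (j + 1))" using ph[OF ij(4)] unfolding J1 .
          show ?thesis
            unfolding ij PS[OF j(1)] J1
            by (intro hom_diff hom_comp[OF bb J2] hom_comp[OF tb J2] hom_comp[OF hom_comp[OF NC(4) ps] D(1)[OF j(2)]])
        qed
      qed
    next
      fix i assume i: "i \<le> n"
      show "dM i * P i = - (P (i + 1) * dN (int i + - 1))"
      proof (cases i)
        case 0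
        have dM0: "dM 0 = J1 1 * d 0 + J2 1 * a"
          using dM[of 0] D(7,12) f(2) one_right[OF dx[of 0]] one_right[OF a] by (simp add: mult.assoc)
        have P1: "P 1 = J2 1 * (\<beta> 0 * b2 0) - J1 1 * (p 1 * b1 0) - J2 1 * (\<tau> 1 * b1 0)"
          using PS[OF n0(2)] by simp
        have tw0: "\<tau> 1 * (w 0 * z) = 0" "p 1 * (w 0 * z) = d 0 * z" "a * (w (- 1) * z) = v (- 1) * z" for z
          using \<tau>(3) mult_eq_left[of "\<tau> 1" "w 0" 0] w0(2) mult_eq_left[of "p 1" "w 0"] mult_eq_left[OF aw] by simp_all
        have ah: "a \<in> hom (x 0) (V 0)" and vh: "v (- 1) \<in> hom (V (- 1)) (V 0)" and w0h: "w 0 \<in> hom (x 0) (W (0 + 1))"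
          using a V(2) DV(3)[of "- 1"] DW(3)[of 0] W(2) by simp_all
        have oy: "one (y 0) * (a * z) = a * z" "one (y 0) * (v (- 1) * z) = v (- 1) * z" for z
          using one_left'[OF ah] one_left'[OF vh] V(2) by simp_all
        have "dM 0 * P 0 = - (P 1 * dN (- 1))"
          unfolding dM0 P0 P1 NC(10)[of "- 1"] m1 \<phi>(2)
          using NK(2)[OF w0h] NK(4)[OF ah] NK(4)[OF vh] NK(5,6)[of 0] tw0 dw ends oy
          by (simp add: algebra_simps)
        then show ?thesis unfolding 0 by simp
      next
        case (Suc j)
        then have ij: "i = j + 1" "j < n" "j + 1 \<le> n" "j \<le> n" "j + 1 \<le> n + 1" "1 \<le> j + 1" "j \<le> n + 1" using i by simp_all
        have ps: "p (j + 1) \<in> hom (W (int j + 1)) (x (j + 1))" using ph[OF ij(5)] unfolding J1 .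
        have K3: "z \<in> hom T (y j) \<Longrightarrow> Q2 (j + 1) * (J2 (j + 1) * (z * w)) = z * w" for z T w
          using K(4)[OF ij(6,5)] unfolding J1 .
        show ?thesis
        proof (cases "j + 1 = n")
          case True
          have dMn: "dM (j + 1) = f (j + 1) * Q1 (j + 1) - e j * Q2 (j + 1)"
            unfolding dM[OF ij(3)] J1(3) unfolding True D(8) Mn
            using one_left'[OF fh[of n]] one_left'[OF dy[OF ij(4)]] True by (simp add: right_diff_distrib)
          have P2: "P (j + 1 + 1) = \<beta> (j + 1) * b2 (int j + 1) - \<tau> (j + 2) * b1 (int j + 1)"
            using PL True by (metis J1(1,2))
          show ?thesis
            unfolding ij J1(1,4) dMn P2 PS[OF ij(2)] NC(10)[of "int j"]
            using NK(2)[of "w (int j + 1)" "W (int j + 1)" "int j + 1"] DW(3)[of "int j + 1"]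
              NK(4)[of "\<phi> (int j + 1)" "W (int j + 1)" "int j + 1"] \<phi>h[of "int j + 1"]
              NK(4)[of "v (int j)" "V (int j)" "int j + 1"] DV(3)[of "int j"] NK(5,6)[of "int j + 1"] \<beta>v[OF ij(4)] S3[OF ij(2)]
              K(2)[OF ij(3) ps] K3[OF \<tau>(1)[OF ij(4)]] K3[OF \<beta>h[OF ij(7)]] K(5,6)[OF ij(5)]
            by (simp add: algebra_simps del: One_nat_def add_Suc_right add_2_eq_Suc')
        next
          case False
          then have j: "j + 1 < n" "j + 2 \<le> n" "j + 2 \<le> n + 1" "1 \<le> j + 2" using ij by simp_all
          have P2: "P (j + 2) = J2 (j + 2) * (\<beta> (j + 1) * b2 (int j + 1)) - J1 (j + 2) * (p (j + 2) * b1 (int j + 1))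
              - J2 (j + 2) * (\<tau> (j + 2) * b1 (int j + 1))"
            using PS[OF j(1)] unfolding J1 .
          show ?thesis
            unfolding ij J1(1,2,4) P2 PS[OF ij(2)] dM[OF ij(3)] J1(2,3) NC(10)[of "int j"]
            using NK(2)[of "w (int j + 1)" "W (int j + 1)" "int j + 1"] DW(3)[of "int j + 1"]
              NK(4)[of "\<phi> (int j + 1)" "W (int j + 1)" "int j + 1"] \<phi>h[of "int j + 1"]
              NK(4)[of "v (int j)" "V (int j)" "int j + 1"] DV(3)[of "int j"] NK(5,6)[of "int j + 1"] \<beta>v[OF ij(4)] S3[OF ij(2)]
              K(2)[OF ij(3) ps] K3[OF \<tau>(1)[OF ij(4)]] K3[OF \<beta>h[OF ij(7)]] K(5,6)[OF ij(5)] wp[OF ij(3), unfolded J1]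
            by (simp add: algebra_simps del: One_nat_def add_Suc_right add_2_eq_Suc')
        qed
      qed
    qed
    have E: "int n + 1 + - 1 = int n" "int 0 + - 1 = - 1" by simp_all
    have alt0: "alt 0 z = z" for z by (simp add: alt_def)
    have en: "e n \<in> hom (y n) (x (n + 1))" and vn: "v (int n) \<in> hom (V (int n)) (x (n + 1))"
      and \<delta>: "\<delta> \<in> hom (x (n + 1)) (SO (x 0))"
      using dy[of n] DV(3)[of "int n"] V(3) xy ex(1) by simp_all
    have en': "e n \<in> hom (y n) (W (int n + 1))" using en W(3) by simp
    have sa: "sig (a1 (- 1)) = tw (a1 (int n + 1))" and sw: "sig (w (- 1)) = tw \<delta>"
      using tws(1,2) W(4) by simp_all
    have vs: "v (int n) * (\<sigma> (n + 1) * z) = 0" and et: "e n * (\<tau> (n + 1) * z) = 0" for z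
      using \<sigma>(4) mult_eq_left[of "v (int n)" "\<sigma> (n + 1)" 0] \<tau>(4) mult_eq_left[of "e n" "\<tau> (n + 1)" 0] by simp_all
    have vg: "v (int n) * \<gamma> n = e n"
      using cmapD(2)[OF \<gamma>c, of n] ends one_left[OF dy[of n]] by simp
    have eb: "e n * (\<beta> n * z) = v (int n) * z" for z
      using \<beta>v[of n z] ends one_left'[OF vn] xy by simp
    have "dN (int n) * I (n + 1) = a1 (int n + 1) * (\<delta> * e n)"
      unfolding NC(10)[of "int n"] IL W(4) \<phi>(3)
      using NK(1)[OF en'] NK(4)[of "\<sigma> (n + 1)" "x (n + 1)" "int n"] NK(3)[of "\<gamma> n" "y n" "int n"] \<gamma>h[of n] \<sigma>(1)[of n]
        NK(5,6)[of "int n"] vs vg one_left[OF en] by (simp add: algebra_simps)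
    \<comment> \<open>The factor (-1)^(n + 1) of \<open>alt\<close> in the last degree equals the
      sign (-1)^n of one period times the minus sign in \<open>I 0\<close>.\<close>
    then have sI: "sig (alt 0 (I 0)) * (\<delta> * e n) = dN (int n + 1 + - 1) * alt (n + 1) (I (n + 1))"
      unfolding alt_last alt0 E I0 by (simp add: sa)
    have ba: "sig (b1 (- 1)) * (a1 (int n + 1) * z) = tw (sig (one (x 0)) * z)"
        "sig (b2 (- 1)) * (a2 (int n + 1) * z) = sig (one (V (- 1))) * z"
        "sig (b1 (- 1)) * (a2 (int n + 1) * z) = 0" "sig (b2 (- 1)) * (a1 (int n + 1) * z) = 0" for z
      using arg_cong[OF NC(6)[of "- 1"], of sig] arg_cong[OF NC(7)[of "- 1"], of sig]
        arg_cong[OF NC(8)[of "- 1"], of sig] arg_cong[OF NC(9)[of "- 1"], of sig] W(2)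
        mult_eq_left[of "sig (b1 (- 1))" "sig (a1 (- 1))"] mult_eq_left[of "sig (b2 (- 1))" "sig (a2 (- 1))"]
        mult_eq_left[of "sig (b1 (- 1))" "sig (a2 (- 1))"] mult_eq_left[of "sig (b2 (- 1))" "sig (a1 (- 1))"]
      unfolding tws by simp_all
    have o0: "x 0 \<in> Obj C" using cpxD(1)[OF cx, of 0] by simp
    have s1: "sig (one (x 0)) * (\<delta> * z) = \<delta> * z" for z
      using one_left'[OF \<delta>] o0 by (simp add: sig_one)
    have s2: "sig (one (V (- 1))) = one (x (n + 1))"
      using tws(5) V(3) xy DV(2)[of "- 1"] by (simp add: sig_one)
    have b1n': "b1 (int n) \<in> hom (N (int n)) (x (n + 1))" using NC(4)[of "int n"] W(3) by simp
    have "sig (P 0) * dN (int n) = - tw (\<delta> * (v (int n) * b2 (int n)))"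
      unfolding NC(10)[of "int n"] P0 W(4) \<phi>(3)
      using ba s1 s2 one_left[OF b1n'] one_left'[OF vn] one_left'[OF c] xy
      by (simp add: algebra_simps sw)
    moreover have "\<delta> * e n * P (n + 1) = \<delta> * (v (int n) * b2 (int n))"
      unfolding PL using et eb by (simp add: algebra_simps)
    ultimately have sP: "sig (alt 0 (P 0)) * dN (int n + 1 + - 1) = \<delta> * e n * alt (n + 1) (P (n + 1))"
      unfolding alt_last alt0 E by simp
    have PI: "alt 0 (P 0) * alt 0 (I 0) = one (M 0)"
      unfolding alt0 P0 I0 using NC(6)[of "- 1"] NC(8)[of "- 1"] W(2) D(10) by (simp add: algebra_simps)
    show "realizes M dM (\<delta> * e n)"
      by (rule realizes_via_last[OF M angle_shift[OF NC(1), of "- 1"] Ia Pa sI sP PI])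
        (rule cocone_exact(4)[OF x y xy f s, of dM], erule dM)
  qed
qed

end

section \<open>The exangulated category\<close>

context additive_category
begin

text \<open>Used with \<open>j1\<close> and with \<open>q1\<close>: at the ends injection and
  projection are the same element, an idempotent or 0.\<close>

definition part1 :: "('a \<Rightarrow> 'a \<Rightarrow> ('a, 'b) gen) \<Rightarrow> nat \<Rightarrow> (nat \<Rightarrow> 'a) \<Rightarrow> (nat \<Rightarrow> 'a) \<Rightarrow> nat \<Rightarrow> ('a, 'b) gen"
  where "part1 j n u v m = (if m = 0 then one (u 0) else if m \<le> n then j (u m) (v m) else 0)"

definition part2 :: "('a \<Rightarrow> 'a \<Rightarrow> ('a, 'b) gen) \<Rightarrow> nat \<Rightarrow> (nat \<Rightarrow> 'a) \<Rightarrow> (nat \<Rightarrow> 'a) \<Rightarrow> nat \<Rightarrow> ('a, 'b) gen"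
  where "part2 j n u v m = (if m = 0 then 0 else if m \<le> n then j (u m) (v m) else one (v (n + 1)))"

lemma split_sum_osum:
  assumes "\<And>m. m \<le> n \<Longrightarrow> u m \<in> Obj C" "\<And>m. m \<le> n \<Longrightarrow> v (m + 1) \<in> Obj C"
    and M: "\<And>m. M m = (if m = 0 then u 0 else if m \<le> n then osum (u m) (v m) else v (n + 1))"
  shows "split_sum n u v M (part1 j1 n u v) (part2 j2 n u v) (part1 q1 n u v) (part2 q2 n u v)"
proof -
  have o: "u m \<in> Obj C" "v m \<in> Obj C" if "0 < m" "m \<le> n" for m
    using assms(1)[of m] assms(2)[of "m - 1"] that by auto
  have e: "u 0 \<in> Obj C" "v (n + 1) \<in> Obj C" using assms(1)[of 0] assms(2)[of n] by simp_all
  note oo = one_hom[OF e(1)] one_hom[OF e(2)] one_left[OF one_hom[OF e(1)]] one_left[OF one_hom[OF e(2)]]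
  have b: "j1 (u m) (v m) \<in> hom (u m) (osum (u m) (v m))" "j2 (u m) (v m) \<in> hom (v m) (osum (u m) (v m))"
    "q1 (u m) (v m) \<in> hom (osum (u m) (v m)) (u m)" "q2 (u m) (v m) \<in> hom (osum (u m) (v m)) (v m)"
    "q1 (u m) (v m) * j1 (u m) (v m) = one (u m)" "q2 (u m) (v m) * j2 (u m) (v m) = one (v m)"
    "q2 (u m) (v m) * j1 (u m) (v m) = 0" "q1 (u m) (v m) * j2 (u m) (v m) = 0"
    "j1 (u m) (v m) * q1 (u m) (v m) + j2 (u m) (v m) * q2 (u m) (v m) = one (osum (u m) (v m))"
    if "0 < m" "m \<le> n" for m
    using bp_hom[OF o[OF that]] bp_eqs[OF o[OF that]] by simp_all
  show ?thesis
    unfolding split_sum_def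
  proof (intro conjI allI ballI impI)
    fix m assume "m \<le> n"
    then show "part1 j1 n u v m \<in> hom (u m) (M m)" "part1 q1 n u v m \<in> hom (M m) (u m)"
      "part1 q1 n u v m * part1 j1 n u v m = one (u m)"
      using b[of m] oo by (simp_all add: part1_def M)
  next
    fix m assume "m \<in> {1..n + 1}"
    then show "part2 j2 n u v m \<in> hom (v m) (M m)" "part2 q2 n u v m \<in> hom (M m) (v m)"
      "part2 q2 n u v m * part2 j2 n u v m = one (v m)"
      using b[of m] oo by (auto simp: part2_def M le_Suc_eq)
  next
    fix m assume "m \<le> n + 1"
    then show "part2 q2 n u v m * part1 j1 n u v m = 0" "part1 q1 n u v m * part2 j2 n u v m = 0"
      "part1 j1 n u v m * part1 q1 n u v m + part2 j2 n u v m * part2 q2 n u v m = one (M m)"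
      using b[of m] oo by (auto simp: part1_def part2_def M le_Suc_eq)
  qed (simp_all add: part1_def part2_def M)
qed

text \<open>With 0 and identities as structure maps at the ends, the column, the matrices and the
  row of the cone become instances of one formula; \<open>1 \<le> n\<close> keeps the column and the
  row in different degrees.\<close>

lemma dfa_mapping_cone:
  assumes X: "is_sequence n X" and Y: "is_sequence n Y" and n: "1 \<le> n"
    and f: "\<And>i. i \<le> n + 1 \<Longrightarrow> f i \<in> mor (ob X i) (ob Y i)"
  defines "u \<equiv> \<lambda>m. ob X (m + 1)" and "v \<equiv> ob Y"
  shows "is_sequence n (mapping_cone n X Y f)"
    "m \<le> n \<Longrightarrow> dfa (mapping_cone n X Y f) m =
      part1 j1 n u v (m + 1) * - dfa X (m + 1) * part1 q1 n u v m
      + part2 j2 n u v (m + 1) * (arr (ob X (m + 1)) (ob Y (m + 1)) (f (m + 1)) * part1 q1 n u v m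
        + dfa Y m * part2 q2 n u v m)"
proof -
  note SX = is_sequenceD[OF X] and SY = is_sequenceD[OF Y]
  let ?M = "mapping_cone n X Y f"
  have *: "ob ?M m \<in> Obj C \<and> ob ?M (m + 1) \<in> Obj C \<and> df ?M m \<in> mor (ob ?M m) (ob ?M (m + 1)) \<and>
      dfa ?M m = part1 j1 n u v (m + 1) * - dfa X (m + 1) * part1 q1 n u v m
      + part2 j2 n u v (m + 1) * (arr (ob X (m + 1)) (ob Y (m + 1)) (f (m + 1)) * part1 q1 n u v m
        + dfa Y m * part2 q2 n u v m)" if m: "m \<le> n" for m
  proof -
    have o: "ob X (m + 1) \<in> Obj C" "ob Y m \<in> Obj C" "ob Y (m + 1) \<in> Obj C"
      using SX(1)[of "m + 1"] SY(1)[of m] SY(1)[of "m + 1"] m by simp_all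
    have fm: "f (m + 1) \<in> mor (ob X (m + 1)) (ob Y (m + 1))" and dY: "df Y m \<in> mor (ob Y m) (ob Y (m + 1))"
      using f[of "m + 1"] SY(2)[OF m] m by simp_all
    note fh = arr_hom[OF o(1,3) fm]
    show ?thesis
    proof (cases "m = n")
      case True
      have M: "ob ?M m = osum (ob X (m + 1)) (ob Y m)" "ob ?M (m + 1) = ob Y (m + 1)"
        "df ?M m = row (ob X (m + 1)) (ob Y m) (ob Y (m + 1)) (f (m + 1)) (df Y m)"
        using n True by (simp_all add: mapping_cone_def)
      have P: "part1 j1 n u v (m + 1) = 0" "part2 j2 n u v (m + 1) = one (ob Y (m + 1))"
        "part1 q1 n u v m = q1 (ob X (m + 1)) (ob Y m)" "part2 q2 n u v m = q2 (ob X (m + 1)) (ob Y m)"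
        using n True by (simp_all add: part1_def part2_def u_def v_def)
      have dd: "dfa ?M m = arr (ob X (m + 1)) (ob Y (m + 1)) (f (m + 1)) * q1 (ob X (m + 1)) (ob Y m)
          + dfa Y m * q2 (ob X (m + 1)) (ob Y m)"
        unfolding dfa_def M arr_row(2)[OF o(3,1,2) fm dY] ..
      show ?thesis
        unfolding dd unfolding M P using o bp_mor(1)[OF o(1,2)] arr_row(1)[OF o(3,1,2) fm dY]
          one_left'[OF fh] one_left'[OF SY(3)[OF m]] by (simp add: distrib_left)
    next
      case False
      then have mn: "m < n" "m + 1 \<le> n" "m + 1 \<le> n + 1" "m + 2 \<le> n + 1" using m by simp_all
      have o2: "ob X (m + 2) \<in> Obj C" and dX: "df X (m + 1) \<in> mor (ob X (m + 1)) (ob X (m + 2))"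
        using SX(1)[OF mn(4)] SX(2)[OF mn(2)] by simp_all
      let ?g = "neg (ob X (m + 1)) (ob X (m + 2)) (df X (m + 1))"
      have g: "?g \<in> mor (ob X (m + 1)) (ob X (m + 2))" "arr (ob X (m + 1)) (ob X (m + 2)) ?g = - dfa X (m + 1)"
        using o o2 dX by (simp_all add: arr_neg dfa_def)
      have P: "part1 j1 n u v (m + 1) = j1 (ob X (m + 2)) (ob Y (m + 1))"
        "part2 j2 n u v (m + 1) = j2 (ob X (m + 2)) (ob Y (m + 1))"
        using mn by (simp_all add: part1_def part2_def u_def v_def)
      have M': "ob ?M (m + 1) = osum (ob X (m + 2)) (ob Y (m + 1))"
        using mn by (simp add: mapping_cone_def)
      show ?thesis
      proof (cases "m = 0")
        case True
        have M: "ob ?M m = ob X (m + 1)" "df ?M m = col (ob X (m + 1)) (ob X (m + 2)) (ob Y (m + 1)) ?g (f (m + 1))"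
          using True by (simp_all add: mapping_cone_def numeral_2_eq_2)
        have P': "part1 q1 n u v m = one (ob X (m + 1))" "part2 q2 n u v m = 0"
          using True by (simp_all add: part1_def part2_def u_def)
        have dd: "dfa ?M m = j1 (ob X (m + 2)) (ob Y (m + 1)) * - dfa X (m + 1)
            + j2 (ob X (m + 2)) (ob Y (m + 1)) * arr (ob X (m + 1)) (ob Y (m + 1)) (f (m + 1))"
          unfolding dfa_def[of ?M] M M' arr_col(2)[OF o(1) o2 o(3) g(1) fm] g(2) ..
        show ?thesis
          unfolding dd unfolding M M' P P' using o bp_mor(1)[OF o2 o(3)] arr_col(1)[OF o(1) o2 o(3) g(1) fm]
            one_right[OF fh] one_right[OF SX(3)[OF mn(2)]] by (simp add: mult.assoc)
      next
        case False
        then have M: "ob ?M m = osum (ob X (m + 1)) (ob Y m)"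
          "df ?M m = mat (ob X (m + 1)) (ob Y m) (ob X (m + 2)) (ob Y (m + 1)) ?g (zero (ob Y m) (ob X (m + 2))) (f (m + 1)) (df Y m)"
          using mn by (simp_all add: mapping_cone_def)
        have P': "part1 q1 n u v m = q1 (ob X (m + 1)) (ob Y m)" "part2 q2 n u v m = q2 (ob X (m + 1)) (ob Y m)"
          using False m by (simp_all add: part1_def part2_def u_def v_def)
        note mt = arr_mat[OF o(1,2) o2 o(3) g(1) zero_mor[OF o(2) o2] fm dY]
        have dd: "dfa ?M m = j1 (ob X (m + 2)) (ob Y (m + 1)) * (- dfa X (m + 1) * q1 (ob X (m + 1)) (ob Y m)) +
            j2 (ob X (m + 2)) (ob Y (m + 1)) * (arr (ob X (m + 1)) (ob Y (m + 1)) (f (m + 1)) * q1 (ob X (m + 1)) (ob Y m)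
              + dfa Y m * q2 (ob X (m + 1)) (ob Y m))"
          unfolding dfa_def[of ?M] M M' mt(2) g(2) arr_zero[OF o(2) o2] dfa_def[of Y] by simp
        show ?thesis
          unfolding dd unfolding M M' P P' using o bp_mor(1)[OF o2 o(3)] bp_mor(1)[OF o(1,2)] mt(1)
          by (simp add: mult.assoc)
      qed
    qed
  qed
  have "ob ?M i \<in> Obj C" if "i \<le> n + 1" for i
    using *[of i] *[of "i - 1"] that by (cases "i \<le> n") (auto simp: le_Suc_eq)
  then show "is_sequence n ?M" using * by (simp add: is_sequence_def)
  show "dfa ?M m = part1 j1 n u v (m + 1) * - dfa X (m + 1) * part1 q1 n u v m
      + part2 j2 n u v (m + 1) * (arr (ob X (m + 1)) (ob Y (m + 1)) (f (m + 1)) * part1 q1 n u v m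
        + dfa Y m * part2 q2 n u v m)" if "m \<le> n" using *[OF that] by blast
qed

lemma dfa_mapping_cocone:
  assumes X: "is_sequence n X" and Y: "is_sequence n Y" and n: "1 \<le> n"
    and f: "\<And>i. i \<le> n + 1 \<Longrightarrow> f i \<in> mor (ob X i) (ob Y i)"
  defines "u \<equiv> ob X" and "v \<equiv> \<lambda>m. ob Y (m - 1)"
  shows "is_sequence n (mapping_cocone n X Y f)"
    "m \<le> n \<Longrightarrow> dfa (mapping_cocone n X Y f) m =
      part1 j1 n u v (m + 1) * dfa X m * part1 q1 n u v m
      + part2 j2 n u v (m + 1) * (arr (ob X m) (ob Y m) (f m) * part1 q1 n u v m
        - dfa Y (m - 1) * part2 q2 n u v m)"
proof -
  note SX = is_sequenceD[OF X] and SY = is_sequenceD[OF Y]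
  let ?M = "mapping_cocone n X Y f"
  have *: "ob ?M m \<in> Obj C \<and> ob ?M (m + 1) \<in> Obj C \<and> df ?M m \<in> mor (ob ?M m) (ob ?M (m + 1)) \<and>
      dfa ?M m = part1 j1 n u v (m + 1) * dfa X m * part1 q1 n u v m
      + part2 j2 n u v (m + 1) * (arr (ob X m) (ob Y m) (f m) * part1 q1 n u v m
        - dfa Y (m - 1) * part2 q2 n u v m)" if m: "m \<le> n" for m
  proof -
    have o: "ob X m \<in> Obj C" "ob Y m \<in> Obj C" "ob X (m + 1) \<in> Obj C"
      using SX(1)[of m] SY(1)[of m] SX(1)[of "m + 1"] m by simp_all
    have fm: "f m \<in> mor (ob X m) (ob Y m)" and dX: "df X m \<in> mor (ob X m) (ob X (m + 1))"
      using f[of m] SX(2)[OF m] m by simp_all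
    note fh = arr_hom[OF o(1,2) fm]
    have Mo: "ob ?M (m + 1) = (if m = n then ob Y m else osum (ob X (m + 1)) (ob Y m))"
      using m n by (simp add: mapping_cocone_def)
    show ?thesis
    proof (cases "m = 0")
      case True
      then have mn: "m \<noteq> n" "m + 1 \<le> n" using n by simp_all
      have M: "ob ?M m = ob X m" "df ?M m = col (ob X m) (ob X (m + 1)) (ob Y m) (df X m) (f m)"
        "ob ?M (m + 1) = osum (ob X (m + 1)) (ob Y m)"
        using True Mo mn by (simp_all add: mapping_cocone_def)
      have P: "part1 j1 n u v (m + 1) = j1 (ob X (m + 1)) (ob Y m)" "part2 j2 n u v (m + 1) = j2 (ob X (m + 1)) (ob Y m)"
        "part1 q1 n u v m = one (ob X m)" "part2 q2 n u v m = 0"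
        using True mn by (simp_all add: part1_def part2_def u_def v_def)
      have dd: "dfa ?M m = j1 (ob X (m + 1)) (ob Y m) * dfa X m + j2 (ob X (m + 1)) (ob Y m) * arr (ob X m) (ob Y m) (f m)"
        unfolding dfa_def M arr_col(2)[OF o(1,3,2) dX fm] ..
      show ?thesis
        unfolding dd unfolding M P using o bp_mor(1)[OF o(3,2)] arr_col(1)[OF o(1,3,2) dX fm]
          one_right[OF fh] one_right[OF SX(3)[OF m]] by (simp add: mult.assoc)
    next
      case False
      define k where "k = m - 1"
      have k: "m = k + 1" "k \<le> n" "m - 1 = k" using False m by (simp_all add: k_def)
      have ok: "ob Y k \<in> Obj C" and dY: "df Y k \<in> mor (ob Y k) (ob Y m)"
        using SY(1)[of k] SY(2)[OF k(2)] k by simp_all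
      let ?g = "neg (ob Y k) (ob Y m) (df Y k)"
      have g: "?g \<in> mor (ob Y k) (ob Y m)" "arr (ob Y k) (ob Y m) ?g = - dfa Y k"
        using o ok dY k(1) by (simp_all add: arr_neg dfa_def)
      have M0: "ob ?M m = osum (ob X m) (ob Y k)" using False m k by (simp add: mapping_cocone_def)
      have P0: "part1 q1 n u v m = q1 (ob X m) (ob Y k)" "part2 q2 n u v m = q2 (ob X m) (ob Y k)"
        using False m k by (simp_all add: part1_def part2_def u_def v_def)
      have yh: "dfa Y k \<in> hom (ob Y k) (ob Y m)" using SY(3)[OF k(2)] k(1) by simp
      show ?thesis
      proof (cases "m = n")
        case True
        have M: "ob ?M (m + 1) = ob Y m" "df ?M m = row (ob X m) (ob Y k) (ob Y m) (f m) ?g"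
          using True Mo n k by (simp_all add: mapping_cocone_def)
        have P: "part1 j1 n u v (m + 1) = 0" "part2 j2 n u v (m + 1) = one (ob Y m)"
          using True by (simp_all add: part1_def part2_def v_def)
        have dd: "dfa ?M m = arr (ob X m) (ob Y m) (f m) * q1 (ob X m) (ob Y k) + - dfa Y k * q2 (ob X m) (ob Y k)"
          unfolding dfa_def[of ?M] M0 M arr_row(2)[OF o(2,1) ok fm g(1)] g(2) ..
        show ?thesis
          unfolding dd k(3) unfolding M0 M P P0 using o bp_mor(1)[OF o(1) ok] arr_row(1)[OF o(2,1) ok fm g(1)]
            one_left'[OF fh] one_left'[OF yh] by (simp add: right_diff_distrib)
      next
        case mn: False
        have M: "ob ?M (m + 1) = osum (ob X (m + 1)) (ob Y m)"
          "df ?M m = mat (ob X m) (ob Y k) (ob X (m + 1)) (ob Y m) (df X m) (zero (ob Y k) (ob X (m + 1))) (f m) ?g"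
          using False mn Mo m k by (simp_all add: mapping_cocone_def)
        have P: "part1 j1 n u v (m + 1) = j1 (ob X (m + 1)) (ob Y m)" "part2 j2 n u v (m + 1) = j2 (ob X (m + 1)) (ob Y m)"
          using mn m by (simp_all add: part1_def part2_def u_def v_def)
        note mt = arr_mat[OF o(1) ok o(3,2) dX zero_mor[OF ok o(3)] fm g(1)]
        have dd: "dfa ?M m = j1 (ob X (m + 1)) (ob Y m) * (dfa X m * q1 (ob X m) (ob Y k)) +
            j2 (ob X (m + 1)) (ob Y m) * (arr (ob X m) (ob Y m) (f m) * q1 (ob X m) (ob Y k) + - dfa Y k * q2 (ob X m) (ob Y k))"
          unfolding dfa_def[of ?M] M0 M mt(2) g(2) arr_zero[OF ok o(3)] dfa_def[of X] by simp
        show ?thesis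
          unfolding dd k(3) unfolding M0 M P P0 using o bp_mor(1)[OF o(3,2)] bp_mor(1)[OF o(1) ok] mt(1)
          by (simp add: mult.assoc)
      qed
    qed
  qed
  have "ob ?M i \<in> Obj C" if "i \<le> n + 1" for i
    using *[of i] *[of "i - 1"] that by (cases "i \<le> n") (auto simp: le_Suc_eq)
  then show "is_sequence n ?M" using * by (simp add: is_sequence_def)
  show "dfa ?M m = part1 j1 n u v (m + 1) * dfa X m * part1 q1 n u v m
      + part2 j2 n u v (m + 1) * (arr (ob X m) (ob Y m) (f m) * part1 q1 n u v m
        - dfa Y (m - 1) * part2 q2 n u v m)" if "m \<le> n" using *[OF that] by blast
qed

end

section \<open>The axioms (EA1), (EA2) and the dual of (EA2)\<close>

context positive_angulated_category
begin

sublocale R: realized_category C "E_Sigma C S" n "s_angles C n Angles"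
  by (rule realized_category_angles)

lemma distinguished_iff:
  "R.distinguished X \<delta> \<longleftrightarrow> is_complex n X \<and> \<delta> \<in> mor (ob X (n + 1)) (FOb S (ob X 0)) \<and>
    realizes (ob X) (dfa X) (arr (ob X (n + 1)) (FOb S (ob X 0)) \<delta>)"
proof (cases "is_complex n X \<and> \<delta> \<in> mor (ob X (n + 1)) (FOb S (ob X 0))")
  case True
  then have "X \<in> complexes n (ob X 0) (ob X (n + 1))" "ob X 0 \<in> Obj C" "ob X (n + 1) \<in> Obj C"
    using is_sequenceD(1)[of n X] by (simp_all add: complexes_def is_complex_iff)
  then show ?thesis
    using True s_angles_iff[of "ob X 0" "ob X (n + 1)" \<delta> X] unfolding R.distinguished_def by simp
qed (auto simp: R.distinguished_def)

text \<open>(F1)(c) puts a given morphism into position 0; after a shift of the periodic angle it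
  stands in position n.\<close>

lemma morphism_inflation_deflation:
  assumes "A \<in> Obj C" "B \<in> Obj C" "f \<in> mor A B"
  shows "R.inflation A B f" "R.deflation A B f"
proof -
  obtain X \<delta> where X: "(X, \<delta>) \<in> Angles" "ob X 0 = A" "ob X 1 = B" "df X 0 = f"
    using F1c[OF assms] by blast
  then show "R.inflation A B f"
    unfolding R.inflation_def distinguished_iff using Angles_realizes[OF X(1)] by blast
  obtain W w where W: "angle W w" "W (int n) = A" "W (int n + 1) = B" "w (int n) = arr A B f"
    using angle_completion[OF arr_hom[OF assms]] by metis
  obtain Y \<rho> where Y: "trunc W w = (Y, \<rho>)" by fastforce
  have "ob Y n = A" "ob Y (n + 1) = B" "df Y n = f"
    using Y W assms by (auto simp: trunc_def carr_arr add.commute)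
  then show "R.deflation A B f"
    unfolding R.deflation_def distinguished_iff using Angles_realizes[of Y \<rho>] W(1) Y unfolding angle_def by metis
qed

lemma distinguished_df:
  assumes "R.distinguished X \<delta>" "i \<le> n"
  shows "ob X i \<in> Obj C" "ob X (i + 1) \<in> Obj C" "df X i \<in> mor (ob X i) (ob X (i + 1))"
  using assms is_sequenceD[of n X] by (simp_all add: distinguished_iff is_complex_iff)

lemma EA2:
  assumes A: "A \<in> Obj C" and B: "B \<in> Obj C" and D: "D \<in> Obj C" and \<rho>: "\<rho> \<in> mor D (FOb S A)" and c: "c \<in> mor B D"
    and X: "X \<in> complexes n A B" "R.distinguished X (E.pull A c \<rho>)"
    and Y: "Y \<in> complexes n A D" "R.distinguished Y \<rho>"
  shows "\<exists>f. chain_map n X Y f \<and> f 0 = Id C A \<and> f (n + 1) = c \<and>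
    R.distinguished (mapping_cone n X Y f) (E.push D (df X 0) \<rho>)"
proof -
  have e: "ob X 0 = A" "ob X (n + 1) = B" "ob Y 0 = A" "ob Y (n + 1) = D"
    and s: "is_sequence n X" "is_sequence n Y"
    using X(1) Y(1) by (simp_all add: complexes_def is_complex_def)
  note SX = is_sequenceD[OF s(1)] and SY = is_sequenceD[OF s(2)]
  let ?\<rho> = "arr D (FOb S A) \<rho>" and ?c = "arr B D c"
  have rX: "realizes (ob X) (dfa X) (?\<rho> * ?c)" and rY: "realizes (ob Y) (dfa Y) ?\<rho>"
    using X(2) Y(2) pull_eq(3)[OF A D B c \<rho>] e by (simp_all add: distinguished_iff)
  have ch: "?c \<in> hom (ob X (n + 1)) (ob Y (n + 1))" using arr_hom[OF B D c] e by simp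
  have xy: "ob X 0 = ob Y 0" using e by simp
  show ?thesis
  proof (rule cone_realizes[OF rX rY xy ch])
    fix F assume F: "cmap n (ob X) (dfa X) (ob Y) (dfa Y) F" "F 0 = one (ob X 0)" "F (n + 1) = ?c"
      and real: "\<And>M dM J1 J2 Q1 Q2. \<lbrakk>split_sum n (\<lambda>m. ob X (m + 1)) (ob Y) M J1 J2 Q1 Q2;
        \<And>m. m \<le> n \<Longrightarrow> dM m = J1 (m + 1) * - dfa X (m + 1) * Q1 m
          + J2 (m + 1) * (F (m + 1) * Q1 m + dfa Y m * Q2 m)\<rbrakk> \<Longrightarrow> realizes M dM (sig (dfa X 0) * ?\<rho>)"
    define f where "f i = carr (ob X i) (ob Y i) (F i)" for i
    have f: "chain_map n X Y f" unfolding f_def by (rule chain_map_of_cmap[OF s F(1)])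
    have fm: "f i \<in> mor (ob X i) (ob Y i)" "arr (ob X i) (ob Y i) (f i) = F i" if "i \<le> n + 1" for i
      using cmapD(1)[OF F(1) that] by (simp_all add: f_def carr_mor arr_carr)
    have fe: "f 0 = Id C A" "f (n + 1) = c"
      using F(2,3) e A B D c by (simp_all add: f_def one_def carr_arr Id_Hom)
    let ?M = "mapping_cone n X Y f"
    note cone = dfa_mapping_cone[OF s n_pos fm(1)]
    have d0: "df X 0 \<in> mor A (ob X 1)" "dfa X 0 = arr A (ob X 1) (df X 0)" and o1: "ob X 1 \<in> Obj C"
      using SX(2)[of 0] SX(1)[of 1] e by (simp_all add: dfa_def)
    have "realizes (ob ?M) (dfa ?M) (sig (dfa X 0) * ?\<rho>)"
    proof (rule real)
      show "split_sum n (\<lambda>m. ob X (m + 1)) (ob Y) (ob ?M) (part1 j1 n (\<lambda>m. ob X (m + 1)) (ob Y))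
          (part2 j2 n (\<lambda>m. ob X (m + 1)) (ob Y)) (part1 q1 n (\<lambda>m. ob X (m + 1)) (ob Y)) (part2 q2 n (\<lambda>m. ob X (m + 1)) (ob Y))"
        by (rule split_sum_osum) (simp_all add: SX(1) SY(1) mapping_cone_def)
    qed (use cone(2) fm(2) in simp)
    then have r: "realizes (ob ?M) (dfa ?M) (arr D (FOb S (ob X 1)) (E.push D (df X 0) \<rho>))"
      using push_eq(3)[OF A o1 D d0(1) \<rho>] d0(2) by simp
    have M: "ob ?M 0 = ob X 1" "ob ?M (n + 1) = D" using e by (simp_all add: mapping_cone_def)
    have "R.distinguished ?M (E.push D (df X 0) \<rho>)"
      unfolding distinguished_iff M is_complex_iff
      using r cone(1) push_eq(2)[OF A o1 D d0(1) \<rho>] by (simp add: realizes_def)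
    then show ?thesis using f fe by blast
  qed
qed

lemma EA2_op:
  assumes A: "A \<in> Obj C" and B: "B \<in> Obj C" and D: "D \<in> Obj C" and \<delta>: "\<delta> \<in> mor D (FOb S A)" and a: "a \<in> mor A B"
    and X: "X \<in> complexes n A D" "R.distinguished X \<delta>"
    and Y: "Y \<in> complexes n B D" "R.distinguished Y (E.push D a \<delta>)"
  shows "\<exists>h. chain_map n X Y h \<and> h 0 = a \<and> h (n + 1) = Id C D \<and>
    R.distinguished (mapping_cocone n X Y h) (E.pull A (df Y n) \<delta>)"
proof -
  have e: "ob X 0 = A" "ob X (n + 1) = D" "ob Y 0 = B" "ob Y (n + 1) = D"
    and s: "is_sequence n X" "is_sequence n Y"
    using X(1) Y(1) by (simp_all add: complexes_def is_complex_def)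
  note SX = is_sequenceD[OF s(1)] and SY = is_sequenceD[OF s(2)]
  let ?\<delta> = "arr D (FOb S A) \<delta>" and ?a = "arr A B a"
  have rX: "realizes (ob X) (dfa X) ?\<delta>" and rY: "realizes (ob Y) (dfa Y) (sig ?a * ?\<delta>)"
    using X(2) Y(2) push_eq(3)[OF A B D a \<delta>] e by (simp_all add: distinguished_iff)
  have ah: "?a \<in> hom (ob X 0) (ob Y 0)" using arr_hom[OF A B a] e by simp
  have xy: "ob X (n + 1) = ob Y (n + 1)" using e by simp
  show ?thesis
  proof (rule cocone_realizes[OF rX rY xy ah])
    fix F assume F: "cmap n (ob X) (dfa X) (ob Y) (dfa Y) F" "F 0 = ?a" "F (n + 1) = one (ob X (n + 1))"
      and real: "\<And>M dM J1 J2 Q1 Q2. \<lbrakk>split_sum n (ob X) (\<lambda>m. ob Y (m - 1)) M J1 J2 Q1 Q2;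
        \<And>m. m \<le> n \<Longrightarrow> dM m = J1 (m + 1) * dfa X m * Q1 m
          + J2 (m + 1) * (F m * Q1 m - dfa Y (m - 1) * Q2 m)\<rbrakk> \<Longrightarrow> realizes M dM (?\<delta> * dfa Y n)"
    define f where "f i = carr (ob X i) (ob Y i) (F i)" for i
    have f: "chain_map n X Y f" unfolding f_def by (rule chain_map_of_cmap[OF s F(1)])
    have fm: "f i \<in> mor (ob X i) (ob Y i)" "arr (ob X i) (ob Y i) (f i) = F i" if "i \<le> n + 1" for i
      using cmapD(1)[OF F(1) that] by (simp_all add: f_def carr_mor arr_carr)
    have fe: "f 0 = a" "f (n + 1) = Id C D"
      using F(2,3) e A B D a by (simp_all add: f_def one_def carr_arr Id_Hom)
    let ?M = "mapping_cocone n X Y f"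
    note cone = dfa_mapping_cocone[OF s n_pos fm(1)]
    have dn: "df Y n \<in> mor (ob Y n) D" "dfa Y n = arr (ob Y n) D (df Y n)" and on: "ob Y n \<in> Obj C"
      using SY(2)[of n] SY(1)[of n] e by (simp_all add: dfa_def)
    have "realizes (ob ?M) (dfa ?M) (?\<delta> * dfa Y n)"
    proof (rule real)
      show "split_sum n (ob X) (\<lambda>m. ob Y (m - 1)) (ob ?M) (part1 j1 n (ob X) (\<lambda>m. ob Y (m - 1)))
          (part2 j2 n (ob X) (\<lambda>m. ob Y (m - 1))) (part1 q1 n (ob X) (\<lambda>m. ob Y (m - 1))) (part2 q2 n (ob X) (\<lambda>m. ob Y (m - 1)))"
        by (rule split_sum_osum) (simp_all add: SX(1) SY(1) mapping_cocone_def)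
    qed (use cone(2) fm(2) in simp)
    then have r: "realizes (ob ?M) (dfa ?M) (arr (ob Y n) (FOb S A) (E.pull A (df Y n) \<delta>))"
      using pull_eq(3)[OF A D on dn(1) \<delta>] dn(2) by simp
    have M: "ob ?M 0 = A" "ob ?M (n + 1) = ob Y n" using e by (simp_all add: mapping_cocone_def)
    have "R.distinguished ?M (E.pull A (df Y n) \<delta>)"
      unfolding distinguished_iff M is_complex_iff
      using r cone(1) pull_eq(2)[OF A D on dn(1) \<delta>] by (simp add: realizes_def)
    then show ?thesis using f fe by blast
  qed
qed

lemma inflation_mor:
  assumes "R.inflation A B f"
  shows "A \<in> Obj C" "B \<in> Obj C" "f \<in> mor A B"
  using assms distinguished_df[of _ _ 0] unfolding R.inflation_def by auto

lemma deflation_mor: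
  assumes "R.deflation A B f"
  shows "A \<in> Obj C" "B \<in> Obj C" "f \<in> mor A B"
  using assms distinguished_df[of _ _ n] unfolding R.deflation_def by auto

lemma exangulated_category_angles: "exangulated_category C (E_Sigma C S) n (s_angles C n Angles)"
proof (intro exangulated_category.intro realized_category_angles exangulated_category_axioms.intro, goal_cases)
  case (1 A B f D g)
  then show ?case
    using inflation_mor[OF 1(1)] inflation_mor[OF 1(2)] Comp_Hom morphism_inflation_deflation(1) by blast
next
  case (2 A B f D g)
  then show ?case
    using deflation_mor[OF 2(1)] deflation_mor[OF 2(2)] Comp_Hom morphism_inflation_deflation(2) by blast
next
  case (3 A B D \<rho> c X Y)
  then show ?case using EA2[of A B D \<rho> c X Y] by simp
next
  case (4 A B D \<delta> a X Y)
  then show ?case using EA2_op[of A B D \<delta> a X Y] by simp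
qed

end

theorem proposition4p5:
  fixes C :: "('o, 'm) precat" and S :: "('o, 'm) endofunctor" and n :: nat
    and Angles :: "(('o, 'm) diagram \<times> 'm) set"
  assumes "1 \<le> n"
    and "angulated_category C S n Angles"
  shows "(\<forall>A\<in>Obj C. \<forall>B\<in>Obj C. \<forall>\<delta>\<in>carrier (EOb (E_Sigma C S) B A).
            (\<exists>X. completes n Angles B A \<delta> X) \<and>
            (\<forall>X. completes n Angles B A \<delta> X \<longrightarrow>
               X \<in> preadditive_category.complexes C n A B \<and>
               s_angles C n Angles B A \<delta> = preadditive_category.hclass C n A B X)) \<and>
         exangulated_category C (E_Sigma C S) n (s_angles C n Angles)"
proof -
  interpret positive_angulated_category C S n Angles
    using assms by (intro positive_angulated_category.intro positive_angulated_category_axioms.intro)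
  have "(\<exists>X. completes n Angles B A \<delta> X) \<and>
      (\<forall>X. completes n Angles B A \<delta> X \<longrightarrow> X \<in> complexes n A B \<and> s_angles C n Angles B A \<delta> = hclass n A B X)"
    if "A \<in> Obj C" "B \<in> Obj C" "\<delta> \<in> carrier (EOb (E_Sigma C S) B A)" for A B \<delta>
    using that completes_exists[of A B \<delta>] completes_realizes[of B A \<delta>] s_angles_iff[of A B \<delta>] by auto
  then show ?thesis using exangulated_category_angles by blast
qed

end
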